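(* Let $R$ be a commutative ring, let $A$ be a (possibly non-commutative) unital $R$-algebra and let $M$ be an $A$-$A$ bimodule. Then the assignment $\Gamma\mapsto \mathcal{H}_*(\Gamma,A,M)$ on finite based digraphs, together with the assignment $f\mapsto f_\bullet$ on base-vertex preserving inclusions of digraphs, is a functor $$\mathcal{H}_*(-,A,M)\colon \mathbf{DirGr}_b\to \mathbf{GrMod}$$ with the property that if $\Gamma$ is a consistently directed $n$-gon (with any vertex as base vertex), then for $0\le i\le n-2$ $$\mathcal{H}_i(\Gamma,A,M)\cong HH_i(A;M),$$ where $HH_i(A;M)$ is the Hochschild homology of the algebra $A$ with coefficients in the bimodule $M$.
   Context: All tensor products are over the commutative ring $R$. For an $R$-algebra $A$, an $A$-$A$ bimodule is understood over $R$ (the left and right actions of $R$ agree). $\mathbf{GrMod}$ is the category of $\mathbb{Z}$-graded $R$-modules. Digraphs. A digraph $\Gamma$ has tail and head functions $t,h\colon Edge(\Gamma)\to Vert(\Gamma)$; it is finite if its vertex and edge sets are finite. An inclusion of digraphs is a map injective on vertices and on edges, compatible with $t$ and $h$. $\mathbf{DirGr}_b$ is the category of finite digraphs with a distinguished base vertex, with inclusions taking base vertex to base vertex as morphisms. A consistently directed $n$-gon is the directed cycle with $n$ vertices and $n$ edges. Path poset. A simple path in $\Gamma$ is a sequence of edges $e_1,\dots,e_r$ with $h(e_i)=t(e_{i+1})$ in which no vertex is encountered twice (in particular it is not closed). A multipath is a collection of (vertex-)disjoint simple paths, regarded as a set of edges; the empty multipath is allowed. $P(\Gamma)$ is the poset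 of multipaths of $\Gamma$ ordered by inclusion of edge sets, viewed as a category with a unique morphism $x\to y$ whenever $x\le y$. Write $x\prec y$ if $x<y$ and there is no $z$ with $x<z<y$; then $y$ has exactly one more edge than $x$. An inclusion $f\colon\Gamma'\to\Gamma$ induces a poset map $\tilde f\colon P(\Gamma')\to P(\Gamma)$. Homology. For a covariant functor $\mathcal{F}\colon P(\Gamma)\to R\text{-}\mathbf{Mod}$ let $\mathcal{S}_k(\Gamma;\mathcal{F})=\bigoplus_{x_0\le x_1\le\cdots\le x_k}\mathcal{F}(x_0)$, with elements written as sums of $\lambda x_0x_1\ldots x_k$, $\lambda\in\mathcal{F}(x_0)$, and differential $$d(\lambda x_0\ldots x_k)=\mathcal{F}(x_0\le x_1)(\lambda)\,x_1\ldots x_k+\sum_{i=1}^k(-1)^i\lambda x_0\ldots\widehat{x_i}\ldots x_k .$$ $H_*(\Gamma;\mathcal{F})$ is the homology of this chain complex. The functor $\mathcal{F}_{A,M}$. For $x\in P(\Gamma)$ let $\Gamma_x$ be the digraph with the vertex set of $\Gamma$ and edge set $x$, and $\pi_0(\Gamma_x)$ its set of connected components. Put $\mathcal{F}_{A,M}(x)=\bigotimes_{\alpha\in\pi_0(\Gamma_x)}M_\alpha$ (unordered tensor product), where $M_\alpha=M$ if $\alpha$ contains the base vertex and $M_\alpha=A$ otherwise. If $x\prec y$ and $e$ is the additional edge of $y$, then $e$ joins two distinct components of $\Gamma_x$, and $\mathcal{F}_{A,M}(x\prec y)$ is the identity on the tensor factors of the components not involved, while on the two fusing factors it is $a\otimes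 b\mapsto ab$, where $a$ is in the factor of the component containing $t(e)$ and $b$ is in the factor of the component containing $h(e)$; here $ab$ is the product of $A$, or the left or right action of $A$ on $M$ if one of the two components contains the base vertex. For general $x\le y$, $\mathcal{F}_{A,M}(x\le y)$ is the composite along any chain $x\prec x_1\prec\cdots\prec x_l\prec y$ (independent of the chain; the identity if $x=y$). This is a covariant functor $P(\Gamma)\to R\text{-}\mathbf{Mod}$, and $$\mathcal{H}_*(\Gamma,A,M):=H_*(\Gamma;\mathcal{F}_{A,M}).$$ Induced maps. Let $f\colon\Gamma'\to\Gamma$ be a morphism of $\mathbf{DirGr}_b$, let $\mathcal{F}'_{A,M}$ denote the functor for $\Gamma'$, and let $W$ be the set of vertices of $\Gamma$ not in the image of $\Gamma'$. For $x\in P(\Gamma')$ there is an identification $\mathcal{F}_{A,M}(\tilde f(x))\cong\mathcal{F}'_{A,M}(x)\otimes\bigotimes_{W}A$, and $\tau_x\colon\mathcal{F}'_{A,M}(x)\to\mathcal{F}_{A,M}(\tilde f(x))$ is $\lambda\mapsto\lambda\otimes\bigotimes_W 1$. The map $f_\bullet\colon\mathcal{H}_*(\Gamma',A,M)\to\mathcal{H}_*(\Gamma,A,M)$ is induced by the chain map $\lambda x_0\ldots x_k\mapsto\tau_{x_0}(\lambda)\,\tilde f(x_0)\ldots\tilde f(x_k)$. Hochschild homology $HH_*(A;M)$ is the homology of the standard Hochschild complex with $n$-chains $M\otimes A^{\otimes n}$ and differential $b(m\otimes a_1\otimes\cdots\otimes a_n)=ma_1\otimes a_2\otimes\cdots\otimes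 a_n+\sum_{i=1}^{n-1}(-1)^i m\otimes\cdots\otimes a_ia_{i+1}\otimes\cdots\otimes a_n+(-1)^n a_nm\otimes a_1\otimes\cdots\otimes a_{n-1}$. *)

theory Defs
  imports "HOL-Algebra.Module" "HOL-Algebra.AbelCoset" "Graph_Theory.Graph_Theory"
begin

section \<open>Categories and functors\<close>

text \<open>
  Arrows do not carry their domain and codomain, so identities are indexed by an object and
  \<open>Cmp C X g f\<close> is the composite of \<open>f\<close> followed by \<open>g\<close>, where \<open>X\<close> is the domain of \<open>f\<close>.
  In the concrete categories below an arrow consists of functions that are \<^const>\<open>extensional\<close>
  on the domain, so that equality of arrows is ordinary equality.
\<close>

record ('o, 'f) cat =
  Obj :: "'o set"
  Arr :: "'o \<Rightarrow> 'o \<Rightarrow> 'f set"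
  Idn :: "'o \<Rightarrow> 'f"
  Cmp :: "'o \<Rightarrow> 'f \<Rightarrow> 'f \<Rightarrow> 'f"

locale category =
  fixes C :: "('o, 'f) cat"
  assumes Idn_Arr: "X \<in> Obj C \<Longrightarrow> Idn C X \<in> Arr C X X"
    and Cmp_Arr: "\<lbrakk>X \<in> Obj C; Y \<in> Obj C; Z \<in> Obj C; f \<in> Arr C X Y; g \<in> Arr C Y Z\<rbrakk>
      \<Longrightarrow> Cmp C X g f \<in> Arr C X Z"
    and Cmp_Idn_right: "\<lbrakk>X \<in> Obj C; Y \<in> Obj C; f \<in> Arr C X Y\<rbrakk> \<Longrightarrow> Cmp C X f (Idn C X) = f"
    and Cmp_Idn_left: "\<lbrakk>X \<in> Obj C; Y \<in> Obj C; f \<in> Arr C X Y\<rbrakk> \<Longrightarrow> Cmp C X (Idn C Y) f = f"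
    and Cmp_assoc: "\<lbrakk>W \<in> Obj C; X \<in> Obj C; Y \<in> Obj C; Z \<in> Obj C;
        f \<in> Arr C W X; g \<in> Arr C X Y; h \<in> Arr C Y Z\<rbrakk>
      \<Longrightarrow> Cmp C W (Cmp C X h g) f = Cmp C W h (Cmp C W g f)"

locale covariant_functor = source: category C + target: category D
  for C :: "('o, 'f) cat" and D :: "('p, 'g) cat" +
  fixes FO :: "'o \<Rightarrow> 'p" and FA :: "'o \<Rightarrow> 'o \<Rightarrow> 'f \<Rightarrow> 'g"
  assumes FO_Obj: "X \<in> Obj C \<Longrightarrow> FO X \<in> Obj D"
    and FA_Arr: "\<lbrakk>X \<in> Obj C; Y \<in> Obj C; f \<in> Arr C X Y\<rbrakk> \<Longrightarrow> FA X Y f \<in> Arr D (FO X) (FO Y)"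
    and FA_Idn: "X \<in> Obj C \<Longrightarrow> FA X X (Idn C X) = Idn D (FO X)"
    and FA_Cmp: "\<lbrakk>X \<in> Obj C; Y \<in> Obj C; Z \<in> Obj C; f \<in> Arr C X Y; g \<in> Arr C Y Z\<rbrakk>
      \<Longrightarrow> FA X Z (Cmp C X g f) = Cmp D (FO X) (FA Y Z g) (FA X Y f)"


section \<open>Modules, algebras and bimodules\<close>

text \<open>
  The library locale \<^locale>\<open>algebra\<close> describes commutative algebras only.  In the module
  records built below the fields \<^const>\<open>monoid.mult\<close> and \<^const>\<open>one\<close> have no meaning.
\<close>

locale assoc_algebra = Module.module R A + ring A
  for R :: "'r ring" (structure) and A :: "('r, 'a, 'z) module_scheme" (structure) +
  assumes smult_mult_left: "\<lbrakk>r \<in> carrier R; a \<in> carrier A; b \<in> carrier A\<rbrakk>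
      \<Longrightarrow> (r \<odot>\<^bsub>A\<^esub> a) \<otimes>\<^bsub>A\<^esub> b = r \<odot>\<^bsub>A\<^esub> (a \<otimes>\<^bsub>A\<^esub> b)"
    and smult_mult_right: "\<lbrakk>r \<in> carrier R; a \<in> carrier A; b \<in> carrier A\<rbrakk>
      \<Longrightarrow> a \<otimes>\<^bsub>A\<^esub> (r \<odot>\<^bsub>A\<^esub> b) = r \<odot>\<^bsub>A\<^esub> (a \<otimes>\<^bsub>A\<^esub> b)"

record ('r, 'm, 'a) bimodule = "('r, 'm) module" +
  lact :: "'a \<Rightarrow> 'm \<Rightarrow> 'm"
  ract :: "'m \<Rightarrow> 'a \<Rightarrow> 'm"

locale algebra_bimodule = alg: assoc_algebra R A + Module.module R M
  for R :: "'r ring" (structure) and A :: "('r, 'a) module" (structure)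
    and M :: "('r, 'm, 'a) bimodule" (structure) +
  assumes lact_closed: "\<lbrakk>a \<in> carrier A; m \<in> carrier M\<rbrakk> \<Longrightarrow> lact M a m \<in> carrier M"
    and ract_closed: "\<lbrakk>a \<in> carrier A; m \<in> carrier M\<rbrakk> \<Longrightarrow> ract M m a \<in> carrier M"
    and lact_add: "\<lbrakk>a \<in> carrier A; m \<in> carrier M; n \<in> carrier M\<rbrakk>
      \<Longrightarrow> lact M a (m \<oplus>\<^bsub>M\<^esub> n) = lact M a m \<oplus>\<^bsub>M\<^esub> lact M a n"
    and ract_add: "\<lbrakk>a \<in> carrier A; m \<in> carrier M; n \<in> carrier M\<rbrakk>
      \<Longrightarrow> ract M (m \<oplus>\<^bsub>M\<^esub> n) a = ract M m a \<oplus>\<^bsub>M\<^esub> ract M n a"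
    and add_lact: "\<lbrakk>a \<in> carrier A; b \<in> carrier A; m \<in> carrier M\<rbrakk>
      \<Longrightarrow> lact M (a \<oplus>\<^bsub>A\<^esub> b) m = lact M a m \<oplus>\<^bsub>M\<^esub> lact M b m"
    and add_ract: "\<lbrakk>a \<in> carrier A; b \<in> carrier A; m \<in> carrier M\<rbrakk>
      \<Longrightarrow> ract M m (a \<oplus>\<^bsub>A\<^esub> b) = ract M m a \<oplus>\<^bsub>M\<^esub> ract M m b"
    and lact_mult: "\<lbrakk>a \<in> carrier A; b \<in> carrier A; m \<in> carrier M\<rbrakk>
      \<Longrightarrow> lact M (a \<otimes>\<^bsub>A\<^esub> b) m = lact M a (lact M b m)"
    and ract_mult: "\<lbrakk>a \<in> carrier A; b \<in> carrier A; m \<in> carrier M\<rbrakk>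
      \<Longrightarrow> ract M m (a \<otimes>\<^bsub>A\<^esub> b) = ract M (ract M m a) b"
    and lact_one: "m \<in> carrier M \<Longrightarrow> lact M \<one>\<^bsub>A\<^esub> m = m"
    and ract_one: "m \<in> carrier M \<Longrightarrow> ract M m \<one>\<^bsub>A\<^esub> = m"
    and lact_ract: "\<lbrakk>a \<in> carrier A; b \<in> carrier A; m \<in> carrier M\<rbrakk>
      \<Longrightarrow> ract M (lact M a m) b = lact M a (ract M m b)"
    and lact_scalar: "\<lbrakk>r \<in> carrier R; m \<in> carrier M\<rbrakk> \<Longrightarrow> lact M (r \<odot>\<^bsub>A\<^esub> \<one>\<^bsub>A\<^esub>) m = r \<odot>\<^bsub>M\<^esub> m"
    and ract_scalar: "\<lbrakk>r \<in> carrier R; m \<in> carrier M\<rbrakk> \<Longrightarrow> ract M m (r \<odot>\<^bsub>A\<^esub> \<one>\<^bsub>A\<^esub>) = r \<odot>\<^bsub>M\<^esub> m"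

definition mod_hom ::
  "'r ring \<Rightarrow> ('r, 'm, 'y) module_scheme \<Rightarrow> ('r, 'n, 'z) module_scheme \<Rightarrow> ('m \<Rightarrow> 'n) set"
  where "mod_hom R M N = {f \<in> carrier M \<rightarrow> carrier N.
    (\<forall>x\<in>carrier M. \<forall>y\<in>carrier M. f (x \<oplus>\<^bsub>M\<^esub> y) = f x \<oplus>\<^bsub>N\<^esub> f y) \<and>
    (\<forall>r\<in>carrier R. \<forall>x\<in>carrier M. f (r \<odot>\<^bsub>M\<^esub> x) = r \<odot>\<^bsub>N\<^esub> f x)}"

definition mod_isomorphic ::
  "'r ring \<Rightarrow> ('r, 'm, 'y) module_scheme \<Rightarrow> ('r, 'n, 'z) module_scheme \<Rightarrow> bool"
  where "mod_isomorphic R M N \<longleftrightarrow>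
    (\<exists>f\<in>mod_hom R M N. bij_betw f (carrier M) (carrier N))"

definition quot_module :: "('r, 'm, 'z) module_scheme \<Rightarrow> 'm set \<Rightarrow> ('r, 'm set) module"
  where "quot_module M N =
    \<lparr>carrier = a_rcosets\<^bsub>M\<^esub> N, monoid.mult = undefined, one = undefined, zero = N,
     add = set_add M, smult = (\<lambda>r X. \<Union>x\<in>X. N +>\<^bsub>M\<^esub> (r \<odot>\<^bsub>M\<^esub> x))\<rparr>"

definition submodule_span ::
  "'r ring \<Rightarrow> ('r, 'm) module \<Rightarrow> 'm set \<Rightarrow> 'm set"
  where "submodule_span R M S = \<Inter>{N. submodule N R M \<and> S \<subseteq> N}"

definition zero_module :: "('r, 'm) module"
  where "zero_module =
    \<lparr>carrier = {undefined}, monoid.mult = undefined, one = undefined, zero = undefined,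
     add = (\<lambda>x y. undefined), smult = (\<lambda>r x. undefined)\<rparr>"

definition dsum :: "'i set \<Rightarrow> ('i \<Rightarrow> ('r, 'm) module) \<Rightarrow> ('r, 'i \<Rightarrow> 'm) module"
  where "dsum I N =
    \<lparr>carrier = {c \<in> \<Pi>\<^sub>E i\<in>I. carrier (N i). finite {i \<in> I. c i \<noteq> \<zero>\<^bsub>N i\<^esub>}},
     monoid.mult = undefined, one = undefined,
     zero = (\<lambda>i\<in>I. \<zero>\<^bsub>N i\<^esub>),
     add = (\<lambda>c c'. \<lambda>i\<in>I. c i \<oplus>\<^bsub>N i\<^esub> c' i),
     smult = (\<lambda>r c. \<lambda>i\<in>I. r \<odot>\<^bsub>N i\<^esub> c i)\<rparr>"

definition dsum_in :: "'i set \<Rightarrow> ('i \<Rightarrow> ('r, 'm) module) \<Rightarrow> 'i \<Rightarrow> 'm \<Rightarrow> 'i \<Rightarrow> 'm"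
  where "dsum_in I N j v = (\<lambda>i\<in>I. if i = j then v else \<zero>\<^bsub>N i\<^esub>)"

definition regular_module :: "'r ring \<Rightarrow> ('r, 'r) module"
  where "regular_module R =
    \<lparr>carrier = carrier R, monoid.mult = undefined, one = undefined, zero = \<zero>\<^bsub>R\<^esub>,
     add = add R, smult = monoid.mult R\<rparr>"

definition free_module :: "'r ring \<Rightarrow> 'i set \<Rightarrow> ('r, 'i \<Rightarrow> 'r) module"
  where "free_module R I = dsum I (\<lambda>i. regular_module R)"

definition free_gen :: "'r ring \<Rightarrow> 'i set \<Rightarrow> 'i \<Rightarrow> 'i \<Rightarrow> 'r"
  where "free_gen R I j = dsum_in I (\<lambda>i. regular_module R) j \<one>\<^bsub>R\<^esub>"

definition sgn_pow :: "'r ring \<Rightarrow> nat \<Rightarrow> 'r"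
  where "sgn_pow R i = (\<ominus>\<^bsub>R\<^esub> \<one>\<^bsub>R\<^esub>) [^]\<^bsub>R\<^esub> i"


section \<open>Unordered tensor products\<close>

text \<open>
  The tensor product over \<open>R\<close> of a family \<open>N\<close> of modules indexed by an (unordered) finite set
  \<open>I\<close> is the free module on \<open>\<Pi>\<^sub>E i\<in>I. carrier (N i)\<close> modulo the multilinearity relations.
\<close>

definition tensor_relations ::
  "'r ring \<Rightarrow> 'i set \<Rightarrow> ('i \<Rightarrow> ('r, 'm) module) \<Rightarrow> (('i \<Rightarrow> 'm) \<Rightarrow> 'r) set"
  where "tensor_relations R I N =
    (let X = (\<Pi>\<^sub>E i\<in>I. carrier (N i)); F = free_module R X; \<delta> = free_gen R X in
     {\<delta> (t(i := u \<oplus>\<^bsub>N i\<^esub> v)) \<ominus>\<^bsub>F\<^esub> (\<delta> (t(i := u)) \<oplus>\<^bsub>F\<^esub> \<delta> (t(i := v))) | t i u v.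
        t \<in> X \<and> i \<in> I \<and> u \<in> carrier (N i) \<and> v \<in> carrier (N i)} \<union>
     {\<delta> (t(i := r \<odot>\<^bsub>N i\<^esub> u)) \<ominus>\<^bsub>F\<^esub> (r \<odot>\<^bsub>F\<^esub> \<delta> (t(i := u))) | t i r u.
        t \<in> X \<and> i \<in> I \<and> r \<in> carrier R \<and> u \<in> carrier (N i)})"

definition tensor ::
  "'r ring \<Rightarrow> 'i set \<Rightarrow> ('i \<Rightarrow> ('r, 'm) module) \<Rightarrow> ('r, (('i \<Rightarrow> 'm) \<Rightarrow> 'r) set) module"
  where "tensor R I N =
    (let F = free_module R (\<Pi>\<^sub>E i\<in>I. carrier (N i)) in
     quot_module F (submodule_span R F (tensor_relations R I N)))"

definition pure_tensor ::
  "'r ring \<Rightarrow> 'i set \<Rightarrow> ('i \<Rightarrow> ('r, 'm) module) \<Rightarrow> ('i \<Rightarrow> 'm) \<Rightarrow> (('i \<Rightarrow> 'm) \<Rightarrow> 'r) set"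
  where "pure_tensor R I N t =
    (let X = (\<Pi>\<^sub>E i\<in>I. carrier (N i)); F = free_module R X in
     submodule_span R F (tensor_relations R I N) +>\<^bsub>F\<^esub> free_gen R X t)"

text \<open>The linear map on a tensor product with prescribed (multilinear) values on pure tensors.\<close>

definition tensor_lift ::
  "'r ring \<Rightarrow> 'i set \<Rightarrow> ('i \<Rightarrow> ('r, 'm) module) \<Rightarrow> ('r, 'p) module \<Rightarrow> (('i \<Rightarrow> 'm) \<Rightarrow> 'p)
    \<Rightarrow> (('i \<Rightarrow> 'm) \<Rightarrow> 'r) set \<Rightarrow> 'p"
  where "tensor_lift R I N P f =
    (THE g. g \<in> mod_hom R (tensor R I N) P \<and> g \<in> extensional (carrier (tensor R I N)) \<and>
      (\<forall>t\<in>\<Pi>\<^sub>E i\<in>I. carrier (N i). g (pure_tensor R I N t) = f t))"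

text \<open>
  The factors of the tensor products below are copies of \<open>A\<close> and \<open>M\<close>, placed in a common type
  by means of \<^const>\<open>Inl\<close> and \<^const>\<open>Inr\<close>.
\<close>

definition transport :: "('m \<Rightarrow> 'n) \<Rightarrow> ('n \<Rightarrow> 'm) \<Rightarrow> ('r, 'm, 'z) module_scheme \<Rightarrow> ('r, 'n) module"
  where "transport f g N =
    \<lparr>carrier = f ` carrier N, monoid.mult = undefined, one = undefined, zero = f \<zero>\<^bsub>N\<^esub>,
     add = (\<lambda>x y. f (g x \<oplus>\<^bsub>N\<^esub> g y)), smult = (\<lambda>r x. f (r \<odot>\<^bsub>N\<^esub> g x))\<rparr>"

definition tensor_factor ::
  "('r, 'a) module \<Rightarrow> ('r, 'm, 'a) bimodule \<Rightarrow> bool \<Rightarrow> ('r, 'a + 'm) module"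
  where "tensor_factor A M is_base =
    (if is_base then transport Inr projr M else transport Inl projl A)"

fun fuse :: "('r, 'a) module \<Rightarrow> ('r, 'm, 'a) bimodule \<Rightarrow> 'a + 'm \<Rightarrow> 'a + 'm \<Rightarrow> 'a + 'm"
  where
    "fuse A M (Inl a) (Inl b) = Inl (a \<otimes>\<^bsub>A\<^esub> b)"
  | "fuse A M (Inl a) (Inr m) = Inr (lact M a m)"
  | "fuse A M (Inr m) (Inl a) = Inr (ract M m a)"
  | "fuse A M (Inr m) (Inr m') = undefined"


section \<open>Chain complexes and homology\<close>

text \<open>
  A chain complex is given by its modules \<open>C k\<close> and its differentials \<open>d k\<close> from \<open>C k\<close> to
  \<open>C (k - 1)\<close>, for all integers \<open>k\<close>.
\<close>

definition cycles ::
  "(int \<Rightarrow> ('r, 'c) module) \<Rightarrow> (int \<Rightarrow> 'c \<Rightarrow> 'c) \<Rightarrow> int \<Rightarrow> ('r, 'c) module"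
  where "cycles C d k = (C k)\<lparr>carrier := a_kernel (C k) (C (k - 1)) (d k)\<rparr>"

definition boundaries ::
  "(int \<Rightarrow> ('r, 'c) module) \<Rightarrow> (int \<Rightarrow> 'c \<Rightarrow> 'c) \<Rightarrow> int \<Rightarrow> 'c set"
  where "boundaries C d k = d (k + 1) ` carrier (C (k + 1))"

definition homology ::
  "(int \<Rightarrow> ('r, 'c) module) \<Rightarrow> (int \<Rightarrow> 'c \<Rightarrow> 'c) \<Rightarrow> int \<Rightarrow> ('r, 'c set) module"
  where "homology C d k = quot_module (cycles C d k) (boundaries C d k)"

definition homology_map ::
  "(int \<Rightarrow> ('r, 'c) module) \<Rightarrow> (int \<Rightarrow> 'c \<Rightarrow> 'c) \<Rightarrow>
   (int \<Rightarrow> ('r, 'e) module) \<Rightarrow> (int \<Rightarrow> 'e \<Rightarrow> 'e) \<Rightarrow> (int \<Rightarrow> 'c \<Rightarrow> 'e) \<Rightarrow> int \<Rightarrow> 'c set \<Rightarrow> 'e set"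
  where "homology_map C d C' d' \<phi> k =
    (\<lambda>X\<in>carrier (homology C d k). \<Union>c\<in>X. boundaries C' d' k +>\<^bsub>cycles C' d' k\<^esub> \<phi> k c)"

text \<open>Graded modules are families of modules indexed by the integers.\<close>

definition GrMod :: "'r ring \<Rightarrow> (int \<Rightarrow> ('r, 'm) module, int \<Rightarrow> 'm \<Rightarrow> 'm) cat"
  where "GrMod R =
    \<lparr>Obj = {X. \<forall>k. Module.module R (X k)},
     Arr = (\<lambda>X Y. {f. \<forall>k. f k \<in> mod_hom R (X k) (Y k) \<and> f k \<in> extensional (carrier (X k))}),
     Idn = (\<lambda>X k. \<lambda>x\<in>carrier (X k). x),
     Cmp = (\<lambda>X g f k. compose (carrier (X k)) (g k) (f k))\<rparr>"


section \<open>Homology of a poset with coefficients in a functor\<close>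

text \<open>
  The posets are sets \<open>P\<close> of sets, ordered by inclusion.  A covariant functor on \<open>P\<close> is given by
  its modules \<open>Fo x\<close> and its maps \<open>Fm x y\<close> for \<open>x \<subseteq> y\<close>.  There are no chains of
  negative degree, so the chain modules of negative degree are zero.
\<close>

definition poset_chains :: "'e set set \<Rightarrow> int \<Rightarrow> 'e set list set"
  where "poset_chains P k =
    {xs. xs \<noteq> [] \<and> set xs \<subseteq> P \<and> sorted_wrt (\<subseteq>) xs \<and> int (length xs) = k + 1}"

definition del_nth :: "nat \<Rightarrow> 'x list \<Rightarrow> 'x list"
  where "del_nth i xs = take i xs @ drop (Suc i) xs"

definition S_mod ::
  "'e set set \<Rightarrow> ('e set \<Rightarrow> ('r, 't) module) \<Rightarrow> int \<Rightarrow> ('r, 'e set list \<Rightarrow> 't) module"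
  where "S_mod P Fo k = dsum (poset_chains P k) (\<lambda>xs. Fo (hd xs))"

text \<open>\<open>S_elem P Fo k \<lambda> xs\<close> is the element of \<open>S_mod P Fo k\<close> written \<open>\<lambda> x\<^sub>0 x\<^sub>1 \<dots> x\<^sub>k\<close>.\<close>

definition S_elem ::
  "'e set set \<Rightarrow> ('e set \<Rightarrow> ('r, 't) module) \<Rightarrow> int \<Rightarrow> 't \<Rightarrow> 'e set list \<Rightarrow> 'e set list \<Rightarrow> 't"
  where "S_elem P Fo k v xs = dsum_in (poset_chains P k) (\<lambda>ys. Fo (hd ys)) xs v"

definition S_diff ::
  "'r ring \<Rightarrow> 'e set set \<Rightarrow> ('e set \<Rightarrow> ('r, 't) module) \<Rightarrow> ('e set \<Rightarrow> 'e set \<Rightarrow> 't \<Rightarrow> 't) \<Rightarrow>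
   int \<Rightarrow> ('e set list \<Rightarrow> 't) \<Rightarrow> 'e set list \<Rightarrow> 't"
  where "S_diff R P Fo Fm k c =
    (let S = S_mod P Fo (k - 1) in
     if k \<le> 0 then \<zero>\<^bsub>S\<^esub>
     else \<Oplus>\<^bsub>S\<^esub>xs\<in>poset_chains P k.
       S_elem P Fo (k - 1) (Fm (xs ! 0) (xs ! 1) (c xs)) (tl xs) \<oplus>\<^bsub>S\<^esub>
       (\<Oplus>\<^bsub>S\<^esub>i\<in>{1..nat k}. sgn_pow R i \<odot>\<^bsub>S\<^esub> S_elem P Fo (k - 1) (c xs) (del_nth i xs)))"

definition covers :: "'e set set \<Rightarrow> 'e set \<Rightarrow> 'e set \<Rightarrow> bool"
  where "covers P x y \<longleftrightarrow> x \<in> P \<and> y \<in> P \<and> x \<subset> y \<and> \<not> (\<exists>z\<in>P. x \<subset> z \<and> z \<subset> y)"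

definition cover_chain :: "'e set set \<Rightarrow> 'e set \<Rightarrow> 'e set \<Rightarrow> 'e set list \<Rightarrow> bool"
  where "cover_chain P x y zs \<longleftrightarrow> zs \<noteq> [] \<and> hd zs = x \<and> last zs = y \<and> set zs \<subseteq> P \<and>
    (\<forall>i. Suc i < length zs \<longrightarrow> covers P (zs ! i) (zs ! Suc i))"

fun chain_composite ::
  "('e set \<Rightarrow> ('r, 't) module) \<Rightarrow> ('e set \<Rightarrow> 'e set \<Rightarrow> 't \<Rightarrow> 't) \<Rightarrow> 'e set list \<Rightarrow> 't \<Rightarrow> 't"
  where
    "chain_composite Fo Fc [] = undefined"
  | "chain_composite Fo Fc [x] = (\<lambda>v\<in>carrier (Fo x). v)"
  | "chain_composite Fo Fc (x # y # zs) =
      compose (carrier (Fo x)) (chain_composite Fo Fc (y # zs)) (Fc x y)"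


section \<open>Based digraphs and multipaths\<close>

text \<open>A finite digraph may have loops and parallel edges (\<^locale>\<open>fin_digraph\<close>).\<close>

definition DirGr_b ::
  "(('v, 'e) pre_digraph \<times> 'v, ('v \<Rightarrow> 'v) \<times> ('e \<Rightarrow> 'e)) cat"
  where "DirGr_b =
    \<lparr>Obj = {(G, b). fin_digraph G \<and> b \<in> verts G},
     Arr = (\<lambda>(G, b) (H, c). {(fv, fe).
        fv \<in> verts G \<rightarrow>\<^sub>E verts H \<and> inj_on fv (verts G) \<and>
        fe \<in> arcs G \<rightarrow>\<^sub>E arcs H \<and> inj_on fe (arcs G) \<and>
        (\<forall>e\<in>arcs G. tail H (fe e) = fv (tail G e) \<and> head H (fe e) = fv (head G e)) \<and>
        fv b = c}),
     Idn = (\<lambda>(G, b). (\<lambda>v\<in>verts G. v, \<lambda>e\<in>arcs G. e)),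
     Cmp = (\<lambda>(G, b) (gv, ge) (fv, fe). (compose (verts G) gv fv, compose (arcs G) ge fe))\<rparr>"

definition directed_ngon :: "nat \<Rightarrow> ('v, 'e) pre_digraph \<Rightarrow> bool"
  where "directed_ngon n G \<longleftrightarrow> n \<ge> 1 \<and>
    (\<exists>v e. bij_betw v {..<n} (verts G) \<and> bij_betw e {..<n} (arcs G) \<and>
      (\<forall>i<n. tail G (e i) = v i \<and> head G (e i) = v (Suc i mod n)))"

definition simple_path :: "('v, 'e) pre_digraph \<Rightarrow> 'e list \<Rightarrow> bool"
  where "simple_path G p \<longleftrightarrow> p \<noteq> [] \<and> (\<exists>u v. pre_digraph.apath G u p v)"

definition path_verts :: "('v, 'e) pre_digraph \<Rightarrow> 'e list \<Rightarrow> 'v set"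
  where "path_verts G p = tail G ` set p \<union> head G ` set p"

definition path_poset :: "('v, 'e) pre_digraph \<Rightarrow> 'e set set"
  where "path_poset G = {x. \<exists>Q. (\<forall>p\<in>Q. simple_path G p) \<and>
    (\<forall>p\<in>Q. \<forall>q\<in>Q. p \<noteq> q \<longrightarrow> path_verts G p \<inter> path_verts G q = {}) \<and>
    x = (\<Union>p\<in>Q. set p)}"

text \<open>Components of \<open>\<Gamma>\<^sub>x\<close> are components of the underlying undirected graph, as vertex sets.\<close>

definition component_rel :: "('v, 'e) pre_digraph \<Rightarrow> 'e set \<Rightarrow> ('v \<times> 'v) set"
  where "component_rel G x =
    {(u, v). reachable (with_proj (mk_symmetric (G\<lparr>arcs := x\<rparr>))) u v}"

definition pi0 :: "('v, 'e) pre_digraph \<Rightarrow> 'e set \<Rightarrow> 'v set set"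
  where "pi0 G x = verts G // component_rel G x"

definition component_of :: "('v, 'e) pre_digraph \<Rightarrow> 'e set \<Rightarrow> 'v \<Rightarrow> 'v set"
  where "component_of G x v = component_rel G x `` {v}"


section \<open>The coefficient functor\<close>

text \<open>In this section \<open>\<Gamma> = (G, b)\<close> is a based digraph.\<close>

definition M_fam ::
  "('r, 'a) module \<Rightarrow> ('r, 'm, 'a) bimodule \<Rightarrow> ('v, 'e) pre_digraph \<times> 'v \<Rightarrow> 'v set
    \<Rightarrow> ('r, 'a + 'm) module"
  where "M_fam A M \<Gamma> \<alpha> = tensor_factor A M (snd \<Gamma> \<in> \<alpha>)"

definition F_obj ::
  "'r ring \<Rightarrow> ('r, 'a) module \<Rightarrow> ('r, 'm, 'a) bimodule \<Rightarrow> ('v, 'e) pre_digraph \<times> 'v \<Rightarrow> 'e set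
    \<Rightarrow> ('r, (('v set \<Rightarrow> 'a + 'm) \<Rightarrow> 'r) set) module"
  where "F_obj R A M \<Gamma> x = tensor R (pi0 (fst \<Gamma>) x) (M_fam A M \<Gamma>)"

text \<open>
  The map for \<open>x \<prec> y\<close>: if \<open>e\<close> is the additional edge of \<open>y\<close>, then the components \<open>\<alpha>\<close> of its
  tail and \<open>\<beta>\<close> of its head fuse to the component \<open>\<alpha> \<union> \<beta>\<close>.
\<close>

definition F_cover ::
  "'r ring \<Rightarrow> ('r, 'a) module \<Rightarrow> ('r, 'm, 'a) bimodule \<Rightarrow> ('v, 'e) pre_digraph \<times> 'v
    \<Rightarrow> 'e set \<Rightarrow> 'e set
    \<Rightarrow> (('v set \<Rightarrow> 'a + 'm) \<Rightarrow> 'r) set \<Rightarrow> (('v set \<Rightarrow> 'a + 'm) \<Rightarrow> 'r) set"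
  where "F_cover R A M \<Gamma> x y =
    (let G = fst \<Gamma>; e = the_elem (y - x);
         \<alpha> = component_of G x (tail G e); \<beta> = component_of G x (head G e) in
     tensor_lift R (pi0 G x) (M_fam A M \<Gamma>) (F_obj R A M \<Gamma> y)
       (\<lambda>t. pure_tensor R (pi0 G y) (M_fam A M \<Gamma>)
         (\<lambda>\<gamma>\<in>pi0 G y. if \<gamma> = \<alpha> \<union> \<beta> then fuse A M (t \<alpha>) (t \<beta>) else t \<gamma>)))"

definition F_map ::
  "'r ring \<Rightarrow> ('r, 'a) module \<Rightarrow> ('r, 'm, 'a) bimodule \<Rightarrow> ('v, 'e) pre_digraph \<times> 'v
    \<Rightarrow> 'e set \<Rightarrow> 'e set
    \<Rightarrow> (('v set \<Rightarrow> 'a + 'm) \<Rightarrow> 'r) set \<Rightarrow> (('v set \<Rightarrow> 'a + 'm) \<Rightarrow> 'r) set"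
  where "F_map R A M \<Gamma> x y =
    chain_composite (F_obj R A M \<Gamma>) (F_cover R A M \<Gamma>)
      (SOME zs. cover_chain (path_poset (fst \<Gamma>)) x y zs)"


section \<open>The homology of a based digraph and its induced maps\<close>

definition dg_mod ::
  "'r ring \<Rightarrow> ('r, 'a) module \<Rightarrow> ('r, 'm, 'a) bimodule \<Rightarrow> ('v, 'e) pre_digraph \<times> 'v \<Rightarrow> int
    \<Rightarrow> ('r, 'e set list \<Rightarrow> (('v set \<Rightarrow> 'a + 'm) \<Rightarrow> 'r) set) module"
  where "dg_mod R A M \<Gamma> = S_mod (path_poset (fst \<Gamma>)) (F_obj R A M \<Gamma>)"

definition dg_diff ::
  "'r ring \<Rightarrow> ('r, 'a) module \<Rightarrow> ('r, 'm, 'a) bimodule \<Rightarrow> ('v, 'e) pre_digraph \<times> 'v \<Rightarrow> int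
    \<Rightarrow> ('e set list \<Rightarrow> (('v set \<Rightarrow> 'a + 'm) \<Rightarrow> 'r) set)
    \<Rightarrow> 'e set list \<Rightarrow> (('v set \<Rightarrow> 'a + 'm) \<Rightarrow> 'r) set"
  where "dg_diff R A M \<Gamma> =
    S_diff R (path_poset (fst \<Gamma>)) (F_obj R A M \<Gamma>) (F_map R A M \<Gamma>)"

definition dg_homology ::
  "'r ring \<Rightarrow> ('r, 'a) module \<Rightarrow> ('r, 'm, 'a) bimodule \<Rightarrow> ('v, 'e) pre_digraph \<times> 'v \<Rightarrow> int
    \<Rightarrow> ('r, ('e set list \<Rightarrow> (('v set \<Rightarrow> 'a + 'm) \<Rightarrow> 'r) set) set) module"
  where "dg_homology R A M \<Gamma> = homology (dg_mod R A M \<Gamma>) (dg_diff R A M \<Gamma>)"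

text \<open>
  \<open>tau R A M \<Gamma>' \<Gamma> (fv, fe) x\<close>: a component of \<open>\<Gamma>\<close> with respect to the image of \<open>x\<close> is either the
  image of a component of \<open>\<Gamma>'\<close> with respect to \<open>x\<close> (namely of its preimage), or a single vertex
  outside the image of \<open>\<Gamma>'\<close>; in the latter case the factor is \<open>1\<close>.
\<close>

definition tau ::
  "'r ring \<Rightarrow> ('r, 'a) module \<Rightarrow> ('r, 'm, 'a) bimodule
    \<Rightarrow> ('v, 'e) pre_digraph \<times> 'v \<Rightarrow> ('v, 'e) pre_digraph \<times> 'v \<Rightarrow> ('v \<Rightarrow> 'v) \<times> ('e \<Rightarrow> 'e)
    \<Rightarrow> 'e set
    \<Rightarrow> (('v set \<Rightarrow> 'a + 'm) \<Rightarrow> 'r) set \<Rightarrow> (('v set \<Rightarrow> 'a + 'm) \<Rightarrow> 'r) set"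
  where "tau R A M \<Gamma>' \<Gamma> f x =
    (let G' = fst \<Gamma>'; G = fst \<Gamma>; fv = fst f; fx = snd f ` x in
     tensor_lift R (pi0 G' x) (M_fam A M \<Gamma>') (F_obj R A M \<Gamma> fx)
       (\<lambda>t. pure_tensor R (pi0 G fx) (M_fam A M \<Gamma>)
         (\<lambda>\<beta>\<in>pi0 G fx. if \<beta> \<inter> fv ` verts G' = {} then Inl \<one>\<^bsub>A\<^esub>
           else t {v \<in> verts G'. fv v \<in> \<beta>})))"

definition dg_chain_map ::
  "'r ring \<Rightarrow> ('r, 'a) module \<Rightarrow> ('r, 'm, 'a) bimodule
    \<Rightarrow> ('v, 'e) pre_digraph \<times> 'v \<Rightarrow> ('v, 'e) pre_digraph \<times> 'v \<Rightarrow> ('v \<Rightarrow> 'v) \<times> ('e \<Rightarrow> 'e)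
    \<Rightarrow> int \<Rightarrow> ('e set list \<Rightarrow> (('v set \<Rightarrow> 'a + 'm) \<Rightarrow> 'r) set)
    \<Rightarrow> 'e set list \<Rightarrow> (('v set \<Rightarrow> 'a + 'm) \<Rightarrow> 'r) set"
  where "dg_chain_map R A M \<Gamma>' \<Gamma> f k c =
    (\<Oplus>\<^bsub>dg_mod R A M \<Gamma> k\<^esub>xs\<in>poset_chains (path_poset (fst \<Gamma>')) k.
      S_elem (path_poset (fst \<Gamma>)) (F_obj R A M \<Gamma>) k
        (tau R A M \<Gamma>' \<Gamma> f (hd xs) (c xs)) (map ((`) (snd f)) xs))"

definition dg_homology_map ::
  "'r ring \<Rightarrow> ('r, 'a) module \<Rightarrow> ('r, 'm, 'a) bimodule
    \<Rightarrow> ('v, 'e) pre_digraph \<times> 'v \<Rightarrow> ('v, 'e) pre_digraph \<times> 'v \<Rightarrow> ('v \<Rightarrow> 'v) \<times> ('e \<Rightarrow> 'e)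
    \<Rightarrow> int \<Rightarrow> ('e set list \<Rightarrow> (('v set \<Rightarrow> 'a + 'm) \<Rightarrow> 'r) set) set
    \<Rightarrow> ('e set list \<Rightarrow> (('v set \<Rightarrow> 'a + 'm) \<Rightarrow> 'r) set) set"
  where "dg_homology_map R A M \<Gamma>' \<Gamma> f =
    homology_map (dg_mod R A M \<Gamma>') (dg_diff R A M \<Gamma>') (dg_mod R A M \<Gamma>) (dg_diff R A M \<Gamma>)
      (dg_chain_map R A M \<Gamma>' \<Gamma> f)"


section \<open>Hochschild homology\<close>

text \<open>
  The chain module of degree \<open>n\<close> is the tensor product indexed by \<open>{0..n}\<close>, with \<open>M\<close> at
  position \<open>0\<close> and \<open>A\<close> at all other positions.  The \<open>i\<close>-th face multiplies the factors \<open>i\<close> and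
  \<open>i + 1\<close> if \<open>i < n\<close>, and the factors \<open>n\<close> and \<open>0\<close> if \<open>i = n\<close>.
\<close>

definition hoch_fam ::
  "('r, 'a) module \<Rightarrow> ('r, 'm, 'a) bimodule \<Rightarrow> nat \<Rightarrow> ('r, 'a + 'm) module"
  where "hoch_fam A M j = tensor_factor A M (j = 0)"

definition hoch_mod ::
  "'r ring \<Rightarrow> ('r, 'a) module \<Rightarrow> ('r, 'm, 'a) bimodule \<Rightarrow> int
    \<Rightarrow> ('r, ((nat \<Rightarrow> 'a + 'm) \<Rightarrow> 'r) set) module"
  where "hoch_mod R A M k =
    (if k < 0 then zero_module else tensor R {0..nat k} (hoch_fam A M))"

definition hoch_face ::
  "('r, 'a) module \<Rightarrow> ('r, 'm, 'a) bimodule \<Rightarrow> nat \<Rightarrow> nat \<Rightarrow> (nat \<Rightarrow> 'a + 'm) \<Rightarrow> nat \<Rightarrow> 'a + 'm"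
  where "hoch_face A M n i t = (\<lambda>j\<in>{0..n - 1}.
    if i < n then (if j < i then t j else if j = i then fuse A M (t i) (t (i + 1)) else t (j + 1))
    else (if j = 0 then fuse A M (t n) (t 0) else t j))"

definition hoch_diff ::
  "'r ring \<Rightarrow> ('r, 'a) module \<Rightarrow> ('r, 'm, 'a) bimodule \<Rightarrow> int
    \<Rightarrow> ((nat \<Rightarrow> 'a + 'm) \<Rightarrow> 'r) set \<Rightarrow> ((nat \<Rightarrow> 'a + 'm) \<Rightarrow> 'r) set"
  where "hoch_diff R A M k =
    (let n = nat k; P = hoch_mod R A M (k - 1) in
     if k \<le> 0 then (\<lambda>x. \<zero>\<^bsub>P\<^esub>)
     else tensor_lift R {0..n} (hoch_fam A M) P
       (\<lambda>t. \<Oplus>\<^bsub>P\<^esub>i\<in>{0..n}. sgn_pow R i \<odot>\<^bsub>P\<^esub>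
         pure_tensor R {0..n - 1} (hoch_fam A M) (hoch_face A M n i t)))"

definition hochschild_homology ::
  "'r ring \<Rightarrow> ('r, 'a) module \<Rightarrow> ('r, 'm, 'a) bimodule \<Rightarrow> int
    \<Rightarrow> ('r, ((nat \<Rightarrow> 'a + 'm) \<Rightarrow> 'r) set set) module"
  where "hochschild_homology R A M = homology (hoch_mod R A M) (hoch_diff R A M)"

end

theory Submission
 imports Defs
begin

text \<open>For the polygon a multipath is the complement of a nonempty set \<open>c\<close> of cut edges, and its coefficient
module is the Hochschild chain module in degree \<open>|c| - 1\<close>; uncutting an edge is a Hochschild face map.  Two
augmented bisimplicial modules with exact rows and columns compare the path poset complex with the complex of
chains indexed by all \<open>c\<close>, and the latter with the Hochschild complex.  Only the columns of the second one are
not contractible: they are exact in degrees below \<open>n - 1\<close>, which is the source of the bound on \<open>i\<close>.\<close>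

section \<open>Module homomorphisms and quotients\<close>

text \<open>Neither comparison is given by a chain map: it is a relation between cycles, traced by
  staircases in a double complex, so that only exactness of rows and columns enters. In the first
  one an index is a chain of multipaths with a set of cuts available to its largest member. For a
  fixed chain these sets are the nonempty faces of a simplex, and for fixed \<open>c\<close> the
  chains live in a poset with top \<open>xc c\<close>; both are cones, so no degree is lost. In the
  second one the faces of the Hochschild module are shared out: some act alone, the others while a
  cut is deleted. Prepending a cut fails to contract where that cut is already present, and
  repairing the defect by induction consumes one edge per degree. The functor itself needs
  \<open>F_map\<close> not to depend on the chosen chain. This comes down to associativity of
  products, once it is known that after deleting two edges of a multipath their tails lie in
  different components, their heads too, and that they close no cycle. Reading this off a
  decomposition into paths is awkward, so multipaths are first replaced by a labelling of the
  vertices by path and position.\<close>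

lemma mod_homI:
 assumes "\<And>x. x \<in> carrier M ==> f x \<in> carrier N"
  and "\<And>x y. [|x \<in> carrier M; y \<in> carrier M|] ==> f (x \<oplus>\<^bsub>M\<^esub> y) = f x \<oplus>\<^bsub>N\<^esub> f y"
  and "\<And>r x. [|r \<in> carrier R; x \<in> carrier M|] ==> f (r \<odot>\<^bsub>M\<^esub> x) = r \<odot>\<^bsub>N\<^esub> f x"
 shows "f \<in> mod_hom R M N"
 using assms by (auto simp: mod_hom_def)

lemma mod_hom_closed: "[|f \<in> mod_hom R M N; x \<in> carrier M|] ==> f x \<in> carrier N"
 by (auto simp: mod_hom_def)

lemma mod_hom_add:
 "[|f \<in> mod_hom R M N; x \<in> carrier M; y \<in> carrier M|] ==> f (x \<oplus>\<^bsub>M\<^esub> y) = f x \<oplus>\<^bsub>N\<^esub> f y"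
 by (auto simp: mod_hom_def)

lemma mod_hom_smult:
 "[|f \<in> mod_hom R M N; r \<in> carrier R; x \<in> carrier M|] ==> f (r \<odot>\<^bsub>M\<^esub> x) = r \<odot>\<^bsub>N\<^esub> f x"
 by (auto simp: mod_hom_def)

text \<open>\<open>mod_hom\<close> constrains values on the carrier only. A raw function, its
  restriction and a formula for it can therefore be exchanged, which is how the extensional maps of
  the definitions meet the unrestricted ones constructed below.\<close>

lemma mod_hom_cong:
 assumes "f \<in> mod_hom R M N" "Module.module R M" "\<And>x. x \<in> carrier M ==> g x = f x"
 shows "g \<in> mod_hom R M N"
proof -
 interpret M: Module.module R M by fact
 show ?thesis
  by (rule mod_homI) (simp_all add: assms(3) mod_hom_closed[OF assms(1)] mod_hom_add[OF assms(1)]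
    mod_hom_smult[OF assms(1)])
qed

lemma mod_hom_zero:
 assumes "f \<in> mod_hom R M N" "Module.module R M" "Module.module R N"
 shows "f \<zero>\<^bsub>M\<^esub> = \<zero>\<^bsub>N\<^esub>"
proof -
 interpret M: Module.module R M by fact
 interpret N: Module.module R N by fact
 have "f \<zero>\<^bsub>M\<^esub> \<oplus>\<^bsub>N\<^esub> f \<zero>\<^bsub>M\<^esub> = f \<zero>\<^bsub>M\<^esub>"
  by (metis M.M.r_zero M.M.zero_closed mod_hom_add[OF assms(1)])
 then show ?thesis
  using mod_hom_closed[OF assms(1) M.M.zero_closed] by (metis N.M.add.r_cancel_one)
qed

lemma mod_hom_a_inv:
 assumes "f \<in> mod_hom R M N" "Module.module R M" "Module.module R N" "x \<in> carrier M"
 shows "f (\<ominus>\<^bsub>M\<^esub> x) = \<ominus>\<^bsub>N\<^esub> f x"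
proof -
 interpret M: Module.module R M by fact
 interpret N: Module.module R N by fact
 have "f (\<ominus>\<^bsub>M\<^esub> x) \<oplus>\<^bsub>N\<^esub> f x = \<zero>\<^bsub>N\<^esub>"
  using assms by (metis M.M.a_inv_closed M.M.l_neg mod_hom_add mod_hom_zero)
 then show ?thesis
  by (metis N.M.minus_equality M.M.a_inv_closed assms(1,4) mod_hom_closed)
qed

lemma mod_hom_minus:
 assumes "f \<in> mod_hom R M N" "Module.module R M" "Module.module R N" "x \<in> carrier M" "y \<in> carrier M"
 shows "f (x \<ominus>\<^bsub>M\<^esub> y) = f x \<ominus>\<^bsub>N\<^esub> f y"
proof -
 interpret M: Module.module R M by fact
 show ?thesis
  using assms by (simp add: a_minus_def mod_hom_add mod_hom_a_inv)
qed

lemma mod_hom_finsum: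
 assumes f: "f \<in> mod_hom R M N" "Module.module R M" "Module.module R N"
  and "finite I" "\<And>i. i \<in> I ==> x i \<in> carrier M"
 shows "f (\<Oplus>\<^bsub>M\<^esub>i\<in>I. x i) = (\<Oplus>\<^bsub>N\<^esub>i\<in>I. f (x i))"
proof -
 interpret M: Module.module R M by fact
 interpret N: Module.module R N by fact
 show ?thesis using assms(4,5)
 proof (induction I rule: finite_induct)
  case empty then show ?case by (simp add: mod_hom_zero[OF f])
 next
  case (insert i I)
  then have "(\<Oplus>\<^bsub>M\<^esub>i\<in>insert i I. x i) = x i \<oplus>\<^bsub>M\<^esub> (\<Oplus>\<^bsub>M\<^esub>i\<in>I. x i)"
   by (intro M.M.finsum_insert) auto
  moreover have "(\<Oplus>\<^bsub>N\<^esub>i\<in>insert i I. f (x i)) = f (x i) \<oplus>\<^bsub>N\<^esub> (\<Oplus>\<^bsub>N\<^esub>i\<in>I. f (x i))"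
   using insert by (intro N.M.finsum_insert) (auto intro: mod_hom_closed[OF f(1)])
  ultimately show ?case
   using insert by (simp add: mod_hom_add[OF f(1)] M.M.finsum_closed Pi_def)
 qed
qed

lemma mod_hom_comp:
 assumes "f \<in> mod_hom R M N" "g \<in> mod_hom R N P"
 shows "(%x. g (f x)) \<in> mod_hom R M P"
 by (rule mod_homI) (use assms in "auto simp: mod_hom_closed mod_hom_add mod_hom_smult")

lemma mod_hom_id: "Module.module R M ==> (%x. x) \<in> mod_hom R M M"
 by (rule mod_homI) auto

lemma mod_hom_const_zero:
 assumes "Module.module R N" shows "(%x. \<zero>\<^bsub>N\<^esub>) \<in> mod_hom R M N"
proof -
 interpret N: Module.module R N by fact
 show ?thesis by (rule mod_homI) auto
qed

lemma mod_hom_pointwise_add: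
 assumes "Module.module R N" "f \<in> mod_hom R M N" "g \<in> mod_hom R M N"
 shows "(%x. f x \<oplus>\<^bsub>N\<^esub> g x) \<in> mod_hom R M N"
proof -
 interpret N: Module.module R N by fact
 show ?thesis
  by (rule mod_homI) (use assms in \<open>auto simp: mod_hom_closed mod_hom_add mod_hom_smult
    N.smult_r_distr N.M.a_ac\<close>)
qed

lemma mod_hom_pointwise_smult:
 assumes "Module.module R N" "f \<in> mod_hom R M N" "r \<in> carrier R"
 shows "(%x. r \<odot>\<^bsub>N\<^esub> f x) \<in> mod_hom R M N"
proof -
 interpret N: Module.module R N by fact
 show ?thesis
  by (rule mod_homI) (use assms in \<open>auto simp: mod_hom_closed mod_hom_add mod_hom_smult
    N.smult_r_distr N.smult_assoc1[symmetric] N.R.m_comm\<close>)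
qed

lemma mod_hom_pointwise_finsum:
 assumes "Module.module R M" "Module.module R N" "finite I" "\<And>i. i \<in> I ==> f i \<in> mod_hom R M N"
 shows "(%x. \<Oplus>\<^bsub>N\<^esub>i\<in>I. f i x) \<in> mod_hom R M N"
 using assms(3,4)
proof (induction I rule: finite_induct)
 case empty
 interpret N: Module.module R N by fact
 show ?case by (simp add: mod_hom_const_zero assms)
next
 case (insert i I)
 interpret N: Module.module R N by fact
 have "(%x. f i x \<oplus>\<^bsub>N\<^esub> (\<Oplus>\<^bsub>N\<^esub>i\<in>I. f i x)) \<in> mod_hom R M N"
  by (intro mod_hom_pointwise_add) (use insert assms in auto)
 then show ?case
 proof (rule mod_hom_cong)
  fix x assume "x \<in> carrier M"
  then show "(\<Oplus>\<^bsub>N\<^esub>i\<in>insert i I. f i x) = f i x \<oplus>\<^bsub>N\<^esub> (\<Oplus>\<^bsub>N\<^esub>i\<in>I. f i x)"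
   using insert by (intro N.M.finsum_insert) (auto intro: mod_hom_closed)
 qed fact
qed

lemma mod_isomorphic_trans:
 assumes "mod_isomorphic R M N" "mod_isomorphic R N P"
 shows "mod_isomorphic R M P"
proof -
 obtain f g where "f \<in> mod_hom R M N" "bij_betw f (carrier M) (carrier N)"
  "g \<in> mod_hom R N P" "bij_betw g (carrier N) (carrier P)"
  using assms unfolding mod_isomorphic_def by blast
 then show ?thesis
  unfolding mod_isomorphic_def using mod_hom_comp[of f R M N g P] bij_betw_trans[of f _ _ g]
  by (force simp: comp_def)
qed

section \<open>Quotients by a submodule and their universal property\<close>

context
 fixes R :: "'r ring" and M :: "('r, 'm) module" and N :: "'m set"
 assumes M: "Module.module R M" and N: "submodule N R M"
begin

interpretation M: Module.module R M by (rule M)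

lemma submodule_abelian_subgroup: "abelian_subgroup N M"
 by (rule abelian_subgroupI3) (use N M.M.abelian_group_axioms in
   \<open>auto simp: submodule_def additive_subgroup_def\<close>)

interpretation N: abelian_subgroup N M by (rule submodule_abelian_subgroup)

lemma coset_eq_iff:
 assumes "x \<in> carrier M" "y \<in> carrier M"
 shows "N +>\<^bsub>M\<^esub> x = N +>\<^bsub>M\<^esub> y \<longleftrightarrow> x \<ominus>\<^bsub>M\<^esub> y \<in> N"
proof -
 have "N +>\<^bsub>M\<^esub> x = N +>\<^bsub>M\<^esub> y \<longleftrightarrow> x \<in> N +>\<^bsub>M\<^esub> y"
  using assms N.a_repr_independence'[of x y] N.a_rcos_self[of x] by auto
 then show ?thesis
  using assms N.a_rcos_module[of y x] by (simp add: a_minus_def)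
qed

lemma quot_carrier: "carrier (quot_module M N) = (%x. N +>\<^bsub>M\<^esub> x) ` carrier M"
 by (auto simp: quot_module_def A_RCOSETS_def')

lemma quot_zero: "\<zero>\<^bsub>quot_module M N\<^esub> = N +>\<^bsub>M\<^esub> \<zero>\<^bsub>M\<^esub>"
 by (simp add: quot_module_def N.a_subset)

lemma quot_add:
 "[|x \<in> carrier M; y \<in> carrier M|] ==>
  (N +>\<^bsub>M\<^esub> x) \<oplus>\<^bsub>quot_module M N\<^esub> (N +>\<^bsub>M\<^esub> y) = N +>\<^bsub>M\<^esub> (x \<oplus>\<^bsub>M\<^esub> y)"
 by (simp add: quot_module_def N.a_rcos_sum)

text \<open>\<open>quot_module\<close> defines the scalar action as a union over all representatives
  of the coset. Representatives differ by elements of \<open>N\<close>, and \<open>N\<close> is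
  closed under scalars, so the union collapses to a single coset.\<close>

lemma quot_smult:
 assumes "r \<in> carrier R" "x \<in> carrier M"
 shows "r \<odot>\<^bsub>quot_module M N\<^esub> (N +>\<^bsub>M\<^esub> x) = N +>\<^bsub>M\<^esub> (r \<odot>\<^bsub>M\<^esub> x)"
proof -
 have "N +>\<^bsub>M\<^esub> (r \<odot>\<^bsub>M\<^esub> y) = N +>\<^bsub>M\<^esub> (r \<odot>\<^bsub>M\<^esub> x)" if "y \<in> N +>\<^bsub>M\<^esub> x" for y
 proof -
  have y: "y \<in> carrier M" using that N.a_elemrcos_carrier assms by blast
  have "N +>\<^bsub>M\<^esub> y = N +>\<^bsub>M\<^esub> x"
   using that N.a_repr_independence' assms by metis
  then have "y \<ominus>\<^bsub>M\<^esub> x \<in> N" using coset_eq_iff y assms by blast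
  then have "r \<odot>\<^bsub>M\<^esub> (y \<ominus>\<^bsub>M\<^esub> x) \<in> N" using N assms by (meson M.submoduleE(4))
  then have "r \<odot>\<^bsub>M\<^esub> y \<ominus>\<^bsub>M\<^esub> r \<odot>\<^bsub>M\<^esub> x \<in> N"
   using assms y by (simp add: a_minus_def M.smult_r_distr M.smult_r_minus)
  then show ?thesis using coset_eq_iff y assms by simp
 qed
 moreover have "x \<in> N +>\<^bsub>M\<^esub> x" using assms N.a_rcos_self by blast
 ultimately have "(\<Union>y\<in>N +>\<^bsub>M\<^esub> x. N +>\<^bsub>M\<^esub> (r \<odot>\<^bsub>M\<^esub> y)) = N +>\<^bsub>M\<^esub> (r \<odot>\<^bsub>M\<^esub> x)"
  by blast
 then show ?thesis by (simp add: quot_module_def)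
qed

lemma module_quot: "Module.module R (quot_module M N)"
proof (rule moduleI)
 show "abelian_group (quot_module M N)"
 proof (rule abelian_groupI)
  fix X assume "X \<in> carrier (quot_module M N)"
  then obtain x where x: "x \<in> carrier M" "X = N +>\<^bsub>M\<^esub> x" by (auto simp: quot_carrier)
  then have "(N +>\<^bsub>M\<^esub> (\<ominus>\<^bsub>M\<^esub> x)) \<oplus>\<^bsub>quot_module M N\<^esub> X = \<zero>\<^bsub>quot_module M N\<^esub>"
   by (simp add: quot_add quot_zero M.M.l_neg)
  then show "\<exists>y\<in>carrier (quot_module M N). y \<oplus>\<^bsub>quot_module M N\<^esub> X = \<zero>\<^bsub>quot_module M N\<^esub>"
   using x by (auto simp: quot_carrier)
 next
  fix X Y assume "X \<in> carrier (quot_module M N)" "Y \<in> carrier (quot_module M N)"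
  then show "X \<oplus>\<^bsub>quot_module M N\<^esub> Y = Y \<oplus>\<^bsub>quot_module M N\<^esub> X"
   by (auto simp: quot_carrier quot_add M.M.a_comm)
 qed (auto simp: quot_carrier quot_add quot_zero M.M.a_assoc)
qed (auto simp: quot_carrier quot_add quot_smult M.smult_l_distr M.smult_r_distr
   M.smult_assoc1 M.R.cring_axioms)

lemma quot_proj_hom: "(%x. N +>\<^bsub>M\<^esub> x) \<in> mod_hom R M (quot_module M N)"
 by (rule mod_homI) (auto simp: quot_carrier quot_add quot_smult)

text \<open>The lift evaluates \<open>f\<close> at a chosen representative. Two representatives
  differ by an element of \<open>N\<close>, which \<open>f\<close> kills, so the choice leaves no
  trace.\<close>

lemma quot_lift:
 assumes P: "Module.module R P" and f: "f \<in> mod_hom R M P" and "\<And>x. x \<in> N ==> f x = \<zero>\<^bsub>P\<^esub>"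
 shows "\<exists>g\<in>mod_hom R (quot_module M N) P. \<forall>x\<in>carrier M. g (N +>\<^bsub>M\<^esub> x) = f x"
proof -
 interpret P: Module.module R P by fact
 define g where "g X = f (SOME x. x \<in> carrier M \<and> X = N +>\<^bsub>M\<^esub> x)" for X
 have g: "g (N +>\<^bsub>M\<^esub> x) = f x" if x: "x \<in> carrier M" for x
 proof -
  define y where "y = (SOME y. y \<in> carrier M \<and> N +>\<^bsub>M\<^esub> x = N +>\<^bsub>M\<^esub> y)"
  have y: "y \<in> carrier M \<and> N +>\<^bsub>M\<^esub> x = N +>\<^bsub>M\<^esub> y"
   unfolding y_def by (rule someI[where x = x]) (use x in auto)
  then have "f (x \<ominus>\<^bsub>M\<^esub> y) = \<zero>\<^bsub>P\<^esub>"
   using x coset_eq_iff assms(3) by blast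
  then have "f x \<ominus>\<^bsub>P\<^esub> f y = \<zero>\<^bsub>P\<^esub>" using x y mod_hom_minus[OF f M P] by simp
  then show ?thesis
   unfolding g_def y_def[symmetric] using x y mod_hom_closed[OF f]
   by (metis P.M.minus_equality P.M.minus_minus P.M.a_inv_closed a_minus_def)
 qed
 have "g \<in> mod_hom R (quot_module M N) P"
  by (rule mod_homI)
   (auto simp: quot_carrier g quot_add quot_smult mod_hom_closed[OF f] mod_hom_add[OF f]
    mod_hom_smult[OF f])
 then show ?thesis using g by blast
qed

end

lemma submodule_kernel:
 assumes "Module.module R M" "Module.module R N" "f \<in> mod_hom R M N"
 shows "submodule {x \<in> carrier M. f x = \<zero>\<^bsub>N\<^esub>} R M"
proof -
 interpret M: Module.module R M by fact
 interpret N: Module.module R N by fact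
 show ?thesis
  by (rule M.submoduleI) (use assms in "auto simp: mod_hom_zero mod_hom_add mod_hom_smult mod_hom_a_inv")
qed

lemma submodule_image:
 assumes "Module.module R M" "Module.module R N" "f \<in> mod_hom R M N"
 shows "submodule (f ` carrier M) R N"
proof -
 interpret M: Module.module R M by fact
 interpret N: Module.module R N by fact
 show ?thesis
 proof (rule N.submoduleI)
  show "\<zero>\<^bsub>N\<^esub> \<in> f ` carrier M"
   using assms by (metis M.M.zero_closed image_eqI mod_hom_zero)
  show "\<ominus>\<^bsub>N\<^esub> a \<in> f ` carrier M" if "a \<in> f ` carrier M" for a
   using that assms by (auto simp: mod_hom_a_inv[symmetric])
  show "a \<oplus>\<^bsub>N\<^esub> b \<in> f ` carrier M" if "a \<in> f ` carrier M" "b \<in> f ` carrier M" for a b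
   using that assms by (auto simp: mod_hom_add[symmetric])
  show "r \<odot>\<^bsub>N\<^esub> b \<in> f ` carrier M" if "r \<in> carrier R" "b \<in> f ` carrier M" for r b
   using that assms by (auto simp: mod_hom_smult[symmetric])
 qed (use assms in "auto simp: mod_hom_closed")
qed

lemma submodule_submodule_span:
 assumes "Module.module R M" "S \<subseteq> carrier M"
 shows "submodule (submodule_span R M S) R M"
proof -
 interpret M: Module.module R M by fact
 let ?F = "{N. submodule N R M \<and> S \<subseteq> N}"
 have "carrier M \<in> ?F" using assms M.carrier_is_submodule by auto
 show ?thesis
  unfolding submodule_span_def
 proof (intro M.submoduleI)
  show "\<zero>\<^bsub>M\<^esub> \<in> \<Inter>?F"
   by (auto intro: additive_subgroup.zero_closed additive_subgroup.intro submodule.axioms(1))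
  show "\<Inter>?F \<subseteq> carrier M" using \<open>carrier M \<in> ?F\<close> by blast
 qed (use M.submoduleE(3,4,5) in blast)+
qed

lemma submodule_span_incl: "S \<subseteq> submodule_span R M S"
 by (auto simp: submodule_span_def)

lemma submodule_span_least: "[|submodule N R M; S \<subseteq> N|] ==> submodule_span R M S \<subseteq> N"
 by (auto simp: submodule_span_def)

section \<open>Direct sums and free modules\<close>

lemma dsum_carrier: "carrier (dsum I N) = {c \<in> \<Pi>\<^sub>E i\<in>I. carrier (N i). finite {i \<in> I. c i \<noteq> \<zero>\<^bsub>N i\<^esub>}}"
 and dsum_zero: "\<zero>\<^bsub>dsum I N\<^esub> = (\<lambda>i\<in>I. \<zero>\<^bsub>N i\<^esub>)"
 and dsum_add: "c \<oplus>\<^bsub>dsum I N\<^esub> c' = (\<lambda>i\<in>I. c i \<oplus>\<^bsub>N i\<^esub> c' i)"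
 and dsum_smult: "r \<odot>\<^bsub>dsum I N\<^esub> c = (\<lambda>i\<in>I. r \<odot>\<^bsub>N i\<^esub> c i)"
 by (simp_all add: dsum_def)

lemma dsum_closed: "[|c \<in> carrier (dsum I N); i \<in> I|] ==> c i \<in> carrier (N i)"
 by (auto simp: dsum_carrier)

lemma dsum_eqI:
 "[|c \<in> carrier (dsum I N); c' \<in> carrier (dsum I N); \<And>i. i \<in> I ==> c i = c' i|] ==> c = c'"
 by (auto simp: dsum_carrier intro: PiE_ext)

lemma module_dsum:
 assumes "cring R" "\<And>i. i \<in> I ==> Module.module R (N i)"
 shows "Module.module R (dsum I N)"
proof (rule moduleI)
 have ag: "abelian_group (N i)" if "i \<in> I" for i
  using assms(2)[OF that] by (simp add: Module.module_def)
 have am: "abelian_monoid (N i)" if "i \<in> I" for i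
  using ag[OF that] by (simp add: abelian_group_def)
 have inv0: "\<ominus>\<^bsub>N i\<^esub> \<zero>\<^bsub>N i\<^esub> = \<zero>\<^bsub>N i\<^esub>" if "i \<in> I" for i
 proof -
  interpret abelian_group "N i" by (rule ag[OF that])
  show ?thesis by (metis l_neg r_zero a_inv_closed zero_closed)
 qed
 show "cring R" by fact
 show "abelian_group (dsum I N)"
 proof (rule abelian_groupI)
  fix c c' assume c: "c \<in> carrier (dsum I N)" "c' \<in> carrier (dsum I N)"
  have "{i \<in> I. c i \<oplus>\<^bsub>N i\<^esub> c' i \<noteq> \<zero>\<^bsub>N i\<^esub>} \<subseteq> {i \<in> I. c i \<noteq> \<zero>\<^bsub>N i\<^esub>} \<union> {i \<in> I. c' i \<noteq> \<zero>\<^bsub>N i\<^esub>}"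
   using am by (auto simp: abelian_monoid.r_zero abelian_monoid.l_zero abelian_monoid.zero_closed)
  then have "finite {i \<in> I. c i \<oplus>\<^bsub>N i\<^esub> c' i \<noteq> \<zero>\<^bsub>N i\<^esub>}"
   by (rule finite_subset) (use c in "auto simp: dsum_carrier")
  then show "c \<oplus>\<^bsub>dsum I N\<^esub> c' \<in> carrier (dsum I N)"
   using c by (auto simp: dsum_carrier dsum_add PiE_iff abelian_monoid.a_closed[OF am]
     intro: rev_finite_subset)
  show "c \<oplus>\<^bsub>dsum I N\<^esub> c' = c' \<oplus>\<^bsub>dsum I N\<^esub> c"
   using c by (auto simp: dsum_add abelian_monoid.a_comm[OF am] dsum_closed intro!: restrict_ext)
 next
  show "\<zero>\<^bsub>dsum I N\<^esub> \<in> carrier (dsum I N)"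
   by (auto simp: dsum_carrier dsum_zero abelian_monoid.zero_closed[OF am])
 next
  fix c c' c'' assume c: "c \<in> carrier (dsum I N)" "c' \<in> carrier (dsum I N)" "c'' \<in> carrier (dsum I N)"
  show "c \<oplus>\<^bsub>dsum I N\<^esub> c' \<oplus>\<^bsub>dsum I N\<^esub> c'' = c \<oplus>\<^bsub>dsum I N\<^esub> (c' \<oplus>\<^bsub>dsum I N\<^esub> c'')"
   using c by (auto simp: dsum_add abelian_monoid.a_assoc[OF am] dsum_closed intro!: restrict_ext)
 next
  fix c assume c: "c \<in> carrier (dsum I N)"
  show "\<zero>\<^bsub>dsum I N\<^esub> \<oplus>\<^bsub>dsum I N\<^esub> c = c"
   using c by (auto simp: dsum_add dsum_zero dsum_carrier fun_eq_iff restrict_def PiE_iff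
     extensional_def abelian_monoid.l_zero[OF am])
  let ?d = "\<lambda>i\<in>I. \<ominus>\<^bsub>N i\<^esub> c i"
  have "{i \<in> I. ?d i \<noteq> \<zero>\<^bsub>N i\<^esub>} \<subseteq> {i \<in> I. c i \<noteq> \<zero>\<^bsub>N i\<^esub>}"
   using inv0 by auto
  then have "finite {i \<in> I. ?d i \<noteq> \<zero>\<^bsub>N i\<^esub>}"
   by (rule finite_subset) (use c in "auto simp: dsum_carrier")
  then have d: "?d \<in> carrier (dsum I N)"
   using c by (auto simp: dsum_carrier abelian_group.a_inv_closed[OF ag] PiE_iff intro: rev_finite_subset)
  have "?d \<oplus>\<^bsub>dsum I N\<^esub> c = \<zero>\<^bsub>dsum I N\<^esub>"
   using c by (auto simp: dsum_add dsum_zero abelian_group.l_neg[OF ag] dsum_closed intro!: restrict_ext)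
  then show "\<exists>y\<in>carrier (dsum I N). y \<oplus>\<^bsub>dsum I N\<^esub> c = \<zero>\<^bsub>dsum I N\<^esub>" using d by blast
 qed
next
 fix r c assume r: "r \<in> carrier R" and c: "c \<in> carrier (dsum I N)"
 have "{i \<in> I. r \<odot>\<^bsub>N i\<^esub> c i \<noteq> \<zero>\<^bsub>N i\<^esub>} \<subseteq> {i \<in> I. c i \<noteq> \<zero>\<^bsub>N i\<^esub>}"
  using r by (auto simp: Module.module.smult_r_null[OF assms(2)])
 then have "finite {i \<in> I. r \<odot>\<^bsub>N i\<^esub> c i \<noteq> \<zero>\<^bsub>N i\<^esub>}"
  by (rule finite_subset) (use c in "auto simp: dsum_carrier")
 then show "r \<odot>\<^bsub>dsum I N\<^esub> c \<in> carrier (dsum I N)"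
  using r c by (auto simp: dsum_carrier dsum_smult Module.module.smult_closed[OF assms(2)] PiE_iff
    intro: rev_finite_subset)
next
 fix r s c assume r: "r \<in> carrier R" "s \<in> carrier R" and c: "c \<in> carrier (dsum I N)"
 show "(r \<oplus>\<^bsub>R\<^esub> s) \<odot>\<^bsub>dsum I N\<^esub> c = r \<odot>\<^bsub>dsum I N\<^esub> c \<oplus>\<^bsub>dsum I N\<^esub> s \<odot>\<^bsub>dsum I N\<^esub> c"
  using r c by (auto simp: dsum_add dsum_smult Module.module.smult_l_distr[OF assms(2)] dsum_closed
    intro!: restrict_ext)
 show "(r \<otimes>\<^bsub>R\<^esub> s) \<odot>\<^bsub>dsum I N\<^esub> c = r \<odot>\<^bsub>dsum I N\<^esub> (s \<odot>\<^bsub>dsum I N\<^esub> c)"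
  using r c by (auto simp: dsum_add dsum_smult Module.module.smult_assoc1[OF assms(2)] dsum_closed
    intro!: restrict_ext)
next
 fix r c c' assume r: "r \<in> carrier R" and c: "c \<in> carrier (dsum I N)" "c' \<in> carrier (dsum I N)"
 show "r \<odot>\<^bsub>dsum I N\<^esub> (c \<oplus>\<^bsub>dsum I N\<^esub> c') = r \<odot>\<^bsub>dsum I N\<^esub> c \<oplus>\<^bsub>dsum I N\<^esub> r \<odot>\<^bsub>dsum I N\<^esub> c'"
  using r c by (auto simp: dsum_add dsum_smult Module.module.smult_r_distr[OF assms(2)] dsum_closed
    intro!: restrict_ext)
next
 fix c assume c: "c \<in> carrier (dsum I N)"
 show "\<one>\<^bsub>R\<^esub> \<odot>\<^bsub>dsum I N\<^esub> c = c"
  using c by (auto simp: dsum_smult dsum_carrier fun_eq_iff restrict_def PiE_iff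
     extensional_def Module.module.smult_one[OF assms(2)])
qed

context
 fixes R :: "'r ring" and I :: "'i set" and N :: "'i => ('r, 'm) module"
 assumes R: "cring R" and N: "\<And>i. i \<in> I ==> Module.module R (N i)"
begin

lemma dsum_eval_hom: "i \<in> I ==> (%c. c i) \<in> mod_hom R (dsum I N) (N i)"
 by (rule mod_homI) (auto simp: dsum_closed dsum_add dsum_smult)

lemma dsum_in_closed:
 assumes "j \<in> I ==> v \<in> carrier (N j)"
 shows "dsum_in I N j v \<in> carrier (dsum I N)"
proof -
 have "{i \<in> I. dsum_in I N j v i \<noteq> \<zero>\<^bsub>N i\<^esub>} \<subseteq> {j}"
  by (auto simp: dsum_in_def)
 then have "finite {i \<in> I. dsum_in I N j v i \<noteq> \<zero>\<^bsub>N i\<^esub>}"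
  by (rule finite_subset) simp
 moreover have "\<zero>\<^bsub>N i\<^esub> \<in> carrier (N i)" if "i \<in> I" for i
  using N[OF that] by (simp add: Module.module_def abelian_group_def abelian_monoid.zero_closed)
 ultimately show ?thesis
  using assms by (auto simp: dsum_carrier dsum_in_def)
qed

lemma dsum_in_notin: "j \<notin> I ==> dsum_in I N j v = \<zero>\<^bsub>dsum I N\<^esub>"
 by (auto simp: dsum_in_def dsum_zero)

lemma dsum_in_hom:
 assumes "j \<in> I" shows "dsum_in I N j \<in> mod_hom R (N j) (dsum I N)"
proof (rule mod_homI)
 have z: "\<zero>\<^bsub>N i\<^esub> \<oplus>\<^bsub>N i\<^esub> \<zero>\<^bsub>N i\<^esub> = \<zero>\<^bsub>N i\<^esub>" if "i \<in> I" for i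
  using N[OF that] by (simp add: Module.module_def abelian_group_def abelian_monoid.zero_closed
    abelian_monoid.l_zero)
 have z': "r \<odot>\<^bsub>N i\<^esub> \<zero>\<^bsub>N i\<^esub> = \<zero>\<^bsub>N i\<^esub>" if "i \<in> I" "r \<in> carrier R" for i r
  using N[OF that(1)] that(2) by (rule Module.module.smult_r_null)
 show "dsum_in I N j (x \<oplus>\<^bsub>N j\<^esub> y) = dsum_in I N j x \<oplus>\<^bsub>dsum I N\<^esub> dsum_in I N j y" for x y
  by (auto simp: dsum_in_def dsum_add z intro!: restrict_ext)
 show "dsum_in I N j (r \<odot>\<^bsub>N j\<^esub> x) = r \<odot>\<^bsub>dsum I N\<^esub> dsum_in I N j x" if "r \<in> carrier R" for r x
  using that by (auto simp: dsum_in_def dsum_smult z' intro!: restrict_ext)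
qed (simp add: dsum_in_closed)

lemma dsum_decomp:
 assumes c: "c \<in> carrier (dsum I N)" and S: "finite S" "S \<subseteq> I" "{i \<in> I. c i \<noteq> \<zero>\<^bsub>N i\<^esub>} \<subseteq> S"
 shows "c = (\<Oplus>\<^bsub>dsum I N\<^esub>i\<in>S. dsum_in I N i (c i))"
proof (rule dsum_eqI)
 interpret D: Module.module R "dsum I N" by (intro module_dsum R N)
 have cl: "dsum_in I N i (c i) \<in> carrier (dsum I N)" if "i \<in> S" for i
  using that S by (intro dsum_in_closed dsum_closed[OF c]) auto
 show "(\<Oplus>\<^bsub>dsum I N\<^esub>i\<in>S. dsum_in I N i (c i)) \<in> carrier (dsum I N)"
  using cl by (intro D.M.finsum_closed) auto
 fix k assume k: "k \<in> I"
 interpret K: Module.module R "N k" by (rule N[OF k])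
 have "(\<Oplus>\<^bsub>dsum I N\<^esub>i\<in>S. dsum_in I N i (c i)) k = (\<Oplus>\<^bsub>N k\<^esub>i\<in>S. dsum_in I N i (c i) k)"
  by (rule mod_hom_finsum[OF dsum_eval_hom[OF k]]) (use cl S in "auto intro: D.module_axioms K.module_axioms")
 also have "\<dots> = (\<Oplus>\<^bsub>N k\<^esub>i\<in>S. if k = i then c k else \<zero>\<^bsub>N k\<^esub>)"
  using k c by (intro K.M.finsum_cong') (auto simp: dsum_in_def dsum_closed)
 also have "\<dots> = c k"
 proof (cases "k \<in> S")
  case True
  show ?thesis
   using K.M.finsum_singleton[OF True S(1), of "%_. c k"] dsum_closed[OF c k] by simp
 next
  case False
  then have "c k = \<zero>\<^bsub>N k\<^esub>" using S k by blast
  moreover have "(\<Oplus>\<^bsub>N k\<^esub>i\<in>S. if k = i then c k else \<zero>\<^bsub>N k\<^esub>) = (\<Oplus>\<^bsub>N k\<^esub>i\<in>S. \<zero>\<^bsub>N k\<^esub>)"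
   using False by (intro K.M.finsum_cong') auto
  ultimately show ?thesis by simp
 qed
 finally show "c k = (\<Oplus>\<^bsub>dsum I N\<^esub>i\<in>S. dsum_in I N i (c i)) k" by simp
qed fact

lemma dsum_hom_ext:
 assumes P: "Module.module R P" and f: "f \<in> mod_hom R (dsum I N) P" and g: "g \<in> mod_hom R (dsum I N) P"
  and eq: "\<And>i v. [|i \<in> I; v \<in> carrier (N i)|] ==> f (dsum_in I N i v) = g (dsum_in I N i v)"
  and c: "c \<in> carrier (dsum I N)"
 shows "f c = g c"
proof -
 let ?S = "{i \<in> I. c i \<noteq> \<zero>\<^bsub>N i\<^esub>}"
 have fin: "finite ?S" using c by (simp add: dsum_carrier)
 have D: "Module.module R (dsum I N)" by (intro module_dsum R N)
 have cl: "dsum_in I N i (c i) \<in> carrier (dsum I N)" if "i \<in> ?S" for i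
  by (intro dsum_in_closed dsum_closed[OF c])
 interpret P: Module.module R P by fact
 have "f c = f (\<Oplus>\<^bsub>dsum I N\<^esub>i\<in>?S. dsum_in I N i (c i))"
  using dsum_decomp[OF c fin] by simp
 also have "\<dots> = (\<Oplus>\<^bsub>P\<^esub>i\<in>?S. f (dsum_in I N i (c i)))"
  by (rule mod_hom_finsum[OF f D P fin]) (rule cl)
 also have "\<dots> = (\<Oplus>\<^bsub>P\<^esub>i\<in>?S. g (dsum_in I N i (c i)))"
  using c by (intro P.M.finsum_cong') (auto simp: eq dsum_closed intro!: mod_hom_closed[OF g] dsum_in_closed)
 also have "\<dots> = g (\<Oplus>\<^bsub>dsum I N\<^esub>i\<in>?S. dsum_in I N i (c i))"
  by (rule mod_hom_finsum[OF g D P fin, symmetric]) (rule cl)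
 also have "\<dots> = g c"
  using dsum_decomp[OF c fin] by simp
 finally show ?thesis .
qed

lemma dsum_lift:
 assumes P: "Module.module R P" and ph: "\<And>i. i \<in> I ==> ph i \<in> mod_hom R (N i) P"
 shows "\<exists>f\<in>mod_hom R (dsum I N) P. \<forall>i\<in>I. \<forall>v\<in>carrier (N i). f (dsum_in I N i v) = ph i v"
proof -
 interpret P: Module.module R P by fact
 interpret D: Module.module R "dsum I N" by (intro module_dsum R N)
 define supp where "supp c = {i \<in> I. c i \<noteq> \<zero>\<^bsub>N i\<^esub>}" for c
 define f where "f c = (\<Oplus>\<^bsub>P\<^esub>i\<in>supp c. ph i (c i))" for c
 have cl: "ph i (c i) \<in> carrier P" if "c \<in> carrier (dsum I N)" "i \<in> I" for i c
  using that by (metis ph dsum_closed mod_hom_closed)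
 \<comment> \<open>The support varies with the argument, so additivity needs sums over a common
   larger index set; the added terms vanish because \<open>ph i\<close> maps zero to zero.\<close>
 have fS: "f c = (\<Oplus>\<^bsub>P\<^esub>i\<in>S. ph i (c i))"
  if "c \<in> carrier (dsum I N)" "finite S" "S \<subseteq> I" "supp c \<subseteq> S" for c S
  unfolding f_def
  by (rule P.M.add.finprod_mono_neutral_cong_left)
   (use that ph cl in "auto simp: supp_def mod_hom_zero[OF ph N P] subset_iff")
 have fin: "finite (supp c)" if "c \<in> carrier (dsum I N)" for c
  using that by (simp add: dsum_carrier supp_def)
 have "f \<in> mod_hom R (dsum I N) P"
 proof (rule mod_homI)
  show "f c \<in> carrier P" if "c \<in> carrier (dsum I N)" for c
   unfolding f_def using cl[OF that] by (intro P.M.finsum_closed) (auto simp: supp_def)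
  show "f (c \<oplus>\<^bsub>dsum I N\<^esub> c') = f c \<oplus>\<^bsub>P\<^esub> f c'"
   if c: "c \<in> carrier (dsum I N)" "c' \<in> carrier (dsum I N)" for c c'
  proof -
   let ?d = "c \<oplus>\<^bsub>dsum I N\<^esub> c'"
   let ?S = "supp c \<union> supp c' \<union> supp ?d"
   have d: "?d \<in> carrier (dsum I N)" using c by simp
   have S: "finite ?S" "?S \<subseteq> I" using c d fin by (auto simp: supp_def)
   have "f ?d = (\<Oplus>\<^bsub>P\<^esub>i\<in>?S. ph i (?d i))"
    by (rule fS[OF d S]) auto
   also have "\<dots> = (\<Oplus>\<^bsub>P\<^esub>i\<in>?S. ph i (c i) \<oplus>\<^bsub>P\<^esub> ph i (c' i))"
    using S cl[OF c(1)] cl[OF c(2)] c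
    by (intro P.M.finsum_cong') (auto simp: dsum_add mod_hom_add[OF ph] dsum_closed subset_iff)
   also have "\<dots> = (\<Oplus>\<^bsub>P\<^esub>i\<in>?S. ph i (c i)) \<oplus>\<^bsub>P\<^esub> (\<Oplus>\<^bsub>P\<^esub>i\<in>?S. ph i (c' i))"
    using S cl[OF c(1)] cl[OF c(2)] by (intro P.M.finsum_addf) auto
   also have "\<dots> = f c \<oplus>\<^bsub>P\<^esub> f c'"
    by (subst (1 2) fS[OF _ S]) (use c in auto)
   finally show ?thesis .
  qed
  show "f (r \<odot>\<^bsub>dsum I N\<^esub> c) = r \<odot>\<^bsub>P\<^esub> f c" if r: "r \<in> carrier R" and c: "c \<in> carrier (dsum I N)" for r c
  proof -
   let ?d = "r \<odot>\<^bsub>dsum I N\<^esub> c"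
   let ?S = "supp c \<union> supp ?d"
   have d: "?d \<in> carrier (dsum I N)" using c r by simp
   have S: "finite ?S" "?S \<subseteq> I" using c d fin by (auto simp: supp_def)
   have "f ?d = (\<Oplus>\<^bsub>P\<^esub>i\<in>?S. ph i (?d i))"
    by (rule fS[OF d S]) auto
   also have "\<dots> = (\<Oplus>\<^bsub>P\<^esub>i\<in>?S. r \<odot>\<^bsub>P\<^esub> ph i (c i))"
    using S cl[OF c] c r
    by (intro P.M.finsum_cong') (auto simp: dsum_smult mod_hom_smult[OF ph] dsum_closed subset_iff)
   also have "\<dots> = r \<odot>\<^bsub>P\<^esub> (\<Oplus>\<^bsub>P\<^esub>i\<in>?S. ph i (c i))"
    using S cl[OF c] r by (intro P.finsum_smult_ldistr[symmetric]) auto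
   also have "\<dots> = r \<odot>\<^bsub>P\<^esub> f c"
    by (subst fS[OF c S]) auto
   finally show ?thesis .
  qed
 qed
 moreover have "f (dsum_in I N i v) = ph i v" if "i \<in> I" "v \<in> carrier (N i)" for i v
 proof -
  have "f (dsum_in I N i v) = (\<Oplus>\<^bsub>P\<^esub>j\<in>{i}. ph j (dsum_in I N i v j))"
   by (rule fS[OF dsum_in_closed]) (use that in "auto simp: supp_def dsum_in_def")
  also have "\<dots> = ph i v"
   using that mod_hom_closed[OF ph] by (simp add: dsum_in_def)
  finally show ?thesis .
 qed
 ultimately show ?thesis by blast
qed

end

lemma module_regular:
 assumes "cring R" shows "Module.module R (regular_module R)"
proof -
 interpret R: cring R by fact
 have "\<exists>y\<in>carrier R. y \<oplus>\<^bsub>R\<^esub> x = \<zero>\<^bsub>R\<^esub>" if "x \<in> carrier R" for x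
  using that R.l_neg by blast
 then have "abelian_group (regular_module R)"
  by (intro abelian_groupI) (auto simp: regular_module_def R.a_ac)
 then show ?thesis
  by (intro moduleI) (auto simp: regular_module_def R.l_distr R.r_distr R.m_assoc assms)
qed

lemma module_free: "cring R ==> Module.module R (free_module R X)"
 by (simp add: free_module_def module_dsum module_regular)

lemma free_gen_closed: "cring R ==> free_gen R X x \<in> carrier (free_module R X)"
 unfolding free_module_def free_gen_def
 by (rule dsum_in_closed) (auto simp: module_regular, simp add: regular_module_def cring.cring_simprules)

lemma dsum_in_regular:
 assumes "cring R" "r \<in> carrier R"
 shows "dsum_in X (%i. regular_module R) x r = r \<odot>\<^bsub>free_module R X\<^esub> free_gen R X x"
proof -
 interpret R: cring R by fact
 show ?thesis
  using assms(2) by (auto simp: free_module_def free_gen_def dsum_smult dsum_in_def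
    regular_module_def intro!: restrict_ext)
qed

lemma free_lift:
 assumes R: "cring R" and P: "Module.module R P" and f: "\<And>x. x \<in> X ==> f x \<in> carrier P"
 shows "\<exists>g\<in>mod_hom R (free_module R X) P. \<forall>x\<in>X. g (free_gen R X x) = f x"
proof -
 interpret R: cring R by fact
 interpret P: Module.module R P by fact
 have "(%r. r \<odot>\<^bsub>P\<^esub> f x) \<in> mod_hom R (regular_module R) P" if "x \<in> X" for x
  by (rule mod_homI) (use f[OF that] in "auto simp: regular_module_def P.smult_l_distr P.smult_assoc1")
 from dsum_lift[OF R module_regular[OF R] P, of X "%x r. r \<odot>\<^bsub>P\<^esub> f x", OF this]
 obtain g where "g \<in> mod_hom R (free_module R X) P"
  "\<forall>x\<in>X. \<forall>r\<in>carrier R. g (dsum_in X (%i. regular_module R) x r) = r \<odot>\<^bsub>P\<^esub> f x"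
  by (auto simp: free_module_def regular_module_def)
 then show ?thesis
  using f by (intro bexI[of _ g]) (auto simp: free_gen_def)
qed

lemma free_hom_ext:
 assumes R: "cring R" and P: "Module.module R P"
  and f: "f \<in> mod_hom R (free_module R X) P" and g: "g \<in> mod_hom R (free_module R X) P"
  and eq: "\<And>x. x \<in> X ==> f (free_gen R X x) = g (free_gen R X x)"
  and c: "c \<in> carrier (free_module R X)"
 shows "f c = g c"
proof (rule dsum_hom_ext[OF R module_regular[OF R] P _ _ _ c[unfolded free_module_def]])
 fix x r assume x: "x \<in> X" and "r \<in> carrier (regular_module R)"
 then have r: "r \<in> carrier R" by (simp add: regular_module_def)
 show "f (dsum_in X (%i. regular_module R) x r) = g (dsum_in X (%i. regular_module R) x r)"
  by (simp add: dsum_in_regular[OF R r] mod_hom_smult[OF f r] mod_hom_smult[OF g r] free_gen_closed[OF R] eq[OF x])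
qed (use f g in "simp_all add: free_module_def")

section \<open>Tensor products\<close>

definition multilinear ::
 "'r ring => 'i set => ('i => ('r, 'm) module) => ('r, 'p) module => (('i => 'm) => 'p) => bool"
 where "multilinear R I N P f \<longleftrightarrow>
  (\<forall>t\<in>\<Pi>\<^sub>E i\<in>I. carrier (N i). f t \<in> carrier P) \<and>
  (\<forall>t\<in>\<Pi>\<^sub>E i\<in>I. carrier (N i). \<forall>i\<in>I. \<forall>u\<in>carrier (N i). \<forall>v\<in>carrier (N i).
   f (t(i := u \<oplus>\<^bsub>N i\<^esub> v)) = f (t(i := u)) \<oplus>\<^bsub>P\<^esub> f (t(i := v))) \<and>
  (\<forall>t\<in>\<Pi>\<^sub>E i\<in>I. carrier (N i). \<forall>i\<in>I. \<forall>r\<in>carrier R. \<forall>u\<in>carrier (N i).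
   f (t(i := r \<odot>\<^bsub>N i\<^esub> u)) = r \<odot>\<^bsub>P\<^esub> f (t(i := u)))"

context
 fixes R :: "'r ring" and I :: "'i set" and N :: "'i => ('r, 'm) module"
 assumes R: "cring R" and N: "\<And>i. i \<in> I ==> Module.module R (N i)"
begin

private abbreviation "X \<equiv> \<Pi>\<^sub>E i\<in>I. carrier (N i)"
private abbreviation "F \<equiv> free_module R X"
private abbreviation "rel \<equiv> submodule_span R F (tensor_relations R I N)"

interpretation F: Module.module R F by (rule module_free[OF R])

private lemma gen: "free_gen R X t \<in> carrier F" by (rule free_gen_closed[OF R])

private lemma relations_subset: "tensor_relations R I N \<subseteq> carrier F"
 unfolding tensor_relations_def Let_def by (auto intro!: F.M.minus_closed F.M.a_closed gen F.smult_closed)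

private lemma rel: "submodule rel R F"
 by (rule submodule_submodule_span[OF module_free[OF R] relations_subset])

lemma module_tensor: "Module.module R (tensor R I N)"
 unfolding tensor_def Let_def by (rule module_quot[OF module_free[OF R] rel])

private lemma proj: "(%x. rel +>\<^bsub>F\<^esub> x) \<in> mod_hom R F (tensor R I N)"
 unfolding tensor_def Let_def by (rule quot_proj_hom[OF module_free[OF R] rel])

lemma pure_tensor_closed: "t \<in> X ==> pure_tensor R I N t \<in> carrier (tensor R I N)"
 using mod_hom_closed[OF proj gen] by (simp add: pure_tensor_def Let_def)

lemma multilinear_pure_tensor: "multilinear R I N (tensor R I N) (pure_tensor R I N)"
proof -
 have p: "pure_tensor R I N t = rel +>\<^bsub>F\<^esub> free_gen R X t" for t
  by (simp add: pure_tensor_def Let_def)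
 have "pure_tensor R I N (t(i := u \<oplus>\<^bsub>N i\<^esub> v)) =
   pure_tensor R I N (t(i := u)) \<oplus>\<^bsub>tensor R I N\<^esub> pure_tensor R I N (t(i := v))"
  if "t \<in> X" "i \<in> I" "u \<in> carrier (N i)" "v \<in> carrier (N i)" for t i u v
 proof -
  have "free_gen R X (t(i := u \<oplus>\<^bsub>N i\<^esub> v)) \<ominus>\<^bsub>F\<^esub> (free_gen R X (t(i := u)) \<oplus>\<^bsub>F\<^esub> free_gen R X (t(i := v))) \<in> rel"
   by (rule subsetD[OF submodule_span_incl], unfold tensor_relations_def Let_def) (use that in blast)
  then have "pure_tensor R I N (t(i := u \<oplus>\<^bsub>N i\<^esub> v)) = rel +>\<^bsub>F\<^esub> (free_gen R X (t(i := u)) \<oplus>\<^bsub>F\<^esub> free_gen R X (t(i := v)))"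
   unfolding p by (subst coset_eq_iff[OF module_free[OF R] rel]) (auto simp: gen)
  then show ?thesis unfolding p using mod_hom_add[OF proj gen gen] by simp
 qed
 moreover have "pure_tensor R I N (t(i := r \<odot>\<^bsub>N i\<^esub> u)) = r \<odot>\<^bsub>tensor R I N\<^esub> pure_tensor R I N (t(i := u))"
  if "t \<in> X" "i \<in> I" "r \<in> carrier R" "u \<in> carrier (N i)" for t i u r
 proof -
  have "free_gen R X (t(i := r \<odot>\<^bsub>N i\<^esub> u)) \<ominus>\<^bsub>F\<^esub> (r \<odot>\<^bsub>F\<^esub> free_gen R X (t(i := u))) \<in> rel"
   by (rule subsetD[OF submodule_span_incl], unfold tensor_relations_def Let_def) (use that in blast)
  then have "pure_tensor R I N (t(i := r \<odot>\<^bsub>N i\<^esub> u)) = rel +>\<^bsub>F\<^esub> (r \<odot>\<^bsub>F\<^esub> free_gen R X (t(i := u)))"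
   unfolding p by (subst coset_eq_iff[OF module_free[OF R] rel]) (auto simp: gen that)
  then show ?thesis unfolding p using mod_hom_smult[OF proj that(3) gen] by simp
 qed
 ultimately show ?thesis by (auto simp: multilinear_def pure_tensor_closed)
qed

lemma tensor_hom_ext:
 assumes P: "Module.module R P" and f: "f \<in> mod_hom R (tensor R I N) P" and g: "g \<in> mod_hom R (tensor R I N) P"
  and eq: "\<And>t. t \<in> X ==> f (pure_tensor R I N t) = g (pure_tensor R I N t)"
  and c: "c \<in> carrier (tensor R I N)"
 shows "f c = g c"
proof -
 obtain x where x: "x \<in> carrier F" "c = rel +>\<^bsub>F\<^esub> x"
  using c quot_carrier[OF module_free[OF R] rel] by (auto simp: tensor_def Let_def)
 show ?thesis unfolding x(2)
  by (rule free_hom_ext[OF R P mod_hom_comp[OF proj f] mod_hom_comp[OF proj g] _ x(1)])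
   (use eq in "simp add: pure_tensor_def Let_def")
qed

text \<open>A multilinear \<open>f\<close> extends to the free module on all families, and its
  multilinearity says exactly that the extension kills the generating relations, so it descends to
  the quotient.\<close>

lemma tensor_lift_exists:
 assumes P: "Module.module R P" and f: "multilinear R I N P f"
 shows "\<exists>g\<in>mod_hom R (tensor R I N) P. \<forall>t\<in>X. g (pure_tensor R I N t) = f t"
proof -
 interpret P: Module.module R P by fact
 have fc: "f t \<in> carrier P" if "t \<in> X" for t using f that by (auto simp: multilinear_def)
 from free_lift[OF R P, of X f, OF fc]
 obtain h where h: "h \<in> mod_hom R F P" "\<And>t. t \<in> X ==> h (free_gen R X t) = f t" by auto
 have upd: "t(i := u) \<in> X" if "t \<in> X" "i \<in> I" "u \<in> carrier (N i)" for t i u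
  using that by (auto simp: PiE_def extensional_def)
 have "tensor_relations R I N \<subseteq> {x \<in> carrier F. h x = \<zero>\<^bsub>P\<^esub>}"
 proof
  fix x assume x: "x \<in> tensor_relations R I N"
  then have xc: "x \<in> carrier F" using relations_subset by blast
  from x consider (add) t i u v where "t \<in> X" "i \<in> I" "u \<in> carrier (N i)" "v \<in> carrier (N i)"
    "x = free_gen R X (t(i := u \<oplus>\<^bsub>N i\<^esub> v)) \<ominus>\<^bsub>F\<^esub> (free_gen R X (t(i := u)) \<oplus>\<^bsub>F\<^esub> free_gen R X (t(i := v)))"
   | (smult) t i r u where "t \<in> X" "i \<in> I" "r \<in> carrier R" "u \<in> carrier (N i)"
    "x = free_gen R X (t(i := r \<odot>\<^bsub>N i\<^esub> u)) \<ominus>\<^bsub>F\<^esub> (r \<odot>\<^bsub>F\<^esub> free_gen R X (t(i := u)))"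
   unfolding tensor_relations_def Let_def by blast
  then have "h x = \<zero>\<^bsub>P\<^esub>"
  proof cases
   case add
   interpret Ni: Module.module R "N i" by (rule N[OF add(2)])
   have uv: "u \<oplus>\<^bsub>N i\<^esub> v \<in> carrier (N i)" using add by simp
   have "f (t(i := u \<oplus>\<^bsub>N i\<^esub> v)) = f (t(i := u)) \<oplus>\<^bsub>P\<^esub> f (t(i := v))"
    using f add unfolding multilinear_def by blast
   then have "h x = (f (t(i := u)) \<oplus>\<^bsub>P\<^esub> f (t(i := v))) \<ominus>\<^bsub>P\<^esub> (f (t(i := u)) \<oplus>\<^bsub>P\<^esub> f (t(i := v)))"
    unfolding add(5) using add upd uv
    by (simp add: mod_hom_minus[OF h(1) module_free[OF R] P] gen mod_hom_add[OF h(1)] h(2))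
   then show ?thesis using fc upd add by (simp add: a_minus_def P.M.r_neg)
  next
   case smult
   interpret Ni: Module.module R "N i" by (rule N[OF smult(2)])
   have ru: "r \<odot>\<^bsub>N i\<^esub> u \<in> carrier (N i)" using smult by simp
   have "f (t(i := r \<odot>\<^bsub>N i\<^esub> u)) = r \<odot>\<^bsub>P\<^esub> f (t(i := u))"
    using f smult unfolding multilinear_def by blast
   then have "h x = (r \<odot>\<^bsub>P\<^esub> f (t(i := u))) \<ominus>\<^bsub>P\<^esub> (r \<odot>\<^bsub>P\<^esub> f (t(i := u)))"
    unfolding smult(5) using smult upd ru
    by (simp add: mod_hom_minus[OF h(1) module_free[OF R] P] gen mod_hom_smult[OF h(1)] h(2))
   then show ?thesis using fc upd smult by (simp add: a_minus_def P.M.r_neg)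
  qed
  then show "x \<in> {x \<in> carrier F. h x = \<zero>\<^bsub>P\<^esub>}" using xc by simp
 qed
 \<comment> \<open>The kernel is a submodule, so containing the generating relations it contains
   their span.\<close>
 then have "rel \<subseteq> {x \<in> carrier F. h x = \<zero>\<^bsub>P\<^esub>}"
  by (rule submodule_span_least[OF submodule_kernel[OF module_free[OF R] P h(1)]])
 then have "\<And>x. x \<in> rel ==> h x = \<zero>\<^bsub>P\<^esub>" by blast
 from quot_lift[OF module_free[OF R] rel P h(1) this]
 obtain g where "g \<in> mod_hom R (tensor R I N) P" "\<forall>x\<in>carrier F. g (rel +>\<^bsub>F\<^esub> x) = h x"
  by (auto simp: tensor_def Let_def)
 then show ?thesis
  by (intro bexI[of _ g]) (auto simp: pure_tensor_def Let_def gen h(2))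
qed

text \<open>\<open>tensor_lift\<close> is a definite description. Pure tensors determine a linear
  map on the carrier and extensionality determines it elsewhere, so the description is met by
  exactly one function.\<close>

lemma tensor_lift:
 assumes P: "Module.module R P" and f: "multilinear R I N P f"
 shows "tensor_lift R I N P f \<in> mod_hom R (tensor R I N) P"
  and "tensor_lift R I N P f \<in> extensional (carrier (tensor R I N))"
  and "t \<in> X ==> tensor_lift R I N P f (pure_tensor R I N t) = f t"
proof -
 let ?Q = "%g. g \<in> mod_hom R (tensor R I N) P \<and> g \<in> extensional (carrier (tensor R I N)) \<and>
   (\<forall>t\<in>X. g (pure_tensor R I N t) = f t)"
 obtain g where g: "g \<in> mod_hom R (tensor R I N) P" "\<forall>t\<in>X. g (pure_tensor R I N t) = f t"
  using tensor_lift_exists[OF P f] by blast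
 let ?g = "restrict g (carrier (tensor R I N))"
 have "?g \<in> mod_hom R (tensor R I N) P"
  by (rule mod_hom_cong[OF g(1) module_tensor]) simp
 then have 1: "?Q ?g" using g(2) pure_tensor_closed by auto
 have "\<exists>!g. ?Q g"
 proof (rule ex1I[where a = ?g])
  show "?Q ?g" by (rule 1)
 next
  fix g' assume g': "?Q g'"
  show "g' = ?g"
  proof (rule extensionalityI[where A = "carrier (tensor R I N)"])
   fix c assume "c \<in> carrier (tensor R I N)"
   then show "g' c = ?g c"
    by (rule tensor_hom_ext[OF P conjunct1[OF g'] conjunct1[OF 1], rotated]) (metis g' 1)
  qed (use g' in auto)
 qed
 then have Q: "?Q (tensor_lift R I N P f)" unfolding tensor_lift_def by (rule theI')
 then show "tensor_lift R I N P f \<in> mod_hom R (tensor R I N) P"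
  and "tensor_lift R I N P f \<in> extensional (carrier (tensor R I N))" by auto
 show "t \<in> X ==> tensor_lift R I N P f (pure_tensor R I N t) = f t" using Q by blast
qed

end

section \<open>Maps between direct sums\<close>

text \<open>If \<open>g i \<notin> J\<close> then the summand of index \<open>i\<close> is sent to \<open>0\<close>.\<close>

definition dmap ::
 "'i set => ('i => ('r, 'm) module) => 'j set => ('j => ('r, 'n) module) => ('i => 'j) => ('i => 'm => 'n)
  => ('i => 'm) => 'j => 'n"
 where "dmap I N J N' g ph c = (\<Oplus>\<^bsub>dsum J N'\<^esub>i\<in>I. dsum_in J N' (g i) (ph i (c i)))"

context
 fixes R :: "'r ring" and I :: "'i set" and N :: "'i => ('r, 'm) module"
  and J :: "'j set" and N' :: "'j => ('r, 'n) module" and g :: "'i => 'j" and ph :: "'i => 'm => 'n"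
 assumes R: "cring R" and N: "\<And>i. i \<in> I ==> Module.module R (N i)"
  and N': "\<And>j. j \<in> J ==> Module.module R (N' j)" and I: "finite I"
  and ph: "\<And>i. [|i \<in> I; g i \<in> J|] ==> ph i \<in> mod_hom R (N i) (N' (g i))"
begin

lemma dmap_summand_hom:
 assumes "i \<in> I"
 shows "(%v. dsum_in J N' (g i) (ph i v)) \<in> mod_hom R (N i) (dsum J N')"
proof (cases "g i \<in> J")
 case True
 show ?thesis
  using mod_hom_comp[OF ph[OF assms True], of "dsum_in J N' (g i)"] dsum_in_hom[of R J N' "g i"] R N' True
  by blast
next
 case False
 then show ?thesis
  using mod_hom_const_zero[OF module_dsum[OF R N']]
  by (simp add: dsum_in_notin[OF R N'])
qed

lemma dmap_hom: "dmap I N J N' g ph \<in> mod_hom R (dsum I N) (dsum J N')"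
 unfolding dmap_def
proof (rule mod_hom_pointwise_finsum[OF module_dsum[OF R N] module_dsum[OF R N'] I])
 fix i assume "i \<in> I"
 then show "(%c. dsum_in J N' (g i) (ph i (c i))) \<in> mod_hom R (dsum I N) (dsum J N')"
  using mod_hom_comp[of "%c. c i" R "dsum I N" "N i", OF _ dmap_summand_hom[of i]]
   dsum_eval_hom[of R I N i] R N by blast
qed

lemma dmap_in:
 assumes i: "i \<in> I" and v: "v \<in> carrier (N i)"
 shows "dmap I N J N' g ph (dsum_in I N i v) = dsum_in J N' (g i) (ph i v)"
proof -
 interpret D: Module.module R "dsum J N'" by (rule module_dsum[OF R N'])
 have cl: "dsum_in J N' (g i) (ph i v) \<in> carrier (dsum J N')"
  by (rule mod_hom_closed[OF dmap_summand_hom[OF i] v])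
 have "dmap I N J N' g ph (dsum_in I N i v) =
   (\<Oplus>\<^bsub>dsum J N'\<^esub>k\<in>I. if i = k then dsum_in J N' (g i) (ph i v) else \<zero>\<^bsub>dsum J N'\<^esub>)"
  unfolding dmap_def
  by (rule D.M.finsum_cong')
   (use cl in "auto simp: dsum_in_def[of I] mod_hom_zero[OF dmap_summand_hom N module_dsum[OF R N']]")
 also have "\<dots> = dsum_in J N' (g i) (ph i v)"
  using D.M.finsum_singleton[OF i I, of "%_. dsum_in J N' (g i) (ph i v)"] cl by simp
 finally show ?thesis .
qed

end

section \<open>Alternating sums\<close>

lemma sgn_pow_closed: "cring R ==> sgn_pow R i \<in> carrier R"
proof -
 assume "cring R"
 then interpret R: cring R .
 show ?thesis unfolding sgn_pow_def by simp
qed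

lemma sgn_pow_0 [simp]: "sgn_pow R 0 = \<one>\<^bsub>R\<^esub>"
 by (simp add: sgn_pow_def)

lemma sgn_pow_Suc:
 assumes "cring R" shows "sgn_pow R (Suc i) = \<ominus>\<^bsub>R\<^esub> sgn_pow R i"
proof -
 interpret R: cring R by fact
 show ?thesis unfolding sgn_pow_def by (simp add: R.r_minus)
qed

lemma sgn_pow_sqr:
 assumes "cring R" shows "sgn_pow R i \<otimes>\<^bsub>R\<^esub> sgn_pow R i = \<one>\<^bsub>R\<^esub>"
proof (induction i)
 interpret R: cring R by fact
 case 0 show ?case by simp
next
 interpret R: cring R by fact
 case (Suc i)
 then show ?case
  by (simp add: sgn_pow_Suc[OF assms] R.l_minus R.r_minus sgn_pow_closed[OF assms])
qed

definition altsum :: "'r ring => ('r, 'n) module => nat => (nat => 'n) => 'n"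
 where "altsum R N k f = (\<Oplus>\<^bsub>N\<^esub>i\<in>{..k}. sgn_pow R i \<odot>\<^bsub>N\<^esub> f i)"

lemma altsum_hom:
 assumes "Module.module R M" "Module.module R N" "\<And>i. i \<le> k ==> D i \<in> mod_hom R M N"
 shows "(%x. altsum R N k (%i. D i x)) \<in> mod_hom R M N"
proof -
 have "cring R" using assms(1) by (simp add: Module.module_def)
 then show ?thesis
  unfolding altsum_def
  by (intro mod_hom_pointwise_finsum mod_hom_pointwise_smult assms sgn_pow_closed) auto
qed

context
 fixes R :: "'r ring" and N :: "('r, 'n) module"
 assumes N: "Module.module R N"
begin

interpretation N: Module.module R N by (rule N)

lemma sgn_pow_closed': "sgn_pow R i \<in> carrier R"
 by (rule sgn_pow_closed[OF N.R.is_cring])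

lemma altsum_closed:
 assumes "\<And>i. i \<le> k ==> f i \<in> carrier N" shows "altsum R N k f \<in> carrier N"
 unfolding altsum_def by (rule N.M.finsum_closed) (use assms in "auto simp: sgn_pow_closed'")

lemma altsum_0: "f 0 \<in> carrier N ==> altsum R N 0 f = f 0"
 by (simp add: altsum_def)

lemma altsum_cong:
 assumes "\<And>i. i \<le> k ==> f i = g i" "\<And>i. i \<le> k ==> g i \<in> carrier N"
 shows "altsum R N k f = altsum R N k g"
 unfolding altsum_def by (rule N.M.finsum_cong') (use assms in "auto simp: sgn_pow_closed'")

lemma altsum_eq_zero:
 assumes "\<And>i. i \<le> k ==> f i = \<zero>\<^bsub>N\<^esub>" shows "altsum R N k f = \<zero>\<^bsub>N\<^esub>"
proof -
 have "altsum R N k f = (\<Oplus>\<^bsub>N\<^esub>i\<in>{..k}. \<zero>\<^bsub>N\<^esub>)" unfolding altsum_def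
  by (rule N.M.finsum_cong') (use assms in "auto simp: sgn_pow_closed'")
 then show ?thesis by simp
qed

lemma altsum_Suc:
 assumes "\<And>i. i \<le> Suc k ==> f i \<in> carrier N"
 shows "altsum R N (Suc k) f = sgn_pow R (Suc k) \<odot>\<^bsub>N\<^esub> f (Suc k) \<oplus>\<^bsub>N\<^esub> altsum R N k f"
 unfolding altsum_def by (rule N.M.finsum_Suc) (use assms in "auto simp: sgn_pow_closed'")

lemma altsum_Suc_shift:
 assumes "\<And>i. i \<le> Suc k ==> f i \<in> carrier N"
 shows "altsum R N (Suc k) f = f 0 \<ominus>\<^bsub>N\<^esub> altsum R N k (%i. f (Suc i))"
proof -
 have "altsum R N (Suc k) f = (\<Oplus>\<^bsub>N\<^esub>i\<in>{..k}. sgn_pow R (Suc i) \<odot>\<^bsub>N\<^esub> f (Suc i)) \<oplus>\<^bsub>N\<^esub> sgn_pow R 0 \<odot>\<^bsub>N\<^esub> f 0"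
  unfolding altsum_def by (rule N.M.finsum_Suc2) (use assms in "auto simp: sgn_pow_closed'")
 also have "(\<Oplus>\<^bsub>N\<^esub>i\<in>{..k}. sgn_pow R (Suc i) \<odot>\<^bsub>N\<^esub> f (Suc i)) =
   (\<Oplus>\<^bsub>N\<^esub>i\<in>{..k}. (\<ominus>\<^bsub>R\<^esub> \<one>\<^bsub>R\<^esub>) \<odot>\<^bsub>N\<^esub> (sgn_pow R i \<odot>\<^bsub>N\<^esub> f (Suc i)))"
  by (rule N.M.finsum_cong')
   (use assms in "auto simp: sgn_pow_closed' sgn_pow_Suc N.R.is_cring N.smult_assoc1[symmetric] N.R.l_minus")
 also have "\<dots> = (\<ominus>\<^bsub>R\<^esub> \<one>\<^bsub>R\<^esub>) \<odot>\<^bsub>N\<^esub> altsum R N k (%i. f (Suc i))"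
  unfolding altsum_def
  by (rule N.finsum_smult_ldistr[symmetric]) (use assms in "auto simp: sgn_pow_closed'")
 also have "\<dots> = \<ominus>\<^bsub>N\<^esub> altsum R N k (%i. f (Suc i))"
  using altsum_closed[of k "%i. f (Suc i)"] assms by (simp add: N.smult_l_minus)
 finally show ?thesis
  using assms altsum_closed[of k "%i. f (Suc i)"] by (simp add: a_minus_def N.M.a_comm)
qed

end

lemma mod_hom_altsum:
 assumes f: "f \<in> mod_hom R M N" and M: "Module.module R M" and N: "Module.module R N"
  and x: "\<And>i. i \<le> k ==> x i \<in> carrier M"
 shows "f (altsum R M k x) = altsum R N k (%i. f (x i))"
proof -
 interpret M: Module.module R M by fact
 interpret N: Module.module R N by fact
 note sg = sgn_pow_closed'[OF M]
 have "f (altsum R M k x) = (\<Oplus>\<^bsub>N\<^esub>i\<in>{..k}. f (sgn_pow R i \<odot>\<^bsub>M\<^esub> x i))"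
  unfolding altsum_def by (rule mod_hom_finsum[OF f M N]) (use x in "auto simp: sg")
 also have "\<dots> = altsum R N k (%i. f (x i))"
  unfolding altsum_def
  by (rule N.M.finsum_cong') (use x f in "auto simp: sg mod_hom_smult mod_hom_closed")
 finally show ?thesis .
qed

text \<open>The simplicial identity pairs the terms with i < j with those with j <= i through (i, j)
  |-> (j - 1, i), and paired terms carry opposite signs. Stated for arbitrary families of faces, it
  yields the vanishing of squared differentials for every simplicial module below.\<close>

lemma altsum_altsum:
 assumes B: "Module.module R B" and C: "Module.module R C"
  and D: "\<And>j. j \<le> Suc k ==> D j x \<in> carrier B"
  and D': "\<And>i. i \<le> k ==> D' i \<in> mod_hom R B C"
  and comm: "\<And>i j. [|i < j; j \<le> Suc k|] ==> D' i (D j x) = D' (j - 1) (D i x)"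
 shows "altsum R C k (%i. D' i (altsum R B (Suc k) (%j. D j x))) = \<zero>\<^bsub>C\<^esub>"
proof -
 interpret B: Module.module R B by fact
 interpret C: Module.module R C by fact
 note sg = sgn_pow_closed'[OF B]
 define T where "T = (%(i, j). (sgn_pow R i \<otimes>\<^bsub>R\<^esub> sgn_pow R j) \<odot>\<^bsub>C\<^esub> D' i (D j x))"
 have DD: "D' i (D j x) \<in> carrier C" if "i \<le> k" "j \<le> Suc k" for i j
  by (rule mod_hom_closed[OF D'[OF that(1)] D[OF that(2)]])
 have Tc: "T p \<in> carrier C" if "p \<in> {..k} \<times> {..Suc k}" for p
  using that DD by (auto simp: T_def sg)
 define L where "L = {(i, j). i < j \<and> j \<le> Suc k}"
 define U where "U = {(i, j). j \<le> i \<and> i \<le> k}"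
 have LU: "L \<inter> U = {}" "L \<union> U = {..k} \<times> {..Suc k}" "finite L" "finite U"
  by (auto simp: L_def U_def intro: finite_subset[of _ "{..k} \<times> {..Suc k}"])
 have TL: "T p \<in> carrier C" if "p \<in> L \<or> p \<in> U" for p
  by (rule Tc) (use that LU(2) in blast)
 have "altsum R C k (%i. D' i (altsum R B (Suc k) (%j. D j x))) = (\<Oplus>\<^bsub>C\<^esub>i\<in>{..k}. \<Oplus>\<^bsub>C\<^esub>j\<in>{..Suc k}. T (i, j))"
  unfolding altsum_def[of R C]
 proof (rule C.M.finsum_cong')
  fix i assume "i \<in> {..k}"
  then have i: "i \<le> k" by simp
  have "sgn_pow R i \<odot>\<^bsub>C\<^esub> D' i (altsum R B (Suc k) (%j. D j x)) =
    sgn_pow R i \<odot>\<^bsub>C\<^esub> (\<Oplus>\<^bsub>C\<^esub>j\<in>{..Suc k}. sgn_pow R j \<odot>\<^bsub>C\<^esub> D' i (D j x))"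
   by (subst mod_hom_altsum[OF D'[OF i] B C D]) (auto simp: altsum_def)
  also have "\<dots> = (\<Oplus>\<^bsub>C\<^esub>j\<in>{..Suc k}. sgn_pow R i \<odot>\<^bsub>C\<^esub> (sgn_pow R j \<odot>\<^bsub>C\<^esub> D' i (D j x)))"
   by (rule C.finsum_smult_ldistr) (use DD[OF i] in "auto simp: sg")
  also have "\<dots> = (\<Oplus>\<^bsub>C\<^esub>j\<in>{..Suc k}. T (i, j))"
   by (rule C.M.finsum_cong') (use DD[OF i] in "auto simp: sg T_def C.smult_assoc1")
  finally show "sgn_pow R i \<odot>\<^bsub>C\<^esub> D' i (altsum R B (Suc k) (%j. D j x)) = (\<Oplus>\<^bsub>C\<^esub>j\<in>{..Suc k}. T (i, j))" .
 qed (auto intro!: C.M.finsum_closed Tc)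
 also have "\<dots> = (\<Oplus>\<^bsub>C\<^esub>i\<in>{..k}. finsum C T (Pair i ` {..Suc k}))"
 proof (rule C.M.finsum_cong')
  fix i assume "i \<in> {..k}"
  then show "(\<Oplus>\<^bsub>C\<^esub>j\<in>{..Suc k}. T (i, j)) = finsum C T (Pair i ` {..Suc k})"
   by (intro C.M.finsum_reindex[symmetric]) (auto intro!: Tc inj_onI)
 qed (auto intro!: C.M.finsum_closed Tc)
 also have "\<dots> = finsum C T (\<Union>i\<in>{..k}. Pair i ` {..Suc k})"
  by (rule C.M.add.finprod_UN_disjoint[symmetric])
   (auto intro!: Tc simp: pairwise_def disjnt_def)
 also have "(\<Union>i\<in>{..k}. Pair i ` {..Suc k}) = L \<union> U"
  by (auto simp: LU(2))
 also have "finsum C T (L \<union> U) = finsum C T L \<oplus>\<^bsub>C\<^esub> finsum C T U"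
  by (rule C.M.finsum_Un_disjoint) (use LU(1,3,4) TL in auto)
 also have "finsum C T U = finsum C T ((%(i, j). (j - 1, i)) ` L)"
 proof -
  have "U = (%(i, j). (j - 1, i)) ` L"
  proof (intro equalityI subsetI)
   fix p assume "p \<in> U"
   then obtain i j where p: "p = (i, j)" "j \<le> i" "i \<le> k" by (auto simp: U_def)
   then have "(j, Suc i) \<in> L" by (auto simp: L_def)
   then show "p \<in> (%(i, j). (j - 1, i)) ` L" by (rule rev_image_eqI) (simp add: p)
  qed (auto simp: L_def U_def)
  then show ?thesis by simp
 qed
 also have "\<dots> = (\<Oplus>\<^bsub>C\<^esub>p\<in>L. T (case p of (i, j) => (j - 1, i)))"
  by (rule C.M.finsum_reindex) (auto simp: L_def inj_on_def U_def intro!: TL)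
 also have "finsum C T L \<oplus>\<^bsub>C\<^esub> \<dots> = (\<Oplus>\<^bsub>C\<^esub>p\<in>L. T p \<oplus>\<^bsub>C\<^esub> T (case p of (i, j) => (j - 1, i)))"
  by (rule C.M.finsum_addf[symmetric]) (auto simp: LU(3) L_def U_def intro!: TL)
 also have "\<dots> = (\<Oplus>\<^bsub>C\<^esub>p\<in>L. \<zero>\<^bsub>C\<^esub>)"
 proof (rule C.M.finsum_cong')
  fix p assume "p \<in> L"
  then obtain i j where p: "p = (i, j)" "i < j" "j \<le> Suc k" by (auto simp: L_def)
  then obtain l where l: "j = Suc l" by (cases j) auto
  let ?y = "D' l (D i x)"
  have y: "?y \<in> carrier C" using DD p l by auto
  have "T p = (\<ominus>\<^bsub>R\<^esub> (sgn_pow R i \<otimes>\<^bsub>R\<^esub> sgn_pow R l)) \<odot>\<^bsub>C\<^esub> ?y"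
   using comm[OF p(2,3)] p l by (simp add: T_def sgn_pow_Suc B.R.is_cring B.R.r_minus sg)
  also have "\<dots> = \<ominus>\<^bsub>C\<^esub> ((sgn_pow R l \<otimes>\<^bsub>R\<^esub> sgn_pow R i) \<odot>\<^bsub>C\<^esub> ?y)"
   using y by (simp add: C.smult_l_minus sg B.R.m_comm)
  finally have "T p = \<ominus>\<^bsub>C\<^esub> T (l, i)" by (simp add: T_def)
  moreover have "T (l, i) \<in> carrier C" using p l by (intro Tc) auto
  ultimately show "T p \<oplus>\<^bsub>C\<^esub> T (case p of (i, j) => (j - 1, i)) = \<zero>\<^bsub>C\<^esub>"
   using p l by (simp add: C.M.l_neg)
 qed auto
 also have "\<dots> = \<zero>\<^bsub>C\<^esub>" by simp
 finally show ?thesis .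
qed

text \<open>Contracting homotopies given by an extra degeneracy in front of, respectively behind, the
  other positions.\<close>

lemma altsum_homotopy_front:
 assumes N: "Module.module R N" and N': "Module.module R N'" and h': "h' \<in> mod_hom R N' N"
  and x: "x \<in> carrier N" and f: "\<And>i. i \<le> k ==> f i \<in> carrier N'"
  and 0: "g 0 = x" and Suc: "\<And>i. i \<le> k ==> g (Suc i) = h' (f i)"
 shows "altsum R N (Suc k) g = x \<ominus>\<^bsub>N\<^esub> h' (altsum R N' k f)"
proof -
 have g: "g i \<in> carrier N" if "i \<le> Suc k" for i
  using that x 0 Suc mod_hom_closed[OF h' f] by (cases i) auto
 have "altsum R N (Suc k) g = g 0 \<ominus>\<^bsub>N\<^esub> altsum R N k (%i. g (Suc i))"
  by (rule altsum_Suc_shift[OF N g])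
 also have "altsum R N k (%i. g (Suc i)) = altsum R N k (%i. h' (f i))"
  by (rule altsum_cong[OF N]) (use Suc mod_hom_closed[OF h' f] in auto)
 also have "\<dots> = h' (altsum R N' k f)"
  by (rule mod_hom_altsum[OF h' N' N f, symmetric])
 finally show ?thesis by (simp add: 0)
qed

lemma altsum_homotopy_back:
 assumes N: "Module.module R N" and N': "Module.module R N'" and h': "h' \<in> mod_hom R N' N"
  and x: "x \<in> carrier N" and f: "\<And>i. i \<le> k ==> f i \<in> carrier N'"
  and Suc: "g (Suc k) = x" and le: "\<And>i. i \<le> k ==> g i = h' (f i)"
 shows "altsum R N (Suc k) g = sgn_pow R (Suc k) \<odot>\<^bsub>N\<^esub> x \<oplus>\<^bsub>N\<^esub> h' (altsum R N' k f)"
proof -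
 have g: "g i \<in> carrier N" if "i \<le> Suc k" for i
  using that x Suc le mod_hom_closed[OF h' f] by (cases "i = Suc k") auto
 have "altsum R N (Suc k) g = sgn_pow R (Suc k) \<odot>\<^bsub>N\<^esub> g (Suc k) \<oplus>\<^bsub>N\<^esub> altsum R N k g"
  by (rule altsum_Suc[OF N g])
 also have "altsum R N k g = altsum R N k (%i. h' (f i))"
  by (rule altsum_cong[OF N]) (use le mod_hom_closed[OF h' f] in auto)
 also have "\<dots> = h' (altsum R N' k f)"
  by (rule mod_hom_altsum[OF h' N' N f, symmetric])
 finally show ?thesis by (simp add: Suc)
qed

section \<open>Homology of chain complexes\<close>

definition chain_complex :: "'r ring => (int => ('r, 'c) module) => (int => 'c => 'c) => bool"
 where "chain_complex R C d \<longleftrightarrow> (\<forall>k. Module.module R (C k)) \<and> (\<forall>k. d k \<in> mod_hom R (C k) (C (k - 1))) \<and>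
  (\<forall>k. \<forall>x\<in>carrier (C (k + 1)). d k (d (k + 1) x) = \<zero>\<^bsub>C (k - 1)\<^esub>)"

definition hclass ::
 "(int => ('r, 'c) module) => (int => 'c => 'c) => int => 'c => 'c set"
 where "hclass C d k x = boundaries C d k +>\<^bsub>cycles C d k\<^esub> x"

lemma cycles_carrier: "carrier (cycles C d k) = {x \<in> carrier (C k). d k x = \<zero>\<^bsub>C (k - 1)\<^esub>}"
 and cycles_add: "x \<oplus>\<^bsub>cycles C d k\<^esub> y = x \<oplus>\<^bsub>C k\<^esub> y"
 and cycles_smult: "r \<odot>\<^bsub>cycles C d k\<^esub> y = r \<odot>\<^bsub>C k\<^esub> y"
 by (simp_all add: cycles_def a_kernel_def')

context
 fixes R :: "'r ring" and C :: "int => ('r, 'c) module" and d :: "int => 'c => 'c"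
 assumes cx: "chain_complex R C d"
begin

lemma chain_complex_module: "Module.module R (C k)"
 and chain_complex_diff: "d k \<in> mod_hom R (C k) (C (k - 1))"
 and chain_complex_diff_diff: "x \<in> carrier (C (k + 1)) ==> d k (d (k + 1) x) = \<zero>\<^bsub>C (k - 1)\<^esub>"
 using cx by (auto simp: chain_complex_def)

lemma submodule_cycles: "submodule (carrier (cycles C d k)) R (C k)"
 using submodule_kernel[OF chain_complex_module chain_complex_module chain_complex_diff[of k]]
 by (simp add: cycles_carrier)

lemma module_cycles: "Module.module R (cycles C d k)"
 using submodule.submodule_is_module[OF submodule_cycles chain_complex_module, of k]
 by (simp add: cycles_def)

lemma submodule_boundaries: "submodule (boundaries C d k) R (cycles C d k)"
proof -
 have "d (k + 1) \<in> mod_hom R (C (k + 1)) (cycles C d k)"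
  using chain_complex_diff[of "k + 1"] chain_complex_diff_diff
  by (intro mod_homI) (auto simp: cycles_carrier cycles_add cycles_smult
    mod_hom_closed mod_hom_add mod_hom_smult)
 then show ?thesis
  unfolding boundaries_def by (rule submodule_image[OF chain_complex_module module_cycles])
qed

lemma module_homology: "Module.module R (homology C d k)"
 unfolding homology_def by (rule module_quot[OF module_cycles submodule_boundaries])

lemma homology_carrier: "carrier (homology C d k) = hclass C d k ` carrier (cycles C d k)"
 unfolding homology_def hclass_def by (rule quot_carrier[OF module_cycles submodule_boundaries])

lemma hclass_hom: "hclass C d k \<in> mod_hom R (cycles C d k) (homology C d k)"
 unfolding homology_def hclass_def[abs_def] by (rule quot_proj_hom[OF module_cycles submodule_boundaries])

lemma hclass_eq_iff:
 assumes x: "x \<in> carrier (cycles C d k)" and y: "y \<in> carrier (cycles C d k)"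
 shows "hclass C d k x = hclass C d k y \<longleftrightarrow> x \<ominus>\<^bsub>C k\<^esub> y \<in> boundaries C d k"
proof -
 interpret Z: Module.module R "cycles C d k" by (rule module_cycles)
 interpret C: Module.module R "C k" by (rule chain_complex_module)
 interpret B: abelian_subgroup "boundaries C d k" "cycles C d k"
  by (rule submodule_abelian_subgroup[OF module_cycles submodule_boundaries])
 \<comment> \<open>The additive inverse is defined by reference to the carrier, and
   \<open>cycles\<close> has a smaller carrier than \<open>C k\<close>, so the two inverses have to
   be identified.\<close>
 have "\<ominus>\<^bsub>cycles C d k\<^esub> y = \<ominus>\<^bsub>C k\<^esub> y"
 proof -
  have y': "\<ominus>\<^bsub>cycles C d k\<^esub> y \<in> carrier (cycles C d k)" using y by simp
  have "\<ominus>\<^bsub>cycles C d k\<^esub> y \<oplus>\<^bsub>C k\<^esub> y = \<zero>\<^bsub>C k\<^esub>"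
   using Z.M.l_neg[OF y] by (simp add: cycles_add) (simp add: cycles_def)
  then show ?thesis
   using y y' by (intro C.M.minus_equality[symmetric]) (auto simp: cycles_carrier)
 qed
 then have "x \<ominus>\<^bsub>cycles C d k\<^esub> y = x \<ominus>\<^bsub>C k\<^esub> y" by (simp add: a_minus_def cycles_add)
 then show ?thesis
  unfolding hclass_def using coset_eq_iff[OF module_cycles submodule_boundaries x y] by simp
qed

lemma mem_hclass_iff:
 assumes x: "x \<in> carrier (cycles C d k)"
 shows "y \<in> hclass C d k x \<longleftrightarrow> y \<in> carrier (cycles C d k) \<and> hclass C d k y = hclass C d k x"
proof -
 interpret B: abelian_subgroup "boundaries C d k" "cycles C d k"
  by (rule submodule_abelian_subgroup[OF module_cycles submodule_boundaries])
 show ?thesis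
  unfolding hclass_def using B.a_repr_independence' B.a_rcos_self B.a_elemrcos_carrier x by metis
qed

end

definition chain_map ::
 "'r ring => (int => ('r, 'c) module) => (int => 'c => 'c) =>
  (int => ('r, 'e) module) => (int => 'e => 'e) => (int => 'c => 'e) => bool"
 where "chain_map R C d C' d' ph \<longleftrightarrow> (\<forall>k. ph k \<in> mod_hom R (C k) (C' k)) \<and>
  (\<forall>k. \<forall>x\<in>carrier (C (k + 1)). ph k (d (k + 1) x) = d' (k + 1) (ph (k + 1) x))"

context
 fixes R :: "'r ring" and C :: "int => ('r, 'c) module" and d :: "int => 'c => 'c"
  and C' :: "int => ('r, 'e) module" and d' :: "int => 'e => 'e" and ph :: "int => 'c => 'e"
 assumes C: "chain_complex R C d" and C': "chain_complex R C' d'" and ph: "chain_map R C d C' d' ph"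
begin

lemma chain_map_hom: "ph k \<in> mod_hom R (C k) (C' k)"
 and chain_map_diff: "x \<in> carrier (C (k + 1)) ==> ph k (d (k + 1) x) = d' (k + 1) (ph (k + 1) x)"
 using ph by (auto simp: chain_map_def)

lemma chain_map_cycles:
 assumes "x \<in> carrier (cycles C d k)" shows "ph k x \<in> carrier (cycles C' d' k)"
proof -
 have "d' k (ph k x) = ph (k - 1) (d k x)"
  using chain_map_diff[of x "k - 1"] assms by (simp add: cycles_carrier)
 also have "\<dots> = \<zero>\<^bsub>C' (k - 1)\<^esub>"
  using assms mod_hom_zero[OF chain_map_hom chain_complex_module[OF C] chain_complex_module[OF C']]
  by (simp add: cycles_carrier)
 finally show ?thesis using assms mod_hom_closed[OF chain_map_hom[of k]] by (auto simp: cycles_carrier)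
qed

text \<open>\<open>homology_map\<close> takes a union over all cycles in a class. Homologous cycles
  have homologous images under a chain map, so the union is the class of any one image.\<close>

lemma homology_map_hclass:
 assumes x: "x \<in> carrier (cycles C d k)"
 shows "homology_map C d C' d' ph k (hclass C d k x) = hclass C' d' k (ph k x)"
proof -
 have "hclass C' d' k (ph k y) = hclass C' d' k (ph k x)" if "y \<in> hclass C d k x" for y
 proof -
  have y: "y \<in> carrier (cycles C d k)" and "y \<ominus>\<^bsub>C k\<^esub> x \<in> boundaries C d k"
   using that mem_hclass_iff[OF C x] hclass_eq_iff[OF C _ x] by auto
  then obtain w where w: "w \<in> carrier (C (k + 1))" "y \<ominus>\<^bsub>C k\<^esub> x = d (k + 1) w"
   by (auto simp: boundaries_def)
  have "ph k y \<ominus>\<^bsub>C' k\<^esub> ph k x = d' (k + 1) (ph (k + 1) w)"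
   using chain_map_diff[OF w(1)] x y
    mod_hom_minus[OF chain_map_hom chain_complex_module[OF C] chain_complex_module[OF C'], of y k x]
   by (simp add: w(2)[symmetric] cycles_carrier)
  then show ?thesis
   using w(1) chain_map_hom[of "k + 1"] x y
   by (subst hclass_eq_iff[OF C']) (auto simp: chain_map_cycles boundaries_def mod_hom_closed)
 qed
 moreover have "x \<in> hclass C d k x" using mem_hclass_iff[OF C x] x by simp
 ultimately have "(\<Union>y\<in>hclass C d k x. hclass C' d' k (ph k y)) = hclass C' d' k (ph k x)" by blast
 then show ?thesis
  using x by (simp add: homology_map_def homology_carrier[OF C] hclass_def)
qed

lemma homology_map_hom: "homology_map C d C' d' ph k \<in> mod_hom R (homology C d k) (homology C' d' k)"
proof -
 interpret Z: Module.module R "cycles C d k" by (rule module_cycles[OF C])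
 note h = hclass_hom[OF C, of k] and h' = hclass_hom[OF C', of k]
 show ?thesis
 proof (rule mod_homI)
  fix X assume "X \<in> carrier (homology C d k)"
  then obtain x where x: "x \<in> carrier (cycles C d k)" "X = hclass C d k x"
   by (auto simp: homology_carrier[OF C])
  show "homology_map C d C' d' ph k X \<in> carrier (homology C' d' k)"
   using x mod_hom_closed[OF h' chain_map_cycles[OF x(1)]] by (simp add: homology_map_hclass)
  show "homology_map C d C' d' ph k (r \<odot>\<^bsub>homology C d k\<^esub> X) =
    r \<odot>\<^bsub>homology C' d' k\<^esub> homology_map C d C' d' ph k X" if r: "r \<in> carrier R" for r
  proof -
   have "homology_map C d C' d' ph k (r \<odot>\<^bsub>homology C d k\<^esub> X) =
     hclass C' d' k (ph k (r \<odot>\<^bsub>cycles C d k\<^esub> x))"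
    unfolding x(2) mod_hom_smult[OF h r x(1), symmetric]
    by (rule homology_map_hclass) (use r x(1) in simp)
   also have "ph k (r \<odot>\<^bsub>cycles C d k\<^esub> x) = r \<odot>\<^bsub>cycles C' d' k\<^esub> ph k x"
    using mod_hom_smult[OF chain_map_hom r] x(1) by (simp add: cycles_smult cycles_carrier)
   finally show ?thesis
    using mod_hom_smult[OF h' r chain_map_cycles[OF x(1)]] by (simp add: x homology_map_hclass)
  qed
  fix Y assume "Y \<in> carrier (homology C d k)"
  then obtain y where y: "y \<in> carrier (cycles C d k)" "Y = hclass C d k y"
   by (auto simp: homology_carrier[OF C])
  show "homology_map C d C' d' ph k (X \<oplus>\<^bsub>homology C d k\<^esub> Y) =
    homology_map C d C' d' ph k X \<oplus>\<^bsub>homology C' d' k\<^esub> homology_map C d C' d' ph k Y"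
  proof -
   have "homology_map C d C' d' ph k (X \<oplus>\<^bsub>homology C d k\<^esub> Y) =
     hclass C' d' k (ph k (x \<oplus>\<^bsub>cycles C d k\<^esub> y))"
    unfolding x(2) y(2) mod_hom_add[OF h x(1) y(1), symmetric]
    by (rule homology_map_hclass) (use y x in simp)
   also have "ph k (x \<oplus>\<^bsub>cycles C d k\<^esub> y) = ph k x \<oplus>\<^bsub>cycles C' d' k\<^esub> ph k y"
    using mod_hom_add[OF chain_map_hom] x(1) y(1) by (simp add: cycles_add cycles_carrier)
   finally show ?thesis
    using mod_hom_add[OF h' chain_map_cycles[OF x(1)] chain_map_cycles[OF y(1)]]
    by (simp add: x y homology_map_hclass)
  qed
 qed
qed

end

lemma homology_map_extensional: "homology_map C d C' d' ph k \<in> extensional (carrier (homology C d k))"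
 by (simp add: homology_map_def)

lemma homology_map_id:
 assumes C: "chain_complex R C d" and ph: "\<And>k x. x \<in> carrier (C k) ==> ph k x = x"
 shows "homology_map C d C d ph k = (\<lambda>X\<in>carrier (homology C d k). X)"
proof (rule extensionalityI[where A = "carrier (homology C d k)"])
 have cm: "chain_map R C d C d ph"
  unfolding chain_map_def
 proof (intro conjI allI ballI)
  show "ph k \<in> mod_hom R (C k) (C k)" for k
   by (rule mod_hom_cong[OF mod_hom_id[OF chain_complex_module[OF C]] chain_complex_module[OF C]])
    (simp add: ph)
  show "ph k (d (k + 1) x) = d (k + 1) (ph (k + 1) x)" if "x \<in> carrier (C (k + 1))" for k x
   using that mod_hom_closed[OF chain_complex_diff[OF C] that] by (simp add: ph)
 qed
 fix X assume "X \<in> carrier (homology C d k)"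
 then obtain x where x: "x \<in> carrier (cycles C d k)" "X = hclass C d k x"
  by (auto simp: homology_carrier[OF C])
 show "homology_map C d C d ph k X = (\<lambda>X\<in>carrier (homology C d k). X) X"
  using x homology_map_hclass[OF C C cm x(1)] \<open>X \<in> _\<close> by (simp add: ph cycles_carrier)
qed (simp_all add: homology_map_extensional)

lemma homology_map_compose:
 assumes C: "chain_complex R C d" and C': "chain_complex R C' d'" and C'': "chain_complex R C'' d''"
  and ph: "chain_map R C d C' d' ph" and ps: "chain_map R C' d' C'' d'' ps"
  and ch0: "\<And>k x. x \<in> carrier (C k) ==> ch0 k x = ps k (ph k x)"
 shows "homology_map C d C'' d'' ch0 k =
  compose (carrier (homology C d k)) (homology_map C' d' C'' d'' ps k) (homology_map C d C' d' ph k)"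
proof (rule extensionalityI[where A = "carrier (homology C d k)"])
 have cm: "chain_map R C d C'' d'' ch0"
  unfolding chain_map_def
 proof (intro conjI allI ballI)
  show "ch0 k \<in> mod_hom R (C k) (C'' k)" for k
   by (rule mod_hom_cong[OF mod_hom_comp[OF chain_map_hom[OF C C' ph] chain_map_hom[OF C' C'' ps]]
      chain_complex_module[OF C]]) (simp add: ch0)
  show "ch0 k (d (k + 1) x) = d'' (k + 1) (ch0 (k + 1) x)" if "x \<in> carrier (C (k + 1))" for k x
   using that mod_hom_closed[OF chain_complex_diff[OF C] that] mod_hom_closed[OF chain_map_hom[OF C C' ph] that]
   by (simp add: ch0 chain_map_diff[OF C C' ph] chain_map_diff[OF C' C'' ps])
 qed
 fix X assume "X \<in> carrier (homology C d k)"
 then obtain x where x: "x \<in> carrier (cycles C d k)" "X = hclass C d k x"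
  by (auto simp: homology_carrier[OF C])
 show "homology_map C d C'' d'' ch0 k X =
  compose (carrier (homology C d k)) (homology_map C' d' C'' d'' ps k) (homology_map C d C' d' ph k) X"
  using x \<open>X \<in> _\<close> homology_map_hclass[OF C C' ph x(1)] homology_map_hclass[OF C C'' cm x(1)]
   homology_map_hclass[OF C' C'' ps chain_map_cycles[OF C C' ph x(1)]]
  by (simp add: compose_def ch0 cycles_carrier)
qed (simp_all add: homology_map_extensional)

text \<open>An additive relation between cycles that is total on both sides and matches boundaries
  with boundaries induces an isomorphism. A relation is used in place of a map because the
  staircases that realise it below involve choices.\<close>

lemma homology_isomorphicI:
 assumes C: "chain_complex R C d" and C': "chain_complex R C' d'"
  and closed: "\<And>x y. rh x y ==> x \<in> carrier (cycles C d k) \<and> y \<in> carrier (cycles C' d' k)"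
  and total: "\<And>x. x \<in> carrier (cycles C d k) ==> \<exists>y. rh x y"
  and surj: "\<And>y. y \<in> carrier (cycles C' d' k) ==> \<exists>x. rh x y"
  and add: "\<And>x y x' y'. [|rh x y; rh x' y'|] ==> rh (x \<oplus>\<^bsub>C k\<^esub> x') (y \<oplus>\<^bsub>C' k\<^esub> y')"
  and smult: "\<And>r x y. [|r \<in> carrier R; rh x y|] ==> rh (r \<odot>\<^bsub>C k\<^esub> x) (r \<odot>\<^bsub>C' k\<^esub> y)"
  and bd: "\<And>x y. rh x y ==> x \<in> boundaries C d k \<longleftrightarrow> y \<in> boundaries C' d' k"
 shows "mod_isomorphic R (homology C d k) (homology C' d' k)"
proof -
 interpret C: Module.module R "C k" by (rule chain_complex_module[OF C])
 interpret C': Module.module R "C' k" by (rule chain_complex_module[OF C'])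
 note h = hclass_hom[OF C, of k] and h' = hclass_hom[OF C', of k]
 have eq: "hclass C d k x = hclass C d k x' \<longleftrightarrow> hclass C' d' k y = hclass C' d' k y'"
  if xy: "rh x y" "rh x' y'" for x y x' y'
 proof -
  have cl: "x \<in> carrier (C k)" "x' \<in> carrier (C k)" "y \<in> carrier (C' k)" "y' \<in> carrier (C' k)"
   using closed xy by (auto simp: cycles_carrier)
  \<comment> \<open>The relation is closed under sums and scalars, so a difference is written as a
    sum with a multiple by minus one.\<close>
  have "rh (x \<oplus>\<^bsub>C k\<^esub> (\<ominus>\<^bsub>R\<^esub> \<one>\<^bsub>R\<^esub>) \<odot>\<^bsub>C k\<^esub> x') (y \<oplus>\<^bsub>C' k\<^esub> (\<ominus>\<^bsub>R\<^esub> \<one>\<^bsub>R\<^esub>) \<odot>\<^bsub>C' k\<^esub> y')"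
   using xy by (intro add smult) auto
  then have "rh (x \<ominus>\<^bsub>C k\<^esub> x') (y \<ominus>\<^bsub>C' k\<^esub> y')"
   using cl by (simp add: a_minus_def C.smult_l_minus C'.smult_l_minus)
  then show ?thesis
   using closed[OF xy(1)] closed[OF xy(2)] bd hclass_eq_iff[OF C] hclass_eq_iff[OF C'] by blast
 qed
 \<comment> \<open>By \<open>eq\<close> the class of \<open>y\<close> depends only on the class of
   \<open>x\<close>; the same equivalence, read backwards, is injectivity.\<close>
 define f where "f X = hclass C' d' k (SOME y. \<exists>x. rh x y \<and> X = hclass C d k x)" for X
 have f: "f (hclass C d k x) = hclass C' d' k y" if "rh x y" for x y
 proof -
  define z where "z = (SOME y. \<exists>x'. rh x' y \<and> hclass C d k x = hclass C d k x')"
  have "\<exists>x'. rh x' z \<and> hclass C d k x = hclass C d k x'"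
   unfolding z_def by (rule someI[where x = y]) (use that in blast)
  then show ?thesis unfolding f_def z_def[symmetric] using eq[OF that] by blast
 qed
 have rep: "\<exists>x y. rh x y \<and> X = hclass C d k x" if "X \<in> carrier (homology C d k)" for X
  using that total unfolding homology_carrier[OF C] by blast
 have "f \<in> mod_hom R (homology C d k) (homology C' d' k)"
 proof (rule mod_homI)
  fix X assume "X \<in> carrier (homology C d k)"
  then obtain x y where x: "rh x y" "X = hclass C d k x" using rep by blast
  note xc = closed[OF x(1)]
  show "f X \<in> carrier (homology C' d' k)"
   using xc by (simp add: x(2) f[OF x(1)] homology_carrier[OF C'])
  show "f (r \<odot>\<^bsub>homology C d k\<^esub> X) = r \<odot>\<^bsub>homology C' d' k\<^esub> f X" if r: "r \<in> carrier R" for r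
   using f[OF smult[OF r x(1)]] mod_hom_smult[OF h r conjunct1[OF xc]]
    mod_hom_smult[OF h' r conjunct2[OF xc]]
   by (simp add: x(2) f[OF x(1)] cycles_smult)
  fix X' assume "X' \<in> carrier (homology C d k)"
  then obtain x' y' where x': "rh x' y'" "X' = hclass C d k x'" using rep by blast
  note xc' = closed[OF x'(1)]
  show "f (X \<oplus>\<^bsub>homology C d k\<^esub> X') = f X \<oplus>\<^bsub>homology C' d' k\<^esub> f X'"
   using f[OF add[OF x(1) x'(1)]] mod_hom_add[OF h conjunct1[OF xc] conjunct1[OF xc']]
    mod_hom_add[OF h' conjunct2[OF xc] conjunct2[OF xc']]
   by (simp add: x(2) x'(2) f[OF x(1)] f[OF x'(1)] cycles_add)
 qed
 moreover have "inj_on f (carrier (homology C d k))"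
 proof (rule inj_onI)
  fix X X' assume X: "X \<in> carrier (homology C d k)" "X' \<in> carrier (homology C d k)" "f X = f X'"
  obtain x y where x: "rh x y" "X = hclass C d k x" using rep[OF X(1)] by blast
  obtain x' y' where x': "rh x' y'" "X' = hclass C d k x'" using rep[OF X(2)] by blast
  show "X = X'" using X(3) eq[OF x(1) x'(1)] f[OF x(1)] f[OF x'(1)] by (simp add: x(2) x'(2))
 qed
 moreover have "f ` carrier (homology C d k) = carrier (homology C' d' k)"
 proof (intro equalityI subsetI)
  fix Y assume "Y \<in> f ` carrier (homology C d k)"
  then show "Y \<in> carrier (homology C' d' k)"
   using calculation(1) by (auto simp: mod_hom_closed)
 next
  fix Y assume "Y \<in> carrier (homology C' d' k)"
  then obtain x y where xy: "rh x y" "Y = hclass C' d' k y"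
   using surj unfolding homology_carrier[OF C'] by blast
  have "hclass C d k x \<in> carrier (homology C d k)"
   using closed[OF xy(1)] by (simp add: homology_carrier[OF C])
  then show "Y \<in> f ` carrier (homology C d k)"
   using f[OF xy(1)] xy(2) by (metis imageI)
 qed
 ultimately show ?thesis unfolding mod_isomorphic_def bij_betw_def by blast
qed

section \<open>Double complexes\<close>

text \<open>A first-quadrant double complex \<open>T p q\<close> with commuting differentials, the horizontal one
  \<open>dh\<close> lowering \<open>p\<close> and the vertical one \<open>dv\<close> lowering \<open>q\<close>, augmented by \<open>ep\<close> to a complex \<open>X\<close> and
  by \<open>et\<close> to a complex \<open>Y\<close>.\<close>

locale double_complex =
 fixes R :: "'r ring"
  and T :: "nat => nat => ('r, 't) module"
  and dh dv :: "nat => nat => 't => 't"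
  and X :: "int => ('r, 'x) module" and dX :: "int => 'x => 'x" and ep :: "nat => 't => 'x"
  and Y :: "int => ('r, 'y) module" and dY :: "int => 'y => 'y" and et :: "nat => 't => 'y"
 assumes T: "Module.module R (T p q)"
  and dh: "dh p q \<in> mod_hom R (T (Suc p) q) (T p q)"
  and dv: "dv p q \<in> mod_hom R (T p (Suc q)) (T p q)"
  and X: "chain_complex R X dX" and Y: "chain_complex R Y dY"
  and X0: "x \<in> carrier (X 0) ==> dX 0 x = \<zero>\<^bsub>X (0 - 1)\<^esub>"
  and Y0: "y \<in> carrier (Y 0) ==> dY 0 y = \<zero>\<^bsub>Y (0 - 1)\<^esub>"
  and ep: "ep p \<in> mod_hom R (T p 0) (X (int p))"
  and et: "et q \<in> mod_hom R (T 0 q) (Y (int q))"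
  and dh_dh: "t \<in> carrier (T (Suc (Suc p)) q) ==> dh p q (dh (Suc p) q t) = \<zero>\<^bsub>T p q\<^esub>"
  and dv_dv: "t \<in> carrier (T p (Suc (Suc q))) ==> dv p q (dv p (Suc q) t) = \<zero>\<^bsub>T p q\<^esub>"
  and dh_dv: "t \<in> carrier (T (Suc p) (Suc q)) ==> dh p q (dv (Suc p) q t) = dv p q (dh p (Suc q) t)"
  and ep_dv: "t \<in> carrier (T p 1) ==> ep p (dv p 0 t) = \<zero>\<^bsub>X (int p)\<^esub>"
  and et_dh: "t \<in> carrier (T 1 q) ==> et q (dh 0 q t) = \<zero>\<^bsub>Y (int q)\<^esub>"
  and ep_dh: "t \<in> carrier (T (Suc p) 0) ==> ep p (dh p 0 t) = dX (int p + 1) (ep (Suc p) t)"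
  and et_dv: "t \<in> carrier (T 0 (Suc q)) ==> et q (dv 0 q t) = dY (int q + 1) (et (Suc q) t)"
begin

text \<open>A row has fixed \<open>p\<close>: it is \<open>T p\<close> with \<open>dv\<close>
  running along it, augmented by \<open>ep p\<close>. The number \<open>n\<close> bounds the
  positions in the row at which exactness is demanded.\<close>

definition rows_exact :: "nat => bool"
 where "rows_exact n \<longleftrightarrow>
  (\<forall>p. \<forall>x\<in>carrier (X (int p)). \<exists>t\<in>carrier (T p 0). ep p t = x) \<and>
  (\<forall>p. \<forall>t\<in>carrier (T p 0). ep p t = \<zero>\<^bsub>X (int p)\<^esub> --> (\<exists>s\<in>carrier (T p 1). dv p 0 s = t)) \<and>
  (\<forall>p q. \<forall>t\<in>carrier (T p (Suc q)). Suc q \<le> n --> dv p q t = \<zero>\<^bsub>T p q\<^esub> -->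
   (\<exists>s\<in>carrier (T p (Suc (Suc q))). dv p (Suc q) s = t))"

text \<open>A staircase down the antidiagonal from \<open>T i 0\<close> to \<open>T 0 i\<close>: it
  starts above \<open>x\<close>, ends above \<open>y\<close>, and consecutive elements have the same
  image in the corner between them. No signs occur since \<open>dh\<close> and \<open>dv\<close>
  commute.\<close>

definition zigzag :: "nat => 'x => 'y => (nat => 't) => bool"
 where "zigzag i x y t \<longleftrightarrow> (\<forall>k\<le>i. t k \<in> carrier (T (i - k) k)) \<and> ep i (t 0) = x \<and> et i (t i) = y \<and>
  (\<forall>k<i. dh (i - Suc k) k (t k) = dv (i - Suc k) k (t (Suc k)))"

text \<open>The differential of \<open>y\<close> is \<open>et\<close> applied to \<open>dv\<close>
  of the last element, which by the staircase equals \<open>dh\<close> of the one before, and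
  \<open>et\<close> kills images of \<open>dh\<close>.\<close>

lemma zigzag_cycle:
 assumes "zigzag i x y t" shows "y \<in> carrier (cycles Y dY (int i))"
proof -
 have ti: "t i \<in> carrier (T 0 i)" and y: "y = et i (t i)" using assms by (auto simp: zigzag_def)
 have "dY (int i) y = \<zero>\<^bsub>Y (int i - 1)\<^esub>"
 proof (cases i)
  case 0
  then show ?thesis using Y0[of y] y ti mod_hom_closed[OF et] by fastforce
 next
  case (Suc j)
  have "t j \<in> carrier (T 1 j)" using assms Suc by (auto simp: zigzag_def dest!: spec[of _ j])
  moreover have "dh 0 j (t j) = dv 0 j (t (Suc j))"
   using assms Suc by (auto simp: zigzag_def)
  ultimately show ?thesis
   using et_dv[of "t (Suc j)" j] et_dh[of "t j" j] ti y Suc by (simp add: add.commute)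
 qed
 then show ?thesis using y ti mod_hom_closed[OF et] by (simp add: cycles_carrier)
qed

text \<open>Each step lifts \<open>dh\<close> of the current element along \<open>dv\<close>. The
  obstruction vanishes because \<open>dv\<close> commutes with \<open>dh\<close> and the previous
  step turns it into a double \<open>dh\<close>. The last lift takes place at position i - 1 of a
  row, whence the bound \<open>Suc n\<close>.\<close>

lemma zigzag_exists:
 assumes ex: "rows_exact n" and i: "i \<le> Suc n" and x: "x \<in> carrier (cycles X dX (int i))"
 shows "\<exists>y t. zigzag i x y t"
proof -
 have "\<exists>t. (\<forall>k\<le>m. t k \<in> carrier (T (i - k) k)) \<and> ep i (t 0) = x \<and>
  (\<forall>k<m. dh (i - Suc k) k (t k) = dv (i - Suc k) k (t (Suc k)))" if "m \<le> i" for m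
  using that
 proof (induction m)
  case 0
  obtain s where "s \<in> carrier (T i 0)" "ep i s = x"
   using ex x unfolding rows_exact_def cycles_carrier by blast
  then show ?case by (intro exI[of _ "%_. s"]) auto
 next
  case (Suc m)
  then obtain t where t: "\<And>k. k \<le> m ==> t k \<in> carrier (T (i - k) k)" "ep i (t 0) = x"
   "\<And>k. k < m ==> dh (i - Suc k) k (t k) = dv (i - Suc k) k (t (Suc k))"
   by auto
  define j where "j = i - Suc m"
  have j: "i - m = Suc j" "i = Suc j + m" using Suc.prems by (auto simp: j_def)
  let ?b = "dh j m (t m)"
  have tm: "t m \<in> carrier (T (Suc j) m)" using t(1)[of m] j by simp
  then have b: "?b \<in> carrier (T j m)" by (rule mod_hom_closed[OF dh])
  have "\<exists>s\<in>carrier (T j (Suc m)). dv j m s = ?b"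
  proof (cases m)
   case 0
   have "ep j ?b = dX (int i) x"
    using ep_dh[of "t m" j] tm t(2) j 0 by (simp add: add.commute)
   also have "\<dots> = \<zero>\<^bsub>X (int j)\<^esub>" using x j 0 by (simp add: cycles_carrier)
   finally show ?thesis using ex b 0 by (auto simp: rows_exact_def)
  next
   case (Suc l)
   have tl: "t l \<in> carrier (T (Suc (Suc j)) l)" using t(1)[of l] j Suc by simp
   have "dv j l ?b = dh j l (dv (Suc j) l (t m))"
    using dh_dv[of "t m" j l] tm Suc by simp
   also have "dv (Suc j) l (t m) = dh (Suc j) l (t l)"
    using t(3)[of l] j Suc by simp
   also have "dh j l \<dots> = \<zero>\<^bsub>T j l\<^esub>" by (rule dh_dh[OF tl])
   finally show ?thesis using ex b Suc \<open>i \<le> Suc n\<close> j by (auto simp: rows_exact_def)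
  qed
  then obtain s where s: "s \<in> carrier (T j (Suc m))" "dv j m s = ?b" by blast
  show ?case
  proof (intro exI[of _ "t(Suc m := s)"] conjI allI impI)
   fix k assume "k \<le> Suc m"
   then show "(t(Suc m := s)) k \<in> carrier (T (i - k) k)"
    using t(1)[of k] s(1) by (auto simp: j_def)
  next
   fix k assume "k < Suc m"
   then show "dh (i - Suc k) k ((t(Suc m := s)) k) = dv (i - Suc k) k ((t(Suc m := s)) (Suc k))"
    using t(3)[of k] s(2) by (auto simp: j_def less_Suc_eq)
  qed (simp add: t(2))
 qed
 from this[of i] show ?thesis by (auto simp: zigzag_def)
qed

text \<open>A preimage of \<open>x\<close> is lifted along \<open>ep\<close> and then pushed down
  the staircase, each time correcting \<open>t m\<close> by \<open>dh\<close> of the element found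
  before. The correction is carried out also at the last position \<open>i\<close>, so exactness is
  needed one place further than for existence.\<close>

lemma zigzag_boundary:
 assumes ex: "rows_exact n" and i: "i \<le> n" and z: "zigzag i x y t" and x: "x \<in> boundaries X dX (int i)"
 shows "y \<in> boundaries Y dY (int i)"
proof -
 have t: "\<And>k. k \<le> i ==> t k \<in> carrier (T (i - k) k)" "ep i (t 0) = x" "et i (t i) = y"
  "\<And>k. k < i ==> dh (i - Suc k) k (t k) = dv (i - Suc k) k (t (Suc k))"
  using z by (auto simp: zigzag_def)
 have step: "\<exists>s'\<in>carrier (T (i - m) (Suc m)). dv (i - m) m s' = t m \<ominus>\<^bsub>T (i - m) m\<^esub> dh (i - m) m s"
  if m: "m \<le> i" and s: "s \<in> carrier (T (Suc (i - m)) m)"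
   and 0: "m = 0 ==> ep i (dh i 0 s) = ep i (t 0)"
   and Suc: "\<And>k. m = Suc k ==> dv (i - m) k (dh (i - m) m s) = dv (i - m) k (t m)" for m s
 proof -
  interpret Tm: Module.module R "T (i - m) m" by (rule T)
  have ds: "dh (i - m) m s \<in> carrier (T (i - m) m)" by (rule mod_hom_closed[OF dh s])
  have u: "t m \<ominus>\<^bsub>T (i - m) m\<^esub> dh (i - m) m s \<in> carrier (T (i - m) m)"
   using t(1)[OF m] ds by simp
  show ?thesis
  proof (cases m)
   case m0: 0
   interpret X: Module.module R "X (int i)" by (rule chain_complex_module[OF X])
   have "ep i (t m \<ominus>\<^bsub>T (i - m) m\<^esub> dh (i - m) m s) = ep i (t 0) \<ominus>\<^bsub>X (int i)\<^esub> ep i (dh i 0 s)"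
    using mod_hom_minus[OF ep T chain_complex_module[OF X]] t(1)[OF m] ds m0 by simp
   also have "\<dots> = \<zero>\<^bsub>X (int i)\<^esub>"
    using 0[OF m0] t(1)[of 0] mod_hom_closed[OF ep] by (simp add: a_minus_def X.M.r_neg)
   finally show ?thesis using ex u m0 by (auto simp: rows_exact_def)
  next
   case mS: (Suc k)
   interpret T': Module.module R "T (i - m) k" by (rule T)
   have c: "dv (i - m) k (t m) \<in> carrier (T (i - m) k)"
    using mod_hom_closed[OF dv] t(1)[OF m] unfolding mS by blast
   have "dv (i - m) k (t m \<ominus>\<^bsub>T (i - m) m\<^esub> dh (i - m) m s) =
     dv (i - m) k (t m) \<ominus>\<^bsub>T (i - m) k\<^esub> dv (i - m) k (dh (i - m) m s)"
    using mod_hom_minus[OF dv T T] t(1)[OF m] ds unfolding mS by blast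
   also have "\<dots> = \<zero>\<^bsub>T (i - m) k\<^esub>"
    using Suc[OF mS] c by (simp add: a_minus_def T'.M.r_neg)
   finally show ?thesis using ex u i m unfolding mS rows_exact_def by auto
  qed
 qed
 \<comment> \<open>The invariant says that \<open>t m\<close> minus \<open>dh\<close> of
   \<open>s\<close> is killed by the outgoing map of the row, which is \<open>ep\<close> at the
   start and \<open>dv\<close> afterwards; so \<open>step\<close> applies to it.\<close>
 have "\<exists>s\<in>carrier (T (Suc (i - m)) m). (m = 0 --> ep i (dh i 0 s) = ep i (t 0)) \<and>
  (\<forall>k. m = Suc k --> dv (i - m) k (dh (i - m) m s) = dv (i - m) k (t m))" if "m \<le> i" for m
  using that
 proof (induction m)
  case 0
  obtain w where "w \<in> carrier (X (int i + 1))" "x = dX (int i + 1) w"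
   using x by (auto simp: boundaries_def)
  moreover then obtain s where "s \<in> carrier (T (Suc i) 0)" "ep (Suc i) s = w"
   using ex unfolding rows_exact_def by (metis of_nat_Suc add.commute)
  ultimately show ?case using ep_dh[of s i] t(2) by auto
 next
  case (Suc m)
  then obtain s where s: "s \<in> carrier (T (Suc (i - m)) m)" "m = 0 ==> ep i (dh i 0 s) = ep i (t 0)"
   "\<And>k. m = Suc k ==> dv (i - m) k (dh (i - m) m s) = dv (i - m) k (t m)"
   by auto
  define j where "j = i - Suc m"
  have j: "i - m = Suc j" using Suc.prems by (simp add: j_def)
  obtain s' where s': "s' \<in> carrier (T (Suc j) (Suc m))"
   "dv (Suc j) m s' = t m \<ominus>\<^bsub>T (Suc j) m\<^esub> dh (Suc j) m s"
   using step[of m s] s Suc.prems unfolding j by auto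
  interpret T': Module.module R "T j m" by (rule T)
  have tm: "t m \<in> carrier (T (Suc j) m)" using t(1)[of m] Suc.prems j by simp
  have ds: "dh (Suc j) m s \<in> carrier (T (Suc j) m)" using mod_hom_closed[OF dh] s(1) j by simp
  have "dv j m (dh j (Suc m) s') = dh j m (dv (Suc j) m s')"
   by (rule dh_dv[OF s'(1), symmetric])
  also have "\<dots> = dh j m (t m) \<ominus>\<^bsub>T j m\<^esub> dh j m (dh (Suc j) m s)"
   unfolding s'(2) by (rule mod_hom_minus[OF dh T T tm ds])
  also have "\<dots> = dh j m (t m)"
   using dh_dh[of s j m] s(1) j mod_hom_closed[OF dh tm] by (simp add: a_minus_def)
  also have "\<dots> = dv j m (t (Suc m))" using t(4)[of m] Suc.prems by (simp add: j_def)
  finally show ?case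
   using s'(1) by (intro bexI[of _ s']) (auto simp: j_def[symmetric])
 qed
 from this[of i] obtain s where s: "s \<in> carrier (T 1 i)" "i = 0 ==> ep i (dh i 0 s) = ep i (t 0)"
   "\<And>k. i = Suc k ==> dv 0 k (dh 0 i s) = dv 0 k (t i)"
  by auto
 obtain s' where s': "s' \<in> carrier (T 0 (Suc i))" "dv 0 i s' = t i \<ominus>\<^bsub>T 0 i\<^esub> dh 0 i s"
  using step[of i s] s by auto
 interpret Y: Module.module R "Y (int i)" by (rule chain_complex_module[OF Y])
 have ti: "t i \<in> carrier (T 0 i)" using t(1)[of i] by simp
 have ds: "dh 0 i s \<in> carrier (T 0 i)" using mod_hom_closed[OF dh] s(1) by simp
 have "dY (int i + 1) (et (Suc i) s') = et i (dv 0 i s')" by (rule et_dv[OF s'(1), symmetric])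
 also have "\<dots> = et i (t i) \<ominus>\<^bsub>Y (int i)\<^esub> et i (dh 0 i s)"
  unfolding s'(2) by (rule mod_hom_minus[OF et T chain_complex_module[OF Y] ti ds])
 also have "\<dots> = y"
  using et_dh[OF s(1)] mod_hom_closed[OF et ti] t(3) by (simp add: a_minus_def)
 finally have "y = dY (int i + 1) (et (Suc i) s')" by simp
 moreover have "et (Suc i) s' \<in> carrier (Y (int i + 1))"
  using mod_hom_closed[OF et s'(1)] by (simp add: add.commute)
 ultimately show ?thesis by (simp add: boundaries_def)
qed

text \<open>The axioms are symmetric in the two directions, so the converse half of every statement
  about staircases comes from the transposed complex.\<close>

lemma double_complex_transpose:
 "double_complex R (%p q. T q p) (%p q. dv q p) (%p q. dh q p) Y dY et X dX ep"
 by (rule double_complex.intro)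
  (auto simp: T dh dv X Y X0 Y0 ep et dh_dh dv_dv dh_dv ep_dv[simplified] et_dh[simplified] ep_dh et_dv)

lemma zigzag_transpose:
 assumes "zigzag i x y t"
 shows "double_complex.zigzag (%p q. T q p) (%p q. dv q p) (%p q. dh q p) et ep i y x (%k. t (i - k))"
proof -
 interpret t: double_complex R "%p q. T q p" "%p q. dv q p" "%p q. dh q p" Y dY et X dX ep
  by (rule double_complex_transpose)
 have z: "\<And>k. k \<le> i ==> t k \<in> carrier (T (i - k) k)" "ep i (t 0) = x" "et i (t i) = y"
  "\<And>k. k < i ==> dh (i - Suc k) k (t k) = dv (i - Suc k) k (t (Suc k))"
  using assms by (auto simp: zigzag_def)
 show ?thesis
  unfolding t.zigzag_def
 proof (intro conjI allI impI)
  fix k assume "k \<le> i"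
  then show "t (i - k) \<in> carrier (T k (i - k))" using z(1)[of "i - k"] by simp
 next
  fix k assume k: "k < i"
  then have "i - Suc (i - Suc k) = k" "Suc (i - Suc k) = i - k" by auto
  then show "dv k (i - Suc k) (t (i - k)) = dh k (i - Suc k) (t (i - Suc k))"
   using z(4)[of "i - Suc k"] k by simp
 qed (use z in auto)
qed

text \<open>The relation of being joined by a staircase satisfies
  \<open>homology_isomorphicI\<close>: exact rows give totality and one half of the boundary
  condition, exact columns the rest. Staircases add and scale entry by entry.\<close>

theorem homology_isomorphic:
 assumes rows: "rows_exact n"
  and cols: "double_complex.rows_exact (%p q. T q p) (%p q. dh q p) Y et n" and i: "i \<le> n"
 shows "mod_isomorphic R (homology X dX (int i)) (homology Y dY (int i))"
proof -
 interpret t: double_complex R "%p q. T q p" "%p q. dv q p" "%p q. dh q p" Y dY et X dX ep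
  by (rule double_complex_transpose)
 define rel where "rel x y \<longleftrightarrow> (\<exists>t. zigzag i x y t)" for x y
 have rev_zigzag: "zigzag i x y (%k. t (i - k))" if "t.zigzag i y x t" for x y t
  using t.zigzag_transpose[OF that] by simp
 show ?thesis
 proof (rule homology_isomorphicI[OF X Y, where rh = rel])
  show "x \<in> carrier (cycles X dX (int i)) \<and> y \<in> carrier (cycles Y dY (int i))" if "rel x y" for x y
   using that unfolding rel_def using zigzag_cycle t.zigzag_cycle zigzag_transpose by metis
  show "\<exists>y. rel x y" if "x \<in> carrier (cycles X dX (int i))" for x
   using zigzag_exists[OF rows _ that] i by (auto simp: rel_def)
  show "\<exists>x. rel x y" if "y \<in> carrier (cycles Y dY (int i))" for y
   using t.zigzag_exists[OF cols _ that] i rev_zigzag unfolding rel_def by (meson le_SucI)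
  show "x \<in> boundaries X dX (int i) \<longleftrightarrow> y \<in> boundaries Y dY (int i)" if "rel x y" for x y
   using that unfolding rel_def using zigzag_boundary[OF rows i] t.zigzag_boundary[OF cols i] zigzag_transpose by meson
  show "rel (x \<oplus>\<^bsub>X (int i)\<^esub> x') (y \<oplus>\<^bsub>Y (int i)\<^esub> y')" if "rel x y" "rel x' y'" for x y x' y'
  proof -
   obtain t where "zigzag i x y t" using \<open>rel x y\<close> unfolding rel_def by blast
   then have t: "\<And>k. k \<le> i ==> t k \<in> carrier (T (i - k) k)" "ep i (t 0) = x" "et i (t i) = y"
    "\<And>k. k < i ==> dh (i - Suc k) k (t k) = dv (i - Suc k) k (t (Suc k))"
    by (auto simp: zigzag_def)
   obtain t' where "zigzag i x' y' t'" using \<open>rel x' y'\<close> unfolding rel_def by blast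
   then have t': "\<And>k. k \<le> i ==> t' k \<in> carrier (T (i - k) k)" "ep i (t' 0) = x'" "et i (t' i) = y'"
    "\<And>k. k < i ==> dh (i - Suc k) k (t' k) = dv (i - Suc k) k (t' (Suc k))"
    by (auto simp: zigzag_def)
   have tS: "t k \<in> carrier (T (Suc (i - Suc k)) k)" "t' k \<in> carrier (T (Suc (i - Suc k)) k)" if "k < i" for k
    using t(1)[of k] t'(1)[of k] that by (simp_all add: Suc_diff_Suc)
   have "zigzag i (x \<oplus>\<^bsub>X (int i)\<^esub> x') (y \<oplus>\<^bsub>Y (int i)\<^esub> y') (%k. t k \<oplus>\<^bsub>T (i - k) k\<^esub> t' k)"
    unfolding zigzag_def
   proof (intro conjI allI impI)
    fix k assume k: "k < i"
    show "dh (i - Suc k) k (t k \<oplus>\<^bsub>T (i - k) k\<^esub> t' k) =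
      dv (i - Suc k) k (t (Suc k) \<oplus>\<^bsub>T (i - Suc k) (Suc k)\<^esub> t' (Suc k))"
     using mod_hom_add[OF dh tS[OF k]] mod_hom_add[OF dv t(1)[of "Suc k"] t'(1)[of "Suc k"]]
      t(4)[OF k] t'(4)[OF k] k by (simp add: Suc_diff_Suc)
   qed (use t t' mod_hom_add[OF ep t(1)[of 0, simplified] t'(1)[of 0, simplified]]
     mod_hom_add[OF et t(1)[of i, simplified] t'(1)[of i, simplified]]
     abelian_monoid.a_closed[OF abelian_group.axioms(1)[OF Module.module.axioms(2)[OF T]]] in auto)
   then show ?thesis unfolding rel_def by blast
  qed
  show "rel (r \<odot>\<^bsub>X (int i)\<^esub> x) (r \<odot>\<^bsub>Y (int i)\<^esub> y)" if r: "r \<in> carrier R" and "rel x y" for r x y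
  proof -
   obtain t where "zigzag i x y t" using \<open>rel x y\<close> unfolding rel_def by blast
   then have t: "\<And>k. k \<le> i ==> t k \<in> carrier (T (i - k) k)" "ep i (t 0) = x" "et i (t i) = y"
    "\<And>k. k < i ==> dh (i - Suc k) k (t k) = dv (i - Suc k) k (t (Suc k))"
    by (auto simp: zigzag_def)
   have tS: "t k \<in> carrier (T (Suc (i - Suc k)) k)" if "k < i" for k
    using t(1)[of k] that by (simp add: Suc_diff_Suc)
   have "zigzag i (r \<odot>\<^bsub>X (int i)\<^esub> x) (r \<odot>\<^bsub>Y (int i)\<^esub> y) (%k. r \<odot>\<^bsub>T (i - k) k\<^esub> t k)"
    unfolding zigzag_def
   proof (intro conjI allI impI)
    fix k assume k: "k < i"
    show "dh (i - Suc k) k (r \<odot>\<^bsub>T (i - k) k\<^esub> t k) = dv (i - Suc k) k (r \<odot>\<^bsub>T (i - Suc k) (Suc k)\<^esub> t (Suc k))"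
     using mod_hom_smult[OF dh r tS[OF k]] mod_hom_smult[OF dv r t(1)[of "Suc k"]]
      t(4)[OF k] k by (simp add: Suc_diff_Suc)
   qed (use r t mod_hom_smult[OF ep r t(1)[of 0, simplified]] mod_hom_smult[OF et r t(1)[of i, simplified]]
     Module.module.smult_closed[OF T] in auto)
   then show ?thesis unfolding rel_def by blast
  qed
 qed
qed

end

section \<open>Multipaths\<close>

lemma cas_nth:
 assumes "pre_digraph.cas G u p v" "i < length p"
 shows "tail G (p ! i) = pre_digraph.awalk_verts G u p ! i \<and> head G (p ! i) = pre_digraph.awalk_verts G u p ! Suc i"
 using assms
proof (induction p arbitrary: u i)
 case (Cons e p)
 have verts_0: "pre_digraph.awalk_verts G w q ! 0 = w" if "pre_digraph.cas G w q v" for w q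
  using that by (cases q) (auto simp: pre_digraph.awalk_verts.simps pre_digraph.cas.simps)
 show ?case
 proof (cases i)
  case 0
  then show ?thesis using Cons.prems verts_0[of "head G e" p]
   by (simp add: pre_digraph.awalk_verts.simps pre_digraph.cas.simps)
 next
  case (Suc j)
  then show ?thesis using Cons.IH[of "head G e" j] Cons.prems
   by (simp add: pre_digraph.awalk_verts.simps pre_digraph.cas.simps)
 qed
qed simp

lemma cas_of_nth:
 assumes "length vs = Suc (length p)" "\<And>i. i < length p ==> tail G (p ! i) = vs ! i \<and> head G (p ! i) = vs ! Suc i"
 shows "pre_digraph.cas G (hd vs) p (last vs) \<and> pre_digraph.awalk_verts G (hd vs) p = vs"
 using assms
proof (induction p arbitrary: vs)
 case Nil
 then show ?case by (cases vs) (auto simp: pre_digraph.awalk_verts.simps pre_digraph.cas.simps)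
next
 case (Cons e p)
 then obtain v w ws where vs: "vs = v # w # ws"
  by (metis length_Cons Suc_length_conv)
 have "pre_digraph.cas G (hd (w # ws)) p (last (w # ws)) \<and> pre_digraph.awalk_verts G (hd (w # ws)) p = w # ws"
 proof (rule Cons.IH)
  show "tail G (p ! i) = (w # ws) ! i \<and> head G (p ! i) = (w # ws) ! Suc i" if "i < length p" for i
   using Cons.prems(2)[of "Suc i"] that by (simp add: vs)
 qed (use Cons.prems vs in simp)
 then show ?case
  using Cons.prems(2)[of 0] by (simp add: vs pre_digraph.awalk_verts.simps pre_digraph.cas.simps)
qed

text \<open>Unfolds \<open>apath\<close> into an explicit list of distinct vertices; distinctness
  includes the two ends, so closed walks are excluded.\<close>

lemma simple_path_iff:
 assumes "fin_digraph G"
 shows "simple_path G p \<longleftrightarrow> p \<noteq> [] \<and> set p \<subseteq> arcs G \<and> (\<exists>vs. length vs = Suc (length p) \<and> distinct vs \<and>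
  (\<forall>i<length p. tail G (p ! i) = vs ! i \<and> head G (p ! i) = vs ! Suc i))" (is "_ \<longleftrightarrow> ?r")
proof -
 interpret fin_digraph G by fact
 show ?thesis
 proof
  assume "simple_path G p"
  then obtain u v where "p \<noteq> []" "apath u p v" by (auto simp: simple_path_def)
  then show ?r
   using cas_nth[of G u p v] length_awalk_verts[of u p]
   by (auto simp: apath_def awalk_def intro!: exI[of _ "awalk_verts u p"])
 next
  assume ?r
  then obtain vs where vs: "length vs = Suc (length p)" "distinct vs" "p \<noteq> []" "set p \<subseteq> arcs G"
   "\<And>i. i < length p ==> tail G (p ! i) = vs ! i \<and> head G (p ! i) = vs ! Suc i" by blast
  have "hd vs = tail G (p ! 0)" using vs(5)[of 0] vs(1,3) by (cases vs) auto
  then have "hd vs \<in> verts G" using vs(3,4) by (simp add: subset_iff)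
  then have "apath (hd vs) p (last vs)"
   using cas_of_nth[OF vs(1,5)] vs by (simp add: apath_def awalk_def)
  then show "simple_path G p" using vs(3) by (auto simp: simple_path_def)
 qed
qed

lemma path_verts_nth:
 assumes "length vs = Suc (length p)" "p \<noteq> []"
  "\<And>i. i < length p ==> tail G (p ! i) = vs ! i \<and> head G (p ! i) = vs ! Suc i"
 shows "path_verts G p = set vs"
proof
 show "path_verts G p \<subseteq> set vs"
 proof
  fix v assume "v \<in> path_verts G p"
  then obtain i where "i < length p" "v = vs ! i \<or> v = vs ! Suc i"
   using assms(3) by (auto simp: path_verts_def in_set_conv_nth)
  then show "v \<in> set vs" using assms(1) by (metis Suc_less_eq less_SucI nth_mem)
 qed
 show "set vs \<subseteq> path_verts G p"
 proof
  fix v assume "v \<in> set vs"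
  then obtain i where i: "i < length vs" "v = vs ! i" by (auto simp: in_set_conv_nth)
  show "v \<in> path_verts G p"
  proof (cases "i < length p")
   case True
   then show ?thesis using assms(3)[OF True] i nth_mem[OF True] by (metis UnI1 image_eqI path_verts_def)
  next
   case False
   then have "i = Suc (length p - 1)" "length p - 1 < length p" using i assms(1,2) by auto
   then show ?thesis using assms(3)[of "length p - 1"] i by (metis UnI2 image_eqI nth_mem path_verts_def)
  qed
 qed
qed

text \<open>A multipath is a set of edges with distinct tails for which the vertices can be labelled
  injectively by a path \<open>l v\<close> and a position \<open>pos v\<close> on it, such that each edge moves one position
  forward on its path.\<close>

definition multipath :: "('v, 'e) pre_digraph => 'e set => bool"
 where "multipath G y \<longleftrightarrow> y \<subseteq> arcs G \<and> inj_on (tail G) y \<and> (\<exists>(l :: 'v => 'v) (pos :: 'v => nat).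
  (\<forall>v\<in>verts G. \<forall>w\<in>verts G. l v = l w --> pos v = pos w --> v = w) \<and>
  (\<forall>e\<in>y. l (head G e) = l (tail G e) \<and> pos (head G e) = Suc (pos (tail G e))))"

lemma multipath_labels:
 fixes G :: "('v, 'e) pre_digraph"
 assumes "multipath G y"
 shows "\<exists>(l :: 'v => 'v) (pos :: 'v => nat).
  (\<forall>v\<in>verts G. \<forall>w\<in>verts G. l v = l w --> pos v = pos w --> v = w) \<and>
  (\<forall>e\<in>y. l (head G e) = l (tail G e) \<and> pos (head G e) = Suc (pos (tail G e)))"
 using assms by (simp add: multipath_def)

lemma multipath_subset: "[|multipath G y; x \<subseteq> y|] ==> multipath G x"
 unfolding multipath_def by (blast intro: inj_on_subset)

text \<open>A vertex on a path is labelled by the first vertex of that path and its index on it; a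
  vertex on no path is labelled by itself at position 0.\<close>

lemma path_poset_imp_multipath:
 fixes G :: "('v, 'e) pre_digraph"
 assumes G: "fin_digraph G" and y: "y \<in> path_poset G"
 shows "multipath G y"
proof -
 interpret fin_digraph G by fact
 obtain Q where Q': "\<forall>p\<in>Q. simple_path G p"
  "\<forall>p\<in>Q. \<forall>q\<in>Q. p \<noteq> q --> path_verts G p \<inter> path_verts G q = {}" "y = (\<Union>p\<in>Q. set p)"
  using y unfolding path_poset_def mem_Collect_eq by metis
 then have Q: "\<And>p. p \<in> Q ==> simple_path G p"
  "\<And>p q. [|p \<in> Q; q \<in> Q; path_verts G p \<inter> path_verts G q \<noteq> {}|] ==> p = q"
  "y = (\<Union>p\<in>Q. set p)"
  by blast+
 have "\<exists>vs. length vs = Suc (length p) \<and> distinct vs \<and>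
  (\<forall>i<length p. tail G (p ! i) = vs ! i \<and> head G (p ! i) = vs ! Suc i)" if "p \<in> Q" for p
  using Q(1)[OF that] simple_path_iff[OF G] by blast
 then obtain V where V: "\<And>p. p \<in> Q ==> length (V p) = Suc (length p)" "\<And>p. p \<in> Q ==> distinct (V p)"
  "\<And>p i. [|p \<in> Q; i < length p|] ==> tail G (p ! i) = V p ! i \<and> head G (p ! i) = V p ! Suc i"
  by metis
 have ne: "p \<noteq> []" "set p \<subseteq> arcs G" if "p \<in> Q" for p
  using Q(1)[OF that] simple_path_iff[OF G] by blast+
 have pv: "path_verts G p = set (V p)" if "p \<in> Q" for p
  using path_verts_nth[OF V(1)[OF that] ne(1)[OF that], of G] V(3)[OF that] by blast
 \<comment> \<open>Paths with a common vertex coincide by disjointness, and vertices along one path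
   are distinct, so a vertex determines its path and its index.\<close>
 have same: "p = q \<and> i = j" if "p \<in> Q" "q \<in> Q" "i \<le> length p" "j \<le> length q" "V p ! i = V q ! j" for p q i j
 proof -
  have "V p ! i \<in> set (V p)" "V q ! j \<in> set (V q)"
   using that(3,4) V(1)[OF that(1)] V(1)[OF that(2)] by (simp_all add: nth_mem)
  then have "p = q" using Q(2)[OF that(1,2)] pv that by auto
  then show ?thesis using that V(1,2) by (metis le_imp_less_Suc nth_eq_iff_index_eq)
 qed
 define on where "on v = (%(p, i). p \<in> Q \<and> i \<le> length p \<and> v = V p ! i)" for v
 have on: "(THE pi. on v pi) = (p, i)" if "p \<in> Q" "i \<le> length p" "v = V p ! i" for v p i
  by (rule the_equality) (use that same in "auto simp: on_def")
 \<comment> \<open>The description is well defined by \<open>on\<close>; vertices off the paths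
   receive the default values.\<close>
 define l where "l v = (if \<exists>pi. on v pi then V (fst (THE pi. on v pi)) ! 0 else v)" for v
 define pos where "pos v = (if \<exists>pi. on v pi then snd (THE pi. on v pi) else 0)" for v
 have lpos: "l (V p ! i) = V p ! 0" "pos (V p ! i) = i" if "p \<in> Q" "i \<le> length p" for p i
 proof -
  have "\<exists>pi. on (V p ! i) pi" using that by (auto simp: on_def)
  then show "l (V p ! i) = V p ! 0" "pos (V p ! i) = i"
   using on[OF that refl] by (simp_all add: l_def pos_def)
 qed
 have edge: "\<exists>p\<in>Q. \<exists>i<length p. e = p ! i \<and> tail G e = V p ! i \<and> head G e = V p ! Suc i" if "e \<in> y" for e
  using that V(3) unfolding Q(3) by (auto simp: in_set_conv_nth)
 \<comment> \<open>In the mixed cases the vertex off the paths would have to be the first vertex of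
   a path, which lies on it.\<close>
 have "v = w" if lp: "l v = l w" "pos v = pos w" for v w
 proof (cases "\<exists>pi. on v pi")
  case True
  then obtain p i where p: "p \<in> Q" "i \<le> length p" "v = V p ! i" by (auto simp: on_def)
  show ?thesis
  proof (cases "\<exists>pi. on w pi")
   case True
   then obtain q j where q: "q \<in> Q" "j \<le> length q" "w = V q ! j" by (auto simp: on_def)
   then show ?thesis using lp lpos p same[of p q 0 0] by auto
  next
   case False
   then have "w = V p ! 0" using lp p lpos by (simp add: l_def[of w])
   then show ?thesis using False p(1) by (auto simp: on_def)
  qed
 next
  case v: False
  show ?thesis
  proof (cases "\<exists>pi. on w pi")
   case True
   then obtain q j where q: "q \<in> Q" "j \<le> length q" "w = V q ! j" by (auto simp: on_def)
   then have "v = V q ! 0" using lp v lpos by (simp add: l_def[of v])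
   then show ?thesis using v q(1) by (auto simp: on_def)
  next
   case False
   then show ?thesis using lp v by (simp add: l_def)
  qed
 qed
 moreover have "inj_on (tail G) y"
 proof (rule inj_onI)
  fix e f assume ef: "e \<in> y" "f \<in> y" "tail G e = tail G f"
  obtain p i where "p \<in> Q" "i < length p" "e = p ! i" "tail G e = V p ! i" using edge[OF ef(1)] by blast
  moreover obtain q j where "q \<in> Q" "j < length q" "f = q ! j" "tail G f = V q ! j" using edge[OF ef(2)] by blast
  ultimately show "e = f" using same[of p q i j] ef(3) by auto
 qed
 moreover have "l (head G e) = l (tail G e) \<and> pos (head G e) = Suc (pos (tail G e))" if e: "e \<in> y" for e
  using edge[OF e] lpos by (metis Suc_leI less_imp_le)
 moreover have "y \<subseteq> arcs G" using ne(2) Q(3) by blast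
 ultimately show ?thesis
  unfolding multipath_def by (intro conjI exI[of _ l] exI[of _ pos] ballI impI) simp_all
qed

text \<open>Remove an edge whose tail has maximal position. Its head then meets no other edge, so
  the edge either prolongs the path that contains its tail or forms a new path.\<close>

lemma multipath_imp_path_poset:
 fixes G :: "('v, 'e) pre_digraph"
 assumes G: "fin_digraph G" and y: "multipath G y"
 shows "y \<in> path_poset G"
 using y
proof (induction "card y" arbitrary: y)
 interpret fin_digraph G by fact
 case 0
 then have "y = {}" using finite_subset[of y "arcs G"] by (auto simp: multipath_def)
 then show ?case unfolding path_poset_def by (intro CollectI exI[of _ "{}"]) auto
next
 interpret fin_digraph G by fact
 case (Suc n)
 obtain l :: "'v => 'v" and pos :: "'v => nat" where lp':
  "\<forall>v\<in>verts G. \<forall>w\<in>verts G. l v = l w --> pos v = pos w --> v = w"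
  "\<forall>e\<in>y. l (head G e) = l (tail G e) \<and> pos (head G e) = Suc (pos (tail G e))"
  using multipath_labels[OF Suc.prems] by (elim exE conjE) (rule that)
 have lp: "y \<subseteq> arcs G" "inj_on (tail G) y"
  "\<And>v w. [|v \<in> verts G; w \<in> verts G; l v = l w; pos v = pos w|] ==> v = w"
  "\<And>e. e \<in> y ==> l (head G e) = l (tail G e) \<and> pos (head G e) = Suc (pos (tail G e))"
  using Suc.prems lp' by (auto simp: multipath_def)
 have fin: "finite y" "y \<noteq> {}" using lp(1) finite_subset[of y "arcs G"] Suc.hyps(2) by auto
 \<comment> \<open>Maximality makes the head of \<open>e\<close> the tail of no edge of
   \<open>y\<close>: the position there exceeds that of every tail.\<close>
 then have "\<exists>e\<in>y. \<forall>f\<in>y. pos (tail G f) \<le> pos (tail G e)"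
  using Max_in[of "(%e. pos (tail G e)) ` y"] Max_ge[of "(%e. pos (tail G e)) ` y"] by fastforce
 then obtain e where e: "e \<in> y" "\<And>f. f \<in> y ==> pos (tail G f) \<le> pos (tail G e)" by blast
 have "y - {e} \<in> path_poset G"
  using Suc e(1) fin multipath_subset[OF Suc.prems, of "y - {e}"] by (intro Suc.hyps(1)) auto
 then obtain Q where Q': "\<forall>p\<in>Q. simple_path G p"
  "\<forall>p\<in>Q. \<forall>q\<in>Q. p \<noteq> q --> path_verts G p \<inter> path_verts G q = {}" "y - {e} = (\<Union>p\<in>Q. set p)"
  unfolding path_poset_def mem_Collect_eq by metis
 then have Q: "\<And>p. p \<in> Q ==> simple_path G p"
  "\<And>p q. [|p \<in> Q; q \<in> Q; p \<noteq> q|] ==> path_verts G p \<inter> path_verts G q = {}"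
  "y - {e} = (\<Union>p\<in>Q. set p)"
  by blast+
 have Qy: "f \<in> y \<and> f \<noteq> e \<and> f \<in> arcs G" if "p \<in> Q" "f \<in> set p" for p f using that Q(3) lp(1) by blast
 have disj: False if "p \<in> Q" "q \<in> Q" "p \<noteq> q" "v \<in> path_verts G p" "v \<in> path_verts G q" for p q v
  using Q(2)[OF that(1-3)] that(4,5) by blast
 have no_tail: "tail G f \<noteq> head G e" if "f \<in> y" for f
  using e lp(4)[OF e(1)] that by (metis Suc_n_not_le_n)
 have no_head: "head G f \<noteq> head G e" if "f \<in> y" "f \<noteq> e" for f
 proof
  assume "head G f = head G e"
  then have "l (tail G f) = l (tail G e)" "pos (tail G f) = pos (tail G e)"
   using lp(4)[OF e(1)] lp(4)[OF that(1)] by auto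
  then have "tail G f = tail G e" using lp(1,3) that(1) e(1) by (meson subset_iff wellformed(1))
  then show False using lp(2) that e(1) by (meson inj_onD)
 qed
 have he: "head G e \<notin> path_verts G p" if "p \<in> Q" for p
  using no_tail no_head Qy[OF that] unfolding path_verts_def by (metis UnE imageE)
 show ?case
 proof (cases "\<exists>p\<in>Q. tail G e \<in> path_verts G p")
  case True
  then obtain p where p: "p \<in> Q" "tail G e \<in> path_verts G p" by blast
  obtain vs where vs: "length vs = Suc (length p)" "distinct vs" "p \<noteq> []"
   "\<And>i. i < length p ==> tail G (p ! i) = vs ! i \<and> head G (p ! i) = vs ! Suc i"
   using Q(1)[OF p(1)] simple_path_iff[OF G] by blast
  have pv: "path_verts G p = set vs" by (rule path_verts_nth[OF vs(1,3,4)])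
  obtain i where i: "i < length vs" "tail G e = vs ! i" using p(2) pv by (metis in_set_conv_nth)
  \<comment> \<open>The tail of \<open>e\<close> can only be the end of \<open>p\<close>: at any
    earlier vertex an edge of \<open>p\<close> leaves, and it would share its tail with
    \<open>e\<close>.\<close>
  have "\<not> i < length p"
  proof
   assume "i < length p"
   then have "tail G (p ! i) = tail G e" "p ! i \<in> set p" using vs(4) i by auto
   then show False using Qy[OF p(1)] lp(2) e(1) by (meson inj_onD)
  qed
  then have i': "i = length p" using i vs(1) by simp
  have "simple_path G (p @ [e])"
   unfolding simple_path_iff[OF G]
  proof (intro conjI exI[of _ "vs @ [head G e]"] allI impI)
   show "set (p @ [e]) \<subseteq> arcs G" using Qy[OF p(1)] e(1) lp(1) by auto
   show "distinct (vs @ [head G e])" using vs(2) he[OF p(1)] pv by simp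
   fix j assume "j < length (p @ [e])"
   then show "tail G ((p @ [e]) ! j) = (vs @ [head G e]) ! j"
    "head G ((p @ [e]) ! j) = (vs @ [head G e]) ! Suc j"
    using vs(1) vs(4)[of j] i i' by (auto simp: nth_append less_Suc_eq)
  qed (use vs in auto)
  moreover have "path_verts G (p @ [e]) = insert (head G e) (path_verts G p)"
   using p(2) by (auto simp: path_verts_def)
  ultimately show ?thesis
   unfolding path_poset_def
  proof (intro CollectI exI[of _ "insert (p @ [e]) (Q - {p})"] conjI ballI impI)
   show "y = \<Union> (set ` insert (p @ [e]) (Q - {p}))"
    using Q(3) p(1) e(1) by auto
  qed (use Q(1) he p in "auto dest: disj")
 next
  case False
  have "simple_path G [e]"
   unfolding simple_path_iff[OF G]
   by (intro conjI exI[of _ "[tail G e, head G e]"]) (use e lp no_tail in auto)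
  moreover have "path_verts G [e] = {tail G e, head G e}" by (auto simp: path_verts_def)
  ultimately show ?thesis
   unfolding path_poset_def
  proof (intro CollectI exI[of _ "insert [e] Q"] conjI ballI impI)
   show "y = \<Union> (set ` insert [e] Q)"
    using Q(3) e(1) by auto
  qed (use Q(1) he False in "auto dest: disj")
 qed
qed

lemma path_poset_iff: "fin_digraph G ==> y \<in> path_poset G \<longleftrightarrow> multipath G y"
 using path_poset_imp_multipath multipath_imp_path_poset by blast

text \<open>Immediate from labels, which restrict to fewer edges; in terms of paths, deleting an
  edge would mean splitting one.\<close>

lemma path_poset_subset: "[|fin_digraph G; y \<in> path_poset G; x \<subseteq> y|] ==> x \<in> path_poset G"
 by (simp add: path_poset_iff multipath_subset)

lemma path_poset_arcs: "[|fin_digraph G; y \<in> path_poset G|] ==> y \<subseteq> arcs G"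
 by (simp add: path_poset_iff multipath_def)

lemma finite_path_poset: 
 assumes "fin_digraph G" shows "finite (path_poset G)"
proof -
 interpret fin_digraph G by fact
 show ?thesis
  by (rule finite_subset[of _ "Pow (arcs G)"]) (use path_poset_arcs[OF assms] in auto)
qed

section \<open>Connected components\<close>

text \<open>The unions of components, in a form that is checked edge by edge. Exhibiting such a set
  is the standard way below to bound a component from above or to separate two vertices.\<close>

definition edge_closed :: "('v, 'e) pre_digraph => 'e set => 'v set => bool"
 where "edge_closed G x U \<longleftrightarrow> (\<forall>e\<in>x. tail G e \<in> U \<longleftrightarrow> head G e \<in> U)"

lemma component_rel_eq:
 "component_rel G x = {(u, v). (u, v) \<in> rtrancl_on (verts G)
  (\<Union>e\<in>x. {(tail G e, head G e), (head G e, tail G e)})}"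
 by (simp add: component_rel_def reachable_def mk_symmetric_def)

lemma component_rel_closed:
 assumes "(u, v) \<in> component_rel G x" "u \<in> U" "edge_closed G x U"
 shows "v \<in> U"
 using assms(1,2) unfolding component_rel_eq mem_Collect_eq prod.case
 by (induction rule: rtrancl_on_induct) (use assms(3) in "auto simp: edge_closed_def")

lemma component_rel_edge:
 assumes "fin_digraph G" "x \<subseteq> arcs G" "e \<in> x"
 shows "(tail G e, head G e) \<in> component_rel G x"
proof -
 interpret fin_digraph G by fact
 show ?thesis
  unfolding component_rel_eq using assms(2,3)
  by (auto intro!: rtrancl_on_into_rtrancl_on[OF rtrancl_on_refl])
qed

lemma equiv_component_rel: "equiv (verts G) (component_rel G x)"
proof (rule equivI)
 show "component_rel G x \<subseteq> verts G \<times> verts G"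
  unfolding component_rel_eq by (auto dest: in_rtrancl_on_in_F)
 show "refl_on (verts G) (component_rel G x)"
  unfolding component_rel_eq by (auto simp: refl_on_def)
 show "sym (component_rel G x)"
  using rtrancl_on_sym[of "\<Union>e\<in>x. {(tail G e, head G e), (head G e, tail G e)}" "verts G"]
  by (simp add: component_rel_eq sym_def) blast
 show "trans (component_rel G x)"
  unfolding component_rel_eq by (auto simp: trans_def intro: rtrancl_on_trans)
qed


lemma component_rel_verts: "(u, v) \<in> component_rel G x ==> u \<in> verts G \<and> v \<in> verts G"
 using equiv_component_rel[of G x] by (auto simp: equiv_def)

lemma component_rel_refl: "v \<in> verts G ==> (v, v) \<in> component_rel G x"
 using equiv_component_rel[of G x] by (auto simp: equiv_def refl_on_def)

lemma component_rel_sym: "(u, v) \<in> component_rel G x ==> (v, u) \<in> component_rel G x"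
 using equiv_component_rel[of G x] by (auto simp: equiv_def sym_def)

lemma component_rel_trans:
 "[|(u, v) \<in> component_rel G x; (v, w) \<in> component_rel G x|] ==> (u, w) \<in> component_rel G x"
 using equiv_component_rel[of G x] unfolding equiv_def by (meson transD)

lemma mem_component_of: "v \<in> component_of G x u \<longleftrightarrow> (u, v) \<in> component_rel G x"
 by (simp add: component_of_def)

lemma pi0_eq: "pi0 G x = component_of G x ` verts G"
 by (auto simp: pi0_def quotient_def component_of_def)

lemma component_of_pi0: "v \<in> verts G ==> component_of G x v \<in> pi0 G x"
 by (simp add: pi0_eq)

lemma component_of_self: "v \<in> verts G ==> v \<in> component_of G x v"
 by (simp add: mem_component_of component_rel_refl)

lemma component_of_eq: "[|ga \<in> pi0 G x; v \<in> ga|] ==> component_of G x v = ga"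
proof -
 assume "ga \<in> pi0 G x" "v \<in> ga"
 then obtain u where "ga = component_of G x u" "(u, v) \<in> component_rel G x"
  by (auto simp: pi0_eq mem_component_of)
 then show ?thesis
  by (auto simp: mem_component_of intro: component_rel_trans component_rel_trans[OF component_rel_sym])
qed

lemma component_of_eq_iff:
 "[|u \<in> verts G; v \<in> verts G|] ==> component_of G x u = component_of G x v \<longleftrightarrow> (u, v) \<in> component_rel G x"
 using component_of_eq[OF component_of_pi0[of u G x], of v] component_of_self[of v G x]
 by (auto simp: mem_component_of)

lemma pi0_disjoint: "[|ga \<in> pi0 G x; de \<in> pi0 G x; v \<in> ga; v \<in> de|] ==> ga = de"
 using component_of_eq[of ga G x v] component_of_eq[of de G x v] by simp

lemma pi0_subset: "ga \<in> pi0 G x ==> ga \<subseteq> verts G"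
 by (auto simp: pi0_eq mem_component_of dest: component_rel_verts)

lemma pi0_nonempty: "ga \<in> pi0 G x ==> \<exists>v\<in>verts G. v \<in> ga"
 using component_of_self by (fastforce simp: pi0_eq)

lemma edge_closed_component_of:
 assumes "fin_digraph G" "x \<subseteq> arcs G"
 shows "edge_closed G x (component_of G x v)"
 unfolding edge_closed_def mem_component_of
 using component_rel_edge[OF assms] component_rel_sym component_rel_trans by meson

text \<open>A component for the larger edge set is closed under the smaller one, hence contains the
  smaller component.\<close>

lemma component_rel_mono:
 assumes G: "fin_digraph G" and "x \<subseteq> y" "y \<subseteq> arcs G" and uv: "(u, v) \<in> component_rel G x"
 shows "(u, v) \<in> component_rel G y"
proof -
 have "v \<in> component_of G y u"
 proof (rule component_rel_closed[OF uv])
  show "u \<in> component_of G y u" using component_rel_verts[OF uv] by (simp add: component_of_self)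
  show "edge_closed G x (component_of G y u)"
   using edge_closed_component_of[OF G \<open>y \<subseteq> arcs G\<close>, of u] \<open>x \<subseteq> y\<close> by (auto simp: edge_closed_def)
 qed
 then show ?thesis by (simp add: mem_component_of)
qed

text \<open>The union of the two end components is closed under the old edges and under
  \<open>e\<close>, so nothing beyond it is joined; an old component that contains neither end stays
  closed.\<close>

lemma component_of_insert:
 assumes G: "fin_digraph G" and x: "insert e x \<subseteq> arcs G" and v: "v \<in> verts G"
 defines "al \<equiv> component_of G x (tail G e)" and "bee \<equiv> component_of G x (head G e)"
 shows "component_of G (insert e x) v = (if v \<in> al \<union> bee then al \<union> bee else component_of G x v)"
proof -
 interpret fin_digraph G by fact
 have e: "tail G e \<in> verts G" "head G e \<in> verts G" using x by auto
 have ab: "tail G e \<in> al" "head G e \<in> bee" unfolding al_def bee_def by (simp_all add: component_of_self e)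
 have cx: "edge_closed G x (component_of G x w)" for w
  using edge_closed_component_of[OF G] x by simp
 have mono: "(u, w) \<in> component_rel G x ==> (u, w) \<in> component_rel G (insert e x)" for u w
  using component_rel_mono[OF G _ x] by blast
 have edge: "(tail G e, head G e) \<in> component_rel G (insert e x)"
  using component_rel_edge[OF G x] by simp
 have least: "component_of G (insert e x) v \<subseteq> U" if "v \<in> U" "edge_closed G (insert e x) U" for U
  using that component_rel_closed by (auto simp: mem_component_of)
 show ?thesis
 proof (cases "v \<in> al \<union> bee")
  case True
  have "component_of G (insert e x) v \<subseteq> al \<union> bee"
   by (rule least[OF True]) (use cx ab in "auto simp: edge_closed_def al_def bee_def")
  moreover have te: "(tail G e, w) \<in> component_rel G (insert e x)" if "w \<in> al \<union> bee" for w
   using that mono[of "tail G e" w] mono[of "head G e" w] component_rel_trans[OF edge, of w]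
   by (auto simp: al_def bee_def mem_component_of)
  have "al \<union> bee \<subseteq> component_of G (insert e x) v"
   using component_rel_trans[OF component_rel_sym[OF te[OF True]] te] by (auto simp: mem_component_of)
  ultimately show ?thesis using True by auto
 next
  case False
  have "tail G e \<notin> component_of G x v" "head G e \<notin> component_of G x v"
   using False component_rel_sym[of v "tail G e" G x] component_rel_sym[of v "head G e" G x]
   by (auto simp: al_def bee_def mem_component_of)
  then have "component_of G (insert e x) v \<subseteq> component_of G x v"
   using cx v by (intro least) (auto simp: edge_closed_def component_of_self)
  moreover have "component_of G x v \<subseteq> component_of G (insert e x) v"
   using mono by (auto simp: mem_component_of)
  ultimately show ?thesis using False by auto
 qed
qed

lemma pi0_insert:
 assumes G: "fin_digraph G" and x: "insert e x \<subseteq> arcs G"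
 defines "al \<equiv> component_of G x (tail G e)" and "bee \<equiv> component_of G x (head G e)"
 shows "pi0 G (insert e x) = insert (al \<union> bee) (pi0 G x - {al, bee})"
proof -
 interpret fin_digraph G by fact
 have e: "tail G e \<in> verts G" "head G e \<in> verts G" using x by auto
 have ab: "tail G e \<in> al" "head G e \<in> bee" "al \<in> pi0 G x" "bee \<in> pi0 G x"
  unfolding al_def bee_def by (simp_all add: component_of_self component_of_pi0 e)
 note ins = component_of_insert[OF G x, folded al_def bee_def]
 show ?thesis
 proof (intro equalityI subsetI)
  fix ga assume "ga \<in> pi0 G (insert e x)"
  then obtain v where v: "v \<in> verts G" "ga = component_of G (insert e x) v" by (auto simp: pi0_eq)
  then show "ga \<in> insert (al \<union> bee) (pi0 G x - {al, bee})"
   using ins[OF v(1)] component_of_self[OF v(1), of x] component_of_pi0[OF v(1), of x] by (auto split: if_splits)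
 next
  fix ga assume "ga \<in> insert (al \<union> bee) (pi0 G x - {al, bee})"
  then consider "ga = al \<union> bee" | "ga \<in> pi0 G x" "ga \<noteq> al" "ga \<noteq> bee" by blast
  then show "ga \<in> pi0 G (insert e x)"
  proof cases
   case 1
   then show ?thesis using ins[OF e(1)] ab component_of_pi0[OF e(1), of "insert e x"] by simp
  next
   case 2
   obtain v where v: "v \<in> verts G" "v \<in> ga" using pi0_nonempty[OF 2(1)] by blast
    have "v \<notin> al \<union> bee"
    using 2 pi0_disjoint[OF 2(1) ab(3) v(2)] pi0_disjoint[OF 2(1) ab(4) v(2)] by blast
   then show ?thesis
    using ins[OF v(1)] component_of_eq[OF 2(1) v(2)] component_of_pi0[OF v(1), of "insert e x"] by simp
  qed
 qed
qed

text \<open>The vertices up to the tail of \<open>e\<close> on the path of \<open>e\<close> form \<open>W e\<close>, those from the head of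
  \<open>e\<close> on form \<open>W' e\<close>.\<close>

definition separates :: "('v, 'e) pre_digraph => 'e set => ('e => 'v set) => ('e => 'v set) => bool"
 where "separates G y W W' \<longleftrightarrow> (\<forall>e\<in>y. tail G e \<in> W e \<and> head G e \<notin> W e \<and> head G e \<in> W' e \<and>
  edge_closed G (y - {e}) (W e) \<and> edge_closed G (y - {e}) (W' e) \<and>
  (\<forall>f\<in>y. tail G f \<in> W e --> tail G e \<in> W f --> e = f) \<and>
  (\<forall>f\<in>y. head G f \<in> W' e --> head G e \<in> W' f --> e = f))"

text \<open>An edge \<open>f\<close> that crosses the border of \<open>W e\<close> or
  \<open>W' e\<close> has its tail at the label and position of the tail of \<open>e\<close>. Labels
  being injective and tails distinct, \<open>f\<close> is \<open>e\<close>.\<close>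

lemma multipath_separates:
 fixes G :: "('v, 'e) pre_digraph"
 assumes G: "fin_digraph G" and y: "y \<in> path_poset G"
 shows "\<exists>W W'. separates G y W W'"
proof -
 interpret fin_digraph G by fact
 have mp: "multipath G y" using y by (simp add: path_poset_iff[OF G])
 obtain l :: "'v => 'v" and pos :: "'v => nat" where lp':
  "\<forall>v\<in>verts G. \<forall>w\<in>verts G. l v = l w --> pos v = pos w --> v = w"
  "\<forall>e\<in>y. l (head G e) = l (tail G e) \<and> pos (head G e) = Suc (pos (tail G e))"
  using multipath_labels[OF mp] by (elim exE conjE) (rule that)
 have lp: "\<And>v w. [|v \<in> verts G; w \<in> verts G; l v = l w; pos v = pos w|] ==> v = w"
  "\<And>e. e \<in> y ==> l (head G e) = l (tail G e)"
  "\<And>e. e \<in> y ==> pos (head G e) = Suc (pos (tail G e))"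
  using lp' by auto
 have y: "y \<subseteq> arcs G" "inj_on (tail G) y" using mp by (auto simp: multipath_def)
 have eq: "e = f" if "e \<in> y" "f \<in> y" "l (tail G e) = l (tail G f)" "pos (tail G e) = pos (tail G f)" for e f
 proof -
  have "tail G e = tail G f" using y(1) lp(1)[of "tail G e" "tail G f"] that by (simp add: subset_iff)
  then show ?thesis using y(2) that by (meson inj_onD)
 qed
 define W where "W e = {v. l v = l (tail G e) \<and> pos v \<le> pos (tail G e)}" for e
 define W' where "W' e = {v. l v = l (head G e) \<and> pos v \<ge> pos (head G e)}" for e
 have "edge_closed G (y - {e}) (W e) \<and> edge_closed G (y - {e}) (W' e)" if "e \<in> y" for e
  unfolding edge_closed_def
 proof (intro conjI ballI)
  fix f assume f: "f \<in> y - {e}"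
  then have ne: "\<not> (l (tail G f) = l (tail G e) \<and> pos (tail G f) = pos (tail G e))" using eq that by blast
  show "tail G f \<in> W e \<longleftrightarrow> head G f \<in> W e" using lp(2,3)[of f] f ne by (auto simp: W_def)
  show "tail G f \<in> W' e \<longleftrightarrow> head G f \<in> W' e"
   using lp(2,3)[of f] lp(2,3)[of e] f that ne by (auto simp: W'_def)
 qed
 moreover have "e = f" if "e \<in> y" "f \<in> y" "tail G f \<in> W e" "tail G e \<in> W f" for e f
  using that by (intro eq) (auto simp: W_def)
 moreover have "e = f" if "e \<in> y" "f \<in> y" "head G f \<in> W' e" "head G e \<in> W' f" for e f
  using that lp(2,3)[of f] lp(2,3)[of e] by (intro eq) (auto simp: W'_def)
 ultimately have "separates G y W W'"
  unfolding separates_def by (auto simp: W_def W'_def lp(3))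
 then show ?thesis by blast
qed

text \<open>The set \<open>W e\<close> is closed under the remaining edges and contains the tail of
  \<open>e\<close> but not its head.\<close>

lemma multipath_tail_head:
 assumes G: "fin_digraph G" and y: "insert e x \<in> path_poset G" "e \<notin> x"
 shows "component_of G x (tail G e) \<noteq> component_of G x (head G e)"
proof -
 interpret fin_digraph G by fact
 obtain W W' where W: "separates G (insert e x) W W'" using multipath_separates[OF G y(1)] by blast
 have "insert e x - {e} = x" using y(2) by auto
 then have "tail G e \<in> W e" "head G e \<notin> W e" "edge_closed G x (W e)"
  using W unfolding separates_def by auto
 moreover have "e \<in> arcs G" using path_poset_arcs[OF G y(1)] by simp
 ultimately show ?thesis
  using component_rel_closed[of "tail G e" "head G e" G x "W e"] by (auto simp: component_of_eq_iff)
qed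

text \<open>These are the conditions under which two merges commute. A common tail or head component
  would make the order of the factors ambiguous, and the third configuration would close a
  cycle.\<close>

lemma multipath_two_edges:
 assumes G: "fin_digraph G" and y: "insert e (insert f x) \<in> path_poset G" "e \<notin> x" "f \<notin> x" "e \<noteq> f"
 shows "component_of G x (tail G e) \<noteq> component_of G x (tail G f)"
  and "component_of G x (head G e) \<noteq> component_of G x (head G f)"
  and "\<not> (component_of G x (tail G e) = component_of G x (head G f) \<and>
   component_of G x (tail G f) = component_of G x (head G e))"
proof -
 interpret fin_digraph G by fact
 obtain W W' where sep: "separates G (insert e (insert f x)) W W'"
  using multipath_separates[OF G y(1)] by blast
 have We: "tail G e \<in> W e" "head G e \<notin> W e" "head G e \<in> W' e"
  and Wf: "tail G f \<in> W f" "head G f \<in> W' f"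
  and ne: "\<not> (tail G f \<in> W e \<and> tail G e \<in> W f)" "\<not> (head G f \<in> W' e \<and> head G e \<in> W' f)"
  and c: "edge_closed G (insert e (insert f x) - {e}) (W e)" "edge_closed G (insert e (insert f x) - {f}) (W f)"
   "edge_closed G (insert e (insert f x) - {e}) (W' e)" "edge_closed G (insert e (insert f x) - {f}) (W' f)"
  using sep y(4) unfolding separates_def by blast+
 have c: "edge_closed G x (W e)" "edge_closed G x (W f)" "edge_closed G x (W' e)" "edge_closed G x (W' f)"
  "tail G f \<in> W e \<longleftrightarrow> head G f \<in> W e"
  using c y(2-4) unfolding edge_closed_def by blast+
 have ef: "e \<in> arcs G" "f \<in> arcs G" using path_poset_arcs[OF G y(1)] by auto
 show "component_of G x (tail G e) \<noteq> component_of G x (tail G f)"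
  using We Wf ne ef component_rel_closed[OF _ _ c(1), of "tail G e" "tail G f"]
   component_rel_closed[OF component_rel_sym _ c(2), of "tail G e" "tail G f"]
  by (auto simp: component_of_eq_iff)
 show "component_of G x (head G e) \<noteq> component_of G x (head G f)"
  using We Wf ne ef component_rel_closed[OF _ _ c(3), of "head G e" "head G f"]
   component_rel_closed[OF component_rel_sym _ c(4), of "head G e" "head G f"]
  by (auto simp: component_of_eq_iff)
 show "\<not> (component_of G x (tail G e) = component_of G x (head G f) \<and>
   component_of G x (tail G f) = component_of G x (head G e))"
  using We ef component_rel_closed[OF _ _ c(1), of "tail G e" "head G f"]
   component_rel_closed[OF _ _ c(1), of "tail G f" "head G e"] c(5)
  by (auto simp: component_of_eq_iff)
qed

section \<open>Maps between tensor products given on pure tensors\<close>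

text \<open>A function \<open>F\<close> between product sets induces a map of tensor products if every coordinate of
  the argument enters linearly in exactly one coordinate of the value.\<close>

definition tensor_fun ::
 "'r ring => 'i set => ('i => ('r, 'm) module) => 'j set => ('j => ('r, 'n) module) =>
  (('i => 'm) => 'j => 'n) => bool"
 where "tensor_fun R I N J N' F \<longleftrightarrow> (\<forall>t\<in>\<Pi>\<^sub>E i\<in>I. carrier (N i). F t \<in> (\<Pi>\<^sub>E j\<in>J. carrier (N' j)) \<and>
  (\<forall>i\<in>I. \<exists>j\<in>J. \<exists>ka\<in>mod_hom R (N i) (N' j). \<forall>u\<in>carrier (N i). F (t(i := u)) = (F t)(j := ka u)))"

definition tensor_map ::
 "'r ring => 'i set => ('i => ('r, 'm) module) => 'j set => ('j => ('r, 'n) module) =>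
  (('i => 'm) => 'j => 'n) => (('i => 'm) => 'r) set => (('j => 'n) => 'r) set"
 where "tensor_map R I N J N' F = tensor_lift R I N (tensor R J N') (%t. pure_tensor R J N' (F t))"

lemma tensor_funI:
 assumes "\<And>t. t \<in> (\<Pi>\<^sub>E i\<in>I. carrier (N i)) ==> F t \<in> (\<Pi>\<^sub>E j\<in>J. carrier (N' j))"
  and "\<And>t i. [|t \<in> (\<Pi>\<^sub>E i\<in>I. carrier (N i)); i \<in> I|] ==> \<exists>j\<in>J. \<exists>ka\<in>mod_hom R (N i) (N' j).
   \<forall>u\<in>carrier (N i). F (t(i := u)) = (F t)(j := ka u)"
 shows "tensor_fun R I N J N' F"
 using assms by (simp add: tensor_fun_def)

lemma tensor_fun_closed:
 "[|tensor_fun R I N J N' F; t \<in> (\<Pi>\<^sub>E i\<in>I. carrier (N i))|] ==> F t \<in> (\<Pi>\<^sub>E j\<in>J. carrier (N' j))"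
 by (simp add: tensor_fun_def)

context
 fixes R :: "'r ring" and I :: "'i set" and N :: "'i => ('r, 'm) module"
  and J :: "'j set" and N' :: "'j => ('r, 'n) module"
 assumes R: "cring R" and N: "\<And>i. i \<in> I ==> Module.module R (N i)"
  and N': "\<And>j. j \<in> J ==> Module.module R (N' j)"
begin

text \<open>Changing one coordinate of the argument changes one coordinate of the value through a
  linear map, so multilinearity is inherited from that of pure tensors.\<close>

lemma multilinear_tensor_fun:
 assumes F: "tensor_fun R I N J N' F"
 shows "multilinear R I N (tensor R J N') (%t. pure_tensor R J N' (F t))"
proof -
 have pure: "multilinear R J N' (tensor R J N') (pure_tensor R J N')"
  by (rule multilinear_pure_tensor[OF R N'])
 have Fc: "F t \<in> (\<Pi>\<^sub>E j\<in>J. carrier (N' j))" if "t \<in> (\<Pi>\<^sub>E i\<in>I. carrier (N i))" for t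
  by (rule tensor_fun_closed[OF F that])
 have upd: "\<exists>j\<in>J. \<exists>ka\<in>mod_hom R (N i) (N' j). \<forall>u\<in>carrier (N i). F (t(i := u)) = (F t)(j := ka u)"
  if "t \<in> (\<Pi>\<^sub>E i\<in>I. carrier (N i))" "i \<in> I" for t i
  using F that by (simp add: tensor_fun_def)
 show ?thesis
  unfolding multilinear_def
 proof (intro conjI ballI)
  fix t assume "t \<in> (\<Pi>\<^sub>E i\<in>I. carrier (N i))"
  then show "pure_tensor R J N' (F t) \<in> carrier (tensor R J N')"
   using pure Fc by (auto simp: multilinear_def)
 next
  fix t i u v assume t: "t \<in> (\<Pi>\<^sub>E i\<in>I. carrier (N i))" and i: "i \<in> I"
   and u: "u \<in> carrier (N i)" and v: "v \<in> carrier (N i)"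
  interpret Ni: Module.module R "N i" by (rule N[OF i])
  obtain j ka where j: "j \<in> J" "ka \<in> mod_hom R (N i) (N' j)"
   "\<And>u. u \<in> carrier (N i) ==> F (t(i := u)) = (F t)(j := ka u)"
   using upd[OF t i] by blast
  have "pure_tensor R J N' ((F t)(j := ka u \<oplus>\<^bsub>N' j\<^esub> ka v)) =
   pure_tensor R J N' ((F t)(j := ka u)) \<oplus>\<^bsub>tensor R J N'\<^esub> pure_tensor R J N' ((F t)(j := ka v))"
   using pure Fc[OF t] j(1) mod_hom_closed[OF j(2) u] mod_hom_closed[OF j(2) v]
   unfolding multilinear_def by blast
  then show "pure_tensor R J N' (F (t(i := u \<oplus>\<^bsub>N i\<^esub> v))) =
   pure_tensor R J N' (F (t(i := u))) \<oplus>\<^bsub>tensor R J N'\<^esub> pure_tensor R J N' (F (t(i := v)))"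
   using u v by (simp add: j(3) mod_hom_add[OF j(2)])
 next
  fix t i r u assume t: "t \<in> (\<Pi>\<^sub>E i\<in>I. carrier (N i))" and i: "i \<in> I"
   and r: "r \<in> carrier R" and u: "u \<in> carrier (N i)"
  interpret Ni: Module.module R "N i" by (rule N[OF i])
  obtain j ka where j: "j \<in> J" "ka \<in> mod_hom R (N i) (N' j)"
   "\<And>u. u \<in> carrier (N i) ==> F (t(i := u)) = (F t)(j := ka u)"
   using upd[OF t i] by blast
  have "pure_tensor R J N' ((F t)(j := r \<odot>\<^bsub>N' j\<^esub> ka u)) =
   r \<odot>\<^bsub>tensor R J N'\<^esub> pure_tensor R J N' ((F t)(j := ka u))"
   using pure Fc[OF t] j(1) r mod_hom_closed[OF j(2) u]
   unfolding multilinear_def by blast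
  then show "pure_tensor R J N' (F (t(i := r \<odot>\<^bsub>N i\<^esub> u))) =
   r \<odot>\<^bsub>tensor R J N'\<^esub> pure_tensor R J N' (F (t(i := u)))"
   using u r by (simp add: j(3) mod_hom_smult[OF j(2)])
 qed
qed

lemma tensor_map_hom:
 "tensor_fun R I N J N' F ==> tensor_map R I N J N' F \<in> mod_hom R (tensor R I N) (tensor R J N')"
 unfolding tensor_map_def
 by (rule tensor_lift(1)[OF R N module_tensor[OF R N'] multilinear_tensor_fun])

lemma tensor_map_pure:
 "[|tensor_fun R I N J N' F; t \<in> (\<Pi>\<^sub>E i\<in>I. carrier (N i))|] ==>
  tensor_map R I N J N' F (pure_tensor R I N t) = pure_tensor R J N' (F t)"
 unfolding tensor_map_def
 by (rule tensor_lift(3)[OF R N module_tensor[OF R N'] multilinear_tensor_fun])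

end

lemma tensor_map_comp:
 assumes R: "cring R" and N: "\<And>i. i \<in> I ==> Module.module R (N i)"
  and N': "\<And>j. j \<in> J ==> Module.module R (N' j)" and N'': "\<And>k. k \<in> K ==> Module.module R (N'' k)"
  and F: "tensor_fun R I N J N' F" and F': "tensor_fun R J N' K N'' F'" and F'': "tensor_fun R I N K N'' F''"
  and eq: "\<And>t. t \<in> (\<Pi>\<^sub>E i\<in>I. carrier (N i)) ==> F' (F t) = F'' t"
  and c: "c \<in> carrier (tensor R I N)"
 shows "tensor_map R J N' K N'' F' (tensor_map R I N J N' F c) = tensor_map R I N K N'' F'' c"
proof (rule tensor_hom_ext[OF R N module_tensor[OF R N''] _ _ _ c])
 show "(%c. tensor_map R J N' K N'' F' (tensor_map R I N J N' F c)) \<in> mod_hom R (tensor R I N) (tensor R K N'')"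
  by (rule mod_hom_comp[OF tensor_map_hom[OF R N N' F] tensor_map_hom[OF R N' N'' F']])
 show "tensor_map R I N K N'' F'' \<in> mod_hom R (tensor R I N) (tensor R K N'')"
  by (rule tensor_map_hom[OF R N N'' F''])
 fix t assume t: "t \<in> (\<Pi>\<^sub>E i\<in>I. carrier (N i))"
 show "tensor_map R J N' K N'' F' (tensor_map R I N J N' F (pure_tensor R I N t)) =
   tensor_map R I N K N'' F'' (pure_tensor R I N t)"
  by (simp add: tensor_map_pure[OF R N N' F t] tensor_map_pure[OF R N N'' F'' t]
    tensor_map_pure[OF R N' N'' F' tensor_fun_closed[OF F t]] eq[OF t])
qed

text \<open>Linear maps agree once they agree on pure tensors, so a square of tensor products is
  reduced to a square of functions between product sets. All later identities for faces,
  degeneracies and merges use this.\<close>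

lemma tensor_map_square:
 assumes R: "cring R" and N: "\<And>i. i \<in> I ==> Module.module R (N i)"
  and N': "\<And>j. j \<in> J ==> Module.module R (N' j)" and L: "\<And>j. j \<in> J' ==> Module.module R (L j)"
  and N'': "\<And>k. k \<in> K ==> Module.module R (N'' k)"
  and F: "tensor_fun R I N J N' F" and F': "tensor_fun R J N' K N'' F'"
  and G: "tensor_fun R I N J' L G" and G': "tensor_fun R J' L K N'' G'"
  and eq: "\<And>t. t \<in> (\<Pi>\<^sub>E i\<in>I. carrier (N i)) ==> F' (F t) = G' (G t)"
  and c: "c \<in> carrier (tensor R I N)"
 shows "tensor_map R J N' K N'' F' (tensor_map R I N J N' F c) = tensor_map R J' L K N'' G' (tensor_map R I N J' L G c)"
proof (rule tensor_hom_ext[OF R N module_tensor[OF R N''] _ _ _ c])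
 show "(%c. tensor_map R J N' K N'' F' (tensor_map R I N J N' F c)) \<in> mod_hom R (tensor R I N) (tensor R K N'')"
  by (rule mod_hom_comp[OF tensor_map_hom[OF R N N' F] tensor_map_hom[OF R N' N'' F']])
 show "(%c. tensor_map R J' L K N'' G' (tensor_map R I N J' L G c)) \<in> mod_hom R (tensor R I N) (tensor R K N'')"
  by (rule mod_hom_comp[OF tensor_map_hom[OF R N L G] tensor_map_hom[OF R L N'' G']])
 fix t assume t: "t \<in> (\<Pi>\<^sub>E i\<in>I. carrier (N i))"
 show "tensor_map R J N' K N'' F' (tensor_map R I N J N' F (pure_tensor R I N t)) =
   tensor_map R J' L K N'' G' (tensor_map R I N J' L G (pure_tensor R I N t))"
  by (simp add: tensor_map_pure[OF R N N' F t] tensor_map_pure[OF R N L G t]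
    tensor_map_pure[OF R N' N'' F' tensor_fun_closed[OF F t]]
    tensor_map_pure[OF R L N'' G' tensor_fun_closed[OF G t]] eq[OF t])
qed

lemma tensor_map_id:
 assumes R: "cring R" and N: "\<And>i. i \<in> I ==> Module.module R (N i)"
  and F: "tensor_fun R I N I N F" and eq: "\<And>t. t \<in> (\<Pi>\<^sub>E i\<in>I. carrier (N i)) ==> F t = t"
  and c: "c \<in> carrier (tensor R I N)"
 shows "tensor_map R I N I N F c = c"
proof (rule tensor_hom_ext[OF R N module_tensor[OF R N] tensor_map_hom[OF R N N F] mod_hom_id[OF module_tensor[OF R N]] _ c])
 fix t assume t: "t \<in> (\<Pi>\<^sub>E i\<in>I. carrier (N i))"
 show "tensor_map R I N I N F (pure_tensor R I N t) = pure_tensor R I N t"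
  by (simp add: tensor_map_pure[OF R N N F t] eq[OF t])
qed

section \<open>The factors and their products\<close>

lemma module_transport:
 fixes N :: "('r, 'm, 'z) module_scheme"
 assumes "Module.module R N" and gf: "\<And>x. g (f x) = x"
 shows "Module.module R (transport f g N)"
proof -
 interpret N: Module.module R N by fact
 show ?thesis
 proof (rule moduleI)
  show "abelian_group (transport f g N)"
  proof (rule abelian_groupI)
   fix x assume "x \<in> carrier (transport f g N)"
   then obtain y where y: "y \<in> carrier N" "x = f y" by (auto simp: transport_def)
   then have "f (\<ominus>\<^bsub>N\<^esub> y) \<in> carrier (transport f g N)"
    "f (\<ominus>\<^bsub>N\<^esub> y) \<oplus>\<^bsub>transport f g N\<^esub> x = \<zero>\<^bsub>transport f g N\<^esub>"
    by (auto simp: transport_def gf N.M.l_neg)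
   then show "\<exists>z\<in>carrier (transport f g N). z \<oplus>\<^bsub>transport f g N\<^esub> x = \<zero>\<^bsub>transport f g N\<^esub>" by blast
  next
   fix x y assume "x \<in> carrier (transport f g N)" "y \<in> carrier (transport f g N)"
   then show "x \<oplus>\<^bsub>transport f g N\<^esub> y = y \<oplus>\<^bsub>transport f g N\<^esub> x"
    by (auto simp: transport_def gf N.M.a_comm)
  qed (auto simp: transport_def gf N.M.a_assoc)
 qed (auto simp: transport_def gf N.smult_l_distr N.smult_r_distr N.smult_assoc1 N.R.is_cring)
qed

locale coefficients =
 fixes R :: "'r ring" and A :: "('r, 'a) module" and M :: "('r, 'm, 'a) bimodule"
 assumes bimod: "algebra_bimodule R A M"
begin

sublocale B: algebra_bimodule R A M by (rule bimod)

lemma R_cring: "cring R" using B.module_axioms by (simp add: Module.module_def)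

abbreviation TF :: "bool => ('r, 'a + 'm) module" where "TF \<equiv> tensor_factor A M"

lemma module_TF: "Module.module R (TF p)"
 by (cases p) (auto simp: tensor_factor_def
   intro!: module_transport B.module_axioms B.alg.module_axioms)

lemma TF_carrier: "carrier (TF p) = (if p then Inr ` carrier M else Inl ` carrier A)"
 and TF_add_True: "Inr m \<oplus>\<^bsub>TF True\<^esub> Inr m' = Inr (m \<oplus>\<^bsub>M\<^esub> m')"
 and TF_add_False: "Inl a \<oplus>\<^bsub>TF False\<^esub> Inl a' = Inl (a \<oplus>\<^bsub>A\<^esub> a')"
 and TF_smult_True: "r \<odot>\<^bsub>TF True\<^esub> Inr m = Inr (r \<odot>\<^bsub>M\<^esub> m)"
 and TF_smult_False: "r \<odot>\<^bsub>TF False\<^esub> Inl a = Inl (r \<odot>\<^bsub>A\<^esub> a)"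
 by (simp_all add: tensor_factor_def transport_def)

text \<open>The bimodule axioms connect scalars with the action of \<open>A\<close> only through
  multiples of the unit, so a scalar is first written as such a multiple acting by
  multiplication.\<close>

lemma smult_lact:
 assumes "r \<in> carrier R" "a \<in> carrier A" "m \<in> carrier M"
 shows "lact M (r \<odot>\<^bsub>A\<^esub> a) m = r \<odot>\<^bsub>M\<^esub> lact M a m"
proof -
 have "r \<odot>\<^bsub>A\<^esub> a = (r \<odot>\<^bsub>A\<^esub> \<one>\<^bsub>A\<^esub>) \<otimes>\<^bsub>A\<^esub> a" using assms by (simp add: B.alg.smult_mult_left)
 then show ?thesis using assms by (simp add: B.lact_mult B.lact_scalar B.lact_closed)
qed

lemma lact_smult:
 assumes "r \<in> carrier R" "a \<in> carrier A" "m \<in> carrier M"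
 shows "lact M a (r \<odot>\<^bsub>M\<^esub> m) = r \<odot>\<^bsub>M\<^esub> lact M a m"
proof -
 have "lact M a (r \<odot>\<^bsub>M\<^esub> m) = lact M (a \<otimes>\<^bsub>A\<^esub> (r \<odot>\<^bsub>A\<^esub> \<one>\<^bsub>A\<^esub>)) m"
  using assms by (simp add: B.lact_mult B.lact_scalar)
 also have "a \<otimes>\<^bsub>A\<^esub> (r \<odot>\<^bsub>A\<^esub> \<one>\<^bsub>A\<^esub>) = r \<odot>\<^bsub>A\<^esub> a" using assms by (simp add: B.alg.smult_mult_right)
 finally show ?thesis using assms by (simp add: smult_lact)
qed

lemma ract_smult:
 assumes "r \<in> carrier R" "a \<in> carrier A" "m \<in> carrier M"
 shows "ract M m (r \<odot>\<^bsub>A\<^esub> a) = r \<odot>\<^bsub>M\<^esub> ract M m a"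
proof -
 have "r \<odot>\<^bsub>A\<^esub> a = a \<otimes>\<^bsub>A\<^esub> (r \<odot>\<^bsub>A\<^esub> \<one>\<^bsub>A\<^esub>)" using assms by (simp add: B.alg.smult_mult_right)
 then show ?thesis using assms by (simp add: B.ract_mult B.ract_scalar B.ract_closed)
qed

lemma smult_ract:
 assumes "r \<in> carrier R" "a \<in> carrier A" "m \<in> carrier M"
 shows "ract M (r \<odot>\<^bsub>M\<^esub> m) a = r \<odot>\<^bsub>M\<^esub> ract M m a"
proof -
 have "ract M (r \<odot>\<^bsub>M\<^esub> m) a = ract M m ((r \<odot>\<^bsub>A\<^esub> \<one>\<^bsub>A\<^esub>) \<otimes>\<^bsub>A\<^esub> a)"
  using assms by (simp add: B.ract_mult B.ract_scalar)
 also have "(r \<odot>\<^bsub>A\<^esub> \<one>\<^bsub>A\<^esub>) \<otimes>\<^bsub>A\<^esub> a = r \<odot>\<^bsub>A\<^esub> a" using assms by (simp add: B.alg.smult_mult_left)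
 finally show ?thesis using assms by (simp add: ract_smult)
qed

text \<open>The flags tell which factor is the copy of \<open>M\<close>. Both being set is the case
  in which \<open>fuse\<close> is undefined; it cannot occur for disjoint components, since only one
  contains the base vertex.\<close>

lemma fuse_closed:
 "[|u \<in> carrier (TF p); v \<in> carrier (TF q); \<not> (p \<and> q)|] ==> fuse A M u v \<in> carrier (TF (p \<or> q))"
 by (auto simp: TF_carrier B.lact_closed B.ract_closed split: if_splits)

lemma fuse_hom_left:
 assumes "v \<in> carrier (TF q)" "\<not> (p \<and> q)"
 shows "(%u. fuse A M u v) \<in> mod_hom R (TF p) (TF (p \<or> q))"
proof (rule mod_homI)
 fix u assume u: "u \<in> carrier (TF p)"
 then show "fuse A M u v \<in> carrier (TF (p \<or> q))" using fuse_closed assms by simp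
 show "fuse A M (r \<odot>\<^bsub>TF p\<^esub> u) v = r \<odot>\<^bsub>TF (p \<or> q)\<^esub> fuse A M u v" if "r \<in> carrier R" for r
  using u assms that by (cases p; cases q) (auto simp: TF_carrier TF_smult_True TF_smult_False smult_lact smult_ract
    B.alg.smult_mult_left)
 fix u' assume u': "u' \<in> carrier (TF p)"
 show "fuse A M (u \<oplus>\<^bsub>TF p\<^esub> u') v = fuse A M u v \<oplus>\<^bsub>TF (p \<or> q)\<^esub> fuse A M u' v"
  using u u' assms by (cases p; cases q) (auto simp: TF_carrier TF_add_True TF_add_False B.add_lact B.ract_add
    B.alg.l_distr)
qed

lemma fuse_hom_right:
 assumes "u \<in> carrier (TF p)" "\<not> (p \<and> q)"
 shows "(%v. fuse A M u v) \<in> mod_hom R (TF q) (TF (p \<or> q))"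
proof (rule mod_homI)
 fix v assume v: "v \<in> carrier (TF q)"
 then show "fuse A M u v \<in> carrier (TF (p \<or> q))" using fuse_closed assms by simp
 show "fuse A M u (r \<odot>\<^bsub>TF q\<^esub> v) = r \<odot>\<^bsub>TF (p \<or> q)\<^esub> fuse A M u v" if "r \<in> carrier R" for r
  using v assms that by (cases p; cases q) (auto simp: TF_carrier TF_smult_True TF_smult_False lact_smult ract_smult
    B.alg.smult_mult_right)
 fix v' assume v': "v' \<in> carrier (TF q)"
 show "fuse A M u (v \<oplus>\<^bsub>TF q\<^esub> v') = fuse A M u v \<oplus>\<^bsub>TF (p \<or> q)\<^esub> fuse A M u v'"
  using v v' assms by (cases p; cases q) (auto simp: TF_carrier TF_add_True TF_add_False B.lact_add B.add_ract
    B.alg.r_distr)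
qed

text \<open>With at most one factor from \<open>M\<close>, each case is associativity in
  \<open>A\<close> or one of the axioms on iterated left, right and mixed actions.\<close>

lemma fuse_assoc:
 assumes "u \<in> carrier (TF p)" "v \<in> carrier (TF q)" "w \<in> carrier (TF r)"
  "\<not> (p \<and> q)" "\<not> (p \<and> r)" "\<not> (q \<and> r)"
 shows "fuse A M (fuse A M u v) w = fuse A M u (fuse A M v w)"
 using assms by (cases p; cases q; cases r)
  (auto simp: TF_carrier B.alg.m_assoc B.lact_mult B.ract_mult B.lact_ract)

lemma fuse_one_left: "v \<in> carrier (TF q) ==> fuse A M (Inl \<one>\<^bsub>A\<^esub>) v = v"
 by (auto simp: TF_carrier B.lact_one split: if_splits)

lemma fuse_one_right: "u \<in> carrier (TF p) ==> fuse A M u (Inl \<one>\<^bsub>A\<^esub>) = u"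
 by (auto simp: TF_carrier B.ract_one split: if_splits)

lemma one_TF: "Inl \<one>\<^bsub>A\<^esub> \<in> carrier (TF False)"
 by (simp add: TF_carrier)

end

section \<open>Functors on down-closed families\<close>

lemma cover_chain_Cons:
 "cover_chain P x y (z # zs) \<longleftrightarrow> z = x \<and> x \<in> P \<and>
  (zs = [] \<and> x = y \<or> zs \<noteq> [] \<and> covers P x (hd zs) \<and> cover_chain P (hd zs) y zs)"
proof (cases zs)
 case (Cons w ws)
 have "(\<forall>i. Suc i < length (z # w # ws) --> covers P ((z # w # ws) ! i) ((z # w # ws) ! Suc i)) \<longleftrightarrow>
  covers P z w \<and> (\<forall>i. Suc i < length (w # ws) --> covers P ((w # ws) ! i) ((w # ws) ! Suc i))" (is "?l \<longleftrightarrow> ?r")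
 proof
  assume l: ?l
  show ?r
  proof (intro conjI allI impI)
   show "covers P z w" using spec[OF l, of 0] by simp
   show "covers P ((w # ws) ! i) ((w # ws) ! Suc i)" if "Suc i < length (w # ws)" for i
    using spec[OF l, of "Suc i"] that by simp
  qed
 next
  assume r: ?r
  show ?l
  proof (intro allI impI)
   fix i assume "Suc i < length (z # w # ws)"
   then show "covers P ((z # w # ws) ! i) ((z # w # ws) ! Suc i)" using r by (cases i) auto
  qed
 qed
 then show ?thesis using Cons by (auto simp: cover_chain_def)
qed (auto simp: cover_chain_def)

lemma not_cover_chain_Nil: "\<not> cover_chain P x y []"
 by (simp add: cover_chain_def)

text \<open>A functor on a down-closed family of finite sets, presented by its maps for adding one
  element. Since any two ways of adding several elements differ by exchanging neighbours,
  \<open>diamond\<close> is all the coherence there is.\<close>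

locale cover_functor =
 fixes R :: "'r ring" and P :: "'e set set" and Fo :: "'e set => ('r, 't) module"
  and Fc :: "'e set => 'e set => 't => 't"
 assumes finite_mem: "x \<in> P ==> finite x"
  and down: "[|y \<in> P; x \<subseteq> y|] ==> x \<in> P"
  and Fo: "x \<in> P ==> Module.module R (Fo x)"
  and Fc: "[|insert e x \<in> P; e \<notin> x|] ==> Fc x (insert e x) \<in> mod_hom R (Fo x) (Fo (insert e x))"
  and diamond: "[|insert e (insert f x) \<in> P; e \<notin> x; f \<notin> x; e \<noteq> f; v \<in> carrier (Fo x)|] ==>
   Fc (insert f x) (insert e (insert f x)) (Fc x (insert f x) v) =
   Fc (insert e x) (insert e (insert f x)) (Fc x (insert e x) v)"
begin

text \<open>Literally the choice made in \<open>F_map\<close>, so that the two agree by unfolding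
  once the locale is instantiated.\<close>

definition Fm :: "'e set => 'e set => 't => 't"
 where "Fm x y = chain_composite Fo Fc (SOME zs. cover_chain P x y zs)"

lemma covers_iff: "covers P x y \<longleftrightarrow> y \<in> P \<and> (\<exists>e. e \<notin> x \<and> y = insert e x)"
proof
 assume c: "covers P x y"
 then obtain e where e: "e \<in> y" "e \<notin> x" by (auto simp: covers_def)
 have "insert e x \<in> P" by (rule down[of y]) (use c e in "auto simp: covers_def")
 have "insert e x = y"
 proof (rule ccontr)
  assume "insert e x \<noteq> y"
  then have "insert e x \<subset> y" "x \<subset> insert e x" using c e by (auto simp: covers_def)
  then show False using c \<open>insert e x \<in> P\<close> by (auto simp: covers_def)
 qed
 then show "y \<in> P \<and> (\<exists>e. e \<notin> x \<and> y = insert e x)" using c e by (auto simp: covers_def)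
next
 assume "y \<in> P \<and> (\<exists>e. e \<notin> x \<and> y = insert e x)"
 then show "covers P x y" using down[of y x] by (auto simp: covers_def)
qed

lemma Fc_covers: "covers P x y ==> Fc x y \<in> mod_hom R (Fo x) (Fo y)"
 using Fc by (auto simp: covers_iff)

lemma cover_chain_subset: "cover_chain P x y zs ==> x \<subseteq> y \<and> x \<in> P \<and> y \<in> P"
proof (induction zs arbitrary: x)
 case Nil
 then show ?case by (simp add: not_cover_chain_Nil)
next
 case (Cons z zs)
 then show ?case
  using Cons.IH[of "hd zs"] by (auto simp: cover_chain_Cons covers_def)
qed

lemma cover_chain_exists: "[|y \<in> P; x \<subseteq> y|] ==> \<exists>zs. cover_chain P x y zs"
proof (induction "card (y - x)" arbitrary: x)
 case 0
 then have "x = y" using finite_mem[of y] by auto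
 then have "cover_chain P x y [x]" using 0 by (simp add: cover_chain_Cons)
 then show ?case by blast
next
 case (Suc n)
 then obtain e where e: "e \<in> y" "e \<notin> x" by (metis Diff_iff card.empty ex_in_conv nat.distinct(1))
 have "y - insert e x = (y - x) - {e}" by auto
 then have "card (y - insert e x) = n"
  using Suc.hyps(2) e finite_mem[OF \<open>y \<in> P\<close>] by simp
 then obtain zs where zs: "cover_chain P (insert e x) y zs"
  using Suc.hyps(1)[of "insert e x"] Suc.prems e by auto
 then have "zs \<noteq> [] \<and> hd zs = insert e x" by (simp add: cover_chain_def)
 moreover have "insert e x \<in> P" "x \<in> P" using e Suc.prems down[of y] by auto
 ultimately have "cover_chain P x y (x # zs)"
  using zs e by (auto simp: cover_chain_Cons covers_iff)
 then show ?case by blast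
qed

lemma chain_composite_hom:
 "cover_chain P x y zs ==> chain_composite Fo Fc zs \<in> mod_hom R (Fo x) (Fo y)"
proof (induction zs arbitrary: x rule: induct_list012)
 case 1
 then show ?case by (simp add: not_cover_chain_Nil)
next
 case (2 z)
 then have "z = x" "y = x" "x \<in> P" by (auto simp: cover_chain_Cons)
 then show ?case by (auto intro!: mod_hom_cong[OF mod_hom_id] Fo)
next
 case (3 z w zs)
 then have zw: "z = x" "x \<in> P" "covers P x w" "cover_chain P w y (w # zs)"
  by (auto simp: cover_chain_Cons[of P x y z])
 have "(%v. chain_composite Fo Fc (w # zs) (Fc x w v)) \<in> mod_hom R (Fo x) (Fo y)"
  by (rule mod_hom_comp[OF Fc_covers[OF zw(3)] 3(2)[OF zw(4)]])
 then show ?case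
  by (rule mod_hom_cong) (use zw Fo in "auto simp: compose_def")
qed

text \<open>Induction on the number of elements still to be added. Two chains that begin with
  different elements are both compared with chains that add these two elements first, in the two
  orders, and then continue together.\<close>

lemma chain_composite_unique:
 "[|cover_chain P x y zs; cover_chain P x y zs'; v \<in> carrier (Fo x)|] ==>
  chain_composite Fo Fc zs v = chain_composite Fo Fc zs' v"
proof (induction "card (y - x)" arbitrary: x v zs zs' rule: less_induct)
 case less
 obtain as where zs: "zs = x # as" "as = [] \<and> x = y \<or> as \<noteq> [] \<and> covers P x (hd as) \<and> cover_chain P (hd as) y as"
  using less.prems(1) by (cases zs) (auto simp: not_cover_chain_Nil cover_chain_Cons)
 obtain bs where zs': "zs' = x # bs" "bs = [] \<and> x = y \<or> bs \<noteq> [] \<and> covers P x (hd bs) \<and> cover_chain P (hd bs) y bs"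
  using less.prems(2) by (cases zs') (auto simp: not_cover_chain_Nil cover_chain_Cons)
 have xy: "x \<subseteq> y" "x \<in> P" "y \<in> P" using cover_chain_subset[OF less.prems(1)] by auto
 show ?case
 proof (cases "x = y")
  case True
  have "\<not> cover_chain P (insert e y) y cs" if "e \<notin> y" for e cs
   using cover_chain_subset[of "insert e y" y cs] that by auto
  then have "as = []" "bs = []" using zs zs' True by (auto simp: covers_iff)
  then show ?thesis using zs zs' by simp
 next
  case False
  obtain e where a: "as \<noteq> []" "e \<notin> x" "hd as = insert e x" "insert e x \<in> P" "cover_chain P (insert e x) y as"
   using zs(2) False unfolding covers_iff by metis
  obtain f where b: "bs \<noteq> []" "f \<notin> x" "hd bs = insert f x" "insert f x \<in> P" "cover_chain P (insert f x) y bs"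
   using zs'(2) False unfolding covers_iff by metis
  have e: "e \<in> y" and f: "f \<in> y" using cover_chain_subset[OF a(5)] cover_chain_subset[OF b(5)] by auto
  have fin: "finite (y - x)" using finite_mem[OF xy(3)] by simp
  have less_e: "card (y - insert e x) < card (y - x)" and less_f: "card (y - insert f x) < card (y - x)"
   by (rule psubset_card_mono[OF fin], use e f a(2) b(2) in blast)+
  have va: "Fc x (insert e x) v \<in> carrier (Fo (insert e x))"
   and vb: "Fc x (insert f x) v \<in> carrier (Fo (insert f x))"
   using mod_hom_closed[OF Fc less.prems(3)] a b by auto
  have cca: "chain_composite Fo Fc zs v = chain_composite Fo Fc as (Fc x (insert e x) v)"
   using zs(1) a less.prems(3) by (cases as) (auto simp: compose_def)
  have ccb: "chain_composite Fo Fc zs' v = chain_composite Fo Fc bs (Fc x (insert f x) v)"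
   using zs'(1) b less.prems(3) by (cases bs) (auto simp: compose_def)
  show ?thesis
  proof (cases "e = f")
   case True
   then show ?thesis using cca ccb less.hyps[OF less_e a(5) _ va] b by auto
  next
   case ne: False
   \<comment> \<open>The meeting point of the two chains; the induction hypothesis is used above
     \<open>insert e x\<close> and above \<open>insert f x\<close>, and \<open>diamond\<close> in
     between.\<close>
   let ?w = "insert e (insert f x)"
   have w: "?w \<in> P" "?w \<subseteq> y" using e f xy down[of y ?w] by auto
   obtain cs where cs: "cover_chain P ?w y cs" using cover_chain_exists[OF xy(3) w(2)] by blast
   then have hd: "cs \<noteq> []" "hd cs = ?w" by (auto simp: cover_chain_def)
   have ce: "cover_chain P (insert e x) y (insert e x # cs)"
    using a(4) w(1) cs hd ne b(2) by (auto simp: cover_chain_Cons covers_iff insert_commute)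
   have cf: "cover_chain P (insert f x) y (insert f x # cs)"
    using b(4) w(1) cs hd ne a(2) by (auto simp: cover_chain_Cons covers_iff)
   have "chain_composite Fo Fc zs v = chain_composite Fo Fc (insert e x # cs) (Fc x (insert e x) v)"
    unfolding cca by (rule less.hyps[OF less_e a(5) ce va])
   also have "\<dots> = chain_composite Fo Fc cs (Fc (insert e x) ?w (Fc x (insert e x) v))"
    using hd va by (cases cs) (auto simp: compose_def)
   also have "\<dots> = chain_composite Fo Fc cs (Fc (insert f x) ?w (Fc x (insert f x) v))"
    by (simp add: diamond[OF w(1) a(2) b(2) ne less.prems(3)])
   also have "\<dots> = chain_composite Fo Fc (insert f x # cs) (Fc x (insert f x) v)"
    using hd vb by (cases cs) (auto simp: compose_def)
   also have "\<dots> = chain_composite Fo Fc zs' v"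
    unfolding ccb by (rule less.hyps[OF less_f cf b(5) vb])
   finally show ?thesis .
  qed
 qed
qed

lemma Fm_eq:
 assumes "cover_chain P x y zs" "v \<in> carrier (Fo x)"
 shows "Fm x y v = chain_composite Fo Fc zs v"
 unfolding Fm_def
 by (rule chain_composite_unique[OF someI[of "cover_chain P x y", OF assms(1)] assms])

lemma Fm_hom: "[|y \<in> P; x \<subseteq> y|] ==> Fm x y \<in> mod_hom R (Fo x) (Fo y)"
 unfolding Fm_def by (rule chain_composite_hom[OF someI_ex[OF cover_chain_exists]])

lemma Fm_refl: "[|x \<in> P; v \<in> carrier (Fo x)|] ==> Fm x x v = v"
 by (subst Fm_eq[of x x "[x]"]) (auto simp: cover_chain_Cons)

lemma Fm_step:
 assumes "insert e x \<subseteq> y" "y \<in> P" "e \<notin> x" "v \<in> carrier (Fo x)"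
 shows "Fm x y v = Fm (insert e x) y (Fc x (insert e x) v)"
proof -
 obtain zs where zs: "cover_chain P (insert e x) y zs" using cover_chain_exists assms by blast
 then have hd: "zs \<noteq> []" "hd zs = insert e x" by (auto simp: cover_chain_def)
 have P: "insert e x \<in> P" "x \<in> P" using assms down[of y] by auto
 then have "cover_chain P x y (x # zs)" using zs hd assms by (auto simp: cover_chain_Cons covers_iff)
 then have "Fm x y v = chain_composite Fo Fc (x # zs) v" by (rule Fm_eq[OF _ assms(4)])
 also have "\<dots> = chain_composite Fo Fc zs (Fc x (insert e x) v)"
  using hd assms(4) by (cases zs) (auto simp: compose_def)
 also have "\<dots> = Fm (insert e x) y (Fc x (insert e x) v)"
  by (rule Fm_eq[symmetric, OF zs mod_hom_closed[OF Fc[OF P(1) assms(3)] assms(4)]])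
 finally show ?thesis .
qed

lemma Fm_cover: "[|insert e x \<in> P; e \<notin> x; v \<in> carrier (Fo x)|] ==> Fm x (insert e x) v = Fc x (insert e x) v"
 using mod_hom_closed[OF Fc] by (subst Fm_step[of e x]) (auto simp: Fm_refl)

lemma Fm_trans:
 "[|z \<in> P; y \<subseteq> z; x \<subseteq> y; v \<in> carrier (Fo x)|] ==> Fm y z (Fm x y v) = Fm x z v"
proof (induction "card (y - x)" arbitrary: x v)
 case 0
 then have "y \<in> P" using down by blast
 then have "x = y" using 0 finite_mem[of y] by auto
 then show ?case using 0 \<open>y \<in> P\<close> by (simp add: Fm_refl)
next
 case (Suc n)
 have yP: "y \<in> P" using Suc down by blast
 obtain e where e: "e \<in> y" "e \<notin> x" using Suc.hyps(2) by (metis Diff_iff card.empty ex_in_conv nat.distinct(1))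
 have P: "insert e x \<in> P" using e Suc.prems yP down[of y "insert e x"] by auto
 have "y - insert e x = (y - x) - {e}" by auto
 then have n: "n = card (y - insert e x)" using Suc.hyps(2) e finite_mem[OF yP] by simp
 have c: "Fc x (insert e x) v \<in> carrier (Fo (insert e x))"
  by (rule mod_hom_closed[OF Fc[OF P e(2)] Suc.prems(4)])
 have "Fm y z (Fm x y v) = Fm y z (Fm (insert e x) y (Fc x (insert e x) v))"
  using Fm_step[of e x y v] e Suc.prems yP by simp
 also have "\<dots> = Fm (insert e x) z (Fc x (insert e x) v)"
  by (rule Suc.hyps(1)[OF n Suc.prems(1,2) _ c]) (use e Suc.prems in auto)
 also have "\<dots> = Fm x z v"
  by (rule Fm_step[symmetric]) (use e Suc.prems in auto)
 finally show ?case .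
qed

end

text \<open>Naturality need only be checked when one element is added. Injectivity of
  \<open>g\<close> ensures that a new element is sent to a new element, so that single steps go to
  single steps.\<close>

lemma cover_functor_natural:
 assumes F: "cover_functor R P Fo Fc" and F': "cover_functor R P' Fo' Fc'"
  and g: "inj_on g (\<Union>P)" and im: "\<And>x. x \<in> P ==> g ` x \<in> P'"
  and sgg: "\<And>x. x \<in> P ==> sgg x \<in> mod_hom R (Fo x) (Fo' (g ` x))"
  and nat: "\<And>x e v. [|insert e x \<in> P; e \<notin> x; v \<in> carrier (Fo x)|] ==>
   sgg (insert e x) (Fc x (insert e x) v) = Fc' (g ` x) (insert (g e) (g ` x)) (sgg x v)"
  and xy: "y \<in> P" "x \<subseteq> y" "v \<in> carrier (Fo x)"
 shows "sgg y (cover_functor.Fm P Fo Fc x y v) = cover_functor.Fm P' Fo' Fc' (g ` x) (g ` y) (sgg x v)"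
proof -
 interpret F: cover_functor R P Fo Fc by fact
 interpret F': cover_functor R P' Fo' Fc' by fact
 show ?thesis using xy
 proof (induction "card (y - x)" arbitrary: x v)
  case 0
  then have "x = y" using F.finite_mem[of y] by auto
  then show ?case using 0 mod_hom_closed[OF sgg] im by (simp add: F.Fm_refl F'.Fm_refl)
 next
  case (Suc n)
  obtain e where e: "e \<in> y" "e \<notin> x" using Suc.hyps(2) by (metis Diff_iff card.empty ex_in_conv nat.distinct(1))
  have P: "insert e x \<in> P" "x \<in> P" using e Suc.prems F.down[of y] by auto
  have ge: "g e \<notin> g ` x"
  proof
   assume "g e \<in> g ` x"
   then obtain e' where "e' \<in> x" "g e = g e'" by auto
   then show False using g e P(1) by (metis UnionI insertI1 insertI2 inj_onD)
  qed
  have "y - insert e x = (y - x) - {e}" by auto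
  then have n: "n = card (y - insert e x)" using Suc.hyps(2) e F.finite_mem[OF \<open>y \<in> P\<close>] by simp
  have c: "Fc x (insert e x) v \<in> carrier (Fo (insert e x))"
   by (rule mod_hom_closed[OF F.Fc[OF P(1) e(2)] Suc.prems(3)])
  have "sgg y (F.Fm x y v) = sgg y (F.Fm (insert e x) y (Fc x (insert e x) v))"
   using F.Fm_step[of e x y v] e Suc.prems by simp
  also have "\<dots> = F'.Fm (g ` insert e x) (g ` y) (sgg (insert e x) (Fc x (insert e x) v))"
   by (rule Suc.hyps(1)[OF n Suc.prems(1) _ c]) (use e Suc.prems in auto)
  also have "\<dots> = F'.Fm (insert (g e) (g ` x)) (g ` y) (Fc' (g ` x) (insert (g e) (g ` x)) (sgg x v))"
   using nat[OF P(1) e(2) Suc.prems(3)] by simp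
  also have "\<dots> = F'.Fm (g ` x) (g ` y) (sgg x v)"
   by (rule F'.Fm_step[symmetric]) (use e Suc.prems ge im mod_hom_closed[OF sgg[OF P(2)]] in auto)
  finally show ?case .
 qed
qed

section \<open>The chain complex of a functor on a poset\<close>

locale poset_functor =
 fixes R :: "'r ring" and P :: "'e set set" and Fo :: "'e set => ('r, 't) module"
  and Fm :: "'e set => 'e set => 't => 't"
 assumes R: "cring R" and finite_P: "finite P"
  and Fo: "x \<in> P ==> Module.module R (Fo x)"
  and Fm: "[|x \<in> P; y \<in> P; x \<subseteq> y|] ==> Fm x y \<in> mod_hom R (Fo x) (Fo y)"
  and Fm_comp: "[|x \<in> P; y \<in> P; z \<in> P; x \<subseteq> y; y \<subseteq> z; v \<in> carrier (Fo x)|] ==> Fm y z (Fm x y v) = Fm x z v"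

section \<open>Deleting entries of a list, with the simplicial identity\<close>

lemma length_del_nth: "i < length xs ==> length (del_nth i xs) = length xs - 1"
 by (simp add: del_nth_def)

lemma nth_del_nth:
 "[|i < length xs; j < length xs - 1|] ==> del_nth i xs ! j = (if j < i then xs ! j else xs ! Suc j)"
 by (auto simp: del_nth_def nth_append)

lemma del_nth_0: "del_nth 0 xs = tl xs"
 by (simp add: del_nth_def drop_Suc)

lemma set_del_nth: "set (del_nth i xs) \<subseteq> set xs"
 by (auto simp: del_nth_def dest: in_set_takeD in_set_dropD)

lemma del_nth_Suc_Cons: "del_nth (Suc i) (x # xs) = x # del_nth i xs"
 by (simp add: del_nth_def)

lemma del_nth_append: "i < length xs ==> del_nth i (xs @ ys) = del_nth i xs @ ys"
 by (simp add: del_nth_def)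

lemma sorted_wrt_del_nth: "sorted_wrt r xs ==> sorted_wrt r (del_nth i xs)"
proof (induction xs arbitrary: i)
 case (Cons x xs)
 then show ?case
  by (cases i) (auto simp: del_nth_0 del_nth_Suc_Cons dest: subsetD[OF set_del_nth])
qed (simp add: del_nth_def)

lemma del_nth_del_nth:
 assumes "i < j" "j < length xs"
 shows "del_nth i (del_nth j xs) = del_nth (j - 1) (del_nth i xs)"
proof (rule nth_equalityI)
 show "length (del_nth i (del_nth j xs)) = length (del_nth (j - 1) (del_nth i xs))"
  using assms by (simp add: length_del_nth)
 fix k assume "k < length (del_nth i (del_nth j xs))"
 then have "k < length xs - 2" using assms by (simp add: length_del_nth)
 then show "del_nth i (del_nth j xs) ! k = del_nth (j - 1) (del_nth i xs) ! k"
  using assms by (auto simp: nth_del_nth length_del_nth)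
qed

lemma hd_del_nth: "[|0 < i; xs \<noteq> []|] ==> hd (del_nth i xs) = hd xs"
 by (cases xs; cases i) (auto simp: del_nth_Suc_Cons)

lemma finite_poset_chains: "finite P ==> finite (poset_chains P k)"
 by (rule finite_subset[OF _ finite_lists_length_eq[of P "nat (k + 1)"]]) (auto simp: poset_chains_def)

lemma poset_chains_del_nth:
 assumes "xs \<in> poset_chains P (k + 1)" "i < length xs" "0 \<le> k"
 shows "del_nth i xs \<in> poset_chains P k"
proof -
 have "length (del_nth i xs) = length xs - 1" by (rule length_del_nth[OF assms(2)])
 then have "int (length (del_nth i xs)) = k + 1" "del_nth i xs \<noteq> []"
  using assms by (auto simp: poset_chains_def)
 then show ?thesis
  using assms(1) set_del_nth[of i xs] sorted_wrt_del_nth by (auto simp: poset_chains_def)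
qed

lemma poset_chains_hd: "xs \<in> poset_chains P k ==> hd xs \<in> P"
 by (auto simp: poset_chains_def)

lemma poset_chains_nth:
 assumes "xs \<in> poset_chains P k" "i \<le> j" "j < length xs"
 shows "xs ! i \<in> P" "xs ! j \<in> P" "xs ! i \<subseteq> xs ! j"
proof -
 show "xs ! i \<in> P" "xs ! j \<in> P" using assms by (auto simp: poset_chains_def subset_iff)
 show "xs ! i \<subseteq> xs ! j"
  using assms by (cases "i = j") (auto simp: poset_chains_def sorted_wrt_iff_nth_less)
qed

context
 fixes R :: "'r ring" and I :: "'i set" and N :: "'i => ('r, 'm) module"
  and P :: "('r, 'p) module" and g :: "'i => 'm => 'p"
 assumes R: "cring R" and N: "\<And>i. i \<in> I ==> Module.module R (N i)" and P: "Module.module R P"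
  and I: "finite I" and g: "\<And>i. i \<in> I ==> g i \<in> mod_hom R (N i) P"
begin

text \<open>\<open>S_diff\<close> is written as a sum over all chains of maps out of the single
  summands; over a finite index set this is the map that these maps induce on the direct
  sum.\<close>

lemma dsum_copair_hom: "(%c. \<Oplus>\<^bsub>P\<^esub>i\<in>I. g i (c i)) \<in> mod_hom R (dsum I N) P"
proof (rule mod_hom_pointwise_finsum[OF module_dsum[OF R N] P I])
 fix i assume i: "i \<in> I"
 show "(%c. g i (c i)) \<in> mod_hom R (dsum I N) P"
  using mod_hom_comp[of "%c. c i" R "dsum I N" "N i", OF dsum_eval_hom[OF R N i] g[OF i]] by simp
qed

lemma dsum_copair_in:
 assumes i: "i \<in> I" and v: "v \<in> carrier (N i)"
 shows "(\<Oplus>\<^bsub>P\<^esub>k\<in>I. g k (dsum_in I N i v k)) = g i v"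
proof -
 interpret P: Module.module R P by (rule P)
 have cl: "g i v \<in> carrier P" by (rule mod_hom_closed[OF g[OF i] v])
 have "(\<Oplus>\<^bsub>P\<^esub>k\<in>I. g k (dsum_in I N i v k)) = (\<Oplus>\<^bsub>P\<^esub>k\<in>I. if i = k then g i v else \<zero>\<^bsub>P\<^esub>)"
  by (rule P.M.finsum_cong') (use cl in "auto simp: dsum_in_def mod_hom_zero[OF g N P]")
 also have "\<dots> = g i v" using P.M.finsum_singleton[OF i I, of "%_. g i v"] cl by simp
 finally show ?thesis .
qed

end

lemma altsum_split:
 assumes N: "Module.module R N" and f: "\<And>i. i \<le> k ==> f i \<in> carrier N"
 shows "altsum R N k f = f 0 \<oplus>\<^bsub>N\<^esub> (\<Oplus>\<^bsub>N\<^esub>i\<in>{1..k}. sgn_pow R i \<odot>\<^bsub>N\<^esub> f i)"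
proof -
 interpret N: Module.module R N by fact
 have "{..k} = insert 0 {1..k}" by auto
 then have "altsum R N k f = sgn_pow R 0 \<odot>\<^bsub>N\<^esub> f 0 \<oplus>\<^bsub>N\<^esub> (\<Oplus>\<^bsub>N\<^esub>i\<in>{1..k}. sgn_pow R i \<odot>\<^bsub>N\<^esub> f i)"
  unfolding altsum_def using f by (simp only:) (rule N.M.finsum_insert, auto simp: sgn_pow_closed'[OF N])
 then show ?thesis using f by simp
qed

lemma hd_tl_nth: "1 < length xs ==> hd (tl xs) = xs ! 1"
 by (cases xs; cases "tl xs") auto

lemma map_del_nth: "map f (del_nth i xs) = del_nth i (map f xs)"
 by (simp add: del_nth_def take_map drop_map)

section \<open>The chain modules of a functor as a simplicial module\<close>

context poset_functor
begin

abbreviation S :: "int => ('r, 'e set list => 't) module" where "S \<equiv> S_mod P Fo"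
abbreviation dS :: "int => ('e set list => 't) => 'e set list => 't" where "dS \<equiv> S_diff R P Fo Fm"

lemma module_Fo_hd: "xs \<in> poset_chains P k ==> Module.module R (Fo (hd xs))"
 by (rule Fo[OF poset_chains_hd])

lemma module_S: "Module.module R (S k)"
 unfolding S_mod_def by (rule module_dsum[OF R module_Fo_hd])

lemma S_elem_hom: "xs \<in> poset_chains P k ==> (%v. S_elem P Fo k v xs) \<in> mod_hom R (Fo (hd xs)) (S k)"
 unfolding S_elem_def S_mod_def
 using dsum_in_hom[of R "poset_chains P k" "%xs. Fo (hd xs)", OF R module_Fo_hd] by simp

lemma S_elem_closed:
 "[|xs \<in> poset_chains P k; v \<in> carrier (Fo (hd xs))|] ==> S_elem P Fo k v xs \<in> carrier (S k)"
 using mod_hom_closed[OF S_elem_hom] by simp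

lemma S_hom_ext:
 assumes "Module.module R N" "f \<in> mod_hom R (S k) N" "g \<in> mod_hom R (S k) N"
  and "\<And>xs v. [|xs \<in> poset_chains P k; v \<in> carrier (Fo (hd xs))|] ==> f (S_elem P Fo k v xs) = g (S_elem P Fo k v xs)"
  and "c \<in> carrier (S k)"
 shows "f c = g c"
 using dsum_hom_ext[of R "poset_chains P k" "%xs. Fo (hd xs)" N f g c, OF R module_Fo_hd] assms
 by (simp add: S_mod_def S_elem_def)

text \<open>The differential treats the deletion of the first entry apart because it moves the
  coefficient. As a face map it differs from the others only in the coefficient map.\<close>

definition S_face :: "int => nat => ('e set list => 't) => 'e set list => 't"
 where "S_face k i = dmap (poset_chains P k) (%xs. Fo (hd xs)) (poset_chains P (k - 1)) (%xs. Fo (hd xs))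
  (del_nth i) (%xs v. if i = 0 then Fm (xs ! 0) (xs ! 1) v else v)"

lemma S_face_coeff_hom:
 assumes "1 \<le> k" "int i \<le> k" "xs \<in> poset_chains P k"
 shows "(%v. if i = 0 then Fm (xs ! 0) (xs ! 1) v else v) \<in> mod_hom R (Fo (hd xs)) (Fo (hd (del_nth i xs)))"
proof -
 have len: "int (length xs) = k + 1" "xs \<noteq> []" using assms(3) by (auto simp: poset_chains_def)
 show ?thesis
 proof (cases "i = 0")
  case True
  have "hd xs = xs ! 0" "hd (tl xs) = xs ! 1"
   using len assms(1) by (simp_all add: hd_conv_nth hd_tl_nth)
  then show ?thesis
   using True Fm[of "xs ! 0" "xs ! 1"] poset_chains_nth[OF assms(3), of 0 1] len assms(1)
   by (simp add: del_nth_0)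
 next
  case False
  then show ?thesis
   using hd_del_nth[of i xs] len mod_hom_id[OF module_Fo_hd[OF assms(3)]] by simp
 qed
qed

lemma
 assumes k: "1 \<le> k" "int i \<le> k"
 shows S_face_hom: "S_face k i \<in> mod_hom R (S k) (S (k - 1))"
  and S_face_elem: "[|xs \<in> poset_chains P k; v \<in> carrier (Fo (hd xs))|] ==>
   S_face k i (S_elem P Fo k v xs) =
   S_elem P Fo (k - 1) (if i = 0 then Fm (xs ! 0) (xs ! 1) v else v) (del_nth i xs)"
proof -
 show "S_face k i \<in> mod_hom R (S k) (S (k - 1))"
  unfolding S_face_def S_mod_def
  by (rule dmap_hom[OF R module_Fo_hd module_Fo_hd finite_poset_chains[OF finite_P]])
   (use S_face_coeff_hom[OF k] in auto)
 show "[|xs \<in> poset_chains P k; v \<in> carrier (Fo (hd xs))|] ==>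
   S_face k i (S_elem P Fo k v xs) =
   S_elem P Fo (k - 1) (if i = 0 then Fm (xs ! 0) (xs ! 1) v else v) (del_nth i xs)"
  unfolding S_face_def S_elem_def
  by (rule dmap_in[OF R module_Fo_hd module_Fo_hd finite_poset_chains[OF finite_P]])
   (use S_face_coeff_hom[OF k] in auto)
qed

text \<open>Brings the differential, defined with its first term written separately, into the form
  to which the general facts on alternating sums apply.\<close>

lemma S_diff_altsum:
 assumes k: "1 \<le> k" and c: "c \<in> carrier (S k)"
 shows "dS k c = altsum R (S (k - 1)) (nat k) (%i. S_face k i c)"
proof -
 interpret S: Module.module R "S (k - 1)" by (rule module_S)
 define g where "g xs v = S_elem P Fo (k - 1) (Fm (xs ! 0) (xs ! 1) v) (tl xs) \<oplus>\<^bsub>S (k - 1)\<^esub>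
    (\<Oplus>\<^bsub>S (k - 1)\<^esub>i\<in>{1..nat k}. sgn_pow R i \<odot>\<^bsub>S (k - 1)\<^esub> S_elem P Fo (k - 1) v (del_nth i xs))" for xs v
 have g: "g xs v = altsum R (S (k - 1)) (nat k) (%i. S_face k i (S_elem P Fo k v xs))"
  if "xs \<in> poset_chains P k" "v \<in> carrier (Fo (hd xs))" for xs v
 proof -
  have cl: "S_face k i (S_elem P Fo k v xs) \<in> carrier (S (k - 1))" if "i \<le> nat k" for i
   by (rule mod_hom_closed[OF S_face_hom[OF k] S_elem_closed]) (use that k \<open>xs \<in> _\<close> \<open>v \<in> _\<close> in auto)
  have "(\<Oplus>\<^bsub>S (k - 1)\<^esub>i\<in>{1..nat k}. sgn_pow R i \<odot>\<^bsub>S (k - 1)\<^esub> S_face k i (S_elem P Fo k v xs)) =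
   (\<Oplus>\<^bsub>S (k - 1)\<^esub>i\<in>{1..nat k}. sgn_pow R i \<odot>\<^bsub>S (k - 1)\<^esub> S_elem P Fo (k - 1) v (del_nth i xs))"
  proof (rule S.M.finsum_cong')
   fix i assume "i \<in> {1..nat k}"
   then have i: "i \<noteq> 0" "i \<le> nat k" "int i \<le> k" by auto
   have "S_face k i (S_elem P Fo k v xs) = S_elem P Fo (k - 1) v (del_nth i xs)"
    using S_face_elem[OF k i(3) that] i(1) by simp
   then show "sgn_pow R i \<odot>\<^bsub>S (k - 1)\<^esub> S_face k i (S_elem P Fo k v xs) =
     sgn_pow R i \<odot>\<^bsub>S (k - 1)\<^esub> S_elem P Fo (k - 1) v (del_nth i xs)" by simp
  next
   show "(%i. sgn_pow R i \<odot>\<^bsub>S (k - 1)\<^esub> S_elem P Fo (k - 1) v (del_nth i xs)) \<in> {1..nat k} \<rightarrow> carrier (S (k - 1))"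
   proof
    fix i assume "i \<in> {1..nat k}"
    then have i: "i \<noteq> 0" "i \<le> nat k" "int i \<le> k" by auto
    have "S_elem P Fo (k - 1) v (del_nth i xs) \<in> carrier (S (k - 1))"
     using S_face_elem[OF k i(3) that] i(1) cl[OF i(2)] by simp
    then show "sgn_pow R i \<odot>\<^bsub>S (k - 1)\<^esub> S_elem P Fo (k - 1) v (del_nth i xs) \<in> carrier (S (k - 1))"
     by (simp add: sgn_pow_closed'[OF module_S])
   qed
  qed simp
  moreover have "S_face k 0 (S_elem P Fo k v xs) = S_elem P Fo (k - 1) (Fm (xs ! 0) (xs ! 1) v) (tl xs)"
   using S_face_elem[OF k _ that, of 0] k by (simp add: del_nth_0)
  ultimately show ?thesis
   unfolding g_def using altsum_split[OF module_S, of "nat k" "%i. S_face k i (S_elem P Fo k v xs)"] cl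
   by simp
 qed
 have face: "(%c. altsum R (S (k - 1)) (nat k) (%i. S_face k i c)) \<in> mod_hom R (S k) (S (k - 1))"
  by (rule altsum_hom[OF module_S module_S S_face_hom]) (use k in auto)
 have g_hom: "g xs \<in> mod_hom R (Fo (hd xs)) (S (k - 1))" if xs: "xs \<in> poset_chains P k" for xs
  by (rule mod_hom_cong[OF mod_hom_comp[OF S_elem_hom[OF xs] face] module_Fo_hd[OF xs]]) (rule g[OF xs])
 have dS: "dS k = (%c. \<Oplus>\<^bsub>S (k - 1)\<^esub>xs\<in>poset_chains P k. g xs (c xs))"
  using k by (auto simp: S_diff_def g_def Let_def)
 show ?thesis
 proof (rule S_hom_ext[where f = "dS k", OF module_S _ face _ c])
  show "dS k \<in> mod_hom R (S k) (S (k - 1))"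
   unfolding dS S_mod_def[of P Fo k]
   by (rule dsum_copair_hom[OF R module_Fo_hd module_S finite_poset_chains[OF finite_P] g_hom])
  fix xs v assume xv: "xs \<in> poset_chains P k" "v \<in> carrier (Fo (hd xs))"
  have "dS k (S_elem P Fo k v xs) = g xs v"
   unfolding dS S_elem_def
   by (rule dsum_copair_in[OF R module_Fo_hd module_S finite_poset_chains[OF finite_P] g_hom]) (use xv in auto)
  then show "dS k (S_elem P Fo k v xs) = altsum R (S (k - 1)) (nat k) (%i. S_face k i (S_elem P Fo k v xs))"
   by (simp add: g[OF xv])
 qed
qed

lemma S_diff_nonpos: "k \<le> 0 ==> dS k c = \<zero>\<^bsub>S (k - 1)\<^esub>"
 by (simp add: S_diff_def Let_def)

lemma S_diff_hom: "dS k \<in> mod_hom R (S k) (S (k - 1))"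
proof (cases "1 \<le> k")
 case True
 have "(%c. altsum R (S (k - 1)) (nat k) (%i. S_face k i c)) \<in> mod_hom R (S k) (S (k - 1))"
  by (rule altsum_hom[OF module_S module_S S_face_hom]) (use True in auto)
 then show ?thesis by (rule mod_hom_cong[OF _ module_S S_diff_altsum[OF True]])
next
 case False
 then have "dS k = (%c. \<zero>\<^bsub>S (k - 1)\<^esub>)" by (auto simp: S_diff_nonpos)
 then show ?thesis using mod_hom_const_zero[OF module_S] by simp
qed

lemma S_face_comm:
 assumes k: "1 \<le> k" and ij: "i < j" "int j \<le> k + 1" and c: "c \<in> carrier (S (k + 1))"
 shows "S_face k i (S_face (k + 1) j c) = S_face k (j - 1) (S_face (k + 1) i c)"
proof (rule S_hom_ext[where f = "%c. S_face k i (S_face (k + 1) j c)"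
   and g = "%c. S_face k (j - 1) (S_face (k + 1) i c)", OF module_S _ _ _ c])
 have h: "S_face (k + 1) j \<in> mod_hom R (S (k + 1)) (S k)" "S_face (k + 1) i \<in> mod_hom R (S (k + 1)) (S k)"
  using S_face_hom[of "k + 1" i] S_face_hom[of "k + 1" j] k ij by auto
 show "(%c. S_face k i (S_face (k + 1) j c)) \<in> mod_hom R (S (k + 1)) (S (k - 1))"
  by (rule mod_hom_comp[OF h(1) S_face_hom]) (use k ij in auto)
 show "(%c. S_face k (j - 1) (S_face (k + 1) i c)) \<in> mod_hom R (S (k + 1)) (S (k - 1))"
  by (rule mod_hom_comp[OF h(2) S_face_hom]) (use k ij in auto)
 fix xs v assume xs: "xs \<in> poset_chains P (k + 1)" and v: "v \<in> carrier (Fo (hd xs))"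
 have len: "int (length xs) = k + 2" "xs \<noteq> []" using xs by (auto simp: poset_chains_def)
 have del: "del_nth l xs \<in> poset_chains P k" if "l \<le> j" for l
  by (rule poset_chains_del_nth[OF xs]) (use k ij len that in auto)
 have hd: "hd xs = xs ! 0" using len by (simp add: hd_conv_nth)
 let ?v = "if i = 0 then Fm (xs ! 0) (xs ! 1) v else v"
 have v': "?v \<in> carrier (Fo (hd (del_nth i xs)))"
  using mod_hom_closed[OF S_face_coeff_hom[of "k + 1" i xs] v] xs k ij by simp
 have vj: "v \<in> carrier (Fo (hd (del_nth j xs)))" using v hd_del_nth[of j xs] ij len by simp
 have "S_face k i (S_face (k + 1) j (S_elem P Fo (k + 1) v xs)) = S_face k i (S_elem P Fo k v (del_nth j xs))"
  using S_face_elem[of "k + 1" j xs v] xs v k ij by simp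
 also have "\<dots> = S_elem P Fo (k - 1) (if i = 0 then Fm (del_nth j xs ! 0) (del_nth j xs ! 1) v else v) (del_nth i (del_nth j xs))"
  by (rule S_face_elem[OF k _ del vj]) (use ij in auto)
 also have "del_nth i (del_nth j xs) = del_nth (j - 1) (del_nth i xs)"
  by (rule del_nth_del_nth) (use ij len in auto)
 also have "(if i = 0 then Fm (del_nth j xs ! 0) (del_nth j xs ! 1) v else v) =
  (if j - 1 = 0 then Fm (del_nth i xs ! 0) (del_nth i xs ! 1) ?v else ?v)"
 \<comment> \<open>The coefficient is moved twice only if the first two entries are deleted; this is
   where functoriality of \<open>Fm\<close> enters.\<close>
 proof (cases "j = 1")
  case True
  have "Fm (xs ! 1) (xs ! 2) (Fm (xs ! 0) (xs ! 1) v) = Fm (xs ! 0) (xs ! 2) v"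
   using poset_chains_nth[OF xs, of 0 1] poset_chains_nth[OF xs, of 1 2] len k v hd
   by (intro Fm_comp) auto
  then show ?thesis using True ij k len by (simp add: nth_del_nth numeral_2_eq_2)
 next
  case False
  then show ?thesis using ij k len by (simp add: nth_del_nth)
 qed
 also have "S_elem P Fo (k - 1) \<dots> (del_nth (j - 1) (del_nth i xs)) =
   S_face k (j - 1) (S_elem P Fo k ?v (del_nth i xs))"
  by (rule S_face_elem[OF k _ del v', symmetric]) (use ij in auto)
 also have "\<dots> = S_face k (j - 1) (S_face (k + 1) i (S_elem P Fo (k + 1) v xs))"
  using S_face_elem[of "k + 1" i xs v] xs v k ij by simp
 finally show "S_face k i (S_face (k + 1) j (S_elem P Fo (k + 1) v xs)) =
  S_face k (j - 1) (S_face (k + 1) i (S_elem P Fo (k + 1) v xs))" .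
qed

lemma chain_complex_S: "chain_complex R S dS"
 unfolding chain_complex_def
proof (intro conjI allI ballI module_S S_diff_hom)
 fix k x assume x: "x \<in> carrier (S (k + 1))"
 show "dS k (dS (k + 1) x) = \<zero>\<^bsub>S (k - 1)\<^esub>"
 proof (cases "1 \<le> k")
  case True
  have cl: "S_face (k + 1) j x \<in> carrier (S k)" if "j \<le> Suc (nat k)" for j
   using mod_hom_closed[OF S_face_hom x, of j] True that by auto
  have "dS (k + 1) x \<in> carrier (S k)" using mod_hom_closed[OF S_diff_hom x] by simp
  moreover have "dS (k + 1) x = altsum R (S k) (Suc (nat k)) (%j. S_face (k + 1) j x)"
   using S_diff_altsum[OF _ x] True by (simp add: Suc_nat_eq_nat_zadd1 add.commute)
  moreover have "altsum R (S (k - 1)) (nat k) (%i. S_face k i (altsum R (S k) (Suc (nat k)) (%j. S_face (k + 1) j x))) = \<zero>\<^bsub>S (k - 1)\<^esub>"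
  proof (rule altsum_altsum[where D = "S_face (k + 1)" and D' = "S_face k", OF module_S module_S])
   show "S_face (k + 1) j x \<in> carrier (S k)" if "j \<le> Suc (nat k)" for j by (rule cl[OF that])
   show "S_face k i \<in> mod_hom R (S k) (S (k - 1))" if "i \<le> nat k" for i
    using S_face_hom True that by simp
   show "S_face k i (S_face (k + 1) j x) = S_face k (j - 1) (S_face (k + 1) i x)"
    if "i < j" "j \<le> Suc (nat k)" for i j
    using S_face_comm[OF True that(1) _ x] that True by auto
  qed
  ultimately show ?thesis using S_diff_altsum[OF True] by simp
 next
  case False
  then show ?thesis by (simp add: S_diff_nonpos)
 qed
qed

end

section \<open>Chain maps induced by a map of posets with a natural map of coefficients\<close>

definition S_map ::
 "'e set set => ('e set => ('r, 't) module) => 'd set set => ('d set => ('r, 's) module) =>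
  ('e => 'd) => ('e set => 't => 's) => int => ('e set list => 't) => 'd set list => 's"
 where "S_map P Fo P' Fo' g sgg k = dmap (poset_chains P k) (%xs. Fo (hd xs))
  (poset_chains P' k) (%xs. Fo' (hd xs)) (map ((`) g)) (%xs. sgg (hd xs))"

lemma poset_chains_map:
 assumes "xs \<in> poset_chains P k" "\<And>x. x \<in> P ==> g ` x \<in> P'"
 shows "map ((`) g) xs \<in> poset_chains P' k"
 using assms by (auto simp: poset_chains_def sorted_wrt_map intro: sorted_wrt_mono_rel[of _ "(\<subseteq>)"])

context
 fixes R :: "'r ring" and P :: "'e set set" and Fo :: "'e set => ('r, 't) module" and Fm
  and P' :: "'d set set" and Fo' :: "'d set => ('r, 's) module" and Fm' and g :: "'e => 'd"
  and sgg :: "'e set => 't => 's"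
 assumes F: "poset_functor R P Fo Fm" and F': "poset_functor R P' Fo' Fm'"
  and im: "\<And>x. x \<in> P ==> g ` x \<in> P'"
  and sgg: "\<And>x. x \<in> P ==> sgg x \<in> mod_hom R (Fo x) (Fo' (g ` x))"
begin

interpretation F: poset_functor R P Fo Fm by (rule F)
interpretation F': poset_functor R P' Fo' Fm' by (rule F')

lemma S_map_coeff_hom:
 assumes "xs \<in> poset_chains P k"
 shows "sgg (hd xs) \<in> mod_hom R (Fo (hd xs)) (Fo' (hd (map ((`) g) xs)))"
proof -
 have "xs \<noteq> []" using assms by (simp add: poset_chains_def)
 then show ?thesis using sgg[OF poset_chains_hd[OF assms]] by (simp add: hd_map)
qed

lemma S_map_hom: "S_map P Fo P' Fo' g sgg k \<in> mod_hom R (S_mod P Fo k) (S_mod P' Fo' k)"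
 unfolding S_map_def S_mod_def
 by (rule dmap_hom[OF F.R F.module_Fo_hd F'.module_Fo_hd finite_poset_chains[OF F.finite_P]])
  (use S_map_coeff_hom in auto)

lemma S_map_elem:
 "[|xs \<in> poset_chains P k; v \<in> carrier (Fo (hd xs))|] ==>
  S_map P Fo P' Fo' g sgg k (S_elem P Fo k v xs) = S_elem P' Fo' k (sgg (hd xs) v) (map ((`) g) xs)"
 unfolding S_map_def S_elem_def
 by (rule dmap_in[OF F.R F.module_Fo_hd F'.module_Fo_hd finite_poset_chains[OF F.finite_P]])
  (use S_map_coeff_hom in auto)

lemma S_map_chain_map:
 assumes nat: "\<And>x y v. [|x \<in> P; y \<in> P; x \<subseteq> y; v \<in> carrier (Fo x)|] ==>
   sgg y (Fm x y v) = Fm' (g ` x) (g ` y) (sgg x v)"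
 shows "chain_map R (S_mod P Fo) (S_diff R P Fo Fm) (S_mod P' Fo') (S_diff R P' Fo' Fm') (S_map P Fo P' Fo' g sgg)"
 unfolding chain_map_def
proof (intro conjI allI ballI S_map_hom)
 let ?ph = "S_map P Fo P' Fo' g sgg"
 fix k c assume c: "c \<in> carrier (S_mod P Fo (k + 1))"
 show "?ph k (S_diff R P Fo Fm (k + 1) c) = S_diff R P' Fo' Fm' (k + 1) (?ph (k + 1) c)"
 proof (cases "0 \<le> k")
  case True
  have face: "?ph k (F.S_face (k + 1) i c) = F'.S_face (k + 1) i (?ph (k + 1) c)" if i: "int i \<le> k + 1" for i
  proof (rule F.S_hom_ext[where f = "%c. ?ph k (F.S_face (k + 1) i c)"
     and g = "%c. F'.S_face (k + 1) i (?ph (k + 1) c)", OF F'.module_S _ _ _ c])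
   show "(%c. ?ph k (F.S_face (k + 1) i c)) \<in> mod_hom R (S_mod P Fo (k + 1)) (S_mod P' Fo' k)"
    using mod_hom_comp[OF F.S_face_hom[of "k + 1" i] S_map_hom[of "k + 1 - 1"]] True i by simp
   show "(%c. F'.S_face (k + 1) i (?ph (k + 1) c)) \<in> mod_hom R (S_mod P Fo (k + 1)) (S_mod P' Fo' k)"
    using mod_hom_comp[OF S_map_hom[of "k + 1"] F'.S_face_hom[of "k + 1" i]] True i by simp
   fix xs v assume xs: "xs \<in> poset_chains P (k + 1)" and v: "v \<in> carrier (Fo (hd xs))"
   have len: "int (length xs) = k + 2" "xs \<noteq> []" using xs by (auto simp: poset_chains_def)
   have hd: "hd xs = xs ! 0" "hd (tl xs) = xs ! 1"
    using len True by (simp_all add: hd_conv_nth hd_tl_nth)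
   let ?v = "if i = 0 then Fm (xs ! 0) (xs ! 1) v else v"
   have v': "?v \<in> carrier (Fo (hd (del_nth i xs)))"
    using mod_hom_closed[OF F.S_face_coeff_hom[of "k + 1" i xs] v] xs True i by simp
   have del: "del_nth i xs \<in> poset_chains P k"
    by (rule poset_chains_del_nth[OF xs]) (use True i len in auto)
   have mxs: "map ((`) g) xs \<in> poset_chains P' (k + 1)" by (rule poset_chains_map[OF xs im])
   have mv: "sgg (hd xs) v \<in> carrier (Fo' (hd (map ((`) g) xs)))"
    by (rule mod_hom_closed[OF S_map_coeff_hom[OF xs] v])
   have "sgg (hd (del_nth i xs)) ?v =
    (if i = 0 then Fm' (map ((`) g) xs ! 0) (map ((`) g) xs ! 1) (sgg (hd xs) v) else sgg (hd xs) v)"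
   proof (cases "i = 0")
    case i0: True
    have "sgg (xs ! 1) (Fm (xs ! 0) (xs ! 1) v) = Fm' (g ` (xs ! 0)) (g ` (xs ! 1)) (sgg (xs ! 0) v)"
     using poset_chains_nth[OF xs, of 0 1] len True v hd by (intro nat) auto
    then show ?thesis using i0 hd len True by (simp add: del_nth_0)
   next
    case False
    then show ?thesis using hd_del_nth[of i xs] len by simp
   qed
   then show "?ph k (F.S_face (k + 1) i (S_elem P Fo (k + 1) v xs)) =
     F'.S_face (k + 1) i (?ph (k + 1) (S_elem P Fo (k + 1) v xs))"
    using F.S_face_elem[of "k + 1" i xs v] F'.S_face_elem[of "k + 1" i "map ((`) g) xs" "sgg (hd xs) v"]
     S_map_elem[OF xs v] S_map_elem[OF del v'] xs v mxs mv True i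
    by (simp add: map_del_nth)
  qed
  have cl: "F.S_face (k + 1) i c \<in> carrier (S_mod P Fo k)" if "i \<le> nat (k + 1)" for i
   using mod_hom_closed[OF F.S_face_hom c, of i] True that by auto
  have "?ph k (S_diff R P Fo Fm (k + 1) c) = ?ph k (altsum R (S_mod P Fo k) (nat (k + 1)) (%i. F.S_face (k + 1) i c))"
   using F.S_diff_altsum[OF _ c] True by simp
  also have "\<dots> = altsum R (S_mod P' Fo' k) (nat (k + 1)) (%i. ?ph k (F.S_face (k + 1) i c))"
   by (rule mod_hom_altsum[OF S_map_hom F.module_S F'.module_S cl])
  also have "\<dots> = altsum R (S_mod P' Fo' k) (nat (k + 1)) (%i. F'.S_face (k + 1) i (?ph (k + 1) c))"
  proof (rule altsum_cong[OF F'.module_S])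
   fix i assume i: "i \<le> nat (k + 1)"
   then show "?ph k (F.S_face (k + 1) i c) = F'.S_face (k + 1) i (?ph (k + 1) c)" using True by (intro face) auto
   then show "F'.S_face (k + 1) i (?ph (k + 1) c) \<in> carrier (S_mod P' Fo' k)"
    using mod_hom_closed[OF S_map_hom cl[OF i]] by simp
  qed
  also have "\<dots> = S_diff R P' Fo' Fm' (k + 1) (?ph (k + 1) c)"
   using F'.S_diff_altsum[OF _ mod_hom_closed[OF S_map_hom c]] True by simp
  finally show ?thesis .
 next
  case False
  then show ?thesis
   using mod_hom_zero[OF S_map_hom F.module_S F'.module_S] by (simp add: F.S_diff_nonpos F'.S_diff_nonpos)
 qed
qed

end

section \<open>The coefficient functor\<close>

definition merge_fun ::
 "('r, 'a) module => ('r, 'm, 'a) bimodule => 'v set => 'v set => 'v set set => ('v set => 'a + 'm) => 'v set => 'a + 'm"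
 where "merge_fun A M al bee J t = (\<lambda>ga\<in>J. if ga = al \<union> bee then fuse A M (t al) (t bee) else t ga)"

text \<open>What the merges use of a set of components: nonempty and pairwise disjoint members. It
  guarantees that the union of two of them is a genuinely new index.\<close>

definition separated :: "'v set set => bool"
 where "separated I \<longleftrightarrow> {} \<notin> I \<and> (\<forall>ga\<in>I. \<forall>de\<in>I. ga \<inter> de \<noteq> {} --> ga = de)"

lemma separated_pi0: "separated (pi0 G x)"
 using pi0_nonempty pi0_disjoint unfolding separated_def by fast

lemma separated_disjoint: "[|separated I; ga \<in> I; de \<in> I; ga \<noteq> de|] ==> ga \<inter> de = {}"
 unfolding separated_def by blast

lemma separated_subset_Un:
 assumes "separated I" "al \<in> I" "ga \<in> I" "de \<in> I" "al \<subseteq> ga \<union> de"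
 shows "al = ga \<or> al = de"
proof -
 have "al \<noteq> {}" using assms unfolding separated_def by auto
 then obtain v where "v \<in> al" by blast
 then have "al \<inter> ga \<noteq> {} \<or> al \<inter> de \<noteq> {}" using assms(5) by blast
 then show ?thesis using assms unfolding separated_def by blast
qed

lemma separated_Un_neq:
 assumes "separated I" "al \<in> I" "bee \<in> I" "al \<noteq> bee" "ga \<in> I"
 shows "al \<union> bee \<noteq> ga"
proof
 assume "al \<union> bee = ga"
 then show False
  using separated_subset_Un[of I al ga ga] separated_subset_Un[of I bee ga ga] assms by auto
qed

lemma separated_Un_Un_neq:
 assumes "separated I" "al \<in> I" "bee \<in> I" "ga \<in> I" "de \<in> I" "al \<noteq> ga" "al \<noteq> de"
 shows "al \<union> bee \<noteq> ga \<union> de"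
 using separated_subset_Un[of I al ga de] assms by auto

context coefficients
begin

abbreviation MF :: "'v => 'v set => ('r, 'a + 'm) module" where "MF b \<equiv> (%ga. TF (b \<in> ga))"

text \<open>Each of the two fused coordinates enters linearly in the product when the other is held
  fixed; every other coordinate is carried along unchanged.\<close>

lemma merge_fun_tensor_fun:
 assumes I: "separated I" and ab: "al \<in> I" "bee \<in> I" "al \<noteq> bee" and J: "J = insert (al \<union> bee) (I - {al, bee})"
 shows "tensor_fun R I (MF b) J (MF b) (merge_fun A M al bee J)"
proof (rule tensor_funI)
 have notin: "al \<union> bee \<notin> I" using separated_Un_neq[OF I ab] by blast
 have nb: "\<not> (b \<in> al \<and> b \<in> bee)" using separated_disjoint[OF I ab] by blast
 fix t assume t: "t \<in> (\<Pi>\<^sub>E ga\<in>I. carrier (MF b ga))"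
 then have tc: "t ga \<in> carrier (MF b ga)" if "ga \<in> I" for ga using that by auto
 show "merge_fun A M al bee J t \<in> (\<Pi>\<^sub>E ga\<in>J. carrier (MF b ga))"
  using fuse_closed[OF tc[OF ab(1)] tc[OF ab(2)] nb] tc by (auto simp: merge_fun_def J)
 fix i assume i: "i \<in> I"
 show "\<exists>j\<in>J. \<exists>ka\<in>mod_hom R (MF b i) (MF b j). \<forall>u\<in>carrier (MF b i).
   merge_fun A M al bee J (t(i := u)) = (merge_fun A M al bee J t)(j := ka u)"
 proof -
  consider "i = al" | "i = bee" | "i \<noteq> al" "i \<noteq> bee" by blast
  then show ?thesis
  proof cases
   case 1
   have "(%u. fuse A M u (t bee)) \<in> mod_hom R (MF b i) (MF b (al \<union> bee))"
    using fuse_hom_left[OF tc[OF ab(2)] nb] 1 by simp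
   moreover have "merge_fun A M al bee J (t(i := u)) = (merge_fun A M al bee J t)(al \<union> bee := fuse A M u (t bee))" for u
    using 1 ab notin by (auto simp: merge_fun_def J fun_eq_iff)
   ultimately show ?thesis
    by (intro bexI[of _ "al \<union> bee"] bexI[of _ "%u. fuse A M u (t bee)"]) (simp_all add: J)
  next
   case 2
   have "(%u. fuse A M (t al) u) \<in> mod_hom R (MF b i) (MF b (al \<union> bee))"
    using fuse_hom_right[OF tc[OF ab(1)] nb] 2 by simp
   moreover have "merge_fun A M al bee J (t(i := u)) = (merge_fun A M al bee J t)(al \<union> bee := fuse A M (t al) u)" for u
    using 2 ab notin by (auto simp: merge_fun_def J fun_eq_iff)
   ultimately show ?thesis
    by (intro bexI[of _ "al \<union> bee"] bexI[of _ "%u. fuse A M (t al) u"]) (simp_all add: J)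
  next
   case 3
   then have "i \<in> J" using i J by blast
   moreover have "merge_fun A M al bee J (t(i := u)) = (merge_fun A M al bee J t)(i := u)" for u
    using 3 i notin ab \<open>i \<in> J\<close> by (auto simp: merge_fun_def fun_eq_iff)
   ultimately show ?thesis using mod_hom_id[OF module_TF] by (intro bexI[of _ i] bexI[of _ "%u. u"]) auto
  qed
 qed
qed

text \<open>Here \<open>al\<close>, \<open>bee\<close> are the tail and head components of one edge
  and \<open>ga\<close>, \<open>de\<close> those of another; the variants with suffix 1 are the
  components of each edge after the other one has been added. Edges in succession give a triple
  product, other edges act on disjoint factors.\<close>

lemma merge_fun_diamond:
 assumes I: "separated I" and mem: "al \<in> I" "bee \<in> I" "ga \<in> I" "de \<in> I"
  and ne: "al \<noteq> bee" "ga \<noteq> de" "al \<noteq> ga" "bee \<noteq> de" "\<not> (al = de \<and> ga = bee)"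
  and J1: "J1 = insert (al \<union> bee) (I - {al, bee})" and J2: "J2 = insert (ga \<union> de) (I - {ga, de})"
  and K1: "K = insert (ga1 \<union> de1) (J1 - {ga1, de1})" and K2: "K = insert (al1 \<union> bee1) (J2 - {al1, bee1})"
  and ga1: "ga1 = (if ga = bee then al \<union> bee else ga)" and de1: "de1 = (if de = al then al \<union> bee else de)"
  and al1: "al1 = (if al = de then ga \<union> de else al)" and bee1: "bee1 = (if bee = ga then ga \<union> de else bee)"
  and t: "t \<in> (\<Pi>\<^sub>E ga\<in>I. carrier (MF b ga))"
 shows "merge_fun A M ga1 de1 K (merge_fun A M al bee J1 t) = merge_fun A M al1 bee1 K (merge_fun A M ga de J2 t)"
proof (rule extensionalityI[where A = K])
 have tc: "t ze \<in> carrier (TF (b \<in> ze))" if "ze \<in> I" for ze using t that by auto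
 have assoc: "fuse A M (fuse A M (t ze) (t et)) (t thh) = fuse A M (t ze) (fuse A M (t et) (t thh))"
  if "ze \<in> I" "et \<in> I" "thh \<in> I" "ze \<noteq> et" "ze \<noteq> thh" "et \<noteq> thh" for ze et thh
  by (rule fuse_assoc[OF tc tc tc])
   (use that separated_disjoint[OF I, of ze et] separated_disjoint[OF I, of ze thh] separated_disjoint[OF I, of et thh] in auto)
 have ab: "al \<union> bee \<noteq> ze" if "ze \<in> I" for ze by (rule separated_Un_neq[OF I mem(1,2) ne(1) that])
 have cd: "ga \<union> de \<noteq> ze" if "ze \<in> I" for ze by (rule separated_Un_neq[OF I mem(3,4) ne(2) that])
 define m1 where "m1 = merge_fun A M al bee J1 t"
 define m2 where "m2 = merge_fun A M ga de J2 t"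
 have m1_ab: "m1 (al \<union> bee) = fuse A M (t al) (t bee)" and m2_cd: "m2 (ga \<union> de) = fuse A M (t ga) (t de)"
  by (simp_all add: m1_def m2_def merge_fun_def J1 J2)
 have m1: "m1 ze = t ze" if "ze \<in> J1" "ze \<noteq> al \<union> bee" for ze using that by (simp add: m1_def merge_fun_def)
 have m2: "m2 ze = t ze" if "ze \<in> J2" "ze \<noteq> ga \<union> de" for ze using that by (simp add: m2_def merge_fun_def)
 have m1_I: "m1 ze = t ze" if "ze \<in> I" "ze \<noteq> al" "ze \<noteq> bee" for ze
  by (rule m1) (use that ab[OF that(1)] in "simp_all add: J1")
 have m2_I: "m2 ze = t ze" if "ze \<in> I" "ze \<noteq> ga" "ze \<noteq> de" for ze
  by (rule m2) (use that cd[OF that(1)] in "simp_all add: J2")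
 fix et assume et: "et \<in> K"
 have L: "merge_fun A M ga1 de1 K m1 et = (if et = ga1 \<union> de1 then fuse A M (m1 ga1) (m1 de1) else m1 et)"
  and L': "merge_fun A M al1 bee1 K m2 et = (if et = al1 \<union> bee1 then fuse A M (m2 al1) (m2 bee1) else m2 et)"
  using et by (simp_all add: merge_fun_def)
 have KJ1: "et \<in> J1 \<and> et \<noteq> ga1 \<and> et \<noteq> de1" if "et \<noteq> ga1 \<union> de1" using et K1 that by blast
 have KJ2: "et \<in> J2 \<and> et \<noteq> al1 \<and> et \<noteq> bee1" if "et \<noteq> al1 \<union> bee1" using et K2 that by blast
 \<comment> \<open>The second edge starts where the first ends, or ends where the first starts, or
   the two touch no common component. The first two cases are associativity.\<close>
 consider (1) "ga = bee" "de \<noteq> al" | (2) "ga \<noteq> bee" "de = al" | (3) "ga \<noteq> bee" "de \<noteq> al" using ne by blast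
 then have "merge_fun A M ga1 de1 K m1 et = merge_fun A M al1 bee1 K m2 et"
 proof cases
  case 1
  have eqs: "ga1 = al \<union> bee" "de1 = de" "al1 = al" "bee1 = ga \<union> de" "ga1 \<union> de1 = al1 \<union> bee1"
   using 1 ne ga1 de1 al1 bee1 by (simp_all add: Un_assoc)
  show ?thesis
  proof (cases "et = ga1 \<union> de1")
   case True
   have "m1 ga1 = fuse A M (t al) (t bee)" "m1 de1 = t de" "m2 al1 = t al" "m2 bee1 = fuse A M (t bee) (t de)"
    using 1 ne mem m1_ab m2_cd m1_I[of de] m2_I[of al] by (metis eqs(1), metis eqs(2), metis eqs(3), metis eqs(4))
   then have "fuse A M (m1 ga1) (m1 de1) = fuse A M (m2 al1) (m2 bee1)"
    using assoc[of al bee de] 1 ne mem by simp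
   then show ?thesis unfolding L L' eqs(5) using True eqs(5) by simp
  next
   case False
   then have "m1 et = t et" "m2 et = t et" using KJ1 KJ2 m1 m2 eqs by metis+
   then show ?thesis unfolding L L' eqs(5) using False eqs(5) by simp
  qed
 next
  case 2
  have eqs: "ga1 = ga" "de1 = al \<union> bee" "al1 = ga \<union> de" "bee1 = bee" "ga1 \<union> de1 = al1 \<union> bee1"
   using 2 ne ga1 de1 al1 bee1 by (simp_all add: Un_assoc)
  show ?thesis
  proof (cases "et = ga1 \<union> de1")
   case True
   have "m1 ga1 = t ga" "m1 de1 = fuse A M (t al) (t bee)" "m2 al1 = fuse A M (t ga) (t al)" "m2 bee1 = t bee"
    using 2 ne mem m1_ab m2_cd m1_I[of ga] m2_I[of bee] by (metis eqs(1), metis eqs(2), metis eqs(3), metis eqs(4))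
   then have "fuse A M (m1 ga1) (m1 de1) = fuse A M (m2 al1) (m2 bee1)"
    using assoc[of ga al bee] 2 ne mem by simp
   then show ?thesis unfolding L L' eqs(5) using True eqs(5) by simp
  next
   case False
   then have "m1 et = t et" "m2 et = t et" using KJ1 KJ2 m1 m2 eqs by metis+
   then show ?thesis unfolding L L' eqs(5) using False eqs(5) by simp
  qed
 next
  case 3
  have eqs: "ga1 = ga" "de1 = de" "al1 = al" "bee1 = bee" using 3 ga1 de1 al1 bee1 by auto
  have abcd: "al \<union> bee \<noteq> ga \<union> de"
   using separated_Un_Un_neq[OF I mem(1,2,3,4)] 3 ne by auto
  have m: "m1 ga = t ga" "m1 de = t de" "m2 al = t al" "m2 bee = t bee"
   using 3 ne mem m1_I[of ga] m1_I[of de] m2_I[of al] m2_I[of bee] by metis+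
  consider "et = al \<union> bee" | "et = ga \<union> de" | "et \<noteq> al \<union> bee" "et \<noteq> ga \<union> de" by blast
  then show ?thesis
  proof cases
   case 1
   then show ?thesis unfolding L L' using abcd by (simp add: eqs m m1_ab)
  next
   case 2
   then show ?thesis unfolding L L' using abcd by (simp add: eqs m m2_cd)
  next
   case 3
   then have "m1 et = t et" "m2 et = t et" using KJ1 KJ2 m1 m2 eqs by metis+
   then show ?thesis unfolding L L' using 3 by (simp add: eqs)
  qed
 qed
 then show "merge_fun A M ga1 de1 K (merge_fun A M al bee J1 t) et = merge_fun A M al1 bee1 K (merge_fun A M ga de J2 t) et"
  by (simp add: m1_def m2_def)
qed (auto simp: merge_fun_def)

end

locale based_digraph = coefficients R A M
 for R :: "'r ring" and A :: "('r, 'a) module" and M :: "('r, 'm, 'a) bimodule" +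
 fixes Gm :: "('v, 'e) pre_digraph \<times> 'v"
 assumes fin_G: "fin_digraph (fst Gm)" and base: "snd Gm \<in> verts (fst Gm)"
begin

abbreviation G :: "('v, 'e) pre_digraph" where "G \<equiv> fst Gm"
abbreviation P :: "'e set set" where "P \<equiv> path_poset G"
abbreviation "Fo \<equiv> F_obj R A M Gm"
abbreviation "Fmap \<equiv> F_map R A M Gm"
abbreviation N :: "'v set => ('r, 'a + 'm) module" where "N \<equiv> M_fam A M Gm"

sublocale fin_digraph G by (rule fin_G)

lemma N_eq: "N = MF (snd Gm)"
 by (simp add: M_fam_def fun_eq_iff)

lemma module_N: "Module.module R (N al)"
 unfolding N_eq by (rule module_TF)

lemma module_F_obj: "Module.module R (Fo x)"
 unfolding F_obj_def by (rule module_tensor[OF R_cring module_N])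

lemma edge_components:
 assumes "insert e x \<in> P" "e \<notin> x"
 shows "component_of G x (tail G e) \<in> pi0 G x" "component_of G x (head G e) \<in> pi0 G x"
  "component_of G x (tail G e) \<noteq> component_of G x (head G e)"
  "pi0 G (insert e x) = insert (component_of G x (tail G e) \<union> component_of G x (head G e))
   (pi0 G x - {component_of G x (tail G e), component_of G x (head G e)})"
proof -
 have a: "insert e x \<subseteq> arcs G" by (rule path_poset_arcs[OF fin_G assms(1)])
 then show "component_of G x (tail G e) \<in> pi0 G x" "component_of G x (head G e) \<in> pi0 G x"
  by (auto intro: component_of_pi0)
 show "component_of G x (tail G e) \<noteq> component_of G x (head G e)"
  by (rule multipath_tail_head[OF fin_G assms])
 show "pi0 G (insert e x) = insert (component_of G x (tail G e) \<union> component_of G x (head G e))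
   (pi0 G x - {component_of G x (tail G e), component_of G x (head G e)})"
  by (rule pi0_insert[OF fin_G a])
qed

lemma F_cover_eq:
 assumes "e \<notin> x"
 shows "F_cover R A M Gm x (insert e x) = tensor_map R (pi0 G x) N (pi0 G (insert e x)) N
  (merge_fun A M (component_of G x (tail G e)) (component_of G x (head G e)) (pi0 G (insert e x)))"
proof -
 have "insert e x - x = {e}" using assms by blast
 then show ?thesis
  by (simp add: F_cover_def Let_def tensor_map_def F_obj_def merge_fun_def)
qed

lemma merge_fun_cover:
 assumes "insert e x \<in> P" "e \<notin> x"
 shows "tensor_fun R (pi0 G x) N (pi0 G (insert e x)) N
  (merge_fun A M (component_of G x (tail G e)) (component_of G x (head G e)) (pi0 G (insert e x)))"
 unfolding N_eq by (rule merge_fun_tensor_fun[OF separated_pi0 edge_components[OF assms]])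

lemma F_cover_diamond:
 assumes ef: "insert e (insert f x) \<in> P" "e \<notin> x" "f \<notin> x" "e \<noteq> f" and v: "v \<in> carrier (Fo x)"
 shows "F_cover R A M Gm (insert f x) (insert e (insert f x)) (F_cover R A M Gm x (insert f x) v) =
  F_cover R A M Gm (insert e x) (insert e (insert f x)) (F_cover R A M Gm x (insert e x) v)"
proof -
 let ?y = "insert e (insert f x)"
 have y: "insert f (insert e x) = ?y" by blast
 have P: "insert e x \<in> P" "insert f x \<in> P" "insert f (insert e x) \<in> P"
  using path_poset_subset[OF fin_G ef(1), of "insert e x"] path_poset_subset[OF fin_G ef(1), of "insert f x"] ef(1) y by auto
 have notin: "e \<notin> insert f x" "f \<notin> insert e x" using ef by auto
 have arcs: "insert e x \<subseteq> arcs G" "insert f x \<subseteq> arcs G" using path_poset_arcs[OF fin_G] P by auto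
 then have V: "tail G e \<in> verts G" "head G e \<in> verts G" "tail G f \<in> verts G" "head G f \<in> verts G" by auto
 have mem: "w \<in> component_of G x u \<longleftrightarrow> component_of G x w = component_of G x u"
  if "u \<in> verts G" "w \<in> verts G" for u w
  using that component_of_eq_iff[of u G w x] by (auto simp: mem_component_of)
 \<comment> \<open>An end of one edge can fall into a component fused by the other in one way only:
   tails avoid tail components and heads avoid head components, so tail meets head.\<close>
 have one: "component_of G (insert e x) (tail G f) =
   (if component_of G x (tail G f) = component_of G x (head G e)
    then component_of G x (tail G e) \<union> component_of G x (head G e) else component_of G x (tail G f))"
  "component_of G (insert e x) (head G f) =
   (if component_of G x (head G f) = component_of G x (tail G e)
    then component_of G x (tail G e) \<union> component_of G x (head G e) else component_of G x (head G f))"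
  "component_of G (insert f x) (tail G e) =
   (if component_of G x (tail G e) = component_of G x (head G f)
    then component_of G x (tail G f) \<union> component_of G x (head G f) else component_of G x (tail G e))"
  "component_of G (insert f x) (head G e) =
   (if component_of G x (head G e) = component_of G x (tail G f)
    then component_of G x (tail G f) \<union> component_of G x (head G f) else component_of G x (head G e))"
  using multipath_two_edges[OF fin_G ef]
  by (simp_all add: component_of_insert[OF fin_G arcs(1)] component_of_insert[OF fin_G arcs(2)] V mem)
 have v': "v \<in> carrier (tensor R (pi0 G x) N)" using v by (simp add: F_obj_def)
 have eq: "merge_fun A M (component_of G (insert f x) (tail G e)) (component_of G (insert f x) (head G e)) (pi0 G ?y)
    (merge_fun A M (component_of G x (tail G f)) (component_of G x (head G f)) (pi0 G (insert f x)) t) =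
   merge_fun A M (component_of G (insert e x) (tail G f)) (component_of G (insert e x) (head G f)) (pi0 G ?y)
    (merge_fun A M (component_of G x (tail G e)) (component_of G x (head G e)) (pi0 G (insert e x)) t)"
  if t: "t \<in> (\<Pi>\<^sub>E ga\<in>pi0 G x. carrier (N ga))" for t
 proof (rule sym, rule merge_fun_diamond)
  show "separated (pi0 G x)" by (rule separated_pi0)
  show "component_of G x (tail G e) \<in> pi0 G x" "component_of G x (head G e) \<in> pi0 G x"
   by (rule edge_components[OF P(1) ef(2)])+
  show "component_of G x (tail G f) \<in> pi0 G x" "component_of G x (head G f) \<in> pi0 G x"
   by (rule edge_components[OF P(2) ef(3)])+
  show "component_of G x (tail G e) \<noteq> component_of G x (head G e)"
   by (rule edge_components(3)[OF P(1) ef(2)])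
  show "component_of G x (tail G f) \<noteq> component_of G x (head G f)"
   by (rule edge_components(3)[OF P(2) ef(3)])
  show "component_of G x (tail G e) \<noteq> component_of G x (tail G f)"
   by (rule multipath_two_edges(1)[OF fin_G ef])
  show "component_of G x (head G e) \<noteq> component_of G x (head G f)"
   by (rule multipath_two_edges(2)[OF fin_G ef])
  show "\<not> (component_of G x (tail G e) = component_of G x (head G f) \<and>
    component_of G x (tail G f) = component_of G x (head G e))"
   using multipath_two_edges(3)[OF fin_G ef] by metis
  show "pi0 G (insert e x) = insert (component_of G x (tail G e) \<union> component_of G x (head G e))
   (pi0 G x - {component_of G x (tail G e), component_of G x (head G e)})"
   by (rule edge_components(4)[OF P(1) ef(2)])
  show "pi0 G (insert f x) = insert (component_of G x (tail G f) \<union> component_of G x (head G f))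
   (pi0 G x - {component_of G x (tail G f), component_of G x (head G f)})"
   by (rule edge_components(4)[OF P(2) ef(3)])
  show "pi0 G ?y = insert (component_of G (insert e x) (tail G f) \<union> component_of G (insert e x) (head G f))
   (pi0 G (insert e x) - {component_of G (insert e x) (tail G f), component_of G (insert e x) (head G f)})"
   by (rule edge_components(4)[OF P(3) notin(2), unfolded y])
  show "pi0 G ?y = insert (component_of G (insert f x) (tail G e) \<union> component_of G (insert f x) (head G e))
   (pi0 G (insert f x) - {component_of G (insert f x) (tail G e), component_of G (insert f x) (head G e)})"
   by (rule edge_components(4)[OF ef(1) notin(1)])
  show "t \<in> (\<Pi>\<^sub>E ga\<in>pi0 G x. carrier (MF (snd Gm) ga))"
   using t by (simp add: N_eq)
  show "component_of G (insert e x) (tail G f) = (if component_of G x (tail G f) = component_of G x (head G e) then component_of G x (tail G e) \<union> component_of G x (head G e) else component_of G x (tail G f))"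
   by (rule one(1))
  show "component_of G (insert e x) (head G f) = (if component_of G x (head G f) = component_of G x (tail G e) then component_of G x (tail G e) \<union> component_of G x (head G e) else component_of G x (head G f))"
   by (rule one(2))
  show "component_of G (insert f x) (tail G e) = (if component_of G x (tail G e) = component_of G x (head G f) then component_of G x (tail G f) \<union> component_of G x (head G f) else component_of G x (tail G e))"
   by (rule one(3))
  show "component_of G (insert f x) (head G e) = (if component_of G x (head G e) = component_of G x (tail G f) then component_of G x (tail G f) \<union> component_of G x (head G f) else component_of G x (head G e))"
   by (rule one(4))
 qed
 define m1 where "m1 = merge_fun A M (component_of G x (tail G f)) (component_of G x (head G f)) (pi0 G (insert f x))"
 have F1: "F_cover R A M Gm x (insert f x) = tensor_map R (pi0 G x) N (pi0 G (insert f x)) N m1"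
  unfolding m1_def by (rule F_cover_eq[OF ef(3)])
 have t1: "tensor_fun R (pi0 G x) N (pi0 G (insert f x)) N m1"
  unfolding m1_def by (rule merge_fun_cover[OF P(2) ef(3)])
 define m2 where "m2 = merge_fun A M (component_of G (insert f x) (tail G e)) (component_of G (insert f x) (head G e)) (pi0 G ?y)"
 have F2: "F_cover R A M Gm (insert f x) ?y = tensor_map R (pi0 G (insert f x)) N (pi0 G ?y) N m2"
  unfolding m2_def by (rule F_cover_eq[OF notin(1)])
 have t2: "tensor_fun R (pi0 G (insert f x)) N (pi0 G ?y) N m2"
  unfolding m2_def by (rule merge_fun_cover[OF ef(1) notin(1)])
 define m3 where "m3 = merge_fun A M (component_of G x (tail G e)) (component_of G x (head G e)) (pi0 G (insert e x))"
 have F3: "F_cover R A M Gm x (insert e x) = tensor_map R (pi0 G x) N (pi0 G (insert e x)) N m3"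
  unfolding m3_def by (rule F_cover_eq[OF ef(2)])
 have t3: "tensor_fun R (pi0 G x) N (pi0 G (insert e x)) N m3"
  unfolding m3_def by (rule merge_fun_cover[OF P(1) ef(2)])
 define m4 where "m4 = merge_fun A M (component_of G (insert e x) (tail G f)) (component_of G (insert e x) (head G f)) (pi0 G ?y)"
 have F4: "F_cover R A M Gm (insert e x) ?y = tensor_map R (pi0 G (insert e x)) N (pi0 G ?y) N m4"
  unfolding m4_def by (rule F_cover_eq[OF notin(2), unfolded y])
 have t4: "tensor_fun R (pi0 G (insert e x)) N (pi0 G ?y) N m4"
  unfolding m4_def by (rule merge_fun_cover[OF P(3) notin(2), unfolded y])
 have "m2 (m1 t) = m4 (m3 t)" if "t \<in> (\<Pi>\<^sub>E ga\<in>pi0 G x. carrier (N ga))" for t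
  unfolding m1_def m2_def m3_def m4_def by (rule eq[OF that])
 then show ?thesis
  unfolding F1 F2 F3 F4
  by (rule tensor_map_square[OF R_cring module_N module_N module_N module_N t1 t2 t3 t4 _ v'])
qed

sublocale cover_functor R P "Fo" "F_cover R A M Gm"
proof (rule cover_functor.intro)
 fix x assume x: "x \<in> P"
 show "finite x" using path_poset_arcs[OF fin_G x] by (rule finite_subset) simp
 show "Module.module R (Fo x)" by (rule module_F_obj)
next
 fix x y assume "y \<in> P" "x \<subseteq> y"
 then show "x \<in> P" by (rule path_poset_subset[OF fin_G])
next
 fix e x assume e: "insert e x \<in> P" "e \<notin> x"
 show "F_cover R A M Gm x (insert e x) \<in> mod_hom R (Fo x) (Fo (insert e x))"
  unfolding F_cover_eq[OF e(2)] F_obj_def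
  by (rule tensor_map_hom[OF R_cring module_N module_N merge_fun_cover[OF e]])
qed (rule F_cover_diamond)

lemma F_map_eq: "Fmap = Fm"
 by (simp add: F_map_def Fm_def fun_eq_iff)

sublocale PF: poset_functor R P "Fo" "Fmap"
proof (rule poset_functor.intro)
 show "cring R" by (rule R_cring)
 show "finite P" by (rule finite_path_poset[OF fin_G])
next
 fix x assume "x \<in> P"
 show "Module.module R (Fo x)" by (rule module_F_obj)
next
 fix x y assume "x \<in> P" "y \<in> P" "x \<subseteq> y"
 then show "Fmap x y \<in> mod_hom R (Fo x) (Fo y)"
  unfolding F_map_eq by (intro Fm_hom)
next
 fix x y z v assume "x \<in> P" "y \<in> P" "z \<in> P" "x \<subseteq> y" "y \<subseteq> z" "v \<in> carrier (Fo x)"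
 then show "Fmap y z (Fmap x y v) = Fmap x z v"
  unfolding F_map_eq by (simp add: Fm_trans)
qed

lemma chain_complex_dg: "chain_complex R (dg_mod R A M Gm) (dg_diff R A M Gm)"
 unfolding dg_mod_def dg_diff_def by (rule PF.chain_complex_S)

end

section \<open>Induced maps and functoriality\<close>

definition tau_fun ::
 "('r, 'a) module => ('v, 'e) pre_digraph \<times> 'v => ('v, 'e) pre_digraph \<times> 'v => ('v => 'v) \<times> ('e => 'e) =>
  'e set => ('v set => 'a + 'm) => 'v set => 'a + 'm"
 where "tau_fun A Gm' Gm f x t = (\<lambda>bee\<in>pi0 (fst Gm) (snd f ` x).
  if bee \<inter> fst f ` verts (fst Gm') = {} then Inl \<one>\<^bsub>A\<^esub> else t {v \<in> verts (fst Gm'). fst f v \<in> bee})"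

lemma tau_eq:
 "tau R A M Gm' Gm f x = tensor_map R (pi0 (fst Gm') x) (M_fam A M Gm') (pi0 (fst Gm) (snd f ` x)) (M_fam A M Gm)
  (tau_fun A Gm' Gm f x)"
 by (simp add: tau_def Let_def tensor_map_def F_obj_def tau_fun_def)

locale based_inclusion = coefficients R A M
 for R :: "'r ring" and A :: "('r, 'a) module" and M :: "('r, 'm, 'a) bimodule" +
 fixes Gm' Gm :: "('v, 'e) pre_digraph \<times> 'v" and f :: "('v => 'v) \<times> ('e => 'e)"
 assumes src: "Gm' \<in> Obj DirGr_b" and tgt: "Gm \<in> Obj DirGr_b" and arr: "f \<in> Arr DirGr_b Gm' Gm"
begin

abbreviation "fv \<equiv> fst f"
abbreviation "fe \<equiv> snd f"
abbreviation "V' \<equiv> verts (fst Gm')"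

sublocale src: based_digraph R A M Gm'
 by unfold_locales (use src in "auto simp: DirGr_b_def fin_digraph_def wf_digraph_def fin_digraph_axioms_def")

sublocale tgt: based_digraph R A M Gm
 by unfold_locales (use tgt in "auto simp: DirGr_b_def fin_digraph_def wf_digraph_def fin_digraph_axioms_def")

lemma fv_closed: "v \<in> V' ==> fv v \<in> verts (fst Gm)"
 and fv_inj: "inj_on fv V'"
 and fe_closed: "e \<in> arcs (fst Gm') ==> fe e \<in> arcs (fst Gm)"
 and fe_inj: "inj_on fe (arcs (fst Gm'))"
 and fe_ends: "e \<in> arcs (fst Gm') ==> tail (fst Gm) (fe e) = fv (tail (fst Gm') e)"
  "e \<in> arcs (fst Gm') ==> head (fst Gm) (fe e) = fv (head (fst Gm') e)"
 and fv_base: "fv (snd Gm') = snd Gm"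
 using arr by (auto simp: DirGr_b_def split: prod.splits)

lemma fv_eq_iff: "[|v \<in> V'; w \<in> V'|] ==> fv v = fv w \<longleftrightarrow> v = w"
 using fv_inj by (meson inj_onD)

text \<open>A labelling of the source is carried over along the injective vertex map and extended to
  the vertices outside the image.\<close>

lemma multipath_image:
 assumes x: "x \<in> src.P" shows "fe ` x \<in> tgt.P"
proof -
 have mp: "multipath src.G x" using x by (simp add: path_poset_iff src.fin_G)
 obtain l :: "'v => 'v" and pos :: "'v => nat" where lp:
  "\<forall>v\<in>V'. \<forall>w\<in>V'. l v = l w --> pos v = pos w --> v = w"
  "\<forall>e\<in>x. l (head src.G e) = l (tail src.G e) \<and> pos (head src.G e) = Suc (pos (tail src.G e))"
  using multipath_labels[OF mp] by (elim exE conjE) (rule that)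
 have x: "x \<subseteq> arcs src.G" "inj_on (tail src.G) x" using mp by (auto simp: multipath_def)
 define g where "g = the_inv_into V' fv"
 have g: "g (fv v) = v" if "v \<in> V'" for v
  unfolding g_def by (rule the_inv_into_f_f[OF fv_inj that])
 \<comment> \<open>Outside vertices label themselves at position 0. Positions inside are raised by
   one, so the two kinds cannot collide even if a label happens to be an outside vertex.\<close>
 define l' where "l' w = (if w \<in> fv ` V' then l (g w) else w)" for w
 define pos' where "pos' w = (if w \<in> fv ` V' then Suc (pos (g w)) else 0)" for w
 have "v = w" if "l' v = l' w" "pos' v = pos' w" for v w
  using that lp(1) g by (auto simp: l'_def pos'_def split: if_splits)
 moreover have "l' (head tgt.G e) = l' (tail tgt.G e) \<and> pos' (head tgt.G e) = Suc (pos' (tail tgt.G e))"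
  if e: "e \<in> fe ` x" for e
 proof -
  obtain e' where e': "e' \<in> x" "e = fe e'" using e by blast
  then have "e' \<in> arcs src.G" using x by blast
  then show ?thesis
   using lp(2) e' by (simp add: fe_ends l'_def pos'_def g)
 qed
 moreover have "inj_on (tail tgt.G) (fe ` x)"
 proof (rule inj_onI)
  fix e e' assume "e \<in> fe ` x" "e' \<in> fe ` x" and eq: "tail tgt.G e = tail tgt.G e'"
  then obtain d d' where d: "d \<in> x" "d' \<in> x" "e = fe d" "e' = fe d'" by blast
  then have "d \<in> arcs src.G" "d' \<in> arcs src.G" using x by auto
  then have "tail src.G d = tail src.G d'" using eq d by (simp add: fe_ends fv_eq_iff)
  then show "e = e'" using x(2) d by (metis inj_onD)
 qed
 moreover have "fe ` x \<subseteq> arcs tgt.G" using x fe_closed by auto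
 ultimately have "multipath tgt.G (fe ` x)"
  unfolding multipath_def by (intro conjI exI[of _ l'] exI[of _ pos'] ballI impI) simp_all
 then show ?thesis by (simp add: path_poset_iff tgt.fin_G)
qed

lemma edge_closed_image:
 assumes "x \<subseteq> arcs src.G" "edge_closed src.G x U" "U \<subseteq> V'"
 shows "edge_closed tgt.G (fe ` x) (fv ` U)"
 unfolding edge_closed_def
proof
 fix e assume "e \<in> fe ` x"
 then obtain d where d: "d \<in> x" "e = fe d" "d \<in> arcs src.G" using assms(1) by blast
 have "fv v \<in> fv ` U \<longleftrightarrow> v \<in> U" if "v \<in> V'" for v
  using that assms(3) fv_inj by (meson inj_on_image_mem_iff)
 then show "tail tgt.G e \<in> fv ` U \<longleftrightarrow> head tgt.G e \<in> fv ` U"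
  using assms(2) d by (simp add: fe_ends edge_closed_def)
qed

text \<open>Both inclusions come from closed sets: the image of a component is closed under the
  image edges, and the preimage of a component under the original edges.\<close>

lemma component_of_image:
 assumes x: "x \<subseteq> arcs src.G" and v: "v \<in> V'"
 shows "component_of tgt.G (fe ` x) (fv v) = fv ` component_of src.G x v"
proof
 have sub: "component_of src.G x v \<subseteq> V'"
  by (rule pi0_subset[OF component_of_pi0[OF v]])
 have "edge_closed tgt.G (fe ` x) (fv ` component_of src.G x v)"
  by (rule edge_closed_image[OF x edge_closed_component_of[OF src.fin_G x] sub])
 then show "component_of tgt.G (fe ` x) (fv v) \<subseteq> fv ` component_of src.G x v"
  using component_rel_closed[of "fv v" _ tgt.G "fe ` x"] component_of_self[OF v]
  by (auto simp: mem_component_of[of _ tgt.G])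
 have xe: "fe ` x \<subseteq> arcs tgt.G" using x fe_closed by auto
 have "edge_closed src.G x {w. fv w \<in> component_of tgt.G (fe ` x) (fv v)}"
  using edge_closed_component_of[OF tgt.fin_G xe, of "fv v"] x
  by (auto simp: edge_closed_def fe_ends subset_iff)
 then have "w \<in> {w. fv w \<in> component_of tgt.G (fe ` x) (fv v)}" if "(v, w) \<in> component_rel src.G x" for w
  by (rule component_rel_closed[OF that, rotated]) (simp add: component_of_self fv_closed v)
 then show "fv ` component_of src.G x v \<subseteq> component_of tgt.G (fe ` x) (fv v)"
  by (auto simp: mem_component_of[of _ src.G])
qed

lemma component_of_outside:
 assumes x: "x \<subseteq> arcs src.G" and w: "w \<in> verts tgt.G" "w \<notin> fv ` V'"
 shows "component_of tgt.G (fe ` x) w = {w}"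
proof -
 have "edge_closed tgt.G (fe ` x) {w}"
  using x w(2) by (auto simp: edge_closed_def fe_ends subset_iff)
 then have "component_of tgt.G (fe ` x) w \<subseteq> {w}"
  using component_rel_closed[of w _ tgt.G "fe ` x" "{w}"] by (auto simp: mem_component_of)
 then show ?thesis using component_of_self[OF w(1), of "fe ` x"] by auto
qed

text \<open>The dichotomy behind \<open>tau\<close>: a component comes from a unique component of
  the source, with the same position relative to the base vertex, or it is an isolated vertex
  without the base, where the unit of \<open>A\<close> is inserted.\<close>

lemma pi0_image_cases:
 assumes x: "x \<subseteq> arcs src.G" and bee: "bee \<in> pi0 tgt.G (fe ` x)"
 obtains (inside) ga where "ga \<in> pi0 src.G x" "bee = fv ` ga" "bee \<inter> fv ` V' \<noteq> {}" "{v \<in> V'. fv v \<in> bee} = ga"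
   "snd Gm \<in> bee \<longleftrightarrow> snd Gm' \<in> ga"
  | (outside) "bee \<inter> fv ` V' = {}" "snd Gm \<notin> bee"
proof -
 obtain w where w: "w \<in> verts tgt.G" "bee = component_of tgt.G (fe ` x) w" using bee by (auto simp: pi0_eq)
 show thesis
 proof (cases "w \<in> fv ` V'")
  case True
  then obtain v where v: "v \<in> V'" "w = fv v" by blast
  let ?ga = "component_of src.G x v"
  have ga: "?ga \<in> pi0 src.G x" "?ga \<subseteq> V'" "v \<in> ?ga"
   by (rule component_of_pi0[OF v(1)], rule pi0_subset[OF component_of_pi0[OF v(1)]], rule component_of_self[OF v(1)])
  have b: "bee = fv ` ?ga" using w v component_of_image[OF x v(1)] by simp
  have iff: "fv u \<in> fv ` ?ga \<longleftrightarrow> u \<in> ?ga" if "u \<in> V'" for u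
   using that ga(2) fv_inj by (meson inj_on_image_mem_iff)
  show thesis
  proof (rule inside[OF ga(1) b])
   show "bee \<inter> fv ` V' \<noteq> {}" using b ga by blast
   show "{v \<in> V'. fv v \<in> bee} = ?ga" using b iff ga(2) by auto
   show "snd Gm \<in> bee \<longleftrightarrow> snd Gm' \<in> ?ga" using iff[OF src.base] b fv_base by simp
  qed
 next
  case False
  then have "bee = {w}" using component_of_outside[OF x w(1)] w by simp
  moreover have "snd Gm \<in> fv ` V'" using imageI[OF src.base, of fv] by (simp add: fv_base)
  ultimately show thesis using False by (intro outside) auto
 qed
qed

lemma pi0_image: "[|x \<subseteq> arcs src.G; ga \<in> pi0 src.G x|] ==> fv ` ga \<in> pi0 tgt.G (fe ` x)"
 by (auto simp: pi0_eq component_of_image[symmetric] fv_closed)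

lemma preimage_image: "[|ga \<in> pi0 src.G x|] ==> {v \<in> V'. fv v \<in> fv ` ga} = ga \<and> fv ` ga \<inter> fv ` V' \<noteq> {}"
 using pi0_subset[of ga src.G x] pi0_nonempty[of ga src.G x] fv_inj by (auto dest: inj_onD)

lemma tau_fun_tensor_fun:
 assumes x: "x \<subseteq> arcs src.G"
 shows "tensor_fun R (pi0 src.G x) src.N (pi0 tgt.G (fe ` x)) tgt.N (tau_fun A Gm' Gm f x)"
proof (rule tensor_funI)
 fix t assume t: "t \<in> (\<Pi>\<^sub>E ga\<in>pi0 src.G x. carrier (src.N ga))"
 show "tau_fun A Gm' Gm f x t \<in> (\<Pi>\<^sub>E bee\<in>pi0 tgt.G (fe ` x). carrier (tgt.N bee))"
 proof (rule PiE_I)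
  fix bee assume bee: "bee \<in> pi0 tgt.G (fe ` x)"
  from x bee show "tau_fun A Gm' Gm f x t bee \<in> carrier (tgt.N bee)"
  proof (cases rule: pi0_image_cases)
   case (inside ga)
   have "t ga \<in> carrier (src.N ga)" using t inside(1) by auto
   then show ?thesis using bee inside by (simp add: tau_fun_def src.N_eq tgt.N_eq)
  next
   case outside
   then show ?thesis using bee one_TF by (simp add: tau_fun_def tgt.N_eq)
  qed
 qed (simp add: tau_fun_def)
 fix ga assume ga: "ga \<in> pi0 src.G x"
 have im: "fv ` ga \<in> pi0 tgt.G (fe ` x)" by (rule pi0_image[OF x ga])
 have "tgt.N (fv ` ga) = src.N ga"
 proof -
  have "snd Gm \<in> fv ` ga \<longleftrightarrow> snd Gm' \<in> ga"
   using preimage_image[OF ga] src.base fv_base[symmetric] by auto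
  then show ?thesis by (simp add: src.N_eq tgt.N_eq)
 qed
 then have "(%u. u) \<in> mod_hom R (src.N ga) (tgt.N (fv ` ga))" using mod_hom_id[OF src.module_N] by simp
 moreover have "tau_fun A Gm' Gm f x (t(ga := u)) = (tau_fun A Gm' Gm f x t)(fv ` ga := u)" for u
 proof (rule extensionalityI[where A = "pi0 tgt.G (fe ` x)"])
  fix bee assume bee: "bee \<in> pi0 tgt.G (fe ` x)"
  from x bee show "tau_fun A Gm' Gm f x (t(ga := u)) bee = ((tau_fun A Gm' Gm f x t)(fv ` ga := u)) bee"
  proof (cases rule: pi0_image_cases)
   case (inside de)
   have "bee = fv ` ga \<longleftrightarrow> de = ga"
    using inside(2,4) conjunct1[OF preimage_image[OF ga]] by metis
   then show ?thesis using bee inside by (simp add: tau_fun_def)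
  next
   case outside
   then have "bee \<noteq> fv ` ga" using preimage_image[OF ga] by auto
   then show ?thesis using bee outside by (simp add: tau_fun_def)
  qed
 qed (use im in "auto simp: tau_fun_def extensional_def")
 ultimately show "\<exists>j\<in>pi0 tgt.G (fe ` x). \<exists>ka\<in>mod_hom R (src.N ga) (tgt.N j). \<forall>u\<in>carrier (src.N ga).
   tau_fun A Gm' Gm f x (t(ga := u)) = (tau_fun A Gm' Gm f x t)(j := ka u)"
  using im by (intro bexI[of _ "fv ` ga"] bexI[of _ "%u. u"]) auto
qed

lemma tau_hom:
 assumes "x \<in> src.P"
 shows "tau R A M Gm' Gm f x \<in> mod_hom R (F_obj R A M Gm' x) (F_obj R A M Gm (fe ` x))"
 unfolding tau_eq F_obj_def
 by (rule tensor_map_hom[OF R_cring src.module_N tgt.module_N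
    tau_fun_tensor_fun[OF path_poset_arcs[OF src.fin_G assms]]])

lemma tau_fun_merge:
 assumes y: "insert e x \<in> src.P" "e \<notin> x"
 shows "tau_fun A Gm' Gm f (insert e x)
   (merge_fun A M (component_of src.G x (tail src.G e)) (component_of src.G x (head src.G e)) (pi0 src.G (insert e x)) t) =
  merge_fun A M (component_of tgt.G (fe ` x) (tail tgt.G (fe e))) (component_of tgt.G (fe ` x) (head tgt.G (fe e)))
   (pi0 tgt.G (insert (fe e) (fe ` x))) (tau_fun A Gm' Gm f x t)"
proof -
 have ya: "insert e x \<subseteq> arcs src.G" by (rule path_poset_arcs[OF src.fin_G y(1)])
 then have xa: "x \<subseteq> arcs src.G" and ea: "e \<in> arcs src.G" by auto
 define al where "al = component_of src.G x (tail src.G e)"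
 define bee where "bee = component_of src.G x (head src.G e)"
 have ab: "al \<in> pi0 src.G x" "bee \<in> pi0 src.G x" "pi0 src.G (insert e x) = insert (al \<union> bee) (pi0 src.G x - {al, bee})"
  using src.edge_components[OF y] by (simp_all add: al_def bee_def)
 have im: "component_of tgt.G (fe ` x) (tail tgt.G (fe e)) = fv ` al"
  "component_of tgt.G (fe ` x) (head tgt.G (fe e)) = fv ` bee"
  using component_of_image[OF xa] ea by (simp_all add: al_def bee_def fe_ends)
 have insf: "insert (fe e) (fe ` x) = fe ` insert e x" by simp
 have tab: "tau_fun A Gm' Gm f x t (fv ` ze) = t ze" if "ze \<in> pi0 src.G x" for ze
  using pi0_image[OF xa that] preimage_image[OF that] by (simp add: tau_fun_def)
 show ?thesis
  unfolding im al_def[symmetric] bee_def[symmetric] insf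
 proof (rule extensionalityI[where A = "pi0 tgt.G (fe ` insert e x)"])
  fix et assume et: "et \<in> pi0 tgt.G (fe ` insert e x)"
  from ya et show "tau_fun A Gm' Gm f (insert e x) (merge_fun A M al bee (pi0 src.G (insert e x)) t) et =
   merge_fun A M (fv ` al) (fv ` bee) (pi0 tgt.G (fe ` insert e x)) (tau_fun A Gm' Gm f x t) et"
  proof (cases rule: pi0_image_cases)
   case (inside ga)
   have "al \<union> bee \<in> pi0 src.G (insert e x)" using ab by simp
   then have iff: "et = fv ` al \<union> fv ` bee \<longleftrightarrow> ga = al \<union> bee"
    using inside preimage_image[of "al \<union> bee" "insert e x"] preimage_image[of ga "insert e x"]
    by (metis image_Un)
   show ?thesis
   proof (cases "ga = al \<union> bee")
    case True
    then show ?thesis using et inside iff tab ab by (simp add: tau_fun_def[of _ _ _ _ "insert e x"] merge_fun_def)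
   next
    case False
    then have "ga \<in> pi0 src.G x" using inside(1) ab(3) by auto
    then show ?thesis using et inside iff tab False by (simp add: tau_fun_def[of _ _ _ _ "insert e x"] merge_fun_def)
   qed
  next
   case outside
   have "et \<noteq> fv ` al \<union> fv ` bee" using outside preimage_image[OF ab(1)] by auto
   \<comment> \<open>A component outside the image is a single vertex, which the added edge does not
     touch.\<close>
   moreover have "et \<in> pi0 tgt.G (fe ` x)"
   proof -
    obtain w where w: "w \<in> verts tgt.G" "et = component_of tgt.G (fe ` insert e x) w" using et by (auto simp: pi0_eq)
    then have "w \<notin> fv ` V'" using outside component_of_self[OF w(1)] by blast
    then have "et = component_of tgt.G (fe ` x) w"
     using w component_of_outside[OF ya w(1)] component_of_outside[OF xa w(1)] by simp
    then show ?thesis using w by (simp add: component_of_pi0)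
   qed
   ultimately show ?thesis using et outside by (simp add: tau_fun_def merge_fun_def)
  qed
 qed (auto simp: tau_fun_def merge_fun_def)
qed

lemma tau_F_map:
 assumes "y \<in> src.P" "x \<subseteq> y" "v \<in> carrier (F_obj R A M Gm' x)"
 shows "tau R A M Gm' Gm f y (F_map R A M Gm' x y v) = F_map R A M Gm (fe ` x) (fe ` y) (tau R A M Gm' Gm f x v)"
 unfolding src.F_map_eq tgt.F_map_eq
proof (rule cover_functor_natural[OF src.cover_functor_axioms tgt.cover_functor_axioms])
 show "inj_on fe (\<Union>src.P)"
  by (rule inj_on_subset[OF fe_inj]) (use path_poset_arcs[OF src.fin_G] in auto)
 show "fe ` x \<in> tgt.P" if "x \<in> src.P" for x by (rule multipath_image[OF that])
 show "tau R A M Gm' Gm f x \<in> mod_hom R (F_obj R A M Gm' x) (F_obj R A M Gm (fe ` x))" if "x \<in> src.P" for x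
  by (rule tau_hom[OF that])
 fix x e v assume y: "insert e x \<in> src.P" "e \<notin> x" and v: "v \<in> carrier (F_obj R A M Gm' x)"
 have ya: "insert e x \<subseteq> arcs src.G" by (rule path_poset_arcs[OF src.fin_G y(1)])
 then have xa: "x \<subseteq> arcs src.G" by auto
 have ne: "fe e \<notin> fe ` x" using y(2) ya fe_inj by (auto dest: inj_onD)
 have im: "insert (fe e) (fe ` x) \<in> tgt.P" using multipath_image[OF y(1)] by simp
 show "tau R A M Gm' Gm f (insert e x) (F_cover R A M Gm' x (insert e x) v) =
   F_cover R A M Gm (fe ` x) (insert (fe e) (fe ` x)) (tau R A M Gm' Gm f x v)"
  unfolding tau_eq src.F_cover_eq[OF y(2)] tgt.F_cover_eq[OF ne]
  using v tau_fun_merge[OF y] tau_fun_tensor_fun[OF ya] tgt.merge_fun_cover[OF im ne]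
  unfolding F_obj_def image_insert
  by (intro tensor_map_square[OF R_cring src.module_N src.module_N tgt.module_N tgt.module_N
     src.merge_fun_cover[OF y] _ tau_fun_tensor_fun[OF xa]]) simp_all
qed (use assms in auto)

lemma dg_chain_map_eq:
 "dg_chain_map R A M Gm' Gm f =
  S_map src.P (F_obj R A M Gm') tgt.P (F_obj R A M Gm) fe (tau R A M Gm' Gm f)"
 by (intro ext) (simp add: dg_chain_map_def S_map_def dmap_def dg_mod_def S_mod_def S_elem_def)

lemma dg_chain_map_chain_map:
 "chain_map R (dg_mod R A M Gm') (dg_diff R A M Gm') (dg_mod R A M Gm) (dg_diff R A M Gm) (dg_chain_map R A M Gm' Gm f)"
 unfolding dg_chain_map_eq dg_mod_def dg_diff_def
 by (rule S_map_chain_map[OF src.PF.poset_functor_axioms tgt.PF.poset_functor_axioms multipath_image tau_hom tau_F_map])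

lemma dg_chain_map_elem:
 "[|xs \<in> poset_chains src.P k; v \<in> carrier (F_obj R A M Gm' (hd xs))|] ==>
  dg_chain_map R A M Gm' Gm f k (S_elem src.P (F_obj R A M Gm') k v xs) =
  S_elem tgt.P (F_obj R A M Gm) k (tau R A M Gm' Gm f (hd xs) v) (map ((`) fe) xs)"
 unfolding dg_chain_map_eq
 by (rule S_map_elem[OF src.PF.poset_functor_axioms tgt.PF.poset_functor_axioms multipath_image tau_hom])

lemma dg_homology_map_hom:
 "dg_homology_map R A M Gm' Gm f k \<in> mod_hom R (dg_homology R A M Gm' k) (dg_homology R A M Gm k)"
 unfolding dg_homology_map_def dg_homology_def
 by (rule homology_map_hom[OF src.chain_complex_dg tgt.chain_complex_dg dg_chain_map_chain_map])

end

section \<open>The categories of based digraphs and of graded modules\<close>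

lemma DirGr_b_Idn: "Gm \<in> Obj DirGr_b ==> Idn DirGr_b Gm \<in> Arr DirGr_b Gm Gm"
 by (auto simp: DirGr_b_def fin_digraph_def wf_digraph_def)

lemma DirGr_b_Cmp:
 assumes "Gm \<in> Obj DirGr_b" "f \<in> Arr DirGr_b Gm Gm1" "g \<in> Arr DirGr_b Gm1 Gm2"
 shows "Cmp DirGr_b Gm g f \<in> Arr DirGr_b Gm Gm2"
proof -
 obtain G b G1 b1 G2 b2 fv fe gv ge where e: "Gm = (G, b)" "Gm1 = (G1, b1)" "Gm2 = (G2, b2)" "f = (fv, fe)" "g = (gv, ge)"
  by (metis prod.exhaust)
 interpret fin_digraph G using assms(1) by (simp add: DirGr_b_def e)
 have f: "fv \<in> verts G \<rightarrow>\<^sub>E verts G1" "inj_on fv (verts G)" "fe \<in> arcs G \<rightarrow>\<^sub>E arcs G1" "inj_on fe (arcs G)"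
   "\<And>a. a \<in> arcs G ==> tail G1 (fe a) = fv (tail G a)" "\<And>a. a \<in> arcs G ==> head G1 (fe a) = fv (head G a)" "fv b = b1"
  and g: "gv \<in> verts G1 \<rightarrow>\<^sub>E verts G2" "inj_on gv (verts G1)" "ge \<in> arcs G1 \<rightarrow>\<^sub>E arcs G2" "inj_on ge (arcs G1)"
   "\<And>a. a \<in> arcs G1 ==> tail G2 (ge a) = gv (tail G1 a)" "\<And>a. a \<in> arcs G1 ==> head G2 (ge a) = gv (head G1 a)" "gv b1 = b2"
  using assms by (simp_all add: DirGr_b_def e)
 have fa: "fe a \<in> arcs G1" if "a \<in> arcs G" for a using f(3) that by auto
 have b: "b \<in> verts G" using assms(1) by (simp add: DirGr_b_def e)
 have "inj_on (compose (verts G) gv fv) (verts G)"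
 proof (subst inj_on_cong)
  show "inj_on (gv \<circ> fv) (verts G)"
   by (rule comp_inj_on[OF f(2) inj_on_subset[OF g(2)]]) (use f(1) in auto)
 qed (simp add: compose_def)
 moreover have "inj_on (compose (arcs G) ge fe) (arcs G)"
 proof (subst inj_on_cong)
  show "inj_on (ge \<circ> fe) (arcs G)"
   by (rule comp_inj_on[OF f(4) inj_on_subset[OF g(4)]]) (use f(3) in auto)
 qed (simp add: compose_def)
 ultimately show ?thesis
  using f g fa b by (auto simp: DirGr_b_def e compose_def)
qed

text \<open>The identity laws hold as equations of functions because the vertex and edge maps of an
  arrow are extensional; the same holds for graded modules.\<close>

lemma category_DirGr_b: "category DirGr_b"
proof (rule category.intro)
 fix X Y :: "('v, 'e) pre_digraph \<times> 'v" and f :: "('v => 'v) \<times> ('e => 'e)"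
 assume "X \<in> Obj DirGr_b" "Y \<in> Obj DirGr_b" "f \<in> Arr DirGr_b X Y"
 moreover obtain G b H c fv fe where e: "X = (G, b)" "Y = (H, c)" "f = (fv, fe)" by (metis prod.exhaust)
 ultimately have f: "fv \<in> verts G \<rightarrow>\<^sub>E verts H" "fe \<in> arcs G \<rightarrow>\<^sub>E arcs H" by (simp_all add: DirGr_b_def)
 have c: "compose S h (\<lambda>x\<in>S. x) = h" "compose S (\<lambda>x\<in>T. x) h = h" if "h \<in> S \<rightarrow>\<^sub>E T" for S T h
  using PiE_mem[OF that] PiE_arb[OF that] by (auto simp: compose_def restrict_def fun_eq_iff)
 show "Cmp DirGr_b X f (Idn DirGr_b X) = f" "Cmp DirGr_b X (Idn DirGr_b Y) f = f"
  using c[OF f(1)] c[OF f(2)] by (simp_all add: DirGr_b_def e)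
next
 fix W X Y Z :: "('v, 'e) pre_digraph \<times> 'v" and f g h :: "('v => 'v) \<times> ('e => 'e)"
 assume "f \<in> Arr DirGr_b W X"
 moreover obtain G b H c fv fe gv ge hv he where e: "W = (G, b)" "X = (H, c)" "f = (fv, fe)" "g = (gv, ge)" "h = (hv, he)"
  by (metis prod.exhaust)
 ultimately have f: "fv \<in> verts G \<rightarrow>\<^sub>E verts H" "fe \<in> arcs G \<rightarrow>\<^sub>E arcs H" by (simp_all add: DirGr_b_def)
 have c: "compose S (compose T k h) f = compose S k (compose S h f)" if "f \<in> S \<rightarrow>\<^sub>E T" for S T f h k
  using PiE_mem[OF that] by (auto simp: compose_def restrict_def fun_eq_iff)
 show "Cmp DirGr_b W (Cmp DirGr_b X h g) f = Cmp DirGr_b W h (Cmp DirGr_b W g f)"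
  unfolding DirGr_b_def e by (simp add: c[OF f(1)] c[OF f(2)])
next
 fix X Y Z :: "('v, 'e) pre_digraph \<times> 'v" and f g :: "('v => 'v) \<times> ('e => 'e)"
 assume "X \<in> Obj DirGr_b" "f \<in> Arr DirGr_b X Y" "g \<in> Arr DirGr_b Y Z"
 then show "Cmp DirGr_b X g f \<in> Arr DirGr_b X Z" by (rule DirGr_b_Cmp)
qed (rule DirGr_b_Idn)

lemma category_GrMod:
 fixes R :: "'r ring"
 shows "category (GrMod R)"
proof (rule category.intro)
 fix X :: "int => ('r, 'm) module" assume "X \<in> Obj (GrMod R)"
 then have m: "Module.module R (X k)" for k by (simp add: GrMod_def)
 have "(\<lambda>x\<in>carrier (X k). x) \<in> mod_hom R (X k) (X k)" for k
  by (rule mod_hom_cong[OF mod_hom_id[OF m] m]) simp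
 then show "Idn (GrMod R) X \<in> Arr (GrMod R) X X" by (simp add: GrMod_def)
next
 fix X Y Z :: "int => ('r, 'm) module" and f g
 assume "X \<in> Obj (GrMod R)" "f \<in> Arr (GrMod R) X Y" "g \<in> Arr (GrMod R) Y Z"
 then have m: "Module.module R (X k)" and f: "f k \<in> mod_hom R (X k) (Y k)" and g: "g k \<in> mod_hom R (Y k) (Z k)" for k
  by (simp_all add: GrMod_def)
 have "compose (carrier (X k)) (g k) (f k) \<in> mod_hom R (X k) (Z k)" for k
  by (rule mod_hom_cong[OF mod_hom_comp[OF f g] m]) (simp add: compose_def)
 then show "Cmp (GrMod R) X g f \<in> Arr (GrMod R) X Z" by (simp add: GrMod_def)
next
 fix X Y :: "int => ('r, 'm) module" and f
 assume "X \<in> Obj (GrMod R)" "Y \<in> Obj (GrMod R)" "f \<in> Arr (GrMod R) X Y"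
 then have f: "f k \<in> mod_hom R (X k) (Y k)" "f k \<in> extensional (carrier (X k))" for k
  by (simp_all add: GrMod_def)
 have "compose (carrier (X k)) (f k) (\<lambda>x\<in>carrier (X k). x) = f k"
  "compose (carrier (X k)) (\<lambda>x\<in>carrier (Y k). x) (f k) = f k" for k
  using mod_hom_closed[OF f(1)[of k]] extensional_arb[OF f(2)[of k]] by (auto simp: compose_def fun_eq_iff)
 then show "Cmp (GrMod R) X f (Idn (GrMod R) X) = f" "Cmp (GrMod R) X (Idn (GrMod R) Y) f = f"
  by (simp_all add: GrMod_def fun_eq_iff)
next
 fix W X Y Z :: "int => ('r, 'm) module" and f g h :: "int => 'm => 'm"
 assume "f \<in> Arr (GrMod R) W X"
 then have f: "f k \<in> mod_hom R (W k) (X k)" for k by (simp add: GrMod_def)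
 have "compose (carrier (W k)) (compose (carrier (X k)) (h k) (g k)) (f k) =
   compose (carrier (W k)) (h k) (compose (carrier (W k)) (g k) (f k))" for k
  using mod_hom_closed[OF f[of k]] by (auto simp: compose_def fun_eq_iff)
 then show "Cmp (GrMod R) W (Cmp (GrMod R) X h g) f = Cmp (GrMod R) W h (Cmp (GrMod R) W g f)"
  by (simp add: GrMod_def)
qed

section \<open>Functor laws for the induced maps in homology\<close>

context coefficients
begin

lemma based_digraphI: "Gm \<in> Obj DirGr_b ==> based_digraph R A M Gm"
 by (intro based_digraph.intro coefficients_axioms based_digraph_axioms.intro) (auto simp: DirGr_b_def)

lemma based_inclusionI:
 "[|Gm' \<in> Obj DirGr_b; Gm \<in> Obj DirGr_b; f \<in> Arr DirGr_b Gm' Gm|] ==> based_inclusion R A M Gm' Gm f"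
 by (intro based_inclusion.intro coefficients_axioms based_inclusion_axioms.intro)

text \<open>No vertex lies outside the image of the identity, so \<open>tau\<close> inserts no unit
  and each component is its own preimage.\<close>

lemma dg_homology_map_Idn:
 assumes G: "Gm \<in> Obj DirGr_b"
 shows "dg_homology_map R A M Gm Gm (Idn DirGr_b Gm) k = (\<lambda>X\<in>carrier (dg_homology R A M Gm k). X)"
proof -
 let ?f = "Idn DirGr_b Gm"
 interpret I: based_inclusion R A M Gm Gm ?f by (rule based_inclusionI[OF G G DirGr_b_Idn[OF G]])
 have f: "fst ?f v = v" if "v \<in> verts I.src.G" for v using that by (cases Gm) (simp add: DirGr_b_def)
 have fe: "snd ?f ` x = x" if "x \<subseteq> arcs I.src.G" for x
  using that by (cases Gm) (auto simp: DirGr_b_def image_iff subset_iff)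
 have tau: "tau R A M Gm Gm ?f x v = v" if x: "x \<in> I.src.P" and v: "v \<in> carrier (F_obj R A M Gm x)" for x v
 proof -
  have xa: "x \<subseteq> arcs I.src.G" by (rule path_poset_arcs[OF I.src.fin_G x])
  have im: "fst ?f ` verts I.src.G = verts I.src.G" using f by auto
  have eq: "tau_fun A Gm Gm ?f x t = t" if t: "t \<in> (\<Pi>\<^sub>E ga\<in>pi0 I.src.G x. carrier (I.src.N ga))" for t
  proof (rule extensionalityI[where A = "pi0 I.src.G x"])
   fix bee assume bee: "bee \<in> pi0 I.src.G x"
   then have "bee \<subseteq> verts I.src.G" "bee \<noteq> {}" by (auto dest: pi0_subset pi0_nonempty)
   then have "{v \<in> verts I.src.G. fst ?f v \<in> bee} = bee" "bee \<inter> verts I.src.G \<noteq> {}" using f by auto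
   then show "tau_fun A Gm Gm ?f x t bee = t bee" using bee by (simp add: tau_fun_def fe[OF xa] im)
  qed (use t in "auto simp: tau_fun_def fe[OF xa] PiE_def")
  show ?thesis
   using tensor_map_id[OF R_cring I.src.module_N I.tau_fun_tensor_fun[OF xa, unfolded fe[OF xa]] eq] v
   by (simp add: tau_eq fe[OF xa] F_obj_def)
 qed
 have elem: "dg_chain_map R A M Gm Gm ?f k x = x" if x: "x \<in> carrier (dg_mod R A M Gm k)" for k x
 proof (rule I.src.PF.S_hom_ext[where f = "dg_chain_map R A M Gm Gm ?f k" and g = "%x. x" and k = k])
  show "dg_chain_map R A M Gm Gm ?f k \<in> mod_hom R (S_mod I.src.P (F_obj R A M Gm) k) (S_mod I.src.P (F_obj R A M Gm) k)"
   using I.dg_chain_map_chain_map by (simp add: chain_map_def dg_mod_def)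
  show "(%x. x) \<in> mod_hom R (S_mod I.src.P (F_obj R A M Gm) k) (S_mod I.src.P (F_obj R A M Gm) k)"
   by (rule mod_hom_id[OF I.src.PF.module_S])
  show "x \<in> carrier (S_mod I.src.P (F_obj R A M Gm) k)" using x by (simp add: dg_mod_def)
  fix xs v assume xs: "xs \<in> poset_chains I.src.P k" and v: "v \<in> carrier (F_obj R A M Gm (hd xs))"
  have P: "set xs \<subseteq> I.src.P" "hd xs \<in> I.src.P" using xs by (auto simp: poset_chains_def)
  have "map ((`) (snd ?f)) xs = xs"
  proof (rule map_idI)
   fix x assume "x \<in> set xs"
   then have "x \<in> I.src.P" using P by blast
   then show "snd ?f ` x = x" by (rule fe[OF path_poset_arcs[OF I.src.fin_G]])
  qed
  then show "dg_chain_map R A M Gm Gm ?f k (S_elem I.src.P (F_obj R A M Gm) k v xs) = S_elem I.src.P (F_obj R A M Gm) k v xs"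
   by (simp add: I.dg_chain_map_elem[OF xs v] tau[OF P(2) v])
 qed (rule I.src.PF.module_S)
 show ?thesis
  unfolding dg_homology_map_def dg_homology_def by (rule homology_map_id[OF I.src.chain_complex_dg elem])
qed

text \<open>Preimages of components compose. A component that meets the image of \<open>g\<close>
  but not that of the composite receives its unit from \<open>f\<close>, one that misses the image
  of \<open>g\<close> from \<open>g\<close>; the composite gives the unit in both cases.\<close>

lemma tau_fun_Cmp:
 assumes f: "based_inclusion R A M Gm Gm1 f" and g: "based_inclusion R A M Gm1 Gm2 g"
  and h: "\<And>v. v \<in> verts (fst Gm) ==> fst h v = fst g (fst f v)" "snd h ` x = snd g ` snd f ` x"
  and x: "x \<subseteq> arcs (fst Gm)"
 shows "tau_fun A Gm1 Gm2 g (snd f ` x) (tau_fun A Gm Gm1 f x t) = tau_fun A Gm Gm2 h x t"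
proof -
 interpret f: based_inclusion R A M Gm Gm1 f by (rule f)
 interpret g: based_inclusion R A M Gm1 Gm2 g by (rule g)
 have xa: "snd f ` x \<subseteq> arcs f.tgt.G" using x f.fe_closed by auto
 show ?thesis
 proof (rule extensionalityI[where A = "pi0 g.tgt.G (snd h ` x)"])
  fix bee assume bee: "bee \<in> pi0 g.tgt.G (snd h ` x)"
  then have bee': "bee \<in> pi0 g.tgt.G (snd g ` snd f ` x)" by (simp add: h)
  from xa bee' show "tau_fun A Gm1 Gm2 g (snd f ` x) (tau_fun A Gm Gm1 f x t) bee = tau_fun A Gm Gm2 h x t bee"
  proof (cases rule: g.pi0_image_cases)
   case (inside ga)
   have mem: "fst h v \<in> bee \<longleftrightarrow> fst f v \<in> ga" if "v \<in> verts f.src.G" for v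
    using inside(4) f.fv_closed[OF that] h(1)[OF that] by auto
   then have "{v \<in> verts f.src.G. fst h v \<in> bee} = {v \<in> verts f.src.G. fst f v \<in> ga}"
    "bee \<inter> fst h ` verts f.src.G = {} \<longleftrightarrow> ga \<inter> fst f ` verts f.src.G = {}" by auto
   then show ?thesis using bee bee' inside by (simp add: tau_fun_def)
  next
   case outside
   then have "bee \<inter> fst h ` verts f.src.G = {}" using f.fv_closed by (auto simp: h(1))
   then show ?thesis using bee bee' outside by (simp add: tau_fun_def)
  qed
 qed (simp_all only: tau_fun_def h(2) restrict_extensional)
qed

lemma dg_homology_map_Cmp:
 assumes obj: "Gm \<in> Obj DirGr_b" "Gm1 \<in> Obj DirGr_b" "Gm2 \<in> Obj DirGr_b"
  and arr: "f \<in> Arr DirGr_b Gm Gm1" "g \<in> Arr DirGr_b Gm1 Gm2"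
 shows "dg_homology_map R A M Gm Gm2 (Cmp DirGr_b Gm g f) k =
  compose (carrier (dg_homology R A M Gm k)) (dg_homology_map R A M Gm1 Gm2 g k) (dg_homology_map R A M Gm Gm1 f k)"
proof -
 let ?h = "Cmp DirGr_b Gm g f"
 interpret f: based_inclusion R A M Gm Gm1 f by (rule based_inclusionI[OF obj(1,2) arr(1)])
 interpret g: based_inclusion R A M Gm1 Gm2 g by (rule based_inclusionI[OF obj(2,3) arr(2)])
 interpret h: based_inclusion R A M Gm Gm2 ?h by (rule based_inclusionI[OF obj(1,3) DirGr_b_Cmp[OF obj(1) arr]])
 have hv: "fst ?h v = fst g (fst f v)" if "v \<in> verts f.src.G" for v
  using that by (cases Gm; cases f; cases g) (simp add: DirGr_b_def compose_def)
 have he: "snd ?h ` x = snd g ` snd f ` x" if "x \<subseteq> arcs f.src.G" for x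
 proof -
  have "snd ?h a = snd g (snd f a)" if "a \<in> arcs f.src.G" for a
   using that by (cases Gm; cases f; cases g) (simp add: DirGr_b_def compose_def)
  then show ?thesis using \<open>x \<subseteq> arcs f.src.G\<close> by (auto simp: image_iff subset_iff)
 qed
 have tau: "tau R A M Gm Gm2 ?h x v = tau R A M Gm1 Gm2 g (snd f ` x) (tau R A M Gm Gm1 f x v)"
  if x: "x \<in> f.src.P" and v: "v \<in> carrier (F_obj R A M Gm x)" for x v
 proof -
  have xa: "x \<subseteq> arcs f.src.G" by (rule path_poset_arcs[OF f.src.fin_G x])
  have xb: "snd f ` x \<subseteq> arcs f.tgt.G" using xa f.fe_closed by auto
  show ?thesis
   unfolding tau_eq he[OF xa]
  proof (rule sym, rule tensor_map_comp[where F = "tau_fun A Gm Gm1 f x" and F' = "tau_fun A Gm1 Gm2 g (snd f ` x)"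
     and F'' = "tau_fun A Gm Gm2 ?h x"])
   show "tensor_fun R (pi0 f.src.G x) f.src.N (pi0 f.tgt.G (snd f ` x)) f.tgt.N (tau_fun A Gm Gm1 f x)"
    by (rule f.tau_fun_tensor_fun[OF xa])
   show "tensor_fun R (pi0 f.tgt.G (snd f ` x)) f.tgt.N (pi0 g.tgt.G (snd g ` snd f ` x)) g.tgt.N (tau_fun A Gm1 Gm2 g (snd f ` x))"
    by (rule g.tau_fun_tensor_fun[OF xb])
   show "tensor_fun R (pi0 f.src.G x) f.src.N (pi0 g.tgt.G (snd g ` snd f ` x)) g.tgt.N (tau_fun A Gm Gm2 ?h x)"
    by (rule h.tau_fun_tensor_fun[OF xa, unfolded he[OF xa]])
   show "tau_fun A Gm1 Gm2 g (snd f ` x) (tau_fun A Gm Gm1 f x t) = tau_fun A Gm Gm2 ?h x t" for t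
    by (rule tau_fun_Cmp[OF f.based_inclusion_axioms g.based_inclusion_axioms hv he[OF xa] xa])
   show "v \<in> carrier (tensor R (pi0 f.src.G x) f.src.N)" using v by (simp add: F_obj_def)
  qed (rule R_cring f.src.module_N f.tgt.module_N g.tgt.module_N)+
 qed
 have elem: "dg_chain_map R A M Gm Gm2 ?h k x = dg_chain_map R A M Gm1 Gm2 g k (dg_chain_map R A M Gm Gm1 f k x)"
  if x: "x \<in> carrier (dg_mod R A M Gm k)" for k x
 proof (rule f.src.PF.S_hom_ext[where f = "dg_chain_map R A M Gm Gm2 ?h k" and k = k
    and g = "%x. dg_chain_map R A M Gm1 Gm2 g k (dg_chain_map R A M Gm Gm1 f k x)"])
  show "dg_chain_map R A M Gm Gm2 ?h k \<in> mod_hom R (S_mod f.src.P (F_obj R A M Gm) k) (dg_mod R A M Gm2 k)"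
   using h.dg_chain_map_chain_map by (simp add: chain_map_def dg_mod_def)
  have "dg_chain_map R A M Gm Gm1 f k \<in> mod_hom R (dg_mod R A M Gm k) (dg_mod R A M Gm1 k)"
   "dg_chain_map R A M Gm1 Gm2 g k \<in> mod_hom R (dg_mod R A M Gm1 k) (dg_mod R A M Gm2 k)"
   using f.dg_chain_map_chain_map g.dg_chain_map_chain_map by (simp_all add: chain_map_def)
  from mod_hom_comp[OF this]
  show "(%x. dg_chain_map R A M Gm1 Gm2 g k (dg_chain_map R A M Gm Gm1 f k x)) \<in>
    mod_hom R (S_mod f.src.P (F_obj R A M Gm) k) (dg_mod R A M Gm2 k)"
   by (simp add: dg_mod_def)
  show "Module.module R (dg_mod R A M Gm2 k)" unfolding dg_mod_def by (rule g.tgt.PF.module_S)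
  show "x \<in> carrier (S_mod f.src.P (F_obj R A M Gm) k)" using x by (simp add: dg_mod_def)
  fix xs v assume xs: "xs \<in> poset_chains f.src.P k" and v: "v \<in> carrier (F_obj R A M Gm (hd xs))"
  have P: "set xs \<subseteq> f.src.P" "hd xs \<in> f.src.P" "xs \<noteq> []" using xs by (auto simp: poset_chains_def)
  have xs1: "map ((`) (snd f)) xs \<in> poset_chains f.tgt.P k"
   by (rule poset_chains_map[OF xs f.multipath_image])
  have hd1: "hd (map ((`) (snd f)) xs) = snd f ` hd xs" by (rule hd_map[OF P(3)])
  have v1: "tau R A M Gm Gm1 f (hd xs) v \<in> carrier (F_obj R A M Gm1 (hd (map ((`) (snd f)) xs)))"
   unfolding hd1 by (rule mod_hom_closed[OF f.tau_hom[OF P(2)] v])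
  have m: "map ((`) (snd ?h)) xs = map ((`) (snd g)) (map ((`) (snd f)) xs)"
   unfolding map_map
  proof (rule map_cong)
   fix x assume "x \<in> set xs"
   then have "x \<in> f.src.P" using P(1) by blast
   from he[OF path_poset_arcs[OF f.src.fin_G this]] show "snd ?h ` x = ((`) (snd g) \<circ> (`) (snd f)) x" by simp
  qed simp
  show "dg_chain_map R A M Gm Gm2 ?h k (S_elem f.src.P (F_obj R A M Gm) k v xs) =
    dg_chain_map R A M Gm1 Gm2 g k (dg_chain_map R A M Gm Gm1 f k (S_elem f.src.P (F_obj R A M Gm) k v xs))"
   by (simp only: h.dg_chain_map_elem[OF xs v] f.dg_chain_map_elem[OF xs v] g.dg_chain_map_elem[OF xs1 v1] m hd1
    tau[OF P(2) v])
 qed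
 show ?thesis
  unfolding dg_homology_map_def dg_homology_def
  by (rule homology_map_compose[OF f.src.chain_complex_dg f.tgt.chain_complex_dg g.tgt.chain_complex_dg
     f.dg_chain_map_chain_map g.dg_chain_map_chain_map]) (rule elem)
qed

lemma functor_dg_homology:
 "covariant_functor (DirGr_b :: (('v, 'e) pre_digraph \<times> 'v, ('v => 'v) \<times> ('e => 'e)) cat) (GrMod R)
  (dg_homology R A M) (dg_homology_map R A M)"
proof (intro covariant_functor.intro category_DirGr_b category_GrMod covariant_functor_axioms.intro)
 fix X :: "('v, 'e) pre_digraph \<times> 'v" assume X: "X \<in> Obj DirGr_b"
 interpret X: based_digraph R A M X by (rule based_digraphI[OF X])
 show "dg_homology R A M X \<in> Obj (GrMod R)"
  using module_homology[OF X.chain_complex_dg] by (simp add: GrMod_def dg_homology_def)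
 show "dg_homology_map R A M X X (Idn DirGr_b X) = Idn (GrMod R) (dg_homology R A M X)"
  by (rule ext) (simp add: dg_homology_map_Idn[OF X] GrMod_def)
next
 fix X Y :: "('v, 'e) pre_digraph \<times> 'v" and f assume "X \<in> Obj DirGr_b" "Y \<in> Obj DirGr_b" "f \<in> Arr DirGr_b X Y"
 then interpret based_inclusion R A M X Y f by (rule based_inclusionI)
 show "dg_homology_map R A M X Y f \<in> Arr (GrMod R) (dg_homology R A M X) (dg_homology R A M Y)"
  using dg_homology_map_hom by (simp add: GrMod_def dg_homology_map_def dg_homology_def homology_map_extensional)
next
 fix X Y Z :: "('v, 'e) pre_digraph \<times> 'v" and f g
 assume "X \<in> Obj DirGr_b" "Y \<in> Obj DirGr_b" "Z \<in> Obj DirGr_b" "f \<in> Arr DirGr_b X Y" "g \<in> Arr DirGr_b Y Z"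
 from dg_homology_map_Cmp[OF this]
 show "dg_homology_map R A M X Z (Cmp DirGr_b X g f) =
   Cmp (GrMod R) (dg_homology R A M X) (dg_homology_map R A M Y Z g) (dg_homology_map R A M X Y f)"
  by (simp add: GrMod_def fun_eq_iff)
qed

end

section \<open>The Hochschild simplicial module\<close>

text \<open>The degeneracy of index \<open>j\<close> in the Hochschild simplicial module: the unit
  is placed right after position \<open>j\<close>, later factors move up by one.\<close>

definition unit_fun :: "('r, 'a) module => nat => nat => (nat => 'a + 'm) => nat => 'a + 'm"
 where "unit_fun A n j t = (\<lambda>l\<in>{0..Suc n}. if l \<le> j then t l else if l = Suc j then Inl \<one>\<^bsub>A\<^esub> else t (l - 1))"

context coefficients
begin

abbreviation HF :: "nat => ('r, 'a + 'm) module" where "HF \<equiv> hoch_fam A M"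
abbreviation HX :: "nat => (nat => 'a + 'm) set" where "HX n \<equiv> \<Pi>\<^sub>E j\<in>{0..n}. carrier (HF j)"
abbreviation H :: "nat => ('r, ((nat => 'a + 'm) => 'r) set) module" where "H n \<equiv> tensor R {0..n} HF"

lemma HF_eq: "HF j = TF (j = 0)"
 by (simp add: hoch_fam_def)

lemma module_HF: "Module.module R (HF j)"
 unfolding HF_eq by (rule module_TF)

lemma module_H: "Module.module R (H n)"
 by (rule module_tensor[OF R_cring module_HF])

lemma HX_nth: "[|t \<in> HX n; j \<le> n|] ==> t j \<in> carrier (TF (j = 0))"
 by (auto simp: HF_eq)

lemma HX_fuse: "[|t \<in> HX n; i \<le> n; j \<le> n; i \<noteq> j|] ==> fuse A M (t i) (t j) \<in> carrier (TF (i = 0 \<or> j = 0))"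
 using fuse_closed[OF HX_nth[of t n i] HX_nth[of t n j]] by auto

lemma HX_fuse_assoc:
 "[|t \<in> HX n; i \<le> n; j \<le> n; k \<le> n; i \<noteq> j; i \<noteq> k; j \<noteq> k|] ==>
  fuse A M (fuse A M (t i) (t j)) (t k) = fuse A M (t i) (fuse A M (t j) (t k))"
 by (rule fuse_assoc[OF HX_nth HX_nth HX_nth]) auto

lemma HX_fuse_one:
 assumes "t \<in> HX n" "j \<le> n"
 shows "fuse A M (Inl \<one>\<^bsub>A\<^esub>) (t j) = t j" "fuse A M (t j) (Inl \<one>\<^bsub>A\<^esub>) = t j"
 using fuse_one_left fuse_one_right HX_nth[OF assms] by auto

lemma hoch_face_closed:
 assumes t: "t \<in> HX (Suc n)" and i: "i \<le> Suc n"
 shows "hoch_face A M (Suc n) i t \<in> HX n"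
proof (rule PiE_I)
 fix j assume j: "j \<in> {0..n}"
 have "t k \<in> carrier (TF (j = 0))" if "k \<le> Suc n" "(k = 0) = (j = 0)" for k
  using HX_nth[OF t that(1)] that(2) by simp
 then show "hoch_face A M (Suc n) i t j \<in> carrier (HF j)"
  using i j HX_fuse[OF t, of i "Suc i"] HX_fuse[OF t, of "Suc n" 0]
  by (auto simp: hoch_face_def HF_eq)
qed (auto simp: hoch_face_def)

lemma hoch_face_tensor_fun:
 assumes i: "i \<le> Suc n"
 shows "tensor_fun R {0..Suc n} HF {0..n} HF (hoch_face A M (Suc n) i)"
proof (rule tensor_funI)
 fix t assume t: "t \<in> HX (Suc n)"
 show "hoch_face A M (Suc n) i t \<in> HX n" by (rule hoch_face_closed[OF t i])
 fix k assume "k \<in> {0..Suc n}"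
 then have k: "k \<le> Suc n" by simp
 let ?F = "hoch_face A M (Suc n) i"
 let ?goal = "\<exists>j\<in>{0..n}. \<exists>ka\<in>mod_hom R (HF k) (HF j). \<forall>u\<in>carrier (HF k). ?F (t(k := u)) = (?F t)(j := ka u)"
 have plain: ?goal if "j \<le> n" "(j = 0) = (k = 0)" "\<And>u. ?F (t(k := u)) = (?F t)(j := u)" for j
  using that mod_hom_id[OF module_HF[of k]] by (intro bexI[of _ j] bexI[of _ "%u. u"]) (auto simp: HF_eq)
 have left: ?goal if "l \<le> Suc n" "l \<noteq> k" "j \<le> n" "(j = 0) = (k = 0 \<or> l = 0)"
   "\<And>u. ?F (t(k := u)) = (?F t)(j := fuse A M u (t l))" for j l
  using that fuse_hom_left[OF HX_nth[OF t that(1)], of "k = 0"]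
  by (intro bexI[of _ j] bexI[of _ "%u. fuse A M u (t l)"]) (auto simp: HF_eq)
 have right: ?goal if "l \<le> Suc n" "l \<noteq> k" "j \<le> n" "(j = 0) = (l = 0 \<or> k = 0)"
   "\<And>u. ?F (t(k := u)) = (?F t)(j := fuse A M (t l) u)" for j l
  using that fuse_hom_right[OF HX_nth[OF t that(1)], of "k = 0"]
  by (intro bexI[of _ j] bexI[of _ "%u. fuse A M (t l) u"]) (auto simp: HF_eq)
 show ?goal
 proof (cases "i = Suc n")
  case True
  consider "k = Suc n" | "k = 0" | "0 < k" "k \<le> n" using k by linarith
  then show ?thesis
  proof cases
   case 1
   show ?thesis by (rule left[of 0 0]) (use 1 True in "auto simp: hoch_face_def fun_eq_iff")
  next
   case 2
   show ?thesis by (rule right[of "Suc n" 0]) (use 2 True in "auto simp: hoch_face_def fun_eq_iff")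
  next
   case 3
   show ?thesis by (rule plain[of k]) (use 3 True in "auto simp: hoch_face_def fun_eq_iff")
  qed
 next
  case False
  then have i: "i \<le> n" using i by simp
  consider "k < i" | "k = i" | "k = Suc i" | "Suc i < k" by linarith
  then show ?thesis
  proof cases
   case 1
   show ?thesis by (rule plain[of k]) (use 1 i in "auto simp: hoch_face_def fun_eq_iff")
  next
   case 2
   show ?thesis by (rule left[of "Suc i" i]) (use 2 i in "auto simp: hoch_face_def fun_eq_iff")
  next
   case 3
   show ?thesis by (rule right[of i i]) (use 3 i in "auto simp: hoch_face_def fun_eq_iff")
  next
   case 4
   show ?thesis by (rule plain[of "k - 1"]) (use 4 i k in "auto simp: hoch_face_def fun_eq_iff")
  qed
 qed
qed

lemma unit_fun_closed:
 assumes t: "t \<in> HX n" and j: "j \<le> n"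
 shows "unit_fun A n j t \<in> HX (Suc n)"
proof (rule PiE_I)
 fix l assume l: "l \<in> {0..Suc n}"
 have "t k \<in> carrier (TF (l = 0))" if "k \<le> n" "(k = 0) = (l = 0)" for k
  using HX_nth[OF t that(1)] that(2) by simp
 then show "unit_fun A n j t l \<in> carrier (HF l)"
  using j l one_TF by (auto simp: unit_fun_def HF_eq)
qed (auto simp: unit_fun_def)

lemma unit_fun_tensor_fun:
 assumes j: "j \<le> n"
 shows "tensor_fun R {0..n} HF {0..Suc n} HF (unit_fun A n j)"
proof (rule tensor_funI)
 fix t assume t: "t \<in> HX n"
 show "unit_fun A n j t \<in> HX (Suc n)" by (rule unit_fun_closed[OF t j])
 fix k assume k: "k \<in> {0..n}"
 let ?l = "if k \<le> j then k else Suc k"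
 show "\<exists>l\<in>{0..Suc n}. \<exists>ka\<in>mod_hom R (HF k) (HF l). \<forall>u\<in>carrier (HF k).
   unit_fun A n j (t(k := u)) = (unit_fun A n j t)(l := ka u)"
 proof (intro bexI[of _ ?l] bexI[of _ "%u. u"] ballI)
  show "unit_fun A n j (t(k := u)) = (unit_fun A n j t)(?l := u)" for u
   using k j by (auto simp: unit_fun_def fun_eq_iff)
  show "(%u. u) \<in> mod_hom R (HF k) (HF ?l)" using mod_hom_id[OF module_HF[of k]] by (auto simp: HF_eq)
  show "?l \<in> {0..Suc n}" using k by auto
 qed
qed

text \<open>Faces multiply cyclically adjacent factors. Where two of them overlap, including across
  the wrap-around, the claim is associativity of a product of three factors.\<close>

lemma hoch_face_face:
 assumes t: "t \<in> HX (Suc (Suc n))" and ij: "i < j" "j \<le> Suc (Suc n)"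
 shows "hoch_face A M (Suc n) i (hoch_face A M (Suc (Suc n)) j t) =
  hoch_face A M (Suc n) (j - 1) (hoch_face A M (Suc (Suc n)) i t)"
proof (rule extensionalityI[where A = "{0..n}"])
 fix l assume l: "l \<in> {0..n}"
 note assoc = HX_fuse_assoc[OF t]
 show "hoch_face A M (Suc n) i (hoch_face A M (Suc (Suc n)) j t) l =
  hoch_face A M (Suc n) (j - 1) (hoch_face A M (Suc (Suc n)) i t) l"
 proof (cases "j = Suc (Suc n)")
  case True
  consider "i = Suc n" | "i < Suc n" using ij True by linarith
  then show ?thesis
   using l True by cases (auto simp: hoch_face_def assoc)
 next
  case False
  then obtain m where m: "j = Suc m" "m \<le> n" using ij by (cases j) auto
  show ?thesis
   using ij l m by (auto simp: hoch_face_def assoc)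
 qed
qed (auto simp: hoch_face_def)

lemma hoch_face_unit_same:
 assumes t: "t \<in> HX n" and j: "j \<le> n"
 shows "hoch_face A M (Suc n) j (unit_fun A n j t) = t"
  and "hoch_face A M (Suc n) (Suc j) (unit_fun A n j t) = t"
proof -
 have ext: "t \<in> extensional {0..n}" using t by (auto simp: PiE_def)
 note one = HX_fuse_one[OF t]
 show "hoch_face A M (Suc n) j (unit_fun A n j t) = t"
  by (rule extensionalityI[where A = "{0..n}"]) (use j ext in "auto simp: hoch_face_def unit_fun_def one")
 show "hoch_face A M (Suc n) (Suc j) (unit_fun A n j t) = t"
  by (rule extensionalityI[where A = "{0..n}"]) (use j ext in "auto simp: hoch_face_def unit_fun_def one")
qed

lemma hoch_face_unit_less:
 assumes t: "t \<in> HX (Suc n)" and ij: "i < j" "j \<le> Suc n"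
 shows "hoch_face A M (Suc (Suc n)) i (unit_fun A (Suc n) j t) = unit_fun A n (j - 1) (hoch_face A M (Suc n) i t)"
proof (rule extensionalityI[where A = "{0..Suc n}"])
 fix l assume l: "l \<in> {0..Suc n}"
 obtain m where m: "j = Suc m" using ij by (cases j) auto
 consider "l < i" | "l = i" | "i < l" by linarith
 then show "hoch_face A M (Suc (Suc n)) i (unit_fun A (Suc n) j t) l = unit_fun A n (j - 1) (hoch_face A M (Suc n) i t) l"
  by cases (use ij l m in "auto simp: hoch_face_def unit_fun_def")
qed (auto simp: hoch_face_def unit_fun_def)

lemma hoch_face_unit_greater:
 assumes t: "t \<in> HX (Suc n)" and ij: "Suc j < i" "i \<le> Suc (Suc n)"
 shows "hoch_face A M (Suc (Suc n)) i (unit_fun A (Suc n) j t) = unit_fun A n j (hoch_face A M (Suc n) (i - 1) t)"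
proof (rule extensionalityI[where A = "{0..Suc n}"])
 fix l assume l: "l \<in> {0..Suc n}"
 obtain m where m: "i = Suc m" using ij by (cases i) auto
 consider "l < m" | "l = m" | "m < l" by linarith
 then show "hoch_face A M (Suc (Suc n)) i (unit_fun A (Suc n) j t) l = unit_fun A n j (hoch_face A M (Suc n) (i - 1) t) l"
  by cases (use ij l m in "auto simp: hoch_face_def unit_fun_def")
qed (auto simp: hoch_face_def unit_fun_def)

definition Hd :: "nat => nat => ((nat => 'a + 'm) => 'r) set => ((nat => 'a + 'm) => 'r) set"
 where "Hd n i = tensor_map R {0..Suc n} HF {0..n} HF (hoch_face A M (Suc n) i)"

definition Hs :: "nat => nat => ((nat => 'a + 'm) => 'r) set => ((nat => 'a + 'm) => 'r) set"
 where "Hs n j = tensor_map R {0..n} HF {0..Suc n} HF (unit_fun A n j)"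

lemma Hd_hom: "i \<le> Suc n ==> Hd n i \<in> mod_hom R (H (Suc n)) (H n)"
 unfolding Hd_def by (rule tensor_map_hom[OF R_cring module_HF module_HF hoch_face_tensor_fun])

lemma Hs_hom: "j \<le> n ==> Hs n j \<in> mod_hom R (H n) (H (Suc n))"
 unfolding Hs_def by (rule tensor_map_hom[OF R_cring module_HF module_HF unit_fun_tensor_fun])

lemma Hd_Hd:
 assumes "i < j" "j \<le> Suc (Suc n)" "v \<in> carrier (H (Suc (Suc n)))"
 shows "Hd n i (Hd (Suc n) j v) = Hd n (j - 1) (Hd (Suc n) i v)"
 unfolding Hd_def
 by (rule tensor_map_square[OF R_cring module_HF module_HF module_HF module_HF])
  (use assms in "simp_all add: hoch_face_tensor_fun hoch_face_face")

lemma Hd_Hs_same: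
 assumes "j \<le> n" "i = j \<or> i = Suc j" "v \<in> carrier (H n)"
 shows "Hd n i (Hs n j v) = v"
proof -
 have id: "tensor_fun R {0..n} HF {0..n} HF (%t. t)"
  by (auto intro!: tensor_funI bexI[of _ "%u. u"] mod_hom_id module_HF)
 have "Hd n i (Hs n j v) = tensor_map R {0..n} HF {0..n} HF (%t. t) v"
  unfolding Hd_def Hs_def
  by (rule tensor_map_comp[OF R_cring module_HF module_HF module_HF])
   (use assms id hoch_face_unit_same[of _ n j] in "auto simp: hoch_face_tensor_fun unit_fun_tensor_fun")
 also have "\<dots> = v" by (rule tensor_map_id[OF R_cring module_HF id _ assms(3)]) simp
 finally show ?thesis .
qed

lemma Hd_Hs_less:
 assumes "i < j" "j \<le> Suc n" "v \<in> carrier (H (Suc n))"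
 shows "Hd (Suc n) i (Hs (Suc n) j v) = Hs n (j - 1) (Hd n i v)"
 unfolding Hd_def Hs_def
 by (rule tensor_map_square[OF R_cring module_HF module_HF module_HF module_HF])
  (use assms in "simp_all add: hoch_face_tensor_fun unit_fun_tensor_fun hoch_face_unit_less")

lemma Hd_Hs_greater:
 assumes "Suc j < i" "i \<le> Suc (Suc n)" "v \<in> carrier (H (Suc n))"
 shows "Hd (Suc n) i (Hs (Suc n) j v) = Hs n j (Hd n (i - 1) v)"
 unfolding Hd_def Hs_def
 by (rule tensor_map_square[OF R_cring module_HF module_HF module_HF module_HF])
  (use assms in "simp_all add: hoch_face_tensor_fun unit_fun_tensor_fun hoch_face_unit_greater")

lemma module_zero: "Module.module R zero_module"
proof (rule moduleI)
 show "abelian_group zero_module" by (rule abelian_groupI) (auto simp: zero_module_def)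
qed (auto simp: zero_module_def R_cring)

lemma hoch_mod_nat: "hoch_mod R A M (int n) = H n"
 by (simp add: hoch_mod_def)

lemma module_hoch_mod: "Module.module R (hoch_mod R A M k)"
 by (simp add: hoch_mod_def module_zero module_H)

text \<open>The definition is a lift of an alternating sum of pure tensors, usable only once that
  expression is known to be multilinear. This is not checked by hand: the expression is the linear
  map \<open>altsum\<close> of the \<open>Hd\<close> evaluated on pure tensors, which are
  multilinear.\<close>

lemma hoch_diff_Suc:
 assumes v: "v \<in> carrier (H (Suc n))"
 shows "hoch_diff R A M (int n + 1) v = altsum R (H n) (Suc n) (%i. Hd n i v)"
proof -
 let ?f = "%t. altsum R (H n) (Suc n) (%i. pure_tensor R {0..n} HF (hoch_face A M (Suc n) i t))"
 have g: "(%v. altsum R (H n) (Suc n) (%i. Hd n i v)) \<in> mod_hom R (H (Suc n)) (H n)"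
  by (rule altsum_hom[OF module_H module_H Hd_hom])
 have pure: "altsum R (H n) (Suc n) (%i. Hd n i (pure_tensor R {0..Suc n} HF t)) = ?f t" if "t \<in> HX (Suc n)" for t
 proof (rule altsum_cong[OF module_H])
  fix i assume i: "i \<le> Suc n"
  show "Hd n i (pure_tensor R {0..Suc n} HF t) = pure_tensor R {0..n} HF (hoch_face A M (Suc n) i t)"
   unfolding Hd_def by (rule tensor_map_pure[OF R_cring module_HF module_HF hoch_face_tensor_fun[OF i] that])
  show "pure_tensor R {0..n} HF (hoch_face A M (Suc n) i t) \<in> carrier (H n)"
   by (rule pure_tensor_closed[OF R_cring module_HF hoch_face_closed[OF that i]])
 qed
 have upd: "t(i := u) \<in> HX (Suc n)" if "t \<in> HX (Suc n)" "i \<in> {0..Suc n}" "u \<in> carrier (HF i)" for t i u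
  using that by (auto simp: PiE_def extensional_def)
 have ml: "multilinear R {0..Suc n} HF (H n) ?f"
 proof -
  have pm: "multilinear R {0..Suc n} HF (H (Suc n)) (pure_tensor R {0..Suc n} HF)"
   by (rule multilinear_pure_tensor[OF R_cring module_HF])
  have pc: "pure_tensor R {0..Suc n} HF t \<in> carrier (H (Suc n))" if "t \<in> HX (Suc n)" for t
   by (rule pure_tensor_closed[OF R_cring module_HF that])
  show ?thesis
   unfolding multilinear_def
  proof (intro conjI ballI)
   fix t assume t: "t \<in> HX (Suc n)"
   show "?f t \<in> carrier (H n)" unfolding pure[OF t, symmetric] by (rule mod_hom_closed[OF g pc[OF t]])
  next
   fix t i u w assume t: "t \<in> HX (Suc n)" "i \<in> {0..Suc n}" "u \<in> carrier (HF i)" "w \<in> carrier (HF i)"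
   interpret Fi: Module.module R "HF i" by (rule module_HF)
   have "u \<oplus>\<^bsub>HF i\<^esub> w \<in> carrier (HF i)" using t by simp
   note up = upd[OF t(1,2) this] upd[OF t(1,2,3)] upd[OF t(1,2,4)]
   have "pure_tensor R {0..Suc n} HF (t(i := u \<oplus>\<^bsub>HF i\<^esub> w)) =
    pure_tensor R {0..Suc n} HF (t(i := u)) \<oplus>\<^bsub>H (Suc n)\<^esub> pure_tensor R {0..Suc n} HF (t(i := w))"
    using pm t unfolding multilinear_def by blast
   then show "?f (t(i := u \<oplus>\<^bsub>HF i\<^esub> w)) = ?f (t(i := u)) \<oplus>\<^bsub>H n\<^esub> ?f (t(i := w))"
    unfolding pure[OF up(1), symmetric] pure[OF up(2), symmetric] pure[OF up(3), symmetric]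
    using mod_hom_add[OF g pc[OF up(2)] pc[OF up(3)]] by simp
  next
   fix t i r u assume t: "t \<in> HX (Suc n)" "i \<in> {0..Suc n}" "r \<in> carrier R" "u \<in> carrier (HF i)"
   interpret Fi: Module.module R "HF i" by (rule module_HF)
   have "r \<odot>\<^bsub>HF i\<^esub> u \<in> carrier (HF i)" using t by simp
   note up = upd[OF t(1,2) this] upd[OF t(1,2,4)]
   have "pure_tensor R {0..Suc n} HF (t(i := r \<odot>\<^bsub>HF i\<^esub> u)) =
    r \<odot>\<^bsub>H (Suc n)\<^esub> pure_tensor R {0..Suc n} HF (t(i := u))"
    using pm t unfolding multilinear_def by blast
   then show "?f (t(i := r \<odot>\<^bsub>HF i\<^esub> u)) = r \<odot>\<^bsub>H n\<^esub> ?f (t(i := u))"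
    unfolding pure[OF up(1), symmetric] pure[OF up(2), symmetric]
    using mod_hom_smult[OF g t(3) pc[OF up(2)]] by simp
  qed
 qed
 have hd: "hoch_diff R A M (int n + 1) = tensor_lift R {0..Suc n} HF (H n) ?f"
  by (simp add: hoch_diff_def Let_def hoch_mod_def altsum_def nat_add_distrib atLeast0AtMost[symmetric])
 show ?thesis
  unfolding hd
  by (rule tensor_hom_ext[where g = "%v. altsum R (H n) (Suc n) (%i. Hd n i v)",
     OF R_cring module_HF module_H tensor_lift(1)[OF R_cring module_HF module_H ml] g _ v])
   (simp add: pure tensor_lift(3)[OF R_cring module_HF module_H ml])
qed

lemma altsum_Hd_Hd:
 assumes v: "v \<in> carrier (H (Suc (Suc n)))"
 shows "altsum R (H n) (Suc n) (%i. Hd n i (altsum R (H (Suc n)) (Suc (Suc n)) (%j. Hd (Suc n) j v))) = \<zero>\<^bsub>H n\<^esub>"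
 by (rule altsum_altsum[where D = "Hd (Suc n)" and D' = "Hd n", OF module_H module_H])
  (use mod_hom_closed[OF Hd_hom v] Hd_hom Hd_Hd[OF _ _ v] in auto)

lemma hoch_diff_hom: "hoch_diff R A M k \<in> mod_hom R (hoch_mod R A M k) (hoch_mod R A M (k - 1))"
proof (cases "1 \<le> k")
 case True
 then obtain n where n: "k = int n + 1" by (metis add.commute zle_iff_zadd)
 have k: "hoch_mod R A M k = H (Suc n)" "hoch_mod R A M (k - 1) = H n"
  using n by (simp_all add: hoch_mod_def nat_add_distrib)
 show ?thesis
  unfolding k
  by (rule mod_hom_cong[OF altsum_hom[OF module_H module_H Hd_hom] module_H]) (simp_all add: n hoch_diff_Suc)
next
 case False
 then have "hoch_diff R A M k = (%x. \<zero>\<^bsub>hoch_mod R A M (k - 1)\<^esub>)" by (simp add: hoch_diff_def Let_def)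
 then show ?thesis using mod_hom_const_zero[OF module_hoch_mod] by simp
qed

lemma chain_complex_hoch: "chain_complex R (hoch_mod R A M) (hoch_diff R A M)"
 unfolding chain_complex_def
proof (intro conjI allI ballI module_hoch_mod hoch_diff_hom)
 fix k x assume x: "x \<in> carrier (hoch_mod R A M (k + 1))"
 show "hoch_diff R A M k (hoch_diff R A M (k + 1) x) = \<zero>\<^bsub>hoch_mod R A M (k - 1)\<^esub>"
 proof (cases "1 \<le> k")
  case True
  then obtain n where n: "k = int n + 1" by (metis add.commute zle_iff_zadd)
  have x: "x \<in> carrier (H (Suc (Suc n)))" using x n by (simp add: hoch_mod_def nat_add_distrib)
  have "altsum R (H (Suc n)) (Suc (Suc n)) (%j. Hd (Suc n) j x) \<in> carrier (H (Suc n))"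
   by (rule altsum_closed[OF module_H]) (rule mod_hom_closed[OF Hd_hom x])
  then show ?thesis
   using hoch_diff_Suc[OF x] hoch_diff_Suc[of _ n] altsum_Hd_Hd[OF x] n
   by (simp add: hoch_mod_def add.commute)
 next
  case False
  then show ?thesis by (simp add: hoch_diff_def Let_def)
 qed
qed

end

section \<open>Cut edges of the directed polygon\<close>

lemma set_del_nth_distinct:
 assumes "i < length xs" "distinct xs"
 shows "set (del_nth i xs) = set xs - {xs ! i}"
proof -
 have e: "xs = take i xs @ xs ! i # drop (Suc i) xs" by (rule id_take_nth_drop[OF assms(1)])
 have "distinct (take i xs @ xs ! i # drop (Suc i) xs)" using assms(2) e by simp
 then have "xs ! i \<notin> set (take i xs) \<union> set (drop (Suc i) xs)" by auto
 moreover have "set xs = set (take i xs) \<union> insert (xs ! i) (set (drop (Suc i) xs))"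
  by (subst e) auto
 ultimately show ?thesis by (auto simp: del_nth_def)
qed

lemma strict_sorted_nth_less_iff:
 assumes "sorted_wrt (<) (c :: nat list)" "i < length c" "j < length c"
 shows "c ! i < c ! j \<longleftrightarrow> i < j"
 using assms sorted_wrt_nth_less[of "(<)" c i j] sorted_wrt_nth_less[of "(<)" c j i]
 by (metis linorder_neqE_nat not_less_iff_gr_or_eq)

lemma strict_sorted_distinct: "sorted_wrt (<) (c :: nat list) ==> distinct c"
 by (simp add: strict_sorted_iff)

text \<open>For a sorted list this counts the cuts below \<open>k\<close>, that is, those met on the
  way from vertex 0 to vertex \<open>k\<close>.\<close>

definition cnt :: "nat list => nat => nat"
 where "cnt c k = length (takeWhile (%a. a < k) c)"

lemma cnt_le: "cnt c k \<le> length c"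
 by (simp add: cnt_def length_takeWhile_le)

lemma nth_less_cnt:
 assumes c: "sorted_wrt (<) c" and i: "i < length c"
 shows "c ! i < k \<longleftrightarrow> i < cnt c k"
proof
 assume "i < cnt c k"
 then show "c ! i < k"
  unfolding cnt_def by (metis nth_mem set_takeWhileD takeWhile_nth)
next
 assume less: "c ! i < k"
 show "i < cnt c k"
 proof (rule ccontr)
  assume "\<not> i < cnt c k"
  then have "cnt c k \<le> i" "cnt c k < length c" using i by simp_all
  then have "\<not> c ! cnt c k < k" "c ! cnt c k \<le> c ! i"
   using nth_length_takeWhile[of "%a. a < k" c] strict_sorted_nth_less_iff[OF c, of i "cnt c k"] i
   by (simp_all add: cnt_def not_less[symmetric])
  then show False using less by simp
 qed
qed

lemma cnt_eqI:
 assumes c: "sorted_wrt (<) c" and p: "p \<le> length c" and iff: "\<And>i. i < length c ==> c ! i < k \<longleftrightarrow> i < p"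
 shows "cnt c k = p"
proof (rule ccontr)
 assume "cnt c k \<noteq> p"
 then consider "cnt c k < p" | "p < cnt c k" by linarith
 then show False
 proof cases
  case 1
  then have "cnt c k < length c" using p by simp
  then show ?thesis using nth_less_cnt[OF c, of "cnt c k" k] iff[of "cnt c k"] 1 by simp
 next
  case 2
  then have "p < length c" using cnt_le[of c k] by simp
  then show ?thesis using nth_less_cnt[OF c, of p k] iff[of p] 2 by simp
 qed
qed

lemma cnt_0: "cnt c 0 = 0"
 by (cases c) (simp_all add: cnt_def)

lemma cnt_nth: "[|sorted_wrt (<) c; i < length c|] ==> cnt c (c ! i) = i"
 by (rule cnt_eqI) (simp_all add: strict_sorted_nth_less_iff)

lemma cnt_Suc_nth:
 assumes "sorted_wrt (<) c" "i < length c"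
 shows "cnt c (Suc (c ! i)) = Suc i"
proof (rule cnt_eqI)
 show "c ! j < Suc (c ! i) \<longleftrightarrow> j < Suc i" if "j < length c" for j
  using strict_sorted_nth_less_iff[OF assms(1,2) that] by (simp add: less_Suc_eq_le not_less[symmetric])
qed (use assms in simp_all)

lemma cnt_Suc_notin:
 assumes "sorted_wrt (<) c" "k \<notin> set c"
 shows "cnt c (Suc k) = cnt c k"
proof (rule cnt_eqI)
 show "c ! j < Suc k \<longleftrightarrow> j < cnt c k" if "j < length c" for j
  using nth_less_cnt[OF assms(1) that, of k] assms(2) nth_mem[OF that] by (metis less_Suc_eq)
qed (use assms cnt_le in simp_all)

lemma cnt_mono: "k \<le> l ==> cnt c k \<le> cnt c l"
proof -
 assume "k \<le> l"
 then have "takeWhile (%a. a < k) c = takeWhile (%a. a < k) (takeWhile (%a. a < l) c)"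
  by (induction c) auto
 then show ?thesis unfolding cnt_def by (metis length_takeWhile_le)
qed

lemma cnt_del_nth:
 assumes c: "sorted_wrt (<) c" and i: "i < length c"
 shows "cnt (del_nth i c) k = (if cnt c k \<le> i then cnt c k else cnt c k - 1)"
proof (rule cnt_eqI)
 show "sorted_wrt (<) (del_nth i c)" by (rule sorted_wrt_del_nth[OF c])
 show "(if cnt c k \<le> i then cnt c k else cnt c k - 1) \<le> length (del_nth i c)"
  using cnt_le[of c k] i by (auto simp: length_del_nth)
 fix j assume "j < length (del_nth i c)"
 then have j: "j < length c - 1" using i by (simp add: length_del_nth)
 then show "del_nth i c ! j < k \<longleftrightarrow> j < (if cnt c k \<le> i then cnt c k else cnt c k - 1)"
  using nth_less_cnt[OF c, of j k] nth_less_cnt[OF c, of "Suc j" k] i by (auto simp: nth_del_nth)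
qed

text \<open>The index of the block of vertices that contains vertex \<open>k\<close>. Vertices
  behind the last cut are connected through the end of the cycle to vertex 0, so the full count is
  identified with 0, and block 0 contains vertex 0.\<close>

definition bidx :: "nat list => nat => nat"
 where "bidx c k = (if cnt c k = length c then 0 else cnt c k)"

text \<open>\<open>collapse m i\<close> identifies \<open>i\<close> with its cyclic successor in \<open>{0..m}\<close>.\<close>

definition collapse :: "nat => nat => nat => nat"
 where "collapse m i j = (if i < m then (if j \<le> i then j else j - 1) else if j = m then 0 else j)"

text \<open>Without cut \<open>i\<close> every count beyond \<open>i\<close> drops by one. Deleting
  the last cut lowers the maximal remaining index to the new full count, which is again read as
  0.\<close>

lemma bidx_del_nth:
 assumes "sorted_wrt (<) c" "length c = Suc (Suc p)" "i \<le> Suc p"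
 shows "bidx (del_nth i c) k = collapse (Suc p) i (bidx c k)"
 using assms cnt_del_nth[of c i k] cnt_le[of c k] by (auto simp: bidx_def collapse_def length_del_nth)

lemma bidx_less: "c \<noteq> [] ==> bidx c k < length c"
 using cnt_le[of c k] by (auto simp: bidx_def)

section \<open>Reindexing tensor products\<close>

lemma tensor_fun_reindex:
 assumes Q: "\<And>i. i \<in> I ==> Module.module R (Q i)" and h: "bij_betw h J I" and Q': "\<And>j. j \<in> J ==> Q' j = Q (h j)"
 shows "tensor_fun R I Q J Q' (%t. \<lambda>j\<in>J. t (h j))"
proof (rule tensor_funI)
 fix t assume t: "t \<in> (\<Pi>\<^sub>E i\<in>I. carrier (Q i))"
 show "(\<lambda>j\<in>J. t (h j)) \<in> (\<Pi>\<^sub>E j\<in>J. carrier (Q' j))"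
  using PiE_mem[OF t] bij_betwE[OF h] Q' by auto
 fix i assume i: "i \<in> I"
 obtain j where j: "j \<in> J" "h j = i" using h i by (auto simp: bij_betw_def)
 have iff: "h j' = i \<longleftrightarrow> j' = j" if "j' \<in> J" for j' using h j that by (auto simp: bij_betw_def dest: inj_onD)
 have "(%u. u) \<in> mod_hom R (Q i) (Q' j)" using mod_hom_id[OF Q[OF i]] Q'[OF j(1)] j(2) by simp
 moreover have "(\<lambda>j\<in>J. (t(i := u)) (h j)) = (\<lambda>j\<in>J. t (h j))(j := u)" for u
  using iff j by (auto simp: fun_eq_iff)
 ultimately show "\<exists>j\<in>J. \<exists>ka\<in>mod_hom R (Q i) (Q' j). \<forall>u\<in>carrier (Q i).
   (\<lambda>j\<in>J. (t(i := u)) (h j)) = (\<lambda>j\<in>J. t (h j))(j := ka u)"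
  using j(1) by (intro bexI[of _ j] bexI[of _ "%u. u"]) auto
qed

lemma tensor_map_reindex:
 assumes R: "cring R" and N: "\<And>i. i \<in> I ==> Module.module R (N i)" and b: "bij_betw b J I"
  and N': "\<And>j. j \<in> J ==> N' j = N (b j)"
 shows "tensor_fun R I N J N' (%t. \<lambda>j\<in>J. t (b j))" (is "?A")
  and "bij_betw (tensor_map R I N J N' (%t. \<lambda>j\<in>J. t (b j))) (carrier (tensor R I N)) (carrier (tensor R J N'))" (is "?B")
proof -
 show A: ?A by (rule tensor_fun_reindex[where h = b and Q = N and Q' = N']) (use N b N' in auto)
 define b' where "b' = the_inv_into J b"
 have b': "bij_betw b' I J" unfolding b'_def by (rule bij_betw_the_inv_into[OF b])
 have bb': "b (b' i) = i" if "i \<in> I" for i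
  unfolding b'_def by (rule f_the_inv_into_f_bij_betw[OF b]) (use that in simp)
 have b'b: "b' (b j) = j" if "j \<in> J" for j
  unfolding b'_def using b that by (simp add: bij_betw_def the_inv_into_f_f)
 have NJ: "Module.module R (N' j)" if "j \<in> J" for j using N N'[OF that] bij_betwE[OF b] that by simp
 have Neq: "N i = N' (b' i)" if "i \<in> I" for i using N'[of "b' i"] bb'[OF that] bij_betwE[OF b'] that by simp
 have A': "tensor_fun R J N' I N (%t. \<lambda>i\<in>I. t (b' i))" by (rule tensor_fun_reindex[where h = b' and Q = N' and Q' = N]) (use NJ b' Neq in auto)
 have id: "tensor_fun R I N I N (%t. \<lambda>i\<in>I. t i)" 
  by (rule tensor_fun_reindex[where h = "%i. i" and Q = N and Q' = N]) (use N bij_betw_id[unfolded id_def] in auto)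
 have id': "tensor_fun R J N' J N' (%t. \<lambda>i\<in>J. t i)" 
  by (rule tensor_fun_reindex[where h = "%i. i" and Q = N' and Q' = N']) (use NJ bij_betw_id[unfolded id_def] in auto)
 have inv1: "tensor_map R J N' I N (%t. \<lambda>i\<in>I. t (b' i)) (tensor_map R I N J N' (%t. \<lambda>j\<in>J. t (b j)) x) = x"
  if x: "x \<in> carrier (tensor R I N)" for x
 proof -
  have "tensor_map R J N' I N (%t. \<lambda>i\<in>I. t (b' i)) (tensor_map R I N J N' (%t. \<lambda>j\<in>J. t (b j)) x) =
    tensor_map R I N I N (%t. \<lambda>i\<in>I. t i) x"
   by (rule tensor_map_comp[OF R N NJ N A A' id _ x]) (assumption+, rule restrict_ext, simp add: bb' bij_betw_apply[OF b'])
  also have "\<dots> = x"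
   by (rule tensor_map_id[OF R N id _ x]) (auto simp: PiE_def extensional_restrict)
  finally show ?thesis .
 qed
 have inv2: "tensor_map R I N J N' (%t. \<lambda>j\<in>J. t (b j)) (tensor_map R J N' I N (%t. \<lambda>i\<in>I. t (b' i)) x) = x"
  if x: "x \<in> carrier (tensor R J N')" for x
 proof -
  have "tensor_map R I N J N' (%t. \<lambda>j\<in>J. t (b j)) (tensor_map R J N' I N (%t. \<lambda>i\<in>I. t (b' i)) x) =
    tensor_map R J N' J N' (%t. \<lambda>i\<in>J. t i) x"
   by (rule tensor_map_comp[OF R NJ N NJ A' A id' _ x]) (assumption+, rule restrict_ext, simp add: b'b bij_betw_apply[OF b])
  also have "\<dots> = x"
   by (rule tensor_map_id[OF R NJ id' _ x]) (auto simp: PiE_def extensional_restrict)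
  finally show ?thesis .
 qed
 show ?B
  by (rule bij_betw_byWitness[where f' = "tensor_map R J N' I N (%t. \<lambda>i\<in>I. t (b' i))"])
   (auto simp: inv1 inv2 mod_hom_closed[OF tensor_map_hom[OF R N NJ A]] mod_hom_closed[OF tensor_map_hom[OF R NJ N A']])
qed

section \<open>The path poset of a directed polygon\<close>

locale ngon = based_digraph R A M Gm
 for R :: "'r ring" and A :: "('r, 'a) module" and M :: "('r, 'm, 'a) bimodule"
  and Gm :: "('v, 'e) pre_digraph \<times> 'v" +
 fixes n :: nat and v :: "nat => 'v" and e :: "nat => 'e"
 assumes n: "1 \<le> n" and v: "bij_betw v {..<n} (verts (fst Gm))" and e: "bij_betw e {..<n} (arcs (fst Gm))"
  and tail_e: "i < n ==> tail (fst Gm) (e i) = v i" and head_e: "i < n ==> head (fst Gm) (e i) = v (Suc i mod n)"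
  and base_v: "v 0 = snd Gm"
begin

lemma verts_eq: "verts G = v ` {..<n}" and arcs_eq: "arcs G = e ` {..<n}"
 using v e by (simp_all add: bij_betw_def)

lemma v_eq_iff: "[|i < n; j < n|] ==> v i = v j \<longleftrightarrow> i = j"
 using v by (auto simp: bij_betw_def dest: inj_onD)

lemma e_eq_iff: "[|i < n; j < n|] ==> e i = e j \<longleftrightarrow> i = j"
 using e by (auto simp: bij_betw_def dest: inj_onD)

text \<open>On the full cycle positions would grow by one at each of the \<open>n\<close> steps and
  yet return to their start. If an edge is missing, the cycle opened there is a single path and its
  positions are a labelling.\<close>

lemma P_iff: "x \<in> P \<longleftrightarrow> x \<subset> arcs G"
proof
 assume "x \<in> P"
 then have mp: "multipath G x" by (simp add: path_poset_iff fin_G)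
 obtain l :: "'v => 'v" and pos :: "'v => nat" where
  pos: "\<forall>a\<in>x. l (head G a) = l (tail G a) \<and> pos (head G a) = Suc (pos (tail G a))"
  using multipath_labels[OF mp] by (elim exE conjE) (rule that)
 have "x \<noteq> arcs G"
 proof
  assume "x = arcs G"
  then have step: "pos (v (Suc i mod n)) = Suc (pos (v i))" if "i < n" for i
   using pos that by (auto simp: arcs_eq tail_e head_e)
  have "i < n ==> pos (v i) = pos (v 0) + i" for i
  proof (induction i)
   case (Suc i)
   then show ?case using step[of i] by simp
  qed simp
  from this[of "n - 1"] show False using step[of "n - 1"] n by simp
 qed
 moreover have "x \<subseteq> arcs G" using mp by (simp add: multipath_def)
 ultimately show "x \<subset> arcs G" by blast
next
 assume x: "x \<subset> arcs G"
 then obtain j where j: "j < n" "e j \<notin> x" by (auto simp: arcs_eq)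
 \<comment> \<open>The number of steps from the head of the missing edge \<open>e j\<close> to
   vertex \<open>i\<close>; it increases along every edge but \<open>e j\<close>, whose tail comes
   last.\<close>
 define q where "q i = (if j < i then i - j - 1 else i + n - j - 1)" for i
 have q_inj: "q i = q k \<longleftrightarrow> i = k" if "i < n" "k < n" for i k
  using that j by (auto simp: q_def split: if_splits)
 have q_step: "q (Suc i mod n) = Suc (q i)" if "i < n" "i \<noteq> j" for i
  using that j by (cases "Suc i = n") (auto simp: q_def)
 define g where "g = the_inv_into {..<n} v"
 have g: "g (v i) = i" if "i < n" for i
  unfolding g_def using v that by (simp add: bij_betw_def the_inv_into_f_f)
 define pos where "pos w = q (g w)" for w
 have "multipath G x"
  unfolding multipath_def
 proof (intro conjI exI[of _ "%w. v 0"] exI[of _ pos] ballI impI)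
  show "x \<subseteq> arcs G" using x by blast
  show "inj_on (tail G) x"
   by (rule inj_on_subset[of _ "arcs G"]) (use x in "auto simp: arcs_eq inj_on_def tail_e v_eq_iff")
 next
  fix u w assume "u \<in> verts G" "w \<in> verts G" "pos u = pos w"
  then show "u = w" by (auto simp: verts_eq pos_def g q_inj)
 next
  fix a assume a: "a \<in> x"
  then obtain i where i: "i < n" "a = e i" using x by (auto simp: arcs_eq)
  then show "pos (head G a) = Suc (pos (tail G a))"
   using a j q_step[of i] n by (auto simp: tail_e head_e pos_def g)
 qed simp
 then show "x \<in> P" by (simp add: path_poset_iff fin_G)
qed

text \<open>Sets of cut edges are represented by strictly increasing lists, so that there is an
  \<open>i\<close>-th cut and deleting it can serve as an \<open>i\<close>-th face.\<close>

definition cuts :: "nat list set"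
 where "cuts = {c. c \<noteq> [] \<and> sorted_wrt (<) c \<and> set c \<subseteq> {..<n}}"

definition xc :: "nat list => 'e set"
 where "xc c = e ` ({..<n} - set c)"

definition cut :: "'e set => nat set"
 where "cut x = {i. i < n \<and> e i \<notin> x}"

lemma cutsD: "c \<in> cuts ==> c \<noteq> []" "c \<in> cuts ==> sorted_wrt (<) c" "c \<in> cuts ==> a \<in> set c ==> a < n"
  "c \<in> cuts ==> i < length c ==> c ! i < n"
 using nth_mem by (fastforce simp: cuts_def)+

lemma xc_P:
 assumes "c \<in> cuts" shows "xc c \<in> P"
proof -
 have "hd c \<in> set c" "hd c < n" using cutsD[OF assms] by auto
 then have "e (hd c) \<in> arcs G" "e (hd c) \<notin> xc c" using e_eq_iff by (auto simp: xc_def arcs_eq)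
 moreover have "xc c \<subseteq> arcs G" by (auto simp: xc_def arcs_eq)
 ultimately show ?thesis unfolding P_iff by blast
qed

lemma cut_subset: "cut x \<subseteq> {..<n}" and cut_antimono: "x \<subseteq> y ==> cut y \<subseteq> cut x"
 and cut_nonempty: "x \<in> P ==> cut x \<noteq> {}"
 by (auto simp: cut_def P_iff arcs_eq)

lemma cut_xc: "c \<in> cuts ==> cut (xc c) = set c"
 using e_eq_iff by (auto simp: cut_def xc_def cuts_def)

lemma subset_xc_iff:
 assumes "x \<in> P" "c \<in> cuts"
 shows "x \<subseteq> xc c \<longleftrightarrow> set c \<subseteq> cut x"
proof
 assume sub: "x \<subseteq> xc c"
 show "set c \<subseteq> cut x"
 proof
  fix a assume "a \<in> set c"
  then show "a \<in> cut x" using cutsD(3)[OF assms(2)] sub e_eq_iff by (auto simp: cut_def xc_def)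
 qed
next
 assume sub: "set c \<subseteq> cut x"
 show "x \<subseteq> xc c"
 proof
  fix a assume a: "a \<in> x"
  then obtain i where "i < n" "a = e i" using assms(1) by (auto simp: P_iff arcs_eq)
  then show "a \<in> xc c" using a sub by (auto simp: xc_def cut_def)
 qed
qed

lemma xc_del_nth:
 assumes c: "c \<in> cuts" and i: "i < length c"
 shows "xc (del_nth i c) = insert (e (c ! i)) (xc c)" "e (c ! i) \<notin> xc c"
proof -
 have "set (del_nth i c) = set c - {c ! i}"
  by (rule set_del_nth_distinct[OF i strict_sorted_distinct[OF cutsD(2)[OF c]]])
 moreover have "c ! i < n" by (rule cutsD(4)[OF c i])
 ultimately show "xc (del_nth i c) = insert (e (c ! i)) (xc c)" by (auto simp: xc_def)
 show "e (c ! i) \<notin> xc c" using \<open>c ! i < n\<close> e_eq_iff i by (auto simp: xc_def)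
qed

lemma cuts_del_nth: "[|c \<in> cuts; i < length c; 1 < length c|] ==> del_nth i c \<in> cuts"
 using set_del_nth[of i c] sorted_wrt_del_nth[of "(<)" c i] length_del_nth[of i c] by (auto simp: cuts_def)

section \<open>Components of the cut polygon as blocks between consecutive cuts\<close>

definition block :: "nat list => nat => 'v set"
 where "block c j = v ` {k. k < n \<and> bidx c k = j}"

lemma v_mem_block: "k < n ==> v k \<in> block c j \<longleftrightarrow> bidx c k = j"
 using v_eq_iff by (auto simp: block_def)

lemma bidx_tail: "[|c \<in> cuts; i < length c|] ==> bidx c (c ! i) = i"
 by (simp add: bidx_def cnt_nth cutsD)

text \<open>At the end of the enumeration the next vertex is vertex 0. All cuts lie below
  \<open>n\<close>, so the full count is reached there and both sides give block 0.\<close>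

lemma bidx_Suc:
 assumes c: "c \<in> cuts" and k: "k < n"
 shows "bidx c (Suc k mod n) = (if cnt c (Suc k) = length c then 0 else cnt c (Suc k))"
proof (cases "Suc k = n")
 case True
 have "cnt c n = length c"
  by (rule cnt_eqI[OF cutsD(2)[OF c]]) (simp_all add: cutsD(4)[OF c])
 then show ?thesis using True cutsD(1)[OF c] by (simp add: bidx_def cnt_0)
next
 case False
 then show ?thesis using k by (simp add: bidx_def)
qed

lemma bidx_head: "[|c \<in> cuts; i < length c|] ==> bidx c (Suc (c ! i) mod n) = Suc i mod length c"
 using bidx_Suc[of c "c ! i"] cutsD(2,4)[of c] by (auto simp: cnt_Suc_nth)

lemma bidx_uncut: "[|c \<in> cuts; k < n; k \<notin> set c|] ==> bidx c (Suc k mod n) = bidx c k"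
 using bidx_Suc[of c k] cutsD(2)[of c] by (simp add: cnt_Suc_notin bidx_def)

text \<open>Blocks are closed under the uncut edges, which separates them. Conversely the vertices
  of a block are joined by walking forward along uncut edges, for block 0 possibly past the end of
  the enumeration.\<close>

lemma component_rel_xc:
 assumes c: "c \<in> cuts" and k: "k < n" "l < n"
 shows "(v k, v l) \<in> component_rel G (xc c) \<longleftrightarrow> bidx c k = bidx c l"
proof
 assume "(v k, v l) \<in> component_rel G (xc c)"
 moreover have "edge_closed G (xc c) (block c (bidx c k))"
  using n by (auto simp: edge_closed_def xc_def tail_e head_e v_mem_block bidx_uncut[OF c])
 ultimately have "v l \<in> block c (bidx c k)"
  using component_rel_closed[of "v k" "v l" G "xc c" "block c (bidx c k)"] k by (simp add: v_mem_block)
 then show "bidx c k = bidx c l" using k by (simp add: v_mem_block)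
next
 let ?r = "component_rel G (xc c)"
 have xa: "xc c \<subseteq> arcs G" by (rule path_poset_arcs[OF fin_G xc_P[OF c]])
 have V: "v i \<in> verts G" if "i < n" for i using that by (auto simp: verts_eq)
 have step: "(v i, v (Suc i mod n)) \<in> ?r" if "i < n" "i \<notin> set c" for i
 proof -
  have "e i \<in> xc c" using that by (auto simp: xc_def)
  from component_rel_edge[OF fin_G xa this] show ?thesis using that by (simp add: tail_e head_e)
 qed
 \<comment> \<open>As long as the count does not change no cut is passed. The end point
   \<open>n\<close> is allowed, and stands for vertex 0.\<close>
 have run: "(v i, v (j mod n)) \<in> ?r" if "i \<le> j" "j \<le> n" "i < n" "cnt c i = cnt c j" for i j
  using that
 proof (induction "j - i" arbitrary: j)
  case 0
  then show ?case using component_rel_refl[OF V[of i]] by simp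
 next
  case (Suc d)
  then obtain j' where j: "j = Suc j'" "i \<le> j'" "d = j' - i" by (cases j) auto
  have eq: "cnt c i = cnt c j'" using cnt_mono[of i j' c] cnt_mono[of j' j c] Suc.prems j by simp
  have "j' \<notin> set c"
  proof
   assume "j' \<in> set c"
   then obtain m where "m < length c" "c ! m = j'" by (auto simp: in_set_conv_nth)
   then show False using cnt_nth[of c m] cnt_Suc_nth[of c m] cutsD(2)[OF c] Suc.prems(4) eq j by simp
  qed
  moreover have "(v i, v (j' mod n)) \<in> ?r" by (rule Suc.hyps(1)[OF j(3)]) (use Suc.prems j eq in auto)
  ultimately show ?case using step[of j'] Suc.prems j component_rel_trans by fastforce
 qed
 have cn: "cnt c n = length c"
  by (rule cnt_eqI[OF cutsD(2)[OF c]]) (simp_all add: cutsD(4)[OF c])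
 have rep: "(v i, v (if cnt c i = length c then 0 else i)) \<in> ?r" if "i < n" for i
  using run[of i n] that cn component_rel_refl[OF V[of i]] by auto
 \<comment> \<open>Vertices behind the last cut are moved to vertex 0, after which vertices of one
   block also have equal counts and \<open>run\<close> applies.\<close>
 define r where "r i = (if cnt c i = length c then 0 else i)" for i
 have r: "r i < n" "cnt c (r i) = bidx c i" if "i < n" for i
  using that n by (auto simp: r_def bidx_def cnt_0)
 assume eq: "bidx c k = bidx c l"
 have "(v (r k), v (r l)) \<in> ?r"
  using run[of "r k" "r l"] component_rel_sym[OF run[of "r l" "r k"]] r[of k] r[of l] k eq
  by (cases "r k \<le> r l") auto
 then show "(v k, v l) \<in> ?r"
  using rep[OF k(1)] component_rel_sym[OF rep[OF k(2)]] component_rel_trans unfolding r_def by metis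
qed

lemma component_of_xc:
 assumes "c \<in> cuts" "k < n"
 shows "component_of G (xc c) (v k) = block c (bidx c k)"
proof (rule Set.set_eqI)
 fix w show "w \<in> component_of G (xc c) (v k) \<longleftrightarrow> w \<in> block c (bidx c k)"
 proof (cases "w \<in> verts G")
  case True
  then obtain l where "l < n" "w = v l" by (auto simp: verts_eq)
  then show ?thesis using component_rel_xc[OF assms, of l] by (auto simp: mem_component_of v_mem_block)
 next
  case False
  then show ?thesis using component_rel_verts[of "v k" w G "xc c"] by (auto simp: mem_component_of block_def verts_eq)
 qed
qed

lemma bidx_surj:
 assumes "c \<in> cuts" "j < length c"
 shows "\<exists>k<n. bidx c k = j"
 using bidx_tail[OF assms] cutsD(4)[OF assms] by blast

lemma block_bij: "c \<in> cuts ==> bij_betw (block c) {..<length c} (pi0 G (xc c))"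
 unfolding bij_betw_def
proof
 assume c: "c \<in> cuts"
 show "inj_on (block c) {..<length c}"
 proof (rule inj_onI)
  fix i j assume "i \<in> {..<length c}" and eq: "block c i = block c j"
  then obtain k where "k < n" "bidx c k = i" using bidx_surj[OF c] by auto
  then show "i = j" using v_mem_block[of k c i] v_mem_block[of k c j] eq by simp
 qed
 have "bidx c ` {..<n} = {..<length c}" using bidx_surj[OF c] bidx_less[OF cutsD(1)[OF c]] by force
 then have "block c ` {..<length c} = (%k. block c (bidx c k)) ` {..<n}" by (metis image_image)
 also have "\<dots> = pi0 G (xc c)"
  unfolding pi0_eq verts_eq image_image by (rule image_cong) (simp_all add: component_of_xc[OF c])
 finally show "block c ` {..<length c} = pi0 G (xc c)" .
qed

lemma base_block: "[|c \<in> cuts; j < length c|] ==> snd Gm \<in> block c j \<longleftrightarrow> j = 0"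
 using v_mem_block[of 0 c j] n cutsD(1)[of c] unfolding base_v[symmetric] by (auto simp: bidx_def cnt_0)

section \<open>The coefficient module of a cut polygon as a Hochschild chain module\<close>

definition bfun :: "nat list => ('v set => 'a + 'm) => nat => 'a + 'm"
 where "bfun c t = (\<lambda>j\<in>{0..length c - 1}. t (block c j))"

text \<open>Lists the unordered tensor factors in the cyclic order of the blocks, starting with the
  block of the base vertex, which carries \<open>M\<close>.\<close>

definition thh :: "nat list => (('v set => 'a + 'm) => 'r) set => ((nat => 'a + 'm) => 'r) set"
 where "thh c = tensor_map R (pi0 G (xc c)) N {0..length c - 1} HF (bfun c)"

lemma bfun_tensor_fun:
 assumes c: "c \<in> cuts"
 shows "tensor_fun R (pi0 G (xc c)) N {0..length c - 1} HF (bfun c)"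
  and "bij_betw (thh c) (carrier (Fo (xc c))) (carrier (H (length c - 1)))"
proof -
 have "{0..length c - 1} = {..<length c}" using cutsD(1)[OF c] by (cases c) auto
 then have b: "bij_betw (block c) {0..length c - 1} (pi0 G (xc c))" using block_bij[OF c] by simp
 have HF: "HF j = N (block c j)" if "j \<in> {0..length c - 1}" for j
  using base_block[OF c, of j] that cutsD(1)[OF c] by (cases c) (auto simp: HF_eq N_eq)
 have eta: "bfun c = (%t. \<lambda>j\<in>{0..length c - 1}. t (block c j))" by (simp add: bfun_def fun_eq_iff)
 show "tensor_fun R (pi0 G (xc c)) N {0..length c - 1} HF (bfun c)"
  unfolding eta by (rule tensor_map_reindex(1)[OF R_cring module_N b]) (rule HF)
 show "bij_betw (thh c) (carrier (Fo (xc c))) (carrier (H (length c - 1)))"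
  unfolding thh_def eta F_obj_def by (rule tensor_map_reindex(2)[OF R_cring module_N b]) (rule HF)
qed

lemma thh_hom: "c \<in> cuts ==> thh c \<in> mod_hom R (Fo (xc c)) (H (length c - 1))"
 unfolding thh_def F_obj_def by (rule tensor_map_hom[OF R_cring module_N module_HF bfun_tensor_fun(1)])

lemma block_del_nth:
 assumes c: "c \<in> cuts" "length c = Suc (Suc p)" and i: "i \<le> Suc p"
 shows "block (del_nth i c) j = \<Union>(block c ` {l. l \<le> Suc p \<and> collapse (Suc p) i l = j})"
proof (rule Set.set_eqI)
 fix w
 have "bidx c k \<le> Suc p" for k using bidx_less[OF cutsD(1)[OF c(1)], of k] c(2) by simp
 then show "w \<in> block (del_nth i c) j \<longleftrightarrow> w \<in> \<Union>(block c ` {l. l \<le> Suc p \<and> collapse (Suc p) i l = j})"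
  using bidx_del_nth[OF cutsD(2)[OF c(1)] c(2) i] by (auto simp: block_def)
qed

text \<open>The \<open>i\<close>-th cut edge runs from block \<open>i\<close> to its cyclic
  successor, so the tail factor stands on the left as in the Hochschild face. For the last cut the
  head lies in block 0, which gives the face that moves the last factor to the front.\<close>

lemma bfun_merge:
 assumes c: "c \<in> cuts" "length c = Suc (Suc p)" and i: "i \<le> Suc p"
 shows "bfun (del_nth i c) (merge_fun A M (block c i) (block c (Suc i mod length c)) (pi0 G (xc (del_nth i c))) t) =
  hoch_face A M (Suc p) i (bfun c t)"
proof (rule extensionalityI[where A = "{0..p}"])
 let ?c = "del_nth i c"
 have il: "i < length c" using i c(2) by simp
 have c': "?c \<in> cuts" "length ?c = Suc p"
  using cuts_del_nth[OF c(1) il] length_del_nth[OF il] c(2) by simp_all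
 show "bfun ?c (merge_fun A M (block c i) (block c (Suc i mod length c)) (pi0 G (xc ?c)) t) \<in> extensional {0..p}"
  by (simp add: bfun_def c'(2))
 show "hoch_face A M (Suc p) i (bfun c t) \<in> extensional {0..p}" by (auto simp: hoch_face_def)
 fix j assume j: "j \<in> {0..p}"
 have bij: "bij_betw (block ?c) {..<Suc p} (pi0 G (xc ?c))" using block_bij[OF c'(1)] c'(2) by simp
 have mem: "block ?c j \<in> pi0 G (xc ?c)" by (rule bij_betw_apply[OF bij]) (use j in simp)
 have inj: "block ?c j = block ?c j' \<longleftrightarrow> j = j'" if "j' \<le> p" for j'
  using bij j that by (auto simp: bij_betw_def dest: inj_onD)
 \<comment> \<open>The index of the merged block after renumbering: \<open>i\<close>, except that
   merging the last block with block 0 yields block 0.\<close>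
 let ?i = "if i < Suc p then i else 0"
 have "{l. l \<le> Suc p \<and> collapse (Suc p) i l = ?i} = {i, Suc i mod length c}"
  using i c(2) by (auto simp: collapse_def split: if_splits)
 then have un: "block c i \<union> block c (Suc i mod length c) = block ?c ?i"
  unfolding block_del_nth[OF c i] by simp
 have other: "block ?c j = block c (if j < i then j else Suc j)" if "j \<noteq> ?i"
 proof -
  have "{l. l \<le> Suc p \<and> collapse (Suc p) i l = j} = {if j < i then j else Suc j}"
   using that i j by (auto simp: collapse_def split: if_splits)
  then show ?thesis unfolding block_del_nth[OF c i] by simp
 qed
 have merge: "merge_fun A M (block c i) (block c (Suc i mod length c)) (pi0 G (xc ?c)) t (block ?c j) =
   (if j = ?i then fuse A M (t (block c i)) (t (block c (Suc i mod length c))) else t (block c (if j < i then j else Suc j)))"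
 proof (cases "j = ?i")
  case True
  then show ?thesis using mem unfolding merge_fun_def un by simp
 next
  case False
  have "?i \<le> p" by simp
  from inj[OF this] False have "block ?c j \<noteq> block ?c ?i" by blast
  then show ?thesis using mem False other[OF False] unfolding merge_fun_def un by simp
 qed
 show "bfun ?c (merge_fun A M (block c i) (block c (Suc i mod length c)) (pi0 G (xc ?c)) t) j =
  hoch_face A M (Suc p) i (bfun c t) j"
 proof (cases "i < Suc p")
  case True
  then show ?thesis using j c(2) c'(2) merge by (auto simp: bfun_def hoch_face_def)
 next
  case False
  then have "i = Suc p" using i by simp
  then show ?thesis using j c(2) c'(2) merge by (auto simp: bfun_def hoch_face_def)
 qed
qed

lemma thh_face:
 assumes c: "c \<in> cuts" "length c = Suc (Suc p)" and i: "i \<le> Suc p" and w: "w \<in> carrier (Fo (xc c))"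
 shows "thh (del_nth i c) (Fmap (xc c) (xc (del_nth i c)) w) = Hd p i (thh c w)"
proof -
 let ?c = "del_nth i c"
 have il: "i < length c" using i c(2) by simp
 have c': "?c \<in> cuts" "length ?c = Suc p"
  using cuts_del_nth[OF c(1) il] length_del_nth[OF il] c(2) by simp_all
 note x = xc_del_nth[OF c(1) il]
 have P': "insert (e (c ! i)) (xc c) \<in> P" using xc_P[OF c'(1)] x(1) by simp
 have ci: "c ! i < n" by (rule cutsD(4)[OF c(1) il])
 have comp: "component_of G (xc c) (tail G (e (c ! i))) = block c i"
  "component_of G (xc c) (head G (e (c ! i))) = block c (Suc i mod length c)"
  using component_of_xc[OF c(1), of "c ! i"] component_of_xc[OF c(1), of "Suc (c ! i) mod n"] ci n
  by (simp_all add: tail_e head_e bidx_tail[OF c(1) il] bidx_head[OF c(1) il])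
 have F: "Fmap (xc c) (xc ?c) w = tensor_map R (pi0 G (xc c)) N (pi0 G (xc ?c)) N
   (merge_fun A M (block c i) (block c (Suc i mod length c)) (pi0 G (xc ?c))) w"
  unfolding x(1) F_map_eq Fm_cover[OF P' x(2) w] F_cover_eq[OF x(2)] comp ..
 have mf: "tensor_fun R (pi0 G (xc c)) N (pi0 G (xc ?c)) N
   (merge_fun A M (block c i) (block c (Suc i mod length c)) (pi0 G (xc ?c)))"
  using merge_fun_cover[OF P' x(2)] unfolding comp x(1) .
 have l: "length ?c - 1 = p" "length c - 1 = Suc p" using c(2) c'(2) by simp_all
 show ?thesis
  unfolding F thh_def Hd_def l
 proof (rule tensor_map_square[OF R_cring module_N module_N module_HF module_HF])
  show "tensor_fun R (pi0 G (xc ?c)) N {0..p} HF (bfun ?c)" using bfun_tensor_fun(1)[OF c'(1)] unfolding l .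
  show "tensor_fun R (pi0 G (xc c)) N {0..Suc p} HF (bfun c)" using bfun_tensor_fun(1)[OF c(1)] unfolding l .
  show "tensor_fun R {0..Suc p} HF {0..p} HF (hoch_face A M (Suc p) i)" by (rule hoch_face_tensor_fun[OF i])
  show "w \<in> carrier (tensor R (pi0 G (xc c)) N)" using w by (simp add: F_obj_def)
  show "bfun ?c (merge_fun A M (block c i) (block c (Suc i mod length c)) (pi0 G (xc ?c)) t) =
   hoch_face A M (Suc p) i (bfun c t)" for t
   by (rule bfun_merge[OF c i])
 qed (rule mf)
qed

end

text \<open>The given enumeration is rotated by the position of \<open>b\<close>.\<close>

lemma directed_ngon_based:
 assumes "directed_ngon n G" "b \<in> verts G"
 shows "\<exists>v e. bij_betw v {..<n} (verts G) \<and> bij_betw e {..<n} (arcs G) \<and>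
  (\<forall>i<n. tail G (e i) = v i \<and> head G (e i) = v (Suc i mod n)) \<and> v 0 = b"
proof -
 obtain v e where n: "1 \<le> n" and v: "bij_betw v {..<n} (verts G)" and e: "bij_betw e {..<n} (arcs G)"
  and ve: "\<forall>i<n. tail G (e i) = v i \<and> head G (e i) = v (Suc i mod n)"
  using assms(1) unfolding directed_ngon_def by (elim exE conjE) (rule that)
 have "b \<in> v ` {..<n}" using v assms(2) by (simp add: bij_betw_def)
 then obtain k where k: "k < n" "v k = b" by blast
 define s where "s i = (i + k) mod n" for i
 have s_less: "s i < n" for i using n by (simp add: s_def)
 have s_eq: "s i = (if i + k < n then i + k else i + k - n)" if "i < n" for i
  using that k by (cases "i + k < n") (simp_all add: s_def le_mod_geq)
 have "inj_on s {..<n}"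
  by (rule inj_onI) (use k(1) in "auto simp: s_eq split: if_splits")
 then have s: "bij_betw s {..<n} {..<n}"
  unfolding bij_betw_def using endo_inj_surj[of "{..<n}" s] s_less by auto
 have "s (Suc i mod n) = Suc (s i) mod n" for i by (simp add: s_def mod_simps)
 then show ?thesis
  using ve s_less k bij_betw_trans[OF s v] bij_betw_trans[OF s e]
  by (intro exI[of _ "v \<circ> s"] exI[of _ "e \<circ> s"]) (auto simp: s_def[of 0])
qed

section \<open>Maps of direct sums permuting the summands\<close>

text \<open>Collects the side conditions of \<open>dmap\<close>, so that composites of such maps can
  be compared on generators without restating them.\<close>

definition dface ::
 "'r ring => 'i set => ('i => ('r, 'm) module) => 'j set => ('j => ('r, 'n) module) => ('i => 'j) => ('i => 'm => 'n) => bool"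
 where "dface R I N J N' g ph \<longleftrightarrow> cring R \<and> finite I \<and> (\<forall>i\<in>I. Module.module R (N i)) \<and> (\<forall>j\<in>J. Module.module R (N' j)) \<and>
  (\<forall>i\<in>I. g i \<in> J --> ph i \<in> mod_hom R (N i) (N' (g i)))"

lemma dface_hom: "dface R I N J N' g ph ==> dmap I N J N' g ph \<in> mod_hom R (dsum I N) (dsum J N')"
 by (rule dmap_hom) (auto simp: dface_def)

lemma dface_in: "[|dface R I N J N' g ph; i \<in> I; v \<in> carrier (N i)|] ==>
  dmap I N J N' g ph (dsum_in I N i v) = dsum_in J N' (g i) (ph i v)"
 by (rule dmap_in[where R = R]) (auto simp: dface_def)

lemma dface_modules:
 "dface R I N J N' g ph ==> Module.module R (dsum I N)" "dface R I N J N' g ph ==> Module.module R (dsum J N')"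
 by (auto simp: dface_def intro!: module_dsum)

lemma dface_hom_ext:
 assumes "dface R I N J N' g ph" "Module.module R P" "f \<in> mod_hom R (dsum I N) P" "f' \<in> mod_hom R (dsum I N) P"
  and "\<And>i v. [|i \<in> I; v \<in> carrier (N i)|] ==> f (dsum_in I N i v) = f' (dsum_in I N i v)" "c \<in> carrier (dsum I N)"
 shows "f c = f' c"
 by (rule dsum_hom_ext[where f = f and g = f' and P = P and R = R and I = I and N = N])
  (use assms in "auto simp: dface_def")

text \<open>On a generator both composites have a single component, so the square becomes an
  equality of indices and of coefficients. Requiring the intermediate indices to lie in their sets
  prevents a generator from being sent to zero halfway along one side only.\<close>

lemma dface_square:
 assumes d1: "dface R I N J N1 g1 ph1" and d2: "dface R J N1 K N2 g2 ph2"
  and d3: "dface R I N J' N3 g3 ph3" and d4: "dface R J' N3 K N2 g4 ph4"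
  and eq: "\<And>i v. [|i \<in> I; v \<in> carrier (N i)|] ==> g1 i \<in> J \<and> g3 i \<in> J' \<and> g2 (g1 i) = g4 (g3 i) \<and>
   ph2 (g1 i) (ph1 i v) = ph4 (g3 i) (ph3 i v)"
  and c: "c \<in> carrier (dsum I N)"
 shows "dmap J N1 K N2 g2 ph2 (dmap I N J N1 g1 ph1 c) = dmap J' N3 K N2 g4 ph4 (dmap I N J' N3 g3 ph3 c)"
proof (rule dface_hom_ext[where f = "%c. dmap J N1 K N2 g2 ph2 (dmap I N J N1 g1 ph1 c)"
   and f' = "%c. dmap J' N3 K N2 g4 ph4 (dmap I N J' N3 g3 ph3 c)", OF d1 dface_modules(2)[OF d2] _ _ _ c])
 show "(%c. dmap J N1 K N2 g2 ph2 (dmap I N J N1 g1 ph1 c)) \<in> mod_hom R (dsum I N) (dsum K N2)"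
  by (rule mod_hom_comp[OF dface_hom[OF d1] dface_hom[OF d2]])
 show "(%c. dmap J' N3 K N2 g4 ph4 (dmap I N J' N3 g3 ph3 c)) \<in> mod_hom R (dsum I N) (dsum K N2)"
  by (rule mod_hom_comp[OF dface_hom[OF d3] dface_hom[OF d4]])
 fix i v assume i: "i \<in> I" and v: "v \<in> carrier (N i)"
 note e = eq[OF i v]
 have "ph1 i v \<in> carrier (N1 (g1 i))" "ph3 i v \<in> carrier (N3 (g3 i))"
  using d1 d3 e i v by (auto simp: dface_def intro: mod_hom_closed[of _ R "N i"])
 then show "dmap J N1 K N2 g2 ph2 (dmap I N J N1 g1 ph1 (dsum_in I N i v)) =
   dmap J' N3 K N2 g4 ph4 (dmap I N J' N3 g3 ph3 (dsum_in I N i v))"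
  using e by (simp add: dface_in[OF d1 i v] dface_in[OF d3 i v] dface_in[OF d2] dface_in[OF d4])
qed

lemma dface_retract:
 assumes d1: "dface R I N J N1 g1 ph1" and d2: "dface R J N1 I N g2 ph2"
  and eq: "\<And>i v. [|i \<in> I; v \<in> carrier (N i)|] ==> g1 i \<in> J \<and> g2 (g1 i) = i \<and> ph2 (g1 i) (ph1 i v) = v"
  and c: "c \<in> carrier (dsum I N)"
 shows "dmap J N1 I N g2 ph2 (dmap I N J N1 g1 ph1 c) = c"
proof (rule dface_hom_ext[where f = "%c. dmap J N1 I N g2 ph2 (dmap I N J N1 g1 ph1 c)"
   and f' = "%c. c", OF d1 dface_modules(2)[OF d2] _ mod_hom_id[OF dface_modules(1)[OF d1]] _ c])
 show "(%c. dmap J N1 I N g2 ph2 (dmap I N J N1 g1 ph1 c)) \<in> mod_hom R (dsum I N) (dsum I N)"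
  by (rule mod_hom_comp[OF dface_hom[OF d1] dface_hom[OF d2]])
 fix i v assume i: "i \<in> I" and v: "v \<in> carrier (N i)"
 note e = eq[OF i v]
 have "ph1 i v \<in> carrier (N1 (g1 i))"
  using d1 e i v by (auto simp: dface_def intro: mod_hom_closed[of _ R "N i"])
 then show "dmap J N1 I N g2 ph2 (dmap I N J N1 g1 ph1 (dsum_in I N i v)) = dsum_in I N i v"
  using e by (simp add: dface_in[OF d1 i v] dface_in[OF d2])
qed

section \<open>Contracting homotopies\<close>

lemma altsum_first:
 assumes N: "Module.module R N" and f0: "f 0 \<in> carrier N" and f: "\<And>i. [|0 < i; i \<le> k|] ==> f i = \<zero>\<^bsub>N\<^esub>"
 shows "altsum R N k f = f 0"
proof (cases k)
 case 0
 then show ?thesis using altsum_0[OF N, of f] f0 by simp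
next
 case (Suc l)
 interpret N: Module.module R N by (rule N)
 have "f i \<in> carrier N" if "i \<le> Suc l" for i using f[of i] f0 Suc that by (cases "i = 0") auto
 then have "altsum R N k f = f 0 \<ominus>\<^bsub>N\<^esub> altsum R N l (%i. f (Suc i))"
  unfolding Suc by (rule altsum_Suc_shift[OF N])
 also have "altsum R N l (%i. f (Suc i)) = \<zero>\<^bsub>N\<^esub>"
  by (rule altsum_eq_zero[OF N]) (use f Suc in auto)
 finally show ?thesis using f0 by (simp add: N.M.minus_eq)
qed

text \<open>An extra degeneracy behind all positions: the last face recovers \<open>x\<close>, the
  other faces come from a vanishing sum. The result is \<open>x\<close> up to the sign of the last
  face, so \<open>y\<close> is multiplied by that sign, whose square is one.\<close>

lemma back_homotopy_exact:
 assumes N: "Module.module R N" and N': "Module.module R N'" and B: "Module.module R B"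
  and h': "h' \<in> mod_hom R N' N" and D: "\<And>i. i \<le> Suc k ==> D i \<in> mod_hom R B N"
  and x: "x \<in> carrier N" and y: "y \<in> carrier B" and f: "\<And>i. i \<le> k ==> f i \<in> carrier N'"
  and Suc: "D (Suc k) y = x" and le: "\<And>i. i \<le> k ==> D i y = h' (f i)" and z: "altsum R N' k f = \<zero>\<^bsub>N'\<^esub>"
 shows "\<exists>s\<in>carrier B. altsum R N (Suc k) (%i. D i s) = x"
proof
 interpret N: Module.module R N by (rule N)
 interpret B: Module.module R B by (rule B)
 have R: "cring R" by (rule N.R.is_cring)
 let ?s = "sgn_pow R (Suc k)"
 show "?s \<odot>\<^bsub>B\<^esub> y \<in> carrier B" using y sgn_pow_closed[OF R] by simp
 have "altsum R N (Suc k) (%i. D i (?s \<odot>\<^bsub>B\<^esub> y)) = ?s \<odot>\<^bsub>N\<^esub> altsum R N (Suc k) (%i. D i y)"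
  by (rule mod_hom_smult[OF altsum_hom[OF B N D] sgn_pow_closed[OF R] y])
 also have "altsum R N (Suc k) (%i. D i y) = ?s \<odot>\<^bsub>N\<^esub> x \<oplus>\<^bsub>N\<^esub> h' (altsum R N' k f)"
  by (rule altsum_homotopy_back[where g = "%i. D i y" and f = f, OF N N' h' x f]) (use Suc le in auto)
 also have "\<dots> = ?s \<odot>\<^bsub>N\<^esub> x"
  using mod_hom_zero[OF h' N' N] z x sgn_pow_closed[OF R] by simp
 also have "?s \<odot>\<^bsub>N\<^esub> (?s \<odot>\<^bsub>N\<^esub> x) = x"
  using sgn_pow_sqr[OF R, of "Suc k"] sgn_pow_closed[OF R] x by (simp add: N.smult_assoc1[symmetric])
 finally show "altsum R N (Suc k) (%i. D i (?s \<odot>\<^bsub>B\<^esub> y)) = x" .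
qed

text \<open>The second alternative covers the generators on which the cone operator \<open>h\<close> degenerates.\<close>

lemma cone_identity:
 assumes d: "dface R I N J N' g ph" and B0: "Module.module R B0" and B2: "Module.module R B2"
  and D2: "\<And>i. i \<le> Suc k ==> D2 i \<in> mod_hom R B2 (dsum I N)" and D1: "\<And>i. i \<le> k ==> D1 i \<in> mod_hom R (dsum I N) B0"
  and h: "h \<in> mod_hom R (dsum I N) B2" and h': "h' \<in> mod_hom R B0 (dsum I N)" and ka: "ka \<in> mod_hom R (dsum I N) (dsum I N)"
  and gen: "\<And>i v x. [|i \<in> I; v \<in> carrier (N i); x = dsum_in I N i v|] ==>
   D2 0 (h x) = x \<and> (\<forall>i\<le>k. D2 (Suc i) (h x) = h' (D1 i x)) \<and> ka x = \<zero>\<^bsub>dsum I N\<^esub> \<or>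
   h x = \<zero>\<^bsub>B2\<^esub> \<and> h' (D1 0 x) = x \<ominus>\<^bsub>dsum I N\<^esub> ka x \<and> (\<forall>i. 0 < i --> i \<le> k --> h' (D1 i x) = \<zero>\<^bsub>dsum I N\<^esub>)"
  and c: "c \<in> carrier (dsum I N)"
 shows "altsum R (dsum I N) (Suc k) (%i. D2 i (h c)) \<oplus>\<^bsub>dsum I N\<^esub> h' (altsum R B0 k (%i. D1 i c)) =
  c \<ominus>\<^bsub>dsum I N\<^esub> ka c"
proof -
 let ?B = "dsum I N"
 have B: "Module.module R ?B" by (rule dface_modules(1)[OF d])
 interpret B: Module.module R ?B by (rule B)
 interpret B0: Module.module R B0 by (rule B0)
 have R: "cring R" by (rule B.R.is_cring)
 have hom1: "(%c. altsum R ?B (Suc k) (%i. D2 i (h c)) \<oplus>\<^bsub>?B\<^esub> h' (altsum R B0 k (%i. D1 i c))) \<in> mod_hom R ?B ?B"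
  by (rule mod_hom_pointwise_add[OF B altsum_hom[OF B B mod_hom_comp[OF h D2]]
     mod_hom_comp[OF altsum_hom[OF B B0 D1] h']])
 \<comment> \<open>Subtraction is spelled with a scalar, so that the right-hand side is visibly a
   linear map and may be compared on generators.\<close>
 have hom2: "(%c. c \<oplus>\<^bsub>?B\<^esub> (\<ominus>\<^bsub>R\<^esub> \<one>\<^bsub>R\<^esub>) \<odot>\<^bsub>?B\<^esub> ka c) \<in> mod_hom R ?B ?B"
  by (rule mod_hom_pointwise_add[OF B mod_hom_id[OF B] mod_hom_pointwise_smult[OF B ka]]) simp
 have minus: "c \<oplus>\<^bsub>?B\<^esub> (\<ominus>\<^bsub>R\<^esub> \<one>\<^bsub>R\<^esub>) \<odot>\<^bsub>?B\<^esub> ka c = c \<ominus>\<^bsub>?B\<^esub> ka c" if "c \<in> carrier ?B" for c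
  using mod_hom_closed[OF ka that] that by (simp add: B.smult_l_minus B.M.minus_eq)
 have "altsum R ?B (Suc k) (%i. D2 i (h c)) \<oplus>\<^bsub>?B\<^esub> h' (altsum R B0 k (%i. D1 i c)) =
   c \<oplus>\<^bsub>?B\<^esub> (\<ominus>\<^bsub>R\<^esub> \<one>\<^bsub>R\<^esub>) \<odot>\<^bsub>?B\<^esub> ka c"
 proof (rule dface_hom_ext[OF d B hom1 hom2 _ c])
  fix i v assume i: "i \<in> I" and v: "v \<in> carrier (N i)"
  let ?x = "dsum_in I N i v"
  have "dsum_in I N i \<in> mod_hom R (N i) ?B" by (rule dsum_in_hom) (use d i in "auto simp: dface_def")
  from mod_hom_closed[OF this v] have x: "?x \<in> carrier ?B" .
  have D1x: "D1 i ?x \<in> carrier B0" if "i \<le> k" for i by (rule mod_hom_closed[OF D1[OF that] x])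
  have hD1: "h' (altsum R B0 k (%i. D1 i ?x)) = altsum R ?B k (%i. h' (D1 i ?x))"
   by (rule mod_hom_altsum[OF h' B0 B D1x])
  have hc: "h' (altsum R B0 k (%i. D1 i ?x)) \<in> carrier ?B"
   by (rule mod_hom_closed[OF h' altsum_closed[OF B0 D1x]])
  consider (front) "D2 0 (h ?x) = ?x" "\<And>i. i \<le> k ==> D2 (Suc i) (h ?x) = h' (D1 i ?x)" "ka ?x = \<zero>\<^bsub>?B\<^esub>"
   | (degenerate) "h ?x = \<zero>\<^bsub>B2\<^esub>" "h' (D1 0 ?x) = ?x \<ominus>\<^bsub>?B\<^esub> ka ?x" "\<And>i. [|0 < i; i \<le> k|] ==> h' (D1 i ?x) = \<zero>\<^bsub>?B\<^esub>"
   using gen[OF i v refl] by blast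
  then have "altsum R ?B (Suc k) (%i. D2 i (h ?x)) \<oplus>\<^bsub>?B\<^esub> h' (altsum R B0 k (%i. D1 i ?x)) = ?x \<ominus>\<^bsub>?B\<^esub> ka ?x"
  proof cases
   case front
   have "altsum R ?B (Suc k) (%i. D2 i (h ?x)) = ?x \<ominus>\<^bsub>?B\<^esub> h' (altsum R B0 k (%i. D1 i ?x))"
    by (rule altsum_homotopy_front[where g = "%i. D2 i (h ?x)" and f = "%i. D1 i ?x", OF B B0 h' x D1x]) (use front in auto)
   then show ?thesis using x hc front(3) by (simp add: B.M.minus_eq B.M.a_assoc B.M.l_neg)
  next
   case degenerate
   have "D2 i (h ?x) = \<zero>\<^bsub>?B\<^esub>" if "i \<le> Suc k" for i
    using mod_hom_zero[OF D2[OF that] B2 B] degenerate(1) by simp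
   then have "altsum R ?B (Suc k) (%i. D2 i (h ?x)) = \<zero>\<^bsub>?B\<^esub>" by (rule altsum_eq_zero[OF B])
   moreover have "h' (altsum R B0 k (%i. D1 i ?x)) = h' (D1 0 ?x)"
    unfolding hD1 by (rule altsum_first[where f = "%i. h' (D1 i ?x)", OF B])
      (use mod_hom_closed[OF h' D1x[of 0]] degenerate(3) in auto)
   ultimately show ?thesis using degenerate(2) x mod_hom_closed[OF ka x] by simp
  qed
  then show "altsum R ?B (Suc k) (%i. D2 i (h ?x)) \<oplus>\<^bsub>?B\<^esub> h' (altsum R B0 k (%i. D1 i ?x)) =
    ?x \<oplus>\<^bsub>?B\<^esub> (\<ominus>\<^bsub>R\<^esub> \<one>\<^bsub>R\<^esub>) \<odot>\<^bsub>?B\<^esub> ka ?x"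
   by (simp only: minus[OF x])
 qed
 then show ?thesis by (simp only: minus[OF c])
qed

section \<open>Augmented bisimplicial modules\<close>

text \<open>The face maps are kept explicit rather than their alternating sums: contractions are
  stated face by face, and the double complex axioms follow from simplicial identities. The
  augmentations coequalise the two faces from degree one and carry faces to the faces
  \<open>FX\<close> and \<open>FY\<close> of their targets.\<close>

locale bisimplicial =
 fixes R :: "'r ring"
  and T :: "nat => nat => ('r, 't) module"
  and Fh Fv :: "nat => nat => nat => 't => 't"
  and X :: "int => ('r, 'x) module" and dX :: "int => 'x => 'x" and FX :: "nat => nat => 'x => 'x" and ep :: "nat => 't => 'x"
  and Y :: "int => ('r, 'y) module" and dY :: "int => 'y => 'y" and FY :: "nat => nat => 'y => 'y" and et :: "nat => 't => 'y"
 assumes T: "Module.module R (T p q)"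
  and Fh: "i \<le> Suc p ==> Fh p q i \<in> mod_hom R (T (Suc p) q) (T p q)"
  and Fv: "j \<le> Suc q ==> Fv p q j \<in> mod_hom R (T p (Suc q)) (T p q)"
  and X: "chain_complex R X dX" and Y: "chain_complex R Y dY"
  and dX_0: "x \<in> carrier (X 0) ==> dX 0 x = \<zero>\<^bsub>X (0 - 1)\<^esub>"
  and dY_0: "y \<in> carrier (Y 0) ==> dY 0 y = \<zero>\<^bsub>Y (0 - 1)\<^esub>"
  and dX: "x \<in> carrier (X (int (Suc p))) ==> dX (int p + 1) x = altsum R (X (int p)) (Suc p) (%i. FX p i x)"
  and dY: "y \<in> carrier (Y (int (Suc q))) ==> dY (int q + 1) y = altsum R (Y (int q)) (Suc q) (%j. FY q j y)"
  and ep: "ep p \<in> mod_hom R (T p 0) (X (int p))"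
  and et: "et q \<in> mod_hom R (T 0 q) (Y (int q))"
  and Fh_Fh: "[|i < j; j \<le> Suc (Suc p); t \<in> carrier (T (Suc (Suc p)) q)|] ==>
   Fh p q i (Fh (Suc p) q j t) = Fh p q (j - 1) (Fh (Suc p) q i t)"
  and Fv_Fv: "[|i < j; j \<le> Suc (Suc q); t \<in> carrier (T p (Suc (Suc q)))|] ==>
   Fv p q i (Fv p (Suc q) j t) = Fv p q (j - 1) (Fv p (Suc q) i t)"
  and Fh_Fv: "[|i \<le> Suc p; j \<le> Suc q; t \<in> carrier (T (Suc p) (Suc q))|] ==>
   Fh p q i (Fv (Suc p) q j t) = Fv p q j (Fh p (Suc q) i t)"
  and ep_Fv: "t \<in> carrier (T p 1) ==> ep p (Fv p 0 0 t) = ep p (Fv p 0 1 t)"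
  and et_Fh: "t \<in> carrier (T 1 q) ==> et q (Fh 0 q 0 t) = et q (Fh 0 q 1 t)"
  and ep_Fh: "[|i \<le> Suc p; t \<in> carrier (T (Suc p) 0)|] ==> ep p (Fh p 0 i t) = FX p i (ep (Suc p) t)"
  and et_Fv: "[|j \<le> Suc q; t \<in> carrier (T 0 (Suc q))|] ==> et q (Fv 0 q j t) = FY q j (et (Suc q) t)"
begin

abbreviation "dh p q t \<equiv> altsum R (T p q) (Suc p) (%i. Fh p q i t)"
abbreviation "dv p q t \<equiv> altsum R (T p q) (Suc q) (%j. Fv p q j t)"

lemma dh_hom: "dh p q \<in> mod_hom R (T (Suc p) q) (T p q)"
 by (rule altsum_hom[OF T T Fh])

lemma dv_hom: "dv p q \<in> mod_hom R (T p (Suc q)) (T p q)"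
 by (rule altsum_hom[OF T T Fv])

lemma altsum_coincide:
 fixes P :: "('r, 'p) module" and Q :: "('r, 'q) module"
 assumes P: "Module.module R P" and Q: "Module.module R Q" and f: "f \<in> mod_hom R P Q"
  and g: "\<And>i. i \<le> Suc 0 ==> g i \<in> carrier P" and eq: "f (g 0) = f (g 1)"
 shows "f (altsum R P (Suc 0) g) = \<zero>\<^bsub>Q\<^esub>"
proof -
 interpret Q: Module.module R Q by (rule Q)
 have c: "f (g i) \<in> carrier Q" if "i \<le> Suc 0" for i by (rule mod_hom_closed[OF f g[OF that]])
 have "f (altsum R P (Suc 0) g) = altsum R Q (Suc 0) (%i. f (g i))" by (rule mod_hom_altsum[OF f P Q g])
 also have "\<dots> = f (g 0) \<ominus>\<^bsub>Q\<^esub> altsum R Q 0 (%i. f (g (Suc i)))" by (rule altsum_Suc_shift[OF Q c])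
 also have "altsum R Q 0 (%i. f (g (Suc i))) = f (g 0)" using altsum_0[OF Q, of "%i. f (g (Suc i))"] c[of 1] eq by simp
 finally show ?thesis using c[of 0] by (simp add: Q.M.minus_eq Q.M.r_neg)
qed

text \<open>Each axiom is an identity of faces summed with signs; for the two augmentations it is
  the cancellation of two coinciding faces.\<close>

sublocale double_complex R T dh dv X dX ep Y dY et
proof (rule double_complex.intro)
 have Xm: "Module.module R (X k)" and Ym: "Module.module R (Y k)" for k
  using chain_complex_module[OF X] chain_complex_module[OF Y] by auto
 show "dh p q (dh (Suc p) q t) = \<zero>\<^bsub>T p q\<^esub>" if t: "t \<in> carrier (T (Suc (Suc p)) q)" for t p q
  by (rule altsum_altsum[where D = "Fh (Suc p) q" and D' = "Fh p q", OF T T])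
   (use mod_hom_closed[OF Fh t] Fh Fh_Fh[OF _ _ t] in auto)
 show "dv p q (dv p (Suc q) t) = \<zero>\<^bsub>T p q\<^esub>" if t: "t \<in> carrier (T p (Suc (Suc q)))" for t p q
  by (rule altsum_altsum[where D = "Fv p (Suc q)" and D' = "Fv p q", OF T T])
   (use mod_hom_closed[OF Fv t] Fv Fv_Fv[OF _ _ t] in auto)
 show "dh p q (dv (Suc p) q t) = dv p q (dh p (Suc q) t)" if t: "t \<in> carrier (T (Suc p) (Suc q))" for t p q
 proof -
  have fv: "Fv (Suc p) q j t \<in> carrier (T (Suc p) q)" if "j \<le> Suc q" for j by (rule mod_hom_closed[OF Fv[OF that] t])
  have fh: "Fh p (Suc q) i t \<in> carrier (T p (Suc q))" if "i \<le> Suc p" for i by (rule mod_hom_closed[OF Fh[OF that] t])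
  have "dh p q (dv (Suc p) q t) = altsum R (T p q) (Suc q) (%j. dh p q (Fv (Suc p) q j t))"
   by (rule mod_hom_altsum[OF dh_hom T T fv])
  also have "\<dots> = dv p q (dh p (Suc q) t)"
  proof (rule altsum_cong[OF T])
   fix j assume j: "j \<le> Suc q"
   have "Fv p q j (dh p (Suc q) t) = altsum R (T p q) (Suc p) (%i. Fv p q j (Fh p (Suc q) i t))"
    by (rule mod_hom_altsum[OF Fv[OF j] T T fh])
   also have "\<dots> = dh p q (Fv (Suc p) q j t)"
    by (rule altsum_cong[OF T]) (use j Fh_Fv[OF _ j t] mod_hom_closed[OF Fh fv[OF j]] in auto)
   finally show "dh p q (Fv (Suc p) q j t) = Fv p q j (dh p (Suc q) t)" by simp
   show "Fv p q j (dh p (Suc q) t) \<in> carrier (T p q)"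
    by (rule mod_hom_closed[OF Fv[OF j] mod_hom_closed[OF dh_hom t]])
  qed
  finally show ?thesis .
 qed
 show "ep p (dv p 0 t) = \<zero>\<^bsub>X (int p)\<^esub>" if t: "t \<in> carrier (T p 1)" for t p
  by (rule altsum_coincide[OF T Xm ep]) (use ep_Fv[OF t] mod_hom_closed[OF Fv[of _ 0 p]] t in auto)
 show "et q (dh 0 q t) = \<zero>\<^bsub>Y (int q)\<^esub>" if t: "t \<in> carrier (T 1 q)" for t q
  by (rule altsum_coincide[OF T Ym et]) (use et_Fh[OF t] mod_hom_closed[OF Fh[of _ 0 q]] t in auto)
 show "ep p (dh p 0 t) = dX (int p + 1) (ep (Suc p) t)" if t: "t \<in> carrier (T (Suc p) 0)" for t p
 proof -
  have fh: "Fh p 0 i t \<in> carrier (T p 0)" if "i \<le> Suc p" for i by (rule mod_hom_closed[OF Fh[OF that] t])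
  have "dX (int p + 1) (ep (Suc p) t) = altsum R (X (int p)) (Suc p) (%i. FX p i (ep (Suc p) t))"
   by (rule dX[OF mod_hom_closed[OF ep t]])
  also have "\<dots> = altsum R (X (int p)) (Suc p) (%i. ep p (Fh p 0 i t))"
   by (rule altsum_cong[OF Xm]) (use ep_Fh[OF _ t] mod_hom_closed[OF ep fh] in auto)
  also have "\<dots> = ep p (dh p 0 t)" by (rule mod_hom_altsum[symmetric, OF ep T Xm fh])
  finally show ?thesis by simp
 qed
 show "et q (dv 0 q t) = dY (int q + 1) (et (Suc q) t)" if t: "t \<in> carrier (T 0 (Suc q))" for t q
 proof -
  have fv: "Fv 0 q j t \<in> carrier (T 0 q)" if "j \<le> Suc q" for j by (rule mod_hom_closed[OF Fv[OF that] t])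
  have "dY (int q + 1) (et (Suc q) t) = altsum R (Y (int q)) (Suc q) (%j. FY q j (et (Suc q) t))"
   by (rule dY[OF mod_hom_closed[OF et t]])
  also have "\<dots> = altsum R (Y (int q)) (Suc q) (%j. et q (Fv 0 q j t))"
   by (rule altsum_cong[OF Ym]) (use et_Fv[OF _ t] mod_hom_closed[OF et fv] in auto)
  also have "\<dots> = et q (dv 0 q t)" by (rule mod_hom_altsum[symmetric, OF et T Ym fv])
  finally show ?thesis by simp
 qed
qed (fact T dh_hom dv_hom X Y dX_0 dY_0 ep et)+

theorem homology_iso:
 assumes "\<And>p x. x \<in> carrier (X (int p)) ==> \<exists>t\<in>carrier (T p 0). ep p t = x"
  and "\<And>p t. [|t \<in> carrier (T p 0); ep p t = \<zero>\<^bsub>X (int p)\<^esub>|] ==> \<exists>s\<in>carrier (T p 1). dv p 0 s = t"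
  and "\<And>p q t. [|t \<in> carrier (T p (Suc q)); dv p q t = \<zero>\<^bsub>T p q\<^esub>|] ==> \<exists>s\<in>carrier (T p (Suc (Suc q))). dv p (Suc q) s = t"
  and "\<And>q y. y \<in> carrier (Y (int q)) ==> \<exists>t\<in>carrier (T 0 q). et q t = y"
  and "\<And>q t. [|t \<in> carrier (T 0 q); et q t = \<zero>\<^bsub>Y (int q)\<^esub>|] ==> \<exists>s\<in>carrier (T 1 q). dh 0 q s = t"
  and "\<And>p q t. [|Suc p \<le> n; t \<in> carrier (T (Suc p) q); dh p q t = \<zero>\<^bsub>T p q\<^esub>|] ==> \<exists>s\<in>carrier (T (Suc (Suc p)) q). dh (Suc p) q s = t"
  and "i \<le> n"
 shows "mod_isomorphic R (homology X dX (int i)) (homology Y dY (int i))"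
proof (rule homology_isomorphic[OF _ _ assms(7)])
 show "rows_exact n" unfolding rows_exact_def using assms(1-3) by blast
 show "double_complex.rows_exact (%p q. T q p) (%p q. dh q p) Y et n"
  unfolding double_complex.rows_exact_def[OF double_complex_transpose] using assms(4-6) by blast
qed

end

section \<open>Comparison with the Hochschild complex\<close>

text \<open>Unlike \<open>cuts\<close> this admits the empty list, which carries the augmentation of
  the complex \<open>K\<close>.\<close>

definition slists :: "nat set => nat => nat list set"
 where "slists S r = {c. sorted_wrt (<) c \<and> set c \<subseteq> S \<and> length c = r}"

lemma finite_slists: "finite S ==> finite (slists S r)"
 by (rule finite_subset[OF _ finite_lists_length_eq[of S r]]) (auto simp: slists_def)

lemma slists_0: "slists S 0 = {[]}"
 by (auto simp: slists_def)

lemma slists_del_nth: "[|c \<in> slists S (Suc r); i \<le> r|] ==> del_nth i c \<in> slists S r"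
 using set_del_nth[of i c] sorted_wrt_del_nth[of "(<)" c i] length_del_nth[of i c] by (auto simp: slists_def)

lemma slists_length: "c \<in> slists S r ==> length c = r"
 by (simp add: slists_def)

lemma slists_Cons: "m < n ==> m # c \<in> slists {m..<n} (Suc r) \<longleftrightarrow> c \<in> slists {Suc m..<n} r"
 by (auto simp: slists_def subset_iff)

lemma slists_hd:
 assumes "c \<in> slists {m..<n} r" "c = [] \<or> hd c \<noteq> m"
 shows "c \<in> slists {Suc m..<n} r"
proof (cases c)
 case (Cons a d)
 then show ?thesis using assms by (auto simp: slists_def subset_iff) (metis Suc_le_eq le_neq_implies_less less_le_trans less_imp_le)+
qed (use assms in "auto simp: slists_def")

text \<open>Turns a simplicial module indexed by natural numbers into a complex indexed by integers,
  zero in negative degrees.\<close>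

definition sx_mod :: "(nat => ('r, 'c) module) => int => ('r, 'c) module"
 where "sx_mod X k = (if k < 0 then zero_module else X (nat k))"

definition sx_diff :: "'r ring => (nat => ('r, 'c) module) => (nat => nat => 'c => 'c) => int => 'c => 'c"
 where "sx_diff R X F k x = (if k \<le> 0 then \<zero>\<^bsub>sx_mod X (k - 1)\<^esub>
  else altsum R (X (nat (k - 1))) (nat k) (%i. F (nat (k - 1)) i x))"

context coefficients
begin

lemma sx_complex:
 assumes X: "\<And>p. Module.module R (X p)" and F: "\<And>p i. i \<le> Suc p ==> F p i \<in> mod_hom R (X (Suc p)) (X p)"
  and FF: "\<And>p i j x. [|i < j; j \<le> Suc (Suc p); x \<in> carrier (X (Suc (Suc p)))|] ==> F p i (F (Suc p) j x) = F p (j - 1) (F (Suc p) i x)"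
 shows "chain_complex R (sx_mod X) (sx_diff R X F)"
  and "sx_mod X (int p) = X p" and "sx_diff R X F (int p + 1) x = altsum R (X p) (Suc p) (%i. F p i x)"
  and "sx_diff R X F 0 x = \<zero>\<^bsub>sx_mod X (0 - 1)\<^esub>"
proof -
 have m: "Module.module R (sx_mod X k)" for k by (simp add: sx_mod_def X module_zero)
 have step: "sx_mod X (int p) = X p" "sx_diff R X F (int p + 1) = (%x. altsum R (X p) (Suc p) (%i. F p i x))" for p
  by (auto simp: sx_mod_def sx_diff_def nat_add_distrib)
 show "sx_mod X (int p) = X p" "sx_diff R X F (int p + 1) x = altsum R (X p) (Suc p) (%i. F p i x)"
  "sx_diff R X F 0 x = \<zero>\<^bsub>sx_mod X (0 - 1)\<^esub>"
  using step[of p] by (simp_all add: sx_diff_def)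
 have sp: "sx_mod X (int p + 1) = X (Suc p)" "sx_mod X (int p + 1 + 1) = X (Suc (Suc p))"
  "sx_diff R X F (int p + 1 + 1) = (%x. altsum R (X (Suc p)) (Suc (Suc p)) (%i. F (Suc p) i x))" for p
  using step(1)[of "Suc p"] step(1)[of "Suc (Suc p)"] step(2)[of "Suc p"] by (simp_all add: algebra_simps)
 have hom: "(%x. altsum R (X p) (Suc p) (%i. F p i x)) \<in> mod_hom R (X (Suc p)) (X p)" for p
  by (rule altsum_hom[OF X X F])
 have neg: "sx_diff R X F k = (%x. \<zero>\<^bsub>sx_mod X (k - 1)\<^esub>)" if "\<not> 1 \<le> k" for k
  using that by (simp add: sx_diff_def fun_eq_iff)
 show "chain_complex R (sx_mod X) (sx_diff R X F)"
  unfolding chain_complex_def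
 proof (intro conjI allI ballI m)
  fix k show "sx_diff R X F k \<in> mod_hom R (sx_mod X k) (sx_mod X (k - 1))"
  proof (cases "1 \<le> k")
   case True
   then obtain p where "k = int p + 1" by (metis add.commute zle_iff_zadd)
   then show ?thesis using hom[of p] by (simp add: sp step)
  next
   case False
   show ?thesis unfolding neg[OF False] by (rule mod_hom_const_zero[OF m])
  qed
 next
  fix k x assume x: "x \<in> carrier (sx_mod X (k + 1))"
  show "sx_diff R X F k (sx_diff R X F (k + 1) x) = \<zero>\<^bsub>sx_mod X (k - 1)\<^esub>"
  proof (cases "1 \<le> k")
   case True
   then obtain p where k: "k = int p + 1" by (metis add.commute zle_iff_zadd)
   have x: "x \<in> carrier (X (Suc (Suc p)))" using x unfolding k sp .
   have "altsum R (X p) (Suc p) (%i. F p i (altsum R (X (Suc p)) (Suc (Suc p)) (%j. F (Suc p) j x))) = \<zero>\<^bsub>X p\<^esub>"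
    by (rule altsum_altsum[where D = "F (Suc p)" and D' = "F p", OF X X])
     (use mod_hom_closed[OF F x] F FF[OF _ _ x] in auto)
   then show ?thesis unfolding k sp step(2) by (simp add: step(1))
  next
   case False
   show ?thesis unfolding neg[OF False] by simp
  qed
 qed
qed

text \<open>The lists are the possible sets of cut edges in \<open>{m..<n}\<close>; the face \<open>Kd i\<close> uncuts the \<open>i\<close>-th
  of them and at the same time multiplies the \<open>i\<close>-th of the last \<open>r\<close> tensor factors.\<close>

definition K :: "nat => nat => nat => nat => ('r, nat list => ((nat => 'a + 'm) => 'r) set) module"
 where "K m n q r = dsum (slists {m..<n} r) (%_. H (q + r))"

definition Kd :: "nat => nat => nat => nat => nat => (nat list => ((nat => 'a + 'm) => 'r) set) => nat list => ((nat => 'a + 'm) => 'r) set"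
 where "Kd m n q r i = dmap (slists {m..<n} (Suc r)) (%_. H (q + Suc r)) (slists {m..<n} r) (%_. H (q + r))
  (del_nth i) (%_. Hd (q + r) (Suc (q + i)))"

text \<open>The two directions use different faces of one Hochschild module: \<open>Kv\<close> the
  faces up to \<open>Suc q\<close>, which leave the cuts alone, and \<open>Kd\<close> those further
  on. They commute by the simplicial identity, which accounts for the shift of index.\<close>

definition Kv :: "nat => nat => nat => nat => (nat list => ((nat => 'a + 'm) => 'r) set) => nat list => ((nat => 'a + 'm) => 'r) set"
 where "Kv n q r j = dmap (slists {0..<n} r) (%_. H (Suc q + r)) (slists {0..<n} r) (%_. H (q + r))
  (%c. c) (%_. Hd (q + r) j)"

definition Ks :: "nat => nat => nat => nat => (nat list => ((nat => 'a + 'm) => 'r) set) => nat list => ((nat => 'a + 'm) => 'r) set"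
 where "Ks n q r j = dmap (slists {0..<n} r) (%_. H (q + r)) (slists {0..<n} r) (%_. H (Suc q + r))
  (%c. c) (%_. Hs (q + r) j)"

text \<open>The candidate for a contraction: a new first cut \<open>m\<close>, with a unit inserted
  behind position \<open>q\<close>, so that the zeroth face of \<open>Kd\<close> undoes it. If
  \<open>m\<close> is already among the cuts the new list is no longer increasing and the value is
  zero.\<close>

definition Kh :: "nat => nat => nat => nat => (nat list => ((nat => 'a + 'm) => 'r) set) => nat list => ((nat => 'a + 'm) => 'r) set"
 where "Kh m n q r = dmap (slists {m..<n} r) (%_. H (q + r)) (slists {m..<n} (Suc r)) (%_. H (q + Suc r))
  ((#) m) (%_. Hs (q + r) q)"

text \<open>Keeps the part on lists that begin with \<open>m\<close> and drops that entry. A list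
  with another head is left too long for the target index set, so \<open>dmap\<close> sends it to
  zero. The Hochschild degree is unchanged: the lost cut is counted in \<open>q\<close>.\<close>

definition Krh :: "nat => nat => nat => nat => (nat list => ((nat => 'a + 'm) => 'r) set) => nat list => ((nat => 'a + 'm) => 'r) set"
 where "Krh m n q r = dmap (slists {m..<n} (Suc r)) (%_. H (q + Suc r)) (slists {Suc m..<n} r) (%_. H (Suc q + r))
  (%c. if hd c = m then tl c else c) (%_ v. v)"

text \<open>The inclusion of the lists that begin with \<open>m\<close>, a right inverse of
  \<open>Krh\<close>. Thus \<open>K m\<close> is built from the lists that avoid \<open>m\<close>
  and a copy of the complex for \<open>Suc m\<close> shifted by one.\<close>

definition Kio :: "nat => nat => nat => nat => (nat list => ((nat => 'a + 'm) => 'r) set) => nat list => ((nat => 'a + 'm) => 'r) set"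
 where "Kio m n q r = dmap (slists {Suc m..<n} r) (%_. H (Suc q + r)) (slists {m..<n} (Suc r)) (%_. H (q + Suc r))
  ((#) m) (%_ v. v)"

abbreviation "KD m n q r z \<equiv> altsum R (K m n q r) r (%i. Kd m n q r i z)"

lemma dface_slists:
 assumes "\<And>c. [|c \<in> slists {m..<n} r; g c \<in> slists {m'..<n'} r'|] ==> ph c \<in> mod_hom R (H a) (H b)"
 shows "dface R (slists {m..<n} r) (%_. H a) (slists {m'..<n'} r') (%_. H b) g ph"
 using assms by (auto simp: dface_def R_cring finite_slists module_H)

lemma dface_Kd: "i \<le> r ==> dface R (slists {m..<n} (Suc r)) (%_. H (q + Suc r)) (slists {m..<n} r) (%_. H (q + r))
  (del_nth i) (%_. Hd (q + r) (Suc (q + i)))"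
 using Hd_hom[of "Suc (q + i)" "q + r"] by (intro dface_slists) simp

lemma dface_Kv: "j \<le> Suc (q + r) ==> dface R (slists {0..<n} r) (%_. H (Suc q + r)) (slists {0..<n} r) (%_. H (q + r))
  (%c. c) (%_. Hd (q + r) j)"
 using Hd_hom[of j "q + r"] by (intro dface_slists) simp

lemma dface_Ks: "j \<le> q + r ==> dface R (slists {0..<n} r) (%_. H (q + r)) (slists {0..<n} r) (%_. H (Suc q + r))
  (%c. c) (%_. Hs (q + r) j)"
 using Hs_hom[of j "q + r"] by (intro dface_slists) simp

lemma dface_Kh: "dface R (slists {m..<n} r) (%_. H (q + r)) (slists {m..<n} (Suc r)) (%_. H (q + Suc r))
  ((#) m) (%_. Hs (q + r) q)"
 using Hs_hom[of q "q + r"] by (intro dface_slists) simp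

lemma dface_Krh: "dface R (slists {m..<n} (Suc r)) (%_. H (q + Suc r)) (slists {Suc m..<n} r) (%_. H (Suc q + r))
  (%c. if hd c = m then tl c else c) (%_ v. v)"
 using mod_hom_id[OF module_H[of "Suc (q + r)"]] by (intro dface_slists) simp

lemma dface_Kio: "dface R (slists {Suc m..<n} r) (%_. H (Suc q + r)) (slists {m..<n} (Suc r)) (%_. H (q + Suc r))
  ((#) m) (%_ v. v)"
 using mod_hom_id[OF module_H[of "Suc (q + r)"]] by (intro dface_slists) simp

lemma module_K: "Module.module R (K m n q r)"
 unfolding K_def by (rule module_dsum[OF R_cring module_H])

lemma Kd_hom: "i \<le> r ==> Kd m n q r i \<in> mod_hom R (K m n q (Suc r)) (K m n q r)"
 unfolding Kd_def K_def by (rule dface_hom[OF dface_Kd])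

lemma Kv_hom: "j \<le> Suc (q + r) ==> Kv n q r j \<in> mod_hom R (K 0 n (Suc q) r) (K 0 n q r)"
 unfolding Kv_def K_def by (rule dface_hom[OF dface_Kv])

lemma Kh_hom: "Kh m n q r \<in> mod_hom R (K m n q r) (K m n q (Suc r))"
 unfolding Kh_def K_def by (rule dface_hom[OF dface_Kh])

lemma Krh_hom: "Krh m n q r \<in> mod_hom R (K m n q (Suc r)) (K (Suc m) n (Suc q) r)"
 unfolding Krh_def K_def by (rule dface_hom[OF dface_Krh])

lemma Kio_hom: "Kio m n q r \<in> mod_hom R (K (Suc m) n (Suc q) r) (K m n q (Suc r))"
 unfolding Kio_def K_def by (rule dface_hom[OF dface_Kio])

lemma KD_hom: "KD m n q r \<in> mod_hom R (K m n q (Suc r)) (K m n q r)"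
 by (rule altsum_hom[OF module_K module_K Kd_hom])

lemma Kd_Kd:
 assumes "i < j" "j \<le> Suc r" "z \<in> carrier (K m n q (Suc (Suc r)))"
 shows "Kd m n q r i (Kd m n q (Suc r) j z) = Kd m n q r (j - 1) (Kd m n q (Suc r) i z)"
 unfolding Kd_def
proof (rule dface_square[OF dface_Kd dface_Kd dface_Kd dface_Kd])
 fix c v assume c: "c \<in> slists {m..<n} (Suc (Suc r))" and v: "v \<in> carrier (H (q + Suc (Suc r)))"
 have "Hd (q + r) (Suc (q + i)) (Hd (Suc (q + r)) (Suc (q + j)) v) = Hd (q + r) (Suc (q + j) - 1) (Hd (Suc (q + r)) (Suc (q + i)) v)"
  by (rule Hd_Hd) (use assms v in auto)
 moreover have "Suc (q + j) - 1 = Suc (q + (j - 1))" using assms by simp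
 ultimately show "del_nth j c \<in> slists {m..<n} (Suc r) \<and> del_nth i c \<in> slists {m..<n} (Suc r) \<and>
   del_nth i (del_nth j c) = del_nth (j - 1) (del_nth i c) \<and>
   Hd (q + r) (Suc (q + i)) (Hd (q + Suc r) (Suc (q + j)) v) = Hd (q + r) (Suc (q + (j - 1))) (Hd (q + Suc r) (Suc (q + i)) v)"
  using slists_del_nth[OF c] del_nth_del_nth[of i j c] slists_length[OF c] assms by simp
qed (use assms in "auto simp: K_def")

lemma Kv_Kv:
 assumes "i < j" "j \<le> Suc (Suc (q + r))" "z \<in> carrier (K 0 n (Suc (Suc q)) r)"
 shows "Kv n q r i (Kv n (Suc q) r j z) = Kv n q r (j - 1) (Kv n (Suc q) r i z)"
 unfolding Kv_def
 by (rule dface_square[OF dface_Kv dface_Kv dface_Kv dface_Kv])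
  (use assms Hd_Hd[of i j "q + r"] in "auto simp: K_def")

text \<open>One Hochschild face lies strictly below the other; exchanging them lowers the upper
  index by one, which is the passage from \<open>Suc q\<close> to \<open>q\<close>.\<close>

lemma Kd_Kv:
 assumes "i \<le> r" "j \<le> Suc q" "z \<in> carrier (K 0 n (Suc q) (Suc r))"
 shows "Kd 0 n q r i (Kv n q (Suc r) j z) = Kv n q r j (Kd 0 n (Suc q) r i z)"
 unfolding Kd_def Kv_def
proof (rule dface_square[OF dface_Kv dface_Kd dface_Kd dface_Kv])
 fix c v assume c: "c \<in> slists {0..<n} (Suc r)" and v: "v \<in> carrier (H (Suc q + Suc r))"
 have "Hd (q + r) j (Hd (Suc (q + r)) (Suc (Suc (q + i))) v) = Hd (q + r) (Suc (Suc (q + i)) - 1) (Hd (Suc (q + r)) j v)"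
  by (rule Hd_Hd) (use assms v in auto)
 then show "c \<in> slists {0..<n} (Suc r) \<and> del_nth i c \<in> slists {0..<n} r \<and> del_nth i c = del_nth i c \<and>
   Hd (q + r) (Suc (q + i)) (Hd (q + Suc r) j v) = Hd (q + r) j (Hd (Suc q + r) (Suc (Suc q + i)) v)"
  using slists_del_nth[OF c assms(1)] c by simp
qed (use assms in "auto simp: K_def")

section \<open>Exactness of the complex indexed by cut sets, up to the number of edges\<close>

lemma K_dsum_in:
 "[|c \<in> slists {m..<n} r; v \<in> carrier (H (q + r))|] ==> dsum_in (slists {m..<n} r) (%_. H (q + r)) c v \<in> carrier (K m n q r)"
 unfolding K_def by (rule mod_hom_closed[OF dsum_in_hom[OF R_cring module_H]])

text \<open>The way in which the operators degenerate: a list that is not increasing or has the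
  wrong length contributes zero.\<close>

lemma slists_dsum_in_notin:
 assumes "c \<notin> slists {m..<n} r"
 shows "dsum_in (slists {m..<n} r) (%_. H a) c v = \<zero>\<^bsub>dsum (slists {m..<n} r) (%_. H a)\<^esub>"
proof -
 have "(\<lambda>i\<in>slists {m..<n} r. if i = c then v else \<zero>\<^bsub>H a\<^esub>) = (\<lambda>i\<in>slists {m..<n} r. \<zero>\<^bsub>H a\<^esub>)"
  by (rule restrict_ext) (use assms in metis)
 then show ?thesis by (simp add: dsum_in_def dsum_def)
qed

text \<open>After deletion of its first entry an increasing list cannot begin with \<open>m\<close>,
  the least possible cut.\<close>

lemma Krh_Kd_0:
 assumes z: "z \<in> carrier (K m n q (Suc (Suc r)))"
 shows "Krh m n q r (Kd m n q (Suc r) 0 z) = \<zero>\<^bsub>K (Suc m) n (Suc q) r\<^esub>"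
proof (rule dface_hom_ext[where f = "%z. Krh m n q r (Kd m n q (Suc r) 0 z)" and f' = "%z. \<zero>\<^bsub>K (Suc m) n (Suc q) r\<^esub>",
   OF dface_Krh[of m n "Suc r" q] module_K _ mod_hom_const_zero[OF module_K]])
 show "(%z. Krh m n q r (Kd m n q (Suc r) 0 z)) \<in> mod_hom R (dsum (slists {m..<n} (Suc (Suc r))) (%_. H (q + Suc (Suc r)))) (K (Suc m) n (Suc q) r)"
  using mod_hom_comp[OF Kd_hom[OF le0] Krh_hom] unfolding K_def .
 show "z \<in> carrier (dsum (slists {m..<n} (Suc (Suc r))) (%_. H (q + Suc (Suc r))))" using z unfolding K_def .
 fix c v assume c: "c \<in> slists {m..<n} (Suc (Suc r))" and v: "v \<in> carrier (H (q + Suc (Suc r)))"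
 have v': "Hd (q + Suc r) (Suc (q + 0)) v \<in> carrier (H (q + Suc r))"
  using mod_hom_closed[OF Hd_hom[of "Suc q" "q + Suc r"]] v by simp
 have d: "del_nth 0 c \<in> slists {m..<n} (Suc r)" by (rule slists_del_nth[OF c]) simp
 obtain a b d' where "c = a # b # d'" using c by (auto simp: slists_def length_Suc_conv)
 then have hd: "hd (del_nth 0 c) \<noteq> m" using c by (auto simp: slists_def del_nth_0)
 have "del_nth 0 c \<notin> slists {Suc m..<n} r" using slists_length[OF d] by (auto dest: slists_length)
 then show "Krh m n q r (Kd m n q (Suc r) 0 (dsum_in (slists {m..<n} (Suc (Suc r))) (%_. H (q + Suc (Suc r))) c v)) = \<zero>\<^bsub>K (Suc m) n (Suc q) r\<^esub>"
  unfolding Kd_def Krh_def dface_in[OF dface_Kd[OF le0] c v] dface_in[OF dface_Krh d v']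
  using hd by (simp add: slists_dsum_in_notin K_def)
qed

text \<open>The remaining faces keep the first entry, so dropping it lowers their index by one,
  while the Hochschild face stays the same since \<open>q\<close> has grown by one.\<close>

lemma Krh_Kd_Suc:
 assumes i: "i \<le> r" and z: "z \<in> carrier (K m n q (Suc (Suc r)))"
 shows "Krh m n q r (Kd m n q (Suc r) (Suc i) z) = Kd (Suc m) n (Suc q) r i (Krh m n q (Suc r) z)"
proof (rule dface_hom_ext[where f = "%z. Krh m n q r (Kd m n q (Suc r) (Suc i) z)" and f' = "%z. Kd (Suc m) n (Suc q) r i (Krh m n q (Suc r) z)",
   OF dface_Krh[of m n "Suc r" q] module_K])
 have si: "Suc i \<le> Suc r" using i by simp
 show "(%z. Krh m n q r (Kd m n q (Suc r) (Suc i) z)) \<in> mod_hom R (dsum (slists {m..<n} (Suc (Suc r))) (%_. H (q + Suc (Suc r)))) (K (Suc m) n (Suc q) r)"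
  using mod_hom_comp[OF Kd_hom[OF si] Krh_hom] unfolding K_def .
 show "(%z. Kd (Suc m) n (Suc q) r i (Krh m n q (Suc r) z)) \<in> mod_hom R (dsum (slists {m..<n} (Suc (Suc r))) (%_. H (q + Suc (Suc r)))) (K (Suc m) n (Suc q) r)"
  using mod_hom_comp[OF Krh_hom Kd_hom[OF i]] unfolding K_def .
 show "z \<in> carrier (dsum (slists {m..<n} (Suc (Suc r))) (%_. H (q + Suc (Suc r))))" using z unfolding K_def .
 fix c v assume c: "c \<in> slists {m..<n} (Suc (Suc r))" and v: "v \<in> carrier (H (q + Suc (Suc r)))"
 let ?x = "dsum_in (slists {m..<n} (Suc (Suc r))) (%_. H (q + Suc (Suc r))) c v"
 have v': "Hd (q + Suc r) (Suc (q + Suc i)) v \<in> carrier (H (q + Suc r))"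
  using mod_hom_closed[OF Hd_hom[of "Suc (q + Suc i)" "q + Suc r"]] v i by simp
 have d: "del_nth (Suc i) c \<in> slists {m..<n} (Suc r)" by (rule slists_del_nth[OF c si])
 obtain a c' where c': "c = a # c'" "c' \<noteq> []" using c by (auto simp: slists_def length_Suc_conv)
 have L: "Krh m n q r (Kd m n q (Suc r) (Suc i) ?x) = dsum_in (slists {Suc m..<n} r) (%_. H (Suc q + r))
   (if a = m then del_nth i c' else a # del_nth i c') (Hd (q + Suc r) (Suc (q + Suc i)) v)"
  unfolding Kd_def Krh_def dface_in[OF dface_Kd[OF si] c v] dface_in[OF dface_Krh d v'] by (simp add: c'(1) del_nth_Suc_Cons)
 have rhx: "Krh m n q (Suc r) ?x = dsum_in (slists {Suc m..<n} (Suc r)) (%_. H (Suc q + Suc r)) (if a = m then c' else a # c') v"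
  unfolding Krh_def dface_in[OF dface_Krh c v] by (simp add: c'(1))
 show "Krh m n q r (Kd m n q (Suc r) (Suc i) ?x) = Kd (Suc m) n (Suc q) r i (Krh m n q (Suc r) ?x)"
 proof (cases "a = m")
  case True
  then have mn: "m < n" and c1: "c' \<in> slists {Suc m..<n} (Suc r)"
   using c slists_Cons[of m n c' "Suc r"] by (auto simp: c'(1) slists_def)
  have v1: "v \<in> carrier (H (Suc q + Suc r))" using v by simp
  have "Kd (Suc m) n (Suc q) r i (dsum_in (slists {Suc m..<n} (Suc r)) (%_. H (Suc q + Suc r)) c' v) =
    dsum_in (slists {Suc m..<n} r) (%_. H (Suc q + r)) (del_nth i c') (Hd (Suc q + r) (Suc (Suc q + i)) v)"
   unfolding Kd_def by (rule dface_in[OF dface_Kd[OF i] c1 v1])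
  then show ?thesis unfolding L rhx using True by simp
 next
  case False
  have l: "a # c' \<notin> slists {Suc m..<n} (Suc r)" "a # del_nth i c' \<notin> slists {Suc m..<n} r"
   using slists_length[OF c] slists_length[OF d] by (auto dest!: slists_length simp: c'(1) del_nth_Suc_Cons)
  have "Kd (Suc m) n (Suc q) r i \<zero>\<^bsub>K (Suc m) n (Suc q) (Suc r)\<^esub> = \<zero>\<^bsub>K (Suc m) n (Suc q) r\<^esub>"
   by (rule mod_hom_zero[OF Kd_hom[OF i] module_K module_K])
  then have "Kd (Suc m) n (Suc q) r i (dsum_in (slists {Suc m..<n} (Suc r)) (%_. H (Suc q + Suc r)) (a # c') v) =
    \<zero>\<^bsub>dsum (slists {Suc m..<n} r) (%_. H (Suc q + r))\<^esub>"
   unfolding slists_dsum_in_notin[OF l(1)] unfolding K_def .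
  then show ?thesis unfolding L rhx using False slists_dsum_in_notin[OF l(2)] by simp
 qed
qed

text \<open>The face of index 0 contributes nothing and the others are shifted by one, so
  \<open>Krh\<close> commutes with the differentials up to the sign of a map of degree one.\<close>

lemma Krh_KD:
 assumes z: "z \<in> carrier (K m n q (Suc (Suc r)))"
 shows "Krh m n q r (KD m n q (Suc r) z) = \<ominus>\<^bsub>K (Suc m) n (Suc q) r\<^esub> KD (Suc m) n (Suc q) r (Krh m n q (Suc r) z)"
proof -
 interpret N: Module.module R "K (Suc m) n (Suc q) r" by (rule module_K)
 have kd: "Kd m n q (Suc r) i z \<in> carrier (K m n q (Suc r))" if "i \<le> Suc r" for i
  by (rule mod_hom_closed[OF Kd_hom[OF that] z])
 have "Krh m n q r (KD m n q (Suc r) z) = altsum R (K (Suc m) n (Suc q) r) (Suc r) (%i. Krh m n q r (Kd m n q (Suc r) i z))"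
  by (rule mod_hom_altsum[OF Krh_hom module_K module_K kd])
 also have "\<dots> = Krh m n q r (Kd m n q (Suc r) 0 z) \<ominus>\<^bsub>K (Suc m) n (Suc q) r\<^esub>
   altsum R (K (Suc m) n (Suc q) r) r (%i. Krh m n q r (Kd m n q (Suc r) (Suc i) z))"
  by (rule altsum_Suc_shift[OF module_K]) (rule mod_hom_closed[OF Krh_hom kd])
 also have "altsum R (K (Suc m) n (Suc q) r) r (%i. Krh m n q r (Kd m n q (Suc r) (Suc i) z)) = KD (Suc m) n (Suc q) r (Krh m n q (Suc r) z)"
  by (rule altsum_cong[OF module_K]) (simp_all add: Krh_Kd_Suc[OF _ z] mod_hom_closed[OF Kd_hom mod_hom_closed[OF Krh_hom z]])
 finally show ?thesis
  using mod_hom_closed[OF KD_hom mod_hom_closed[OF Krh_hom z]] by (simp add: Krh_Kd_0[OF z] N.M.minus_eq)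
qed

lemma Krh_Kio:
 assumes "m < n" "y \<in> carrier (K (Suc m) n (Suc q) r)"
 shows "Krh m n q r (Kio m n q r y) = y"
 unfolding Krh_def Kio_def
 by (rule dface_retract[OF dface_Kio dface_Krh]) (use assms in "auto simp: slists_Cons K_def")

text \<open>On lists that avoid \<open>m\<close> the operator \<open>Kh\<close> is a cone
  contraction; on lists that begin with \<open>m\<close> it degenerates. The defect
  \<open>ka z\<close> depends on \<open>Krh z\<close> only, so \<open>Kh\<close> contracts all
  elements that \<open>Krh\<close> kills.\<close>

lemma K_cone:
 assumes m: "m < n" and z: "z \<in> carrier (K m n q (Suc r))"
 defines "ka \<equiv> %z. Kio m n q r (Krh m n q r z) \<ominus>\<^bsub>K m n q (Suc r)\<^esub> Kh m n q r (Kd m n q r 0 (Kio m n q r (Krh m n q r z)))"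
 shows "KD m n q (Suc r) (Kh m n q (Suc r) z) \<oplus>\<^bsub>K m n q (Suc r)\<^esub> Kh m n q r (KD m n q r z) = z \<ominus>\<^bsub>K m n q (Suc r)\<^esub> ka z"
proof -
 let ?I = "slists {m..<n} (Suc r)" and ?N = "%_::nat list. H (q + Suc r)"
 note Keq = K_def[of m n q "Suc r"]
 interpret B: Module.module R "K m n q (Suc r)" by (rule module_K)
 have iorh: "(%z. Kio m n q r (Krh m n q r z)) \<in> mod_hom R (K m n q (Suc r)) (K m n q (Suc r))"
  by (rule mod_hom_comp[OF Krh_hom Kio_hom])
 have hd0: "(%z. Kh m n q r (Kd m n q r 0 z)) \<in> mod_hom R (K m n q (Suc r)) (K m n q (Suc r))"
  by (rule mod_hom_comp[OF Kd_hom Kh_hom]) simp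
 have ka': "(%z. Kio m n q r (Krh m n q r z) \<oplus>\<^bsub>K m n q (Suc r)\<^esub> (\<ominus>\<^bsub>R\<^esub> \<one>\<^bsub>R\<^esub>) \<odot>\<^bsub>K m n q (Suc r)\<^esub> Kh m n q r (Kd m n q r 0 (Kio m n q r (Krh m n q r z))))
   \<in> mod_hom R (K m n q (Suc r)) (K m n q (Suc r))"
  by (rule mod_hom_pointwise_add[OF module_K iorh mod_hom_pointwise_smult[OF module_K mod_hom_comp[OF iorh hd0]]]) simp
 have ka: "ka \<in> mod_hom R (K m n q (Suc r)) (K m n q (Suc r))"
  by (rule mod_hom_cong[OF ka' module_K])
   (use mod_hom_closed[OF iorh] mod_hom_closed[OF mod_hom_comp[OF iorh hd0]] in "auto simp: ka_def B.smult_l_minus B.M.minus_eq")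
 show ?thesis
 proof (rule cone_identity[where h = "Kh m n q (Suc r)" and h' = "Kh m n q r" and ka = ka and k = r
    and ?D2.0 = "Kd m n q (Suc r)" and ?D1.0 = "Kd m n q r" and ?B0.0 = "K m n q r" and ?B2.0 = "K m n q (Suc (Suc r))",
    OF dface_Kh[of m n "Suc r" q] module_K module_K, folded Keq])
  show "z \<in> carrier (K m n q (Suc r))" by (rule z)
  fix c v x assume c: "c \<in> ?I" and v: "v \<in> carrier (H (q + Suc r))" and x: "x = dsum_in ?I ?N c v"
  obtain a c' where ac: "c = a # c'" using c by (cases c) (auto simp: slists_def)
  have xK: "x \<in> carrier (K m n q (Suc r))" unfolding x by (rule K_dsum_in[OF c v])
  have hx: "Kh m n q (Suc r) x = dsum_in (slists {m..<n} (Suc (Suc r))) (%_. H (q + Suc (Suc r))) (m # c) (Hs (q + Suc r) q v)"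
   unfolding x Kh_def by (rule dface_in[OF dface_Kh c v])
  have dx: "Kd m n q r i x = dsum_in (slists {m..<n} r) (%_. H (q + r)) (del_nth i c) (Hd (q + r) (Suc (q + i)) v)" if "i \<le> r" for i
   unfolding x Kd_def by (rule dface_in[OF dface_Kd[OF that] c v])
  have dv: "Hd (q + r) (Suc (q + i)) v \<in> carrier (H (q + r))" if "i \<le> r" for i
   using mod_hom_closed[OF Hd_hom[of "Suc (q + i)" "q + r"]] v that by simp
  have hdx: "Kh m n q r (Kd m n q r i x) = dsum_in ?I ?N (m # del_nth i c) (Hs (q + r) q (Hd (q + r) (Suc (q + i)) v))" if "i \<le> r" for i
   unfolding dx[OF that] unfolding Kh_def by (rule dface_in[OF dface_Kh slists_del_nth[OF c that] dv[OF that]])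
  have rhx: "Krh m n q r x = dsum_in (slists {Suc m..<n} r) (%_. H (Suc q + r)) (if a = m then c' else a # c') v"
   unfolding x Krh_def using dface_in[OF dface_Krh c v] by (simp add: ac)
  show "Kd m n q (Suc r) 0 (Kh m n q (Suc r) x) = x \<and>
    (\<forall>i\<le>r. Kd m n q (Suc r) (Suc i) (Kh m n q (Suc r) x) = Kh m n q r (Kd m n q r i x)) \<and> ka x = \<zero>\<^bsub>K m n q (Suc r)\<^esub> \<or>
   Kh m n q (Suc r) x = \<zero>\<^bsub>K m n q (Suc (Suc r))\<^esub> \<and> Kh m n q r (Kd m n q r 0 x) = x \<ominus>\<^bsub>K m n q (Suc r)\<^esub> ka x \<and>
    (\<forall>i. 0 < i --> i \<le> r --> Kh m n q r (Kd m n q r i x) = \<zero>\<^bsub>K m n q (Suc r)\<^esub>)"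
  proof (cases "a = m")
   case False
   have mc: "m # c \<in> slists {m..<n} (Suc (Suc r))"
    using slists_hd[OF c] False m by (simp add: slists_Cons ac)
   have hv: "Hs (q + Suc r) q v \<in> carrier (H (q + Suc (Suc r)))"
    using mod_hom_closed[OF Hs_hom[of q "q + Suc r"]] v by simp
   have D2: "Kd m n q (Suc r) i (Kh m n q (Suc r) x) = dsum_in ?I ?N (del_nth i (m # c)) (Hd (q + Suc r) (Suc (q + i)) (Hs (q + Suc r) q v))"
    if "i \<le> Suc r" for i
    unfolding hx Kd_def by (rule dface_in[OF dface_Kd[OF that] mc hv])
   have "Hd (q + Suc r) (Suc (q + 0)) (Hs (q + Suc r) q v) = v" by (rule Hd_Hs_same) (use v in auto)
   then have 0: "Kd m n q (Suc r) 0 (Kh m n q (Suc r) x) = x" unfolding D2[OF le0] unfolding x by (simp add: del_nth_0)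
   have 1: "Kd m n q (Suc r) (Suc i) (Kh m n q (Suc r) x) = Kh m n q r (Kd m n q r i x)" if "i \<le> r" for i
   proof -
    have "Hd (Suc (q + r)) (Suc (Suc (q + i))) (Hs (Suc (q + r)) q v) = Hs (q + r) q (Hd (q + r) (Suc (Suc (q + i)) - 1) v)"
     by (rule Hd_Hs_greater) (use that v in auto)
    then show ?thesis using that by (simp add: D2 hdx del_nth_Suc_Cons)
   qed
   have "a # c' \<notin> slists {Suc m..<n} r" using slists_length[OF c] by (auto dest!: slists_length simp: ac)
   then have "Krh m n q r x = \<zero>\<^bsub>K (Suc m) n (Suc q) r\<^esub>" unfolding rhx using False by (simp add: slists_dsum_in_notin K_def)
   then have "ka x = \<zero>\<^bsub>K m n q (Suc r)\<^esub>"
    unfolding ka_def by (simp add: mod_hom_zero[OF Kio_hom module_K module_K] mod_hom_zero[OF hd0 module_K module_K] B.M.minus_eq)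
   then show ?thesis using 0 1 by blast
  next
   case True
   have nsl: "m # d \<notin> slists S k" if "m \<in> set d" for d S k using that by (auto simp: slists_def)
   have "m # c \<notin> slists {m..<n} (Suc (Suc r))" by (rule nsl) (simp add: ac True)
   then have hx0: "Kh m n q (Suc r) x = \<zero>\<^bsub>K m n q (Suc (Suc r))\<^esub>" unfolding hx by (simp add: slists_dsum_in_notin K_def)
   have "Kh m n q r (Kd m n q r i x) = \<zero>\<^bsub>K m n q (Suc r)\<^esub>" if "0 < i" "i \<le> r" for i
   proof -
    have "m # del_nth i c \<notin> ?I" by (rule nsl) (use that True in "cases i; simp add: ac del_nth_Suc_Cons")
    then show ?thesis using that by (simp add: hdx slists_dsum_in_notin K_def)
   qed
   moreover have "Kh m n q r (Kd m n q r 0 x) = x \<ominus>\<^bsub>K m n q (Suc r)\<^esub> ka x"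
   proof -
    have c1: "c' \<in> slists {Suc m..<n} r" using c m slists_Cons[of m n c' r] by (simp add: ac True)
    have v1: "v \<in> carrier (H (Suc q + r))" using v by simp
    have "Kio m n q r (Krh m n q r x) = x"
     unfolding rhx unfolding x Kio_def using dface_in[OF dface_Kio c1 v1] True by (simp add: ac)
    moreover have "Kh m n q r (Kd m n q r 0 x) \<in> carrier (K m n q (Suc r))" by (rule mod_hom_closed[OF hd0 xK])
    ultimately show ?thesis
     unfolding ka_def using xK by (simp add: B.M.minus_eq B.M.minus_add B.M.minus_minus B.M.a_assoc[symmetric] B.M.r_neg)
   qed
   ultimately show ?thesis using hx0 by blast
  qed
 qed (simp_all add: Kd_hom Kh_hom ka)
qed

text \<open>The part of \<open>z\<close> on lists beginning with \<open>m\<close> is a cycle of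
  lower degree for \<open>Suc m\<close>, hence a boundary by induction. Correcting \<open>z\<close>
  by a boundary removes this part, and then \<open>Kh\<close> contracts. Each descent uses up one
  edge, whence \<open>r + m < n\<close>. For \<open>r = 0\<close> nothing is assumed on
  \<open>z\<close>: this is surjectivity of the augmentation.\<close>

lemma K_exact:
 assumes "r + m < n" "z \<in> carrier (K m n q r)" "\<And>p. r = Suc p ==> KD m n q p z = \<zero>\<^bsub>K m n q p\<^esub>"
 shows "\<exists>x\<in>carrier (K m n q (Suc r)). KD m n q r x = z"
 using assms
proof (induction r arbitrary: m q z)
 case 0
 \<comment> \<open>Only the empty list occurs, and \<open>m < n\<close> is what makes the
   one-element list of \<open>m\<close> available.\<close>
 have "Kd m n q 0 0 (Kh m n q 0 z) = z"
  unfolding Kd_def Kh_def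
 proof (rule dface_retract[OF dface_Kh dface_Kd])
  fix c v assume c: "c \<in> slists {m..<n} 0" and v: "v \<in> carrier (H (q + 0))"
  have "Hd (q + 0) (Suc (q + 0)) (Hs (q + 0) q v) = v" by (rule Hd_Hs_same) (use v in auto)
  then show "m # c \<in> slists {m..<n} (Suc 0) \<and> del_nth 0 (m # c) = c \<and> Hd (q + 0) (Suc (q + 0)) (Hs (q + 0) q v) = v"
   using c 0(1) by (simp add: slists_Cons slists_0 del_nth_0)
 qed (use 0 in "simp_all add: K_def")
 then have "KD m n q 0 (Kh m n q 0 z) = z" using 0(2) by (subst altsum_0[OF module_K]) simp_all
 then show ?case using mod_hom_closed[OF Kh_hom 0(2)] by blast
next
 case (Suc r)
 have mn: "m < n" using Suc.prems(1) by simp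
 interpret B: Module.module R "K m n q (Suc r)" by (rule module_K)
 interpret N: Module.module R "K (Suc m) n (Suc q) r" by (rule module_K)
 interpret B2: Module.module R "K m n q (Suc (Suc r))" by (rule module_K)
 interpret B0: Module.module R "K m n q r" by (rule module_K)
 have z: "z \<in> carrier (K m n q (Suc r))" and Dz: "KD m n q r z = \<zero>\<^bsub>K m n q r\<^esub>" using Suc.prems(2,3) by auto
 have rhz: "Krh m n q r z \<in> carrier (K (Suc m) n (Suc q) r)" by (rule mod_hom_closed[OF Krh_hom z])
 have "\<exists>y\<in>carrier (K (Suc m) n (Suc q) (Suc r)). KD (Suc m) n (Suc q) r y = Krh m n q r z"
 proof (rule Suc.IH[OF _ rhz])
  show "r + Suc m < n" using Suc.prems(1) by simp
  fix s assume s: "r = Suc s"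
  have "\<ominus>\<^bsub>K (Suc m) n (Suc q) s\<^esub> KD (Suc m) n (Suc q) s (Krh m n q (Suc s) z) = Krh m n q s (KD m n q (Suc s) z)"
   using Krh_KD[of z m n q s] z s by simp
  also have "\<dots> = \<zero>\<^bsub>K (Suc m) n (Suc q) s\<^esub>" using Dz s mod_hom_zero[OF Krh_hom module_K module_K] by simp
  finally have eq: "\<ominus>\<^bsub>K (Suc m) n (Suc q) s\<^esub> KD (Suc m) n (Suc q) s (Krh m n q (Suc s) z) = \<zero>\<^bsub>K (Suc m) n (Suc q) s\<^esub>" .
  interpret S: Module.module R "K (Suc m) n (Suc q) s" by (rule module_K)
  have "KD (Suc m) n (Suc q) s (Krh m n q (Suc s) z) \<in> carrier (K (Suc m) n (Suc q) s)"
   by (rule mod_hom_closed[OF KD_hom]) (use rhz s in simp)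
  then have "KD (Suc m) n (Suc q) s (Krh m n q (Suc s) z) = \<zero>\<^bsub>K (Suc m) n (Suc q) s\<^esub>"
   using eq S.M.r_neg S.M.r_zero by metis
  then show "KD (Suc m) n (Suc q) s (Krh m n q r z) = \<zero>\<^bsub>K (Suc m) n (Suc q) s\<^esub>" by (simp add: s)
 qed
 then obtain y where y: "y \<in> carrier (K (Suc m) n (Suc q) (Suc r))" "KD (Suc m) n (Suc q) r y = Krh m n q r z" by blast
 \<comment> \<open>By the sign in \<open>Krh_KD\<close>, adding the differential of \<open>u\<close>
   cancels \<open>Krh z\<close> rather than doubling it.\<close>
 define u where "u = Kio m n q (Suc r) y"
 have u: "u \<in> carrier (K m n q (Suc (Suc r)))" unfolding u_def by (rule mod_hom_closed[OF Kio_hom y(1)])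
 define w where "w = z \<oplus>\<^bsub>K m n q (Suc r)\<^esub> KD m n q (Suc r) u"
 have Du: "KD m n q (Suc r) u \<in> carrier (K m n q (Suc r))" by (rule mod_hom_closed[OF KD_hom u])
 have w: "w \<in> carrier (K m n q (Suc r))" using z Du by (simp add: w_def)
 have "Krh m n q r w = Krh m n q r z \<oplus>\<^bsub>K (Suc m) n (Suc q) r\<^esub> Krh m n q r (KD m n q (Suc r) u)"
  unfolding w_def by (rule mod_hom_add[OF Krh_hom z Du])
 also have "Krh m n q r (KD m n q (Suc r) u) = \<ominus>\<^bsub>K (Suc m) n (Suc q) r\<^esub> Krh m n q r z"
  unfolding Krh_KD[OF u] unfolding u_def Krh_Kio[OF mn y(1)] y(2) ..
 finally have rhw: "Krh m n q r w = \<zero>\<^bsub>K (Suc m) n (Suc q) r\<^esub>" using rhz by (simp add: N.M.r_neg)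
 have DD: "KD m n q r (KD m n q (Suc r) u) = \<zero>\<^bsub>K m n q r\<^esub>"
 proof (cases r)
  case 0
  have "KD m n q 0 (KD m n q (Suc 0) u) = Kd m n q 0 0 (KD m n q (Suc 0) u)"
   by (rule altsum_0[OF module_K]) (rule mod_hom_closed[OF Kd_hom[OF order_refl]], use Du 0 in simp)
  also have "\<dots> = altsum R (K m n q 0) (Suc 0) (%i. Kd m n q 0 0 (Kd m n q (Suc 0) i u))"
   by (rule mod_hom_altsum[OF Kd_hom[OF order_refl] module_K module_K]) (use mod_hom_closed[OF Kd_hom] u 0 in blast)
  also have "\<dots> = Kd m n q 0 0 (Kd m n q (Suc 0) 0 u) \<ominus>\<^bsub>K m n q 0\<^esub> altsum R (K m n q 0) 0 (%i. Kd m n q 0 0 (Kd m n q (Suc 0) (Suc i) u))"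
   by (rule altsum_Suc_shift[OF module_K]) (use mod_hom_closed[OF Kd_hom[OF order_refl] mod_hom_closed[OF Kd_hom]] u 0 in blast)
  also have "altsum R (K m n q 0) 0 (%i. Kd m n q 0 0 (Kd m n q (Suc 0) (Suc i) u)) = Kd m n q 0 0 (Kd m n q (Suc 0) (Suc 0) u)"
   by (rule altsum_0[OF module_K]) (use mod_hom_closed[OF Kd_hom[OF order_refl] mod_hom_closed[OF Kd_hom[OF order_refl]]] u 0 in blast)
  also have "Kd m n q 0 0 (Kd m n q (Suc 0) (Suc 0) u) = Kd m n q 0 0 (Kd m n q (Suc 0) 0 u)"
   using Kd_Kd[of 0 "Suc 0" 0 u m n q] u 0 by simp
  finally have eq: "KD m n q 0 (KD m n q (Suc 0) u) = Kd m n q 0 0 (Kd m n q (Suc 0) 0 u) \<ominus>\<^bsub>K m n q 0\<^esub>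
    Kd m n q 0 0 (Kd m n q (Suc 0) 0 u)" .
  interpret Z: Module.module R "K m n q 0" by (rule module_K)
  have "Kd m n q 0 0 (Kd m n q (Suc 0) 0 u) \<in> carrier (K m n q 0)"
   by (rule mod_hom_closed[OF Kd_hom[OF le0] mod_hom_closed[OF Kd_hom[OF le0]]]) (use u 0 in simp)
  then show ?thesis unfolding 0 eq by (simp add: Z.M.minus_eq Z.M.r_neg)
 next
  case (Suc s)
  show ?thesis
   unfolding Suc
   by (rule altsum_altsum[where D = "Kd m n q (Suc (Suc s))" and D' = "Kd m n q (Suc s)", OF module_K module_K])
    (use mod_hom_closed[OF Kd_hom] Kd_hom Kd_Kd u Suc in auto)
 qed
 have Dw: "KD m n q r w = \<zero>\<^bsub>K m n q r\<^esub>"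
  unfolding w_def mod_hom_add[OF KD_hom z Du] Dz DD by simp
 \<comment> \<open>With both \<open>KD w\<close> and \<open>Krh w\<close> zero, all correction terms
   of \<open>K_cone\<close> vanish.\<close>
 have "KD m n q (Suc r) (Kh m n q (Suc r) w) = w"
  using K_cone[OF mn w] mod_hom_closed[OF KD_hom mod_hom_closed[OF Kh_hom w]] w
  unfolding Dw rhw mod_hom_zero[OF Kh_hom module_K module_K] mod_hom_zero[OF Kio_hom module_K module_K]
   mod_hom_zero[OF Kd_hom[OF le0] module_K module_K] by (simp add: B.M.minus_eq)
 then have "KD m n q (Suc r) (Kh m n q (Suc r) w \<ominus>\<^bsub>K m n q (Suc (Suc r))\<^esub> u) = w \<ominus>\<^bsub>K m n q (Suc r)\<^esub> KD m n q (Suc r) u"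
  by (subst mod_hom_minus[OF KD_hom module_K module_K mod_hom_closed[OF Kh_hom w] u]) simp
 also have "\<dots> = z" unfolding w_def using z Du by (simp add: B.M.minus_eq B.M.a_assoc B.M.r_neg)
 finally show ?case using mod_hom_closed[OF Kh_hom w] u by (intro bexI[of _ "Kh m n q (Suc r) w \<ominus>\<^bsub>K m n q (Suc (Suc r))\<^esub> u"]) simp_all
qed

end

section \<open>The complex indexed by cut sets and its comparison with Hochschild chains\<close>

context coefficients
begin

definition Cn :: "nat => nat => ('r, nat list => ((nat => 'a + 'm) => 'r) set) module"
 where "Cn n p = dsum (slists {0..<n} (Suc p)) (%_. H p)"

definition Cd :: "nat => nat => nat => (nat list => ((nat => 'a + 'm) => 'r) set) => nat list => ((nat => 'a + 'm) => 'r) set"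
 where "Cd n p i = dmap (slists {0..<n} (Suc (Suc p))) (%_. H (Suc p)) (slists {0..<n} (Suc p)) (%_. H p)
  (del_nth i) (%_. Hd p i)"

text \<open>The face of index 0 serves as augmentation: it coequalises the first two faces and
  lowers the index of all later ones by one, so that the faces of \<open>Kd\<close> for
  \<open>q = 0\<close> become those of \<open>Cd\<close>.\<close>

definition Ce :: "nat => nat => (nat list => ((nat => 'a + 'm) => 'r) set) => nat list => ((nat => 'a + 'm) => 'r) set"
 where "Ce n p = dmap (slists {0..<n} (Suc p)) (%_. H (0 + Suc p)) (slists {0..<n} (Suc p)) (%_. H p)
  (%c. c) (%_. Hd p 0)"

definition Cs :: "nat => nat => (nat list => ((nat => 'a + 'm) => 'r) set) => nat list => ((nat => 'a + 'm) => 'r) set"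
 where "Cs n p = dmap (slists {0..<n} (Suc p)) (%_. H p) (slists {0..<n} (Suc p)) (%_. H (0 + Suc p))
  (%c. c) (%_. Hs p 0)"

abbreviation "C_diff n \<equiv> sx_diff R (Cn n) (Cd n)"

lemma dface_Cd: "i \<le> Suc p ==> dface R (slists {0..<n} (Suc (Suc p))) (%_. H (Suc p)) (slists {0..<n} (Suc p)) (%_. H p)
  (del_nth i) (%_. Hd p i)"
 using Hd_hom[of i p] by (intro dface_slists) simp

lemma dface_Ce: "dface R (slists {0..<n} (Suc p)) (%_. H (0 + Suc p)) (slists {0..<n} (Suc p)) (%_. H p) (%c. c) (%_. Hd p 0)"
 using Hd_hom[of 0 p] by (intro dface_slists) simp

lemma dface_Cs: "dface R (slists {0..<n} (Suc p)) (%_. H p) (slists {0..<n} (Suc p)) (%_. H (0 + Suc p)) (%c. c) (%_. Hs p 0)"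
 using Hs_hom[of 0 p] by (intro dface_slists) simp

lemma module_Cn: "Module.module R (Cn n p)"
 unfolding Cn_def by (rule module_dsum[OF R_cring module_H])

lemma Cd_hom: "i \<le> Suc p ==> Cd n p i \<in> mod_hom R (Cn n (Suc p)) (Cn n p)"
 unfolding Cd_def Cn_def by (rule dface_hom[OF dface_Cd])

lemma Ce_hom: "Ce n p \<in> mod_hom R (K 0 n 0 (Suc p)) (Cn n p)"
 unfolding Ce_def Cn_def K_def by (rule dface_hom[OF dface_Ce])

lemma Cs_hom: "Cs n p \<in> mod_hom R (Cn n p) (K 0 n 0 (Suc p))"
 unfolding Cs_def Cn_def K_def by (rule dface_hom[OF dface_Cs])

lemma Ks_hom: "j \<le> q + r ==> Ks n q r j \<in> mod_hom R (K 0 n q r) (K 0 n (Suc q) r)"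
 unfolding Ks_def K_def by (rule dface_hom[OF dface_Ks])

lemma Cd_Cd:
 assumes "i < j" "j \<le> Suc (Suc p)" "z \<in> carrier (Cn n (Suc (Suc p)))"
 shows "Cd n p i (Cd n (Suc p) j z) = Cd n p (j - 1) (Cd n (Suc p) i z)"
 unfolding Cd_def
proof (rule dface_square[OF dface_Cd dface_Cd dface_Cd dface_Cd])
 fix c v assume c: "c \<in> slists {0..<n} (Suc (Suc (Suc p)))" and v: "v \<in> carrier (H (Suc (Suc p)))"
 show "del_nth j c \<in> slists {0..<n} (Suc (Suc p)) \<and> del_nth i c \<in> slists {0..<n} (Suc (Suc p)) \<and>
   del_nth i (del_nth j c) = del_nth (j - 1) (del_nth i c) \<and> Hd p i (Hd (Suc p) j v) = Hd p (j - 1) (Hd (Suc p) i v)"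
  using slists_del_nth[OF c] del_nth_del_nth[of i j c] slists_length[OF c] assms(1,2) Hd_Hd[OF assms(1,2) v] by simp
qed (use assms in "auto simp: Cn_def")

lemma C_complex:
 shows "chain_complex R (sx_mod (Cn n)) (C_diff n)"
  and "sx_mod (Cn n) (int p) = Cn n p"
  and "C_diff n (int p + 1) x = altsum R (Cn n p) (Suc p) (%i. Cd n p i x)"
  and "C_diff n 0 x = \<zero>\<^bsub>sx_mod (Cn n) (0 - 1)\<^esub>"
proof -
 note c = sx_complex[where X = "Cn n" and F = "Cd n", OF module_Cn Cd_hom Cd_Cd]
 show "chain_complex R (sx_mod (Cn n)) (C_diff n)" by (rule c(1))
 show "sx_mod (Cn n) (int p) = Cn n p" by (rule c(2))
 show "C_diff n (int p + 1) x = altsum R (Cn n p) (Suc p) (%i. Cd n p i x)" by (rule c(3))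
 show "C_diff n 0 x = \<zero>\<^bsub>sx_mod (Cn n) (0 - 1)\<^esub>" by (rule c(4))
qed

lemma K_eval_hom: "(%z. z []) \<in> mod_hom R (K 0 n q 0) (H q)"
 using dsum_eval_hom[where i = "[]" and I = "slists {0..<n} 0" and N = "%_. H (q + 0)", OF R_cring module_H]
 by (simp add: K_def slists_0)

lemma Kv_at_Nil:
 assumes "j \<le> Suc q" "z \<in> carrier (K 0 n (Suc q) 0)"
 shows "Kv n q 0 j z [] = Hd q j (z [])"
proof -
 have hom: "(%z. Kv n q 0 j z []) \<in> mod_hom R (K 0 n (Suc q) 0) (H (q + 0))"
  using mod_hom_comp[OF Kv_hom[of j q 0 n] K_eval_hom] assms(1) by simp
 have hom2: "(%z. Hd q j (z [])) \<in> mod_hom R (K 0 n (Suc q) 0) (H (q + 0))"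
  using mod_hom_comp[OF K_eval_hom Hd_hom[of j q]] assms(1) by simp
 have j: "j \<le> Suc (q + 0)" using assms(1) by simp
 show ?thesis
 proof (rule dface_hom_ext[where f = "%z. Kv n q 0 j z []" and f' = "%z. Hd q j (z [])", OF dface_Kv[OF j] module_H,
    folded K_def, OF hom hom2 _ assms(2)])
  fix c v assume c: "c \<in> slists {0..<n} 0" and v: "v \<in> carrier (H (Suc q + 0))"
  show "Kv n q 0 j (dsum_in (slists {0..<n} 0) (%_. H (Suc q + 0)) c v) [] = Hd q j (dsum_in (slists {0..<n} 0) (%_. H (Suc q + 0)) c v [])"
   unfolding Kv_def dface_in[OF dface_Kv[OF j] c v] using c by (simp add: dsum_in_def slists_0)
 qed
qed

text \<open>The double complex consists of the \<open>K 0 n q r\<close> with \<open>r\<close>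
  positive; the part with \<open>r = 0\<close> is the Hochschild complex and augments the columns.
  The rows split by a degeneracy next to the last face used by \<open>Kv\<close>.\<close>

theorem C_hochschild:
 assumes n: "i + 2 \<le> n"
 shows "mod_isomorphic R (homology (sx_mod (Cn n)) (C_diff n) (int i)) (homology (hoch_mod R A M) (hoch_diff R A M) (int i))"
proof -
 have eta: "(%c. Kd 0 n q 0 0 c []) \<in> mod_hom R (K 0 n q (Suc 0)) (H q)" for q
  by (rule mod_hom_comp[OF Kd_hom[OF le0] K_eval_hom])
 interpret bisimplicial R "%p q. K 0 n q (Suc p)" "%p q i. Kd 0 n q (Suc p) i" "%p q j. Kv n q (Suc p) j"
  "sx_mod (Cn n)" "C_diff n" "Cd n" "Ce n" "hoch_mod R A M" "hoch_diff R A M" Hd "%q c. Kd 0 n q 0 0 c []"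
 proof (rule bisimplicial.intro)
  show "chain_complex R (sx_mod (Cn n)) (C_diff n)" by (rule C_complex(1))
  show "chain_complex R (hoch_mod R A M) (hoch_diff R A M)" by (rule chain_complex_hoch)
  show "C_diff n 0 x = \<zero>\<^bsub>sx_mod (Cn n) (0 - 1)\<^esub>" for x by (rule C_complex(4))
  show "hoch_diff R A M 0 y = \<zero>\<^bsub>hoch_mod R A M (0 - 1)\<^esub>" for y by (simp add: hoch_diff_def Let_def)
  show "C_diff n (int p + 1) x = altsum R (sx_mod (Cn n) (int p)) (Suc p) (%i. Cd n p i x)" for p x
   unfolding C_complex(2) by (rule C_complex(3))
  show "hoch_diff R A M (int q + 1) y = altsum R (hoch_mod R A M (int q)) (Suc q) (%j. Hd q j y)"
   if "y \<in> carrier (hoch_mod R A M (int (Suc q)))" for q y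
   using that unfolding hoch_mod_nat by (rule hoch_diff_Suc)
  show "Ce n p \<in> mod_hom R (K 0 n 0 (Suc p)) (sx_mod (Cn n) (int p))" for p
   unfolding C_complex(2) by (rule Ce_hom)
  show "(%c. Kd 0 n q 0 0 c []) \<in> mod_hom R (K 0 n q (Suc 0)) (hoch_mod R A M (int q))" for q
   unfolding hoch_mod_nat by (rule eta)
  show "Kd 0 n q (Suc p) i (Kd 0 n q (Suc (Suc p)) j t) = Kd 0 n q (Suc p) (j - 1) (Kd 0 n q (Suc (Suc p)) i t)"
   if "i < j" "j \<le> Suc (Suc p)" "t \<in> carrier (K 0 n q (Suc (Suc (Suc p))))" for i j p q t
   by (rule Kd_Kd[OF that])
  show "Kv n q (Suc p) i (Kv n (Suc q) (Suc p) j t) = Kv n q (Suc p) (j - 1) (Kv n (Suc q) (Suc p) i t)"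
   if "i < j" "j \<le> Suc (Suc q)" "t \<in> carrier (K 0 n (Suc (Suc q)) (Suc p))" for i j p q t
   by (rule Kv_Kv[OF that(1) _ that(3)]) (use that in simp)
  show "Kd 0 n q (Suc p) i (Kv n q (Suc (Suc p)) j t) = Kv n q (Suc p) j (Kd 0 n (Suc q) (Suc p) i t)"
   if "i \<le> Suc p" "j \<le> Suc q" "t \<in> carrier (K 0 n (Suc q) (Suc (Suc p)))" for i j p q t
   by (rule Kd_Kv[OF that])
  show "Ce n p (Kv n 0 (Suc p) 0 t) = Ce n p (Kv n 0 (Suc p) 1 t)" if t: "t \<in> carrier (K 0 n 1 (Suc p))" for t p
   unfolding Ce_def Kv_def
  proof (rule dface_square[OF dface_Kv dface_Ce dface_Kv dface_Ce])
   show "t \<in> carrier (dsum (slists {0..<n} (Suc p)) (%_. H (Suc 0 + Suc p)))" using t by (simp add: K_def)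
   fix c v assume "c \<in> slists {0..<n} (Suc p)" "v \<in> carrier (H (Suc 0 + Suc p))"
   then show "c \<in> slists {0..<n} (Suc p) \<and> c \<in> slists {0..<n} (Suc p) \<and> c = c \<and>
     Hd p 0 (Hd (0 + Suc p) 0 v) = Hd p 0 (Hd (0 + Suc p) 1 v)"
    using Hd_Hd[of 0 1 p v] by simp
  qed simp_all
  show "Kd 0 n q 0 0 (Kd 0 n q (Suc 0) 0 t) [] = Kd 0 n q 0 0 (Kd 0 n q (Suc 0) 1 t) []" if t: "t \<in> carrier (K 0 n q (Suc 1))" for t q
   using Kd_Kd[of 0 1 0 t 0 n q] t by simp
  show "Ce n p (Kd 0 n 0 (Suc p) i t) = Cd n p i (Ce n (Suc p) t)" if i: "i \<le> Suc p" and t: "t \<in> carrier (K 0 n 0 (Suc (Suc p)))" for i p t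
   unfolding Ce_def Kd_def Cd_def
  proof (rule dface_square[OF dface_Kd[OF i] dface_Ce dface_Ce dface_Cd[OF i]])
   show "t \<in> carrier (dsum (slists {0..<n} (Suc (Suc p))) (%_. H (0 + Suc (Suc p))))" using t by (simp add: K_def)
   fix c v assume c: "c \<in> slists {0..<n} (Suc (Suc p))" and v: "v \<in> carrier (H (0 + Suc (Suc p)))"
   have "Hd p 0 (Hd (Suc p) (Suc i) v) = Hd p (Suc i - 1) (Hd (Suc p) 0 v)" by (rule Hd_Hd) (use i v in auto)
   then show "del_nth i c \<in> slists {0..<n} (Suc p) \<and> c \<in> slists {0..<n} (Suc (Suc p)) \<and> del_nth i c = del_nth i c \<and>
     Hd p 0 (Hd (0 + Suc p) (Suc (0 + i)) v) = Hd p i (Hd (Suc p) 0 v)"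
    using slists_del_nth[OF c i] c by simp
  qed
  show "Kd 0 n q 0 0 (Kv n q (Suc 0) j t) [] = Hd q j (Kd 0 n (Suc q) 0 0 t [])"
   if j: "j \<le> Suc q" and t: "t \<in> carrier (K 0 n (Suc q) (Suc 0))" for j q t
   unfolding Kd_Kv[OF order_refl j t] by (rule Kv_at_Nil[OF j mod_hom_closed[OF Kd_hom[OF order_refl] t]])
 qed (simp_all add: module_K Kd_hom Kv_hom)
 show ?thesis
 proof (rule homology_iso[where n = i and i = i])
  fix p x assume "x \<in> carrier (sx_mod (Cn n) (int p))"
  then have x: "x \<in> carrier (Cn n p)" by (simp add: C_complex(2))
  have "Ce n p (Cs n p x) = x"
   unfolding Ce_def Cs_def
   by (rule dface_retract[OF dface_Cs dface_Ce]) (use x Hd_Hs_same[of 0 p 0] in "auto simp: Cn_def")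
  then show "\<exists>t\<in>carrier (K 0 n 0 (Suc p)). Ce n p t = x" using mod_hom_closed[OF Cs_hom x] by blast
 next
  fix p t assume t: "t \<in> carrier (K 0 n 0 (Suc p))" and "Ce n p t = \<zero>\<^bsub>sx_mod (Cn n) (int p)\<^esub>"
  then have z: "Ce n p t = \<zero>\<^bsub>Cn n p\<^esub>" by (simp add: C_complex(2))
  interpret Cp: Module.module R "Cn n p" by (rule module_Cn)
  \<comment> \<open>The degeneracy of index 1 exists because at least one cut, hence one further
    tensor factor, is present. Face 1 undoes it, while face 0 passes through it and leaves the
    splitting \<open>Cs\<close> of the augmentation.\<close>
  have 1: "Kv n 0 (Suc p) (Suc 0) (Ks n 0 (Suc p) (Suc 0) t) = t"
   unfolding Kv_def Ks_def
   by (rule dface_retract[OF dface_Ks dface_Kv]) (use t Hd_Hs_same[of "Suc 0" "Suc p" "Suc 0"] in "auto simp: K_def")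
  have 0: "Kv n 0 (Suc p) 0 (Ks n 0 (Suc p) (Suc 0) t) = Cs n p (Ce n p t)"
   unfolding Kv_def Ks_def Cs_def Ce_def
   by (rule dface_square[OF dface_Ks dface_Kv dface_Ce dface_Cs]) (use t Hd_Hs_less[of 0 "Suc 0" p] in "auto simp: K_def")
  have "\<exists>s\<in>carrier (K 0 n (Suc 0) (Suc p)). altsum R (K 0 n 0 (Suc p)) (Suc 0) (%j. Kv n 0 (Suc p) j s) = t"
  proof (rule back_homotopy_exact[where D = "Kv n 0 (Suc p)" and h' = "Cs n p" and y = "Ks n 0 (Suc p) (Suc 0) t" and k = 0
     and f = "%_. Ce n p t", OF module_K module_Cn module_K Cs_hom])
   show "altsum R (Cn n p) 0 (%_. Ce n p t) = \<zero>\<^bsub>Cn n p\<^esub>" using altsum_0[OF module_Cn, of "%_. Ce n p t"] z by simp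
   show "Kv n 0 (Suc p) j \<in> mod_hom R (K 0 n (Suc 0) (Suc p)) (K 0 n 0 (Suc p))" if "j \<le> Suc 0" for j
    by (rule Kv_hom) (use that in simp)
   show "Ks n 0 (Suc p) (Suc 0) t \<in> carrier (K 0 n (Suc 0) (Suc p))" by (rule mod_hom_closed[OF Ks_hom t]) simp
  qed (use t 0 1 mod_hom_closed[OF Ce_hom t] in simp_all)
  then show "\<exists>s\<in>carrier (K 0 n 1 (Suc p)). altsum R (K 0 n 0 (Suc p)) (Suc 0) (%j. Kv n 0 (Suc p) j s) = t" by simp
 next
  fix p q t assume t: "t \<in> carrier (K 0 n (Suc q) (Suc p))"
   and z: "altsum R (K 0 n q (Suc p)) (Suc q) (%j. Kv n q (Suc p) j t) = \<zero>\<^bsub>K 0 n q (Suc p)\<^esub>"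
  \<comment> \<open>The index equals that of the last vertical face, which therefore undoes the
    degeneracy; all earlier faces pass through and lower its index.\<close>
  have 1: "Kv n (Suc q) (Suc p) (Suc (Suc q)) (Ks n (Suc q) (Suc p) (Suc (Suc q)) t) = t"
   unfolding Kv_def Ks_def
   by (rule dface_retract[OF dface_Ks dface_Kv]) (use t Hd_Hs_same[of "Suc (Suc q)" "Suc q + Suc p" "Suc (Suc q)"] in "auto simp: K_def")
  have 0: "Kv n (Suc q) (Suc p) j (Ks n (Suc q) (Suc p) (Suc (Suc q)) t) = Ks n q (Suc p) (Suc q) (Kv n q (Suc p) j t)" if "j \<le> Suc q" for j
   unfolding Kv_def Ks_def
   by (rule dface_square[OF dface_Ks dface_Kv dface_Kv dface_Ks])
    (use that t Hd_Hs_less[of j "Suc (Suc q)" "q + Suc p"] in "auto simp: K_def")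
  show "\<exists>s\<in>carrier (K 0 n (Suc (Suc q)) (Suc p)). altsum R (K 0 n (Suc q) (Suc p)) (Suc (Suc q)) (%j. Kv n (Suc q) (Suc p) j s) = t"
  proof (rule back_homotopy_exact[where D = "Kv n (Suc q) (Suc p)" and h' = "Ks n q (Suc p) (Suc q)"
     and y = "Ks n (Suc q) (Suc p) (Suc (Suc q)) t" and k = "Suc q" and f = "%j. Kv n q (Suc p) j t", OF module_K module_K module_K])
   show "Ks n (Suc q) (Suc p) (Suc (Suc q)) t \<in> carrier (K 0 n (Suc (Suc q)) (Suc p))" by (rule mod_hom_closed[OF Ks_hom t]) simp
   show "Ks n q (Suc p) (Suc q) \<in> mod_hom R (K 0 n q (Suc p)) (K 0 n (Suc q) (Suc p))" by (rule Ks_hom) simp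
   show "Kv n q (Suc p) j t \<in> carrier (K 0 n q (Suc p))" if "j \<le> Suc q" for j
    by (rule mod_hom_closed[OF Kv_hom t]) (use that in simp)
   show "Kv n (Suc q) (Suc p) j \<in> mod_hom R (K 0 n (Suc (Suc q)) (Suc p)) (K 0 n (Suc q) (Suc p))" if "j \<le> Suc (Suc q)" for j
    by (rule Kv_hom) (use that in simp)
  qed (use t z 0 1 in simp_all)
 next
  fix q y assume "y \<in> carrier (hoch_mod R A M (int q))"
  then have y: "y \<in> carrier (H (q + 0))" by (simp add: hoch_mod_nat)
  \<comment> \<open>The Hochschild chain placed on the empty list, where exactness of the column
    amounts to surjectivity.\<close>
  let ?z = "dsum_in (slists {0..<n} 0) (%_. H (q + 0)) [] y"
  have z: "?z \<in> carrier (K 0 n q 0)" by (rule K_dsum_in[OF _ y]) (simp add: slists_0)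
  obtain x where x: "x \<in> carrier (K 0 n q (Suc 0))" "KD 0 n q 0 x = ?z"
   using K_exact[OF _ z] n by auto
  have eq: "KD 0 n q 0 x = Kd 0 n q 0 0 x" by (rule altsum_0[OF module_K]) (rule mod_hom_closed[OF Kd_hom[OF order_refl] x(1)])
  have "Kd 0 n q 0 0 x [] = y" unfolding eq[symmetric] x(2) by (simp add: dsum_in_def slists_0)
  then show "\<exists>t\<in>carrier (K 0 n q (Suc 0)). Kd 0 n q 0 0 t [] = y" using x(1) by blast
 next
  fix q t assume t: "t \<in> carrier (K 0 n q (Suc 0))" and z: "Kd 0 n q 0 0 t [] = \<zero>\<^bsub>hoch_mod R A M (int q)\<^esub>"
  have kt: "Kd 0 n q 0 0 t \<in> carrier (K 0 n q 0)" by (rule mod_hom_closed[OF Kd_hom[OF order_refl] t])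
  interpret K0: Module.module R "K 0 n q 0" by (rule module_K)
  have "Kd 0 n q 0 0 t = \<zero>\<^bsub>K 0 n q 0\<^esub>"
  proof (rule dsum_eqI[of _ "slists {0..<n} 0" "%_. H (q + 0)"])
   show "Kd 0 n q 0 0 t \<in> carrier (dsum (slists {0..<n} 0) (%_. H (q + 0)))" using kt unfolding K_def .
   show "\<zero>\<^bsub>K 0 n q 0\<^esub> \<in> carrier (dsum (slists {0..<n} 0) (%_. H (q + 0)))" using K0.M.zero_closed unfolding K_def .
   show "Kd 0 n q 0 0 t c = \<zero>\<^bsub>K 0 n q 0\<^esub> c" if "c \<in> slists {0..<n} 0" for c
    using that z by (simp add: K_def dsum_def slists_0 hoch_mod_nat)
  qed
  moreover have "KD 0 n q 0 t = Kd 0 n q 0 0 t" by (rule altsum_0[OF module_K]) (rule kt)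
  ultimately have "\<exists>x\<in>carrier (K 0 n q (Suc (Suc 0))). KD 0 n q (Suc 0) x = t"
   using n by (intro K_exact[OF _ t]) auto
  then show "\<exists>s\<in>carrier (K 0 n q (Suc 1)). altsum R (K 0 n q (Suc 0)) (Suc 0) (%i. Kd 0 n q (Suc 0) i s) = t" by simp
 next
  fix p q t assume p: "Suc p \<le> i" and t: "t \<in> carrier (K 0 n q (Suc (Suc p)))"
   and z: "altsum R (K 0 n q (Suc p)) (Suc p) (%i. Kd 0 n q (Suc p) i t) = \<zero>\<^bsub>K 0 n q (Suc p)\<^esub>"
  \<comment> \<open>The element lives on lists of p + 2 cuts with p + 2 <= i + 1, and
    \<open>K_exact\<close> requires fewer than \<open>n\<close> of them.\<close>
  show "\<exists>s\<in>carrier (K 0 n q (Suc (Suc (Suc p)))). altsum R (K 0 n q (Suc (Suc p))) (Suc (Suc p)) (%i. Kd 0 n q (Suc (Suc p)) i s) = t"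
   by (rule K_exact[OF _ t]) (use z p n in auto)
 qed simp
qed

end

section \<open>Comparison with the path poset complex\<close>

lemma mod_hom_inv_into:
 assumes f: "f \<in> mod_hom R M N" and bij: "bij_betw f (carrier M) (carrier N)" and M: "Module.module R M"
 shows "inv_into (carrier M) f \<in> mod_hom R N M"
proof -
 interpret M: Module.module R M by (rule M)
 have c: "inv_into (carrier M) f y \<in> carrier M" if "y \<in> carrier N" for y
  by (rule inv_into_into) (use bij that in "simp add: bij_betw_def")
 have r: "f (inv_into (carrier M) f y) = y" if "y \<in> carrier N" for y
  by (rule f_inv_into_f) (use bij that in "simp add: bij_betw_def")
 have l: "inv_into (carrier M) f (f x) = x" if "x \<in> carrier M" for x
  by (rule inv_into_f_f) (use bij that in "simp_all add: bij_betw_def")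
 show ?thesis
 proof (rule mod_homI)
  fix x y assume xy: "x \<in> carrier N" "y \<in> carrier N"
  show "inv_into (carrier M) f (x \<oplus>\<^bsub>N\<^esub> y) = inv_into (carrier M) f x \<oplus>\<^bsub>M\<^esub> inv_into (carrier M) f y"
   using l[of "inv_into (carrier M) f x \<oplus>\<^bsub>M\<^esub> inv_into (carrier M) f y"] mod_hom_add[OF f c[OF xy(1)] c[OF xy(2)]] c xy r by simp
 next
  fix a x assume a: "a \<in> carrier R" and x: "x \<in> carrier N"
  show "inv_into (carrier M) f (a \<odot>\<^bsub>N\<^esub> x) = a \<odot>\<^bsub>M\<^esub> inv_into (carrier M) f x"
   using l[of "a \<odot>\<^bsub>M\<^esub> inv_into (carrier M) f x"] mod_hom_smult[OF f a c[OF x]] c x a r by simp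
 qed (rule c)
qed

text \<open>The least element of \<open>S\<close> lies below all entries or is the first entry. In
  the first case it can be prepended to the list and to all its faces; in the second it survives
  every face but the one of index 0, and prepending it again leaves the index set.\<close>

lemma slists_Min:
 assumes "c \<in> slists S (Suc r)" "finite S" "S \<subseteq> {..<n::nat}"
 shows "Min S \<notin> set c \<and> Min S # c \<in> slists S (Suc (Suc r)) \<and> (\<forall>i\<le>r. Min S # del_nth i c \<in> slists S (Suc r)) \<or>
  (\<exists>c'. c = Min S # c' \<and> Min S # c \<notin> slists S (Suc (Suc r)) \<and> (\<forall>i. 0 < i --> i \<le> r --> Min S # del_nth i c \<notin> slists S (Suc r)))"
proof -
 obtain a c' where c: "c = a # c'" using assms(1) by (cases c) (auto simp: slists_def)
 have S: "set c \<subseteq> S" "sorted_wrt (<) c" using assms(1) by (auto simp: slists_def)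
 have le: "Min S \<le> b" if "b \<in> set c" for b using that S(1) assms(2) by (auto intro: Min_le)
 have MS: "Min S \<in> S" by (rule Min_in[OF assms(2)]) (use S(1) c in auto)
 have nsl: "m # d \<notin> slists T k" if "m \<in> set d" for m d T k using that by (auto simp: slists_def)
 show ?thesis
 proof (cases "a = Min S")
  case True
  have "Min S \<in> set (del_nth i c)" if "0 < i" for i using that by (cases i) (simp_all add: c True del_nth_Suc_Cons)
  then show ?thesis using True c nsl by auto
 next
  case False
  have "Min S < b" if "b \<in> set c" for b
   using le[of a] le[OF that] False S(2) that by (auto simp: c)
  then have less: "\<forall>b\<in>set c. Min S < b" by blast
  have cons: "Min S # d \<in> slists S (Suc k)" if "d \<in> slists S k" "set d \<subseteq> set c" for d k
   using that MS less by (auto simp: slists_def)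
  have "Min S \<notin> set c" using less by blast
  moreover have "Min S # c \<in> slists S (Suc (Suc r))" by (rule cons[OF assms(1)]) simp
  moreover have "Min S # del_nth i c \<in> slists S (Suc r)" if "i \<le> r" for i
   by (rule cons[OF slists_del_nth[OF assms(1) that] set_del_nth])
  ultimately show ?thesis by blast
 qed
qed

context ngon
begin

text \<open>The condition on the cuts means that every member of the chain is contained in
  \<open>xc c\<close>. Faces may be taken on either side: a smaller last multipath has more cuts
  available, and fewer cuts give a larger \<open>xc c\<close>.\<close>

definition TI :: "nat => nat => ('e set list \<times> nat list) set"
 where "TI p q = {(xs, c). xs \<in> poset_chains P (int p) \<and> c \<in> slists (cut (last xs)) (Suc q)}"

abbreviation TN :: "'e set list \<times> nat list => ('r, (('v set => 'a + 'm) => 'r) set) module" where "TN u \<equiv> Fo (hd (fst u))"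
abbreviation CI :: "nat => 'e set list set" where "CI p \<equiv> poset_chains P (int p)"
abbreviation LI :: "nat => nat list set" where "LI q \<equiv> slists {0..<n} (Suc q)"

abbreviation cf :: "nat => 'e set list => (('v set => 'a + 'm) => 'r) set => (('v set => 'a + 'm) => 'r) set"
 where "cf i xs w \<equiv> if i = 0 then Fmap (xs ! 0) (xs ! 1) w else w"

definition "TT p q = dsum (TI p q) TN"
definition "Th p q i = dmap (TI (Suc p) q) TN (TI p q) TN (%u. (del_nth i (fst u), snd u)) (%u. cf i (fst u))"
definition "Tv p q j = dmap (TI p (Suc q)) TN (TI p q) TN (%u. (fst u, del_nth j (snd u))) (%_ w. w)"
definition "Tep p = dmap (TI p 0) TN (CI p) (%xs. Fo (hd xs)) fst (%_ w. w)"
text \<open>The coefficient sits at the smallest multipath, so it is first moved up to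
  \<open>xc c\<close>, where it can be read as a Hochschild chain.\<close>

definition "Tet q = dmap (TI 0 q) TN (LI q) (%_. H q) snd (%u w. thh (snd u) (Fmap (hd (fst u)) (xc (snd u)) w))"
text \<open>The cone over the simplex of available cuts, with the least of them as apex so that
  prepending keeps lists increasing.\<close>

definition "Tm p q = dmap (TI p q) TN (TI p (Suc q)) TN (%u. (fst u, Min (cut (last (fst u))) # snd u)) (%_ w. w)"
definition "Tm0 p = dmap (CI p) (%xs. Fo (hd xs)) (TI p 0) TN (%xs. (xs, [Min (cut (last xs))])) (%_ w. w)"
text \<open>The cone over the chains below \<open>xc c\<close>. The top is put at the far end, so
  the coefficient at the front does not move.\<close>

definition "Tc p q = dmap (TI p q) TN (TI (Suc p) q) TN (%u. (fst u @ [xc (snd u)], snd u)) (%_ w. w)"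
text \<open>A splitting of \<open>Tet\<close>: a Hochschild chain is placed at the one-element chain
  of \<open>xc c\<close> through the inverse of \<open>thh\<close>.\<close>

definition "Tc0 q = dmap (LI q) (%_. H q) (TI 0 q) TN (%c. ([xc c], c)) (%c. inv_into (carrier (Fo (xc c))) (thh c))"

lemma CI_facts:
 assumes "xs \<in> CI p"
 shows "length xs = Suc p" "hd xs = xs ! 0" "last xs = xs ! p" "hd xs \<in> P" "last xs \<in> P" "hd xs \<subseteq> last xs"
  "\<And>y. y \<in> set xs ==> y \<subseteq> last xs"
proof -
 show l: "length xs = Suc p" using assms by (auto simp: poset_chains_def)
 then have ne: "xs \<noteq> []" by auto
 show h: "hd xs = xs ! 0" "last xs = xs ! p" using ne l by (simp_all add: hd_conv_nth last_conv_nth)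
 show "hd xs \<in> P" "last xs \<in> P" "hd xs \<subseteq> last xs"
  using poset_chains_nth[OF assms, of 0 p] l by (simp_all add: h)
 fix y assume "y \<in> set xs"
 then obtain k where "k < length xs" "xs ! k = y" by (auto simp: in_set_conv_nth)
 then show "y \<subseteq> last xs" using poset_chains_nth(3)[OF assms, of k p] l by (simp add: h)
qed

lemma CI_del: "[|xs \<in> CI (Suc p); i \<le> Suc p|] ==> del_nth i xs \<in> CI p"
 using poset_chains_del_nth[of xs P "int p" i] CI_facts(1)[of xs "Suc p"] by (simp add: add.commute)

text \<open>A face can only shrink the largest multipath, so cuts that were available remain
  so.\<close>

lemma last_del:
 assumes "xs \<in> CI (Suc p)" "i \<le> Suc p"
 shows "cut (last xs) \<subseteq> cut (last (del_nth i xs))"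
proof (rule cut_antimono)
 have "del_nth i xs \<noteq> []" using CI_facts(1)[OF CI_del[OF assms]] by auto
 then have "last (del_nth i xs) \<in> set xs" using set_del_nth[of i xs] by auto
 then show "last (del_nth i xs) \<subseteq> last xs" by (rule CI_facts(7)[OF assms(1)])
qed

lemma finite_TI: "finite (TI p q)"
proof (rule finite_subset)
 show "TI p q \<subseteq> CI p \<times> LI q" using cut_subset by (fastforce simp: TI_def slists_def)
 show "finite (CI p \<times> LI q)" using finite_poset_chains[OF PF.finite_P] finite_slists by blast
qed

lemma TI_cuts:
 assumes "u \<in> TI p q"
 shows "fst u \<in> CI p" "snd u \<in> slists (cut (last (fst u))) (Suc q)" "snd u \<in> cuts" "length (snd u) = Suc q" "snd u \<in> LI q"
  "xc (snd u) \<in> P" "last (fst u) \<subseteq> xc (snd u)" "hd (fst u) \<subseteq> xc (snd u)" "hd (fst u) \<in> P"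
proof -
 show 1: "fst u \<in> CI p" "snd u \<in> slists (cut (last (fst u))) (Suc q)" using assms by (auto simp: TI_def)
 show c: "snd u \<in> cuts" using 1(2) cut_subset by (fastforce simp: slists_def cuts_def)
 show "length (snd u) = Suc q" using 1(2) by (rule slists_length)
 show "snd u \<in> LI q" using 1(2) cut_subset by (fastforce simp: slists_def)
 show "xc (snd u) \<in> P" by (rule xc_P[OF c])
 show l: "last (fst u) \<subseteq> xc (snd u)"
  using subset_xc_iff[OF CI_facts(5)[OF 1(1)] c] 1(2) by (auto simp: slists_def)
 show "hd (fst u) \<subseteq> xc (snd u)" using l CI_facts(6)[OF 1(1)] by blast
 show "hd (fst u) \<in> P" by (rule CI_facts(4)[OF 1(1)])
qed

lemma LI_cuts: "c \<in> LI q ==> c \<in> cuts" "c \<in> LI q ==> length c = Suc q"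
 by (auto simp: slists_def cuts_def)

lemma dface_T:
 assumes "finite I" "\<And>u. [|u \<in> I; g u \<in> J|] ==> ph u \<in> mod_hom R (Fo (k u)) (Fo (k' (g u)))"
 shows "dface R I (%u. Fo (k u)) J (%u. Fo (k' u)) g ph"
 using assms by (auto simp: dface_def R_cring module_F_obj)

lemma cf_hom: "[|xs \<in> CI (Suc p); i \<le> Suc p|] ==> cf i xs \<in> mod_hom R (Fo (hd xs)) (Fo (hd (del_nth i xs)))"
 by (rule PF.S_face_coeff_hom[of "int (Suc p)"]) simp_all

lemma dface_Th: "i \<le> Suc p ==> dface R (TI (Suc p) q) TN (TI p q) TN (%u. (del_nth i (fst u), snd u)) (%u. cf i (fst u))"
proof (rule dface_T[OF finite_TI])
 fix u assume i: "i \<le> Suc p" and u: "u \<in> TI (Suc p) q"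
 show "cf i (fst u) \<in> mod_hom R (TN u) (TN (del_nth i (fst u), snd u))"
  unfolding fst_conv by (rule cf_hom[OF TI_cuts(1)[OF u] i])
qed

lemma dface_Tv: "dface R (TI p (Suc q)) TN (TI p q) TN (%u. (fst u, del_nth j (snd u))) (%_ w. w)"
 by (rule dface_T[OF finite_TI]) (simp add: mod_hom_id[OF module_F_obj])

lemma dface_Tep: "dface R (TI p 0) TN (CI p) (%xs. Fo (hd xs)) fst (%_ w. w)"
 by (rule dface_T[OF finite_TI]) (simp add: mod_hom_id[OF module_F_obj])

lemma dface_Tet: "dface R (TI 0 q) TN (LI q) (%_. H q) snd (%u w. thh (snd u) (Fmap (hd (fst u)) (xc (snd u)) w))"
proof -
 have "(%w. thh (snd u) (Fmap (hd (fst u)) (xc (snd u)) w)) \<in> mod_hom R (TN u) (H q)" if u: "u \<in> TI 0 q" for u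
  using mod_hom_comp[OF PF.Fm[OF TI_cuts(9)[OF u] TI_cuts(6)[OF u] TI_cuts(8)[OF u]] thh_hom[OF TI_cuts(3)[OF u]]]
   TI_cuts(4)[OF u] by simp
 then show ?thesis by (simp add: dface_def R_cring module_F_obj module_H finite_TI)
qed

lemma dface_Tm: "dface R (TI p q) TN (TI p (Suc q)) TN (%u. (fst u, Min (cut (last (fst u))) # snd u)) (%_ w. w)"
 by (rule dface_T[OF finite_TI]) (simp add: mod_hom_id[OF module_F_obj])

lemma dface_Tm0: "dface R (CI p) (%xs. Fo (hd xs)) (TI p 0) TN (%xs. (xs, [Min (cut (last xs))])) (%_ w. w)"
 by (rule dface_T[OF finite_poset_chains[OF PF.finite_P]]) (simp add: mod_hom_id[OF module_F_obj])

lemma hd_snoc: "xs \<in> CI p ==> hd (xs @ ys) = hd xs"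
 using CI_facts(1)[of xs p] by (cases xs) auto

lemma dface_Tc: "dface R (TI p q) TN (TI (Suc p) q) TN (%u. (fst u @ [xc (snd u)], snd u)) (%_ w. w)"
proof (rule dface_T[OF finite_TI])
 fix u assume u: "u \<in> TI p q"
 show "(%w. w) \<in> mod_hom R (TN u) (TN (fst u @ [xc (snd u)], snd u))"
  unfolding fst_conv hd_snoc[OF TI_cuts(1)[OF u]] by (rule mod_hom_id[OF module_F_obj])
qed

lemma dface_Tc0: "dface R (LI q) (%_. H q) (TI 0 q) TN (%c. ([xc c], c)) (%c. inv_into (carrier (Fo (xc c))) (thh c))"
proof -
 have "inv_into (carrier (Fo (xc c))) (thh c) \<in> mod_hom R (H q) (Fo (xc c))" if c: "c \<in> LI q" for c
  using mod_hom_inv_into[OF thh_hom[OF LI_cuts(1)[OF c]] bfun_tensor_fun(2)[OF LI_cuts(1)[OF c]] module_F_obj] LI_cuts(2)[OF c] by simp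
 then show ?thesis by (simp add: dface_def R_cring module_F_obj module_H finite_slists)
qed

lemma TI_del_snd: "[|u \<in> TI p (Suc q); j \<le> Suc q|] ==> (fst u, del_nth j (snd u)) \<in> TI p q"
 using slists_del_nth[of "snd u" _ "Suc q" j] by (auto simp: TI_def)

lemma TI_del_fst: "[|u \<in> TI (Suc p) q; i \<le> Suc p|] ==> (del_nth i (fst u), snd u) \<in> TI p q"
 using CI_del[of "fst u" p i] last_del[of "fst u" p i] by (fastforce simp: TI_def slists_def)

lemma TI_snoc:
 assumes u: "u \<in> TI p q" shows "(fst u @ [xc (snd u)], snd u) \<in> TI (Suc p) q"
proof -
 note t = TI_cuts[OF u]
 have "y \<subseteq> xc (snd u)" if "y \<in> set (fst u)" for y using CI_facts(7)[OF t(1) that] t(7) by blast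
 then have "fst u @ [xc (snd u)] \<in> CI (Suc p)" using t(1,6) by (auto simp: poset_chains_def sorted_wrt_append)
 then show ?thesis using t(2) by (simp add: TI_def cut_xc[OF t(3)] slists_def)
qed

lemma cf_cf:
 assumes xs: "xs \<in> CI (Suc (Suc p))" and ij: "i < j" "j \<le> Suc (Suc p)" and w: "w \<in> carrier (Fo (hd xs))"
 shows "cf i (del_nth j xs) (cf j xs w) = cf (j - 1) (del_nth i xs) (cf i xs w)"
proof (cases "i = 0")
 case True
 have l: "length xs = Suc (Suc (Suc p))" by (rule CI_facts(1)[OF xs])
 have ch: "xs ! a \<in> P" "a \<le> b ==> xs ! a \<subseteq> xs ! b" if "a \<le> 2" "b \<le> 2" for a b
  using poset_chains_nth[OF xs, of a a] poset_chains_nth[OF xs, of a b] that l by auto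
 have w: "w \<in> carrier (Fo (xs ! 0))" using w by (simp add: CI_facts(2)[OF xs])
 have "Fmap (xs ! 1) (xs ! 2) (Fmap (xs ! 0) (xs ! 1) w) = Fmap (xs ! 0) (xs ! 2) w"
  by (rule PF.Fm_comp) (use ch(1)[of 0 0] ch(1)[of 1 1] ch(1)[of 2 2] ch(2)[of 0 1] ch(2)[of 1 2] w in auto)
 moreover have "del_nth j xs ! 0 = xs ! 0" "del_nth j xs ! 1 = (if j = 1 then xs ! 2 else xs ! 1)"
  "del_nth 0 xs ! 0 = xs ! 1" "del_nth 0 xs ! 1 = xs ! 2"
  using ij True l nth_del_nth[of j xs 0] nth_del_nth[of j xs 1] nth_del_nth[of 0 xs 0] nth_del_nth[of 0 xs 1]
  by (auto simp: numeral_2_eq_2)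
 ultimately show ?thesis using ij True by (cases "j = 1") simp_all
qed (use ij in simp)

lemma module_TT: "Module.module R (TT p q)"
 unfolding TT_def by (rule dface_modules(1)[OF dface_Tm])


lemma S_face_eq: "PF.S_face (int (Suc p)) i = dmap (CI (Suc p)) (%xs. Fo (hd xs)) (CI p) (%xs. Fo (hd xs)) (del_nth i) (cf i)"
 by (simp add: PF.S_face_def)

lemma dface_S: "i \<le> Suc p ==> dface R (CI (Suc p)) (%xs. Fo (hd xs)) (CI p) (%xs. Fo (hd xs)) (del_nth i) (cf i)"
 by (rule dface_T[OF finite_poset_chains[OF PF.finite_P]]) (rule cf_hom)

lemma Th_hom: "i \<le> Suc p ==> Th p q i \<in> mod_hom R (TT (Suc p) q) (TT p q)"
 and Tv_hom: "Tv p q j \<in> mod_hom R (TT p (Suc q)) (TT p q)"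
 and Tep_hom: "Tep p \<in> mod_hom R (TT p 0) (dsum (CI p) (%xs. Fo (hd xs)))"
 and Tet_hom: "Tet q \<in> mod_hom R (TT 0 q) (Cn n q)"
 and Tm_hom: "Tm p q \<in> mod_hom R (TT p q) (TT p (Suc q))"
 and Tm0_hom: "Tm0 p \<in> mod_hom R (dsum (CI p) (%xs. Fo (hd xs))) (TT p 0)"
 and Tc_hom: "Tc p q \<in> mod_hom R (TT p q) (TT (Suc p) q)"
 and Tc0_hom: "Tc0 q \<in> mod_hom R (Cn n q) (TT 0 q)"
 unfolding TT_def Th_def Tv_def Tep_def Tet_def Tm_def Tm0_def Tc_def Tc0_def Cn_def
 by (rule dface_hom[OF dface_Th] dface_hom[OF dface_Tv] dface_hom[OF dface_Tep] dface_hom[OF dface_Tet]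
   dface_hom[OF dface_Tm] dface_hom[OF dface_Tm0] dface_hom[OF dface_Tc] dface_hom[OF dface_Tc0]; assumption?)+

lemma Fmap_trans: "[|x \<in> P; y \<in> P; z \<in> P; x \<subseteq> y; y \<subseteq> z; w \<in> carrier (Fo x)|] ==> Fmap y z (Fmap x y w) = Fmap x z w"
 by (rule PF.Fm_comp)

lemma Th_Th:
 assumes ij: "i < j" "j \<le> Suc (Suc p)" and t: "t \<in> carrier (TT (Suc (Suc p)) q)"
 shows "Th p q i (Th (Suc p) q j t) = Th p q (j - 1) (Th (Suc p) q i t)"
 unfolding Th_def
proof (rule dface_square[OF dface_Th dface_Th dface_Th dface_Th])
 fix u w assume u: "u \<in> TI (Suc (Suc p)) q" and w: "w \<in> carrier (TN u)"
 have i: "i \<le> Suc (Suc p)" using ij by simp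
 note xs = TI_cuts(1)[OF u]
 have C: "(del_nth i (del_nth j (fst u)), snd u) = (del_nth (j - 1) (del_nth i (fst u)), snd u)"
  using del_nth_del_nth[of i j "fst u"] CI_facts(1)[OF xs] ij by simp
 show "(del_nth j (fst u), snd u) \<in> TI (Suc p) q \<and> (del_nth i (fst u), snd u) \<in> TI (Suc p) q \<and>
   (del_nth i (fst (del_nth j (fst u), snd u)), snd (del_nth j (fst u), snd u)) =
   (del_nth (j - 1) (fst (del_nth i (fst u), snd u)), snd (del_nth i (fst u), snd u)) \<and>
   cf i (fst (del_nth j (fst u), snd u)) (cf j (fst u) w) = cf (j - 1) (fst (del_nth i (fst u), snd u)) (cf i (fst u) w)"
  unfolding fst_conv snd_conv
  by (intro conjI) (rule TI_del_fst[OF u ij(2)], rule TI_del_fst[OF u i], rule C, rule cf_cf[OF xs ij w])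
qed (use ij t in "simp_all add: TT_def")

lemma Tv_Tv:
 assumes ij: "i < j" "j \<le> Suc (Suc q)" and t: "t \<in> carrier (TT p (Suc (Suc q)))"
 shows "Tv p q i (Tv p (Suc q) j t) = Tv p q (j - 1) (Tv p (Suc q) i t)"
 unfolding Tv_def
proof (rule dface_square[OF dface_Tv dface_Tv dface_Tv dface_Tv])
 fix u w assume u: "u \<in> TI p (Suc (Suc q))"
 have i: "i \<le> Suc (Suc q)" using ij by simp
 have C: "(fst u, del_nth i (del_nth j (snd u))) = (fst u, del_nth (j - 1) (del_nth i (snd u)))"
  using del_nth_del_nth[of i j "snd u"] TI_cuts(4)[OF u] ij by simp
 show "(fst u, del_nth j (snd u)) \<in> TI p (Suc q) \<and> (fst u, del_nth i (snd u)) \<in> TI p (Suc q) \<and>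
   (fst (fst u, del_nth j (snd u)), del_nth i (snd (fst u, del_nth j (snd u)))) =
   (fst (fst u, del_nth i (snd u)), del_nth (j - 1) (snd (fst u, del_nth i (snd u)))) \<and> w = w"
  unfolding fst_conv snd_conv
  by (intro conjI) (rule TI_del_snd[OF u ij(2)], rule TI_del_snd[OF u i], rule C, rule refl)
qed (use t in "simp add: TT_def")

lemma Th_Tv:
 assumes ij: "i \<le> Suc p" "j \<le> Suc q" and t: "t \<in> carrier (TT (Suc p) (Suc q))"
 shows "Th p q i (Tv (Suc p) q j t) = Tv p q j (Th p (Suc q) i t)"
 unfolding Th_def Tv_def
proof (rule dface_square[OF dface_Tv dface_Th[OF ij(1)] dface_Th[OF ij(1)] dface_Tv])
 fix u w assume u: "u \<in> TI (Suc p) (Suc q)"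
 show "(fst u, del_nth j (snd u)) \<in> TI (Suc p) q \<and> (del_nth i (fst u), snd u) \<in> TI p (Suc q) \<and>
   (del_nth i (fst (fst u, del_nth j (snd u))), snd (fst u, del_nth j (snd u))) =
   (fst (del_nth i (fst u), snd u), del_nth j (snd (del_nth i (fst u), snd u))) \<and>
   cf i (fst (fst u, del_nth j (snd u))) w = cf i (fst u) w"
  unfolding fst_conv snd_conv
  by (intro conjI) (rule TI_del_snd[OF u ij(2)], rule TI_del_fst[OF u ij(1)], rule refl, rule refl)
qed (use t in "simp add: TT_def")

lemma Tep_Tv:
 assumes t: "t \<in> carrier (TT p (Suc 0))"
 shows "Tep p (Tv p 0 0 t) = Tep p (Tv p 0 (Suc 0) t)"
 unfolding Tep_def Tv_def
 by (rule dface_square[OF dface_Tv dface_Tep dface_Tv dface_Tep]) (use t TI_del_snd[of _ p 0] in "simp_all add: TT_def")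

lemma Tep_Th:
 assumes i: "i \<le> Suc p" and t: "t \<in> carrier (TT (Suc p) 0)"
 shows "Tep p (Th p 0 i t) = PF.S_face (int (Suc p)) i (Tep (Suc p) t)"
 unfolding Tep_def Th_def S_face_eq
proof (rule dface_square[OF dface_Th[OF i] dface_Tep dface_Tep dface_S[OF i]])
 fix u w assume u: "u \<in> TI (Suc p) 0"
 show "(del_nth i (fst u), snd u) \<in> TI p 0 \<and> fst u \<in> CI (Suc p) \<and> fst (del_nth i (fst u), snd u) = del_nth i (fst u) \<and>
   cf i (fst u) w = cf i (fst u) w"
  by (intro conjI) (rule TI_del_fst[OF u i], rule TI_cuts(1)[OF u], simp, rule refl)
qed (use t in "simp add: TT_def")

text \<open>Moving the coefficient to \<open>xc c\<close> directly or by way of the second member of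
  the chain is the same by functoriality.\<close>

lemma Tet_Th:
 assumes t: "t \<in> carrier (TT (Suc 0) q)"
 shows "Tet q (Th 0 q 0 t) = Tet q (Th 0 q (Suc 0) t)"
 unfolding Tet_def Th_def
proof (rule dface_square[OF dface_Th[OF le0] dface_Tet dface_Th[OF order_refl] dface_Tet])
 fix u w assume u: "u \<in> TI (Suc 0) q" and w: "w \<in> carrier (TN u)"
 note f = TI_cuts[OF u] and xs = CI_facts[OF TI_cuts(1)[OF u]]
 obtain x0 x1 where x: "fst u = [x0, x1]" using xs(1) by (auto simp: length_Suc_conv)
 have "x0 \<in> P" "x1 \<in> P" "x0 \<subseteq> x1" "x1 \<subseteq> xc (snd u)" "w \<in> carrier (Fo x0)" using f xs(4,5,6) w by (simp_all add: x)
 then have "Fmap x1 (xc (snd u)) (Fmap x0 x1 w) = Fmap x0 (xc (snd u)) w" using Fmap_trans f(6) by blast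
 then show "(del_nth 0 (fst u), snd u) \<in> TI 0 q \<and> (del_nth (Suc 0) (fst u), snd u) \<in> TI 0 q \<and>
   snd (del_nth 0 (fst u), snd u) = snd (del_nth (Suc 0) (fst u), snd u) \<and>
   thh (snd (del_nth 0 (fst u), snd u)) (Fmap (hd (fst (del_nth 0 (fst u), snd u))) (xc (snd (del_nth 0 (fst u), snd u))) (cf 0 (fst u) w)) =
   thh (snd (del_nth (Suc 0) (fst u), snd u)) (Fmap (hd (fst (del_nth (Suc 0) (fst u), snd u))) (xc (snd (del_nth (Suc 0) (fst u), snd u))) (cf (Suc 0) (fst u) w))"
  using TI_del_fst[OF u le0] TI_del_fst[OF u order_refl] by (simp add: x del_nth_0 del_nth_Suc_Cons)
qed (use t in "simp add: TT_def")

text \<open>Deleting a cut moves the target of the coefficient from one \<open>xc\<close> to a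
  larger one by a single added edge; by \<open>thh_face\<close> this is the Hochschild face.\<close>

lemma Tet_Tv:
 assumes j: "j \<le> Suc q" and t: "t \<in> carrier (TT 0 (Suc q))"
 shows "Tet q (Tv 0 q j t) = Cd n q j (Tet (Suc q) t)"
 unfolding Tet_def Tv_def Cd_def
proof (rule dface_square[OF dface_Tv dface_Tet dface_Tet dface_Cd[OF j]])
 fix u w assume u: "u \<in> TI 0 (Suc q)" and w: "w \<in> carrier (TN u)"
 note f = TI_cuts[OF u]
 have u': "(fst u, del_nth j (snd u)) \<in> TI 0 q" by (rule TI_del_snd[OF u j])
 have jl: "j < length (snd u)" using f(4) j by simp
 have xsub: "xc (snd u) \<subseteq> xc (del_nth j (snd u))" using xc_del_nth(1)[OF f(3) jl] by auto
 have w': "Fmap (hd (fst u)) (xc (snd u)) w \<in> carrier (Fo (xc (snd u)))"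
  by (rule mod_hom_closed[OF PF.Fm[OF f(9) f(6) f(8)] w])
 have "thh (del_nth j (snd u)) (Fmap (xc (snd u)) (xc (del_nth j (snd u))) (Fmap (hd (fst u)) (xc (snd u)) w)) =
   Hd q j (thh (snd u) (Fmap (hd (fst u)) (xc (snd u)) w))"
  by (rule thh_face[OF f(3,4) j w'])
 moreover have "Fmap (xc (snd u)) (xc (del_nth j (snd u))) (Fmap (hd (fst u)) (xc (snd u)) w) = Fmap (hd (fst u)) (xc (del_nth j (snd u))) w"
  using TI_cuts(6)[OF u'] by (intro Fmap_trans f(6,8,9) xsub w) simp
 ultimately show "(fst u, del_nth j (snd u)) \<in> TI 0 q \<and> snd u \<in> slists {0..<n} (Suc (Suc q)) \<and>
   snd (fst u, del_nth j (snd u)) = del_nth j (snd u) \<and>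
   thh (snd (fst u, del_nth j (snd u))) (Fmap (hd (fst (fst u, del_nth j (snd u)))) (xc (snd (fst u, del_nth j (snd u)))) w) =
   Hd q j (thh (snd u) (Fmap (hd (fst u)) (xc (snd u)) w))"
  using u' f(5) by simp
qed (use t in "simp add: TT_def")

text \<open>The alternatives are those of \<open>slists_Min\<close>, in the shape that
  \<open>cone_identity\<close> expects. When the apex already begins the list, deleting and
  restoring it gives the generator back.\<close>

lemma Tm_cone_gen:
 assumes u: "u \<in> TI p q" and w: "w \<in> carrier (TN u)"
 defines "m \<equiv> Min (cut (last (fst u)))" and "x \<equiv> dsum_in (TI p q) TN u w"
 shows "Tv p q 0 (Tm p q x) = x \<and> (\<forall>i\<le>q. Tv p q (Suc i) (Tm p q x) = dsum_in (TI p q) TN (fst u, m # del_nth i (snd u)) w) \<or>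
  Tm p q x = \<zero>\<^bsub>TT p (Suc q)\<^esub> \<and> dsum_in (TI p q) TN (fst u, m # del_nth 0 (snd u)) w = x \<and>
  (\<forall>i. 0 < i --> i \<le> q --> dsum_in (TI p q) TN (fst u, m # del_nth i (snd u)) w = \<zero>\<^bsub>TT p q\<^esub>)"
proof -
 note f = TI_cuts[OF u]
 let ?S = "cut (last (fst u))"
 have fin: "finite ?S" by (rule finite_subset[OF cut_subset]) simp
 have mem: "(fst u, c) \<in> TI p r \<longleftrightarrow> c \<in> slists ?S (Suc r)" for c r using f(1) by (simp add: TI_def)
 have Tmx: "Tm p q x = dsum_in (TI p (Suc q)) TN (fst u, m # snd u) w"
  unfolding Tm_def x_def m_def by (rule dface_in[OF dface_Tm u w])
 have zero: "dsum_in (TI p r) TN a w = \<zero>\<^bsub>TT p r\<^esub>" if "a \<notin> TI p r" for a r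
 proof -
  have "(\<lambda>i\<in>TI p r. if i = a then w else \<zero>\<^bsub>TN i\<^esub>) = (\<lambda>i\<in>TI p r. \<zero>\<^bsub>TN i\<^esub>)"
   by (rule restrict_ext) (use that in metis)
  then show ?thesis by (simp add: dsum_in_def TT_def dsum_def)
 qed
 from slists_Min[OF f(2) fin cut_subset] show ?thesis
 proof (elim disjE conjE exE)
  assume c: "Min ?S # snd u \<in> slists ?S (Suc (Suc q))"
  then have u': "(fst u, m # snd u) \<in> TI p (Suc q)" by (simp add: mem m_def)
  have w': "w \<in> carrier (TN (fst u, m # snd u))" using w by simp
  have "Tv p q j (Tm p q x) = dsum_in (TI p q) TN (fst u, del_nth j (m # snd u)) w" for j
   unfolding Tmx Tv_def dface_in[OF dface_Tv u' w'] by simp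
  then show ?thesis by (simp add: del_nth_0 del_nth_Suc_Cons x_def)
 next
  fix c' assume c: "snd u = Min ?S # c'" "Min ?S # snd u \<notin> slists ?S (Suc (Suc q))"
   and d: "\<forall>i. 0 < i --> i \<le> q --> Min ?S # del_nth i (snd u) \<notin> slists ?S (Suc q)"
  have "Tm p q x = \<zero>\<^bsub>TT p (Suc q)\<^esub>" unfolding Tmx by (rule zero) (use c(2) in "simp add: mem m_def")
  moreover have "(fst u, m # del_nth 0 (snd u)) = u" using c(1) by (simp add: m_def del_nth_0 prod_eq_iff)
  moreover have "dsum_in (TI p q) TN (fst u, m # del_nth i (snd u)) w = \<zero>\<^bsub>TT p q\<^esub>" if "0 < i" "i \<le> q" for i
   by (rule zero) (use d that in "simp add: mem m_def")
  ultimately show ?thesis by (simp add: x_def)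
 qed
qed

lemma TT_minus_zero: "t \<in> carrier (TT p q) ==> t \<ominus>\<^bsub>TT p q\<^esub> \<zero>\<^bsub>TT p q\<^esub> = t"
 and TT_add_zero: "t \<in> carrier (TT p q) ==> t \<oplus>\<^bsub>TT p q\<^esub> \<zero>\<^bsub>TT p q\<^esub> = t"
proof -
 interpret T: Module.module R "TT p q" by (rule module_TT)
 show "t \<in> carrier (TT p q) ==> t \<ominus>\<^bsub>TT p q\<^esub> \<zero>\<^bsub>TT p q\<^esub> = t" "t \<in> carrier (TT p q) ==> t \<oplus>\<^bsub>TT p q\<^esub> \<zero>\<^bsub>TT p q\<^esub> = t"
  by (simp_all add: T.M.minus_eq)
qed

text \<open>The cone identity without defect. The outgoing map is left abstract so that both the
  augmentation at the start of a row and the vertical faces further along are covered.\<close>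

lemma rows_contract:
 assumes t: "t \<in> carrier (TT p q)" and B0: "Module.module R B0" and h': "h' \<in> mod_hom R B0 (TT p q)"
  and D: "\<And>i. i \<le> q ==> D i \<in> mod_hom R (TT p q) B0"
  and hD: "\<And>u w i. [|u \<in> TI p q; w \<in> carrier (TN u); i \<le> q|] ==>
   h' (D i (dsum_in (TI p q) TN u w)) = dsum_in (TI p q) TN (fst u, Min (cut (last (fst u))) # del_nth i (snd u)) w"
  and z: "altsum R B0 q (%i. D i t) = \<zero>\<^bsub>B0\<^esub>"
 shows "\<exists>s\<in>carrier (TT p (Suc q)). altsum R (TT p q) (Suc q) (%j. Tv p q j s) = t"
proof
 show s: "Tm p q t \<in> carrier (TT p (Suc q))" by (rule mod_hom_closed[OF Tm_hom t])
 have "altsum R (TT p q) (Suc q) (%j. Tv p q j (Tm p q t)) \<oplus>\<^bsub>TT p q\<^esub> h' (altsum R B0 q (%i. D i t)) = t \<ominus>\<^bsub>TT p q\<^esub> \<zero>\<^bsub>TT p q\<^esub>"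
 proof (rule cone_identity[where ?D2.0 = "Tv p q" and ?D1.0 = D and h = "Tm p q" and h' = h' and ?B0.0 = B0 and ?B2.0 = "TT p (Suc q)"
    and k = q and ka = "%_. \<zero>\<^bsub>TT p q\<^esub>", OF dface_Tm[of p q] B0 module_TT, folded TT_def])
  fix u w x assume u: "u \<in> TI p q" and w: "w \<in> carrier (TN u)" and x: "x = dsum_in (TI p q) TN u w"
  have "dsum_in (TI p q) TN u \<in> mod_hom R (TN u) (TT p q)"
   unfolding TT_def by (rule dsum_in_hom[OF R_cring module_F_obj u])
  from mod_hom_closed[OF this w] have xc: "x \<in> carrier (TT p q)" unfolding x .
  show "Tv p q 0 (Tm p q x) = x \<and> (\<forall>i\<le>q. Tv p q (Suc i) (Tm p q x) = h' (D i x)) \<and> \<zero>\<^bsub>TT p q\<^esub> = \<zero>\<^bsub>TT p q\<^esub> \<or>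
   Tm p q x = \<zero>\<^bsub>TT p (Suc q)\<^esub> \<and> h' (D 0 x) = x \<ominus>\<^bsub>TT p q\<^esub> \<zero>\<^bsub>TT p q\<^esub> \<and> (\<forall>i. 0 < i --> i \<le> q --> h' (D i x) = \<zero>\<^bsub>TT p q\<^esub>)"
   using Tm_cone_gen[OF u w] hD[OF u w] xc unfolding x[symmetric] by (simp add: TT_minus_zero)
 qed (use t D h' Tv_hom Tm_hom mod_hom_const_zero[OF module_TT] in auto)
 then show "altsum R (TT p q) (Suc q) (%j. Tv p q j (Tm p q t)) = t"
  unfolding z mod_hom_zero[OF h' B0 module_TT]
  using TT_add_zero[OF altsum_closed[OF module_TT mod_hom_closed[OF Tv_hom s]]] TT_minus_zero[OF t] by simp
qed

text \<open>Rows contract because a multipath of the polygon leaves at least one cut to serve as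
  apex, columns because the multipaths below \<open>xc c\<close> have a largest element. Hence the
  statement is free of any bound on \<open>i\<close>.\<close>

theorem path_complex_C:
 "mod_isomorphic R (dg_homology R A M Gm (int i)) (homology (sx_mod (Cn n)) (C_diff n) (int i))"
proof -
 have Sk: "dg_mod R A M Gm (int p) = dsum (CI p) (%xs. Fo (hd xs))" for p by (simp add: dg_mod_def S_mod_def)
 interpret bisimplicial R TT Th Tv "dg_mod R A M Gm" "dg_diff R A M Gm" "%p. PF.S_face (int (Suc p))" Tep
  "sx_mod (Cn n)" "C_diff n" "Cd n" Tet
 proof (rule bisimplicial.intro)
  show "chain_complex R (dg_mod R A M Gm) (dg_diff R A M Gm)" by (rule chain_complex_dg)
  show "chain_complex R (sx_mod (Cn n)) (C_diff n)" by (rule C_complex(1))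
  show "dg_diff R A M Gm 0 x = \<zero>\<^bsub>dg_mod R A M Gm (0 - 1)\<^esub>" for x
   unfolding dg_diff_def dg_mod_def by (rule PF.S_diff_nonpos) simp
  show "C_diff n 0 x = \<zero>\<^bsub>sx_mod (Cn n) (0 - 1)\<^esub>" for x by (rule C_complex(4))
  show "dg_diff R A M Gm (int p + 1) x = altsum R (dg_mod R A M Gm (int p)) (Suc p) (%i. PF.S_face (int (Suc p)) i x)"
   if x: "x \<in> carrier (dg_mod R A M Gm (int (Suc p)))" for p x
  proof -
   have e: "int p + 1 = int (Suc p)" "int (Suc p) - 1 = int p" by simp_all
   have k: "1 \<le> int (Suc p)" by simp
   show ?thesis
    using PF.S_diff_altsum[OF k, of x] x unfolding dg_diff_def dg_mod_def e nat_int by blast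
  qed
  show "C_diff n (int q + 1) x = altsum R (sx_mod (Cn n) (int q)) (Suc q) (%i. Cd n q i x)" for q x
   unfolding C_complex(2) by (rule C_complex(3))
  show "Tep p \<in> mod_hom R (TT p 0) (dg_mod R A M Gm (int p))" for p unfolding Sk by (rule Tep_hom)
  show "Tet q \<in> mod_hom R (TT 0 q) (sx_mod (Cn n) (int q))" for q unfolding C_complex(2) by (rule Tet_hom)
  show "Tep p (Tv p 0 0 t) = Tep p (Tv p 0 1 t)" if "t \<in> carrier (TT p 1)" for p t using Tep_Tv that by simp
  show "Tet q (Th 0 q 0 t) = Tet q (Th 0 q 1 t)" if "t \<in> carrier (TT 1 q)" for q t using Tet_Th that by simp
 qed (simp_all add: module_TT Th_hom Tv_hom Th_Th Tv_Tv Th_Tv Tep_Th Tet_Tv del: of_nat_Suc)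
 show ?thesis
  unfolding dg_homology_def
 proof (rule homology_iso[where n = i and i = i])
  fix p x assume "x \<in> carrier (dg_mod R A M Gm (int p))"
  then have x: "x \<in> carrier (dsum (CI p) (%xs. Fo (hd xs)))" by (simp add: Sk)
  have "Tep p (Tm0 p x) = x"
   unfolding Tep_def Tm0_def
  proof (rule dface_retract[OF dface_Tm0 dface_Tep _ x])
   fix xs :: "'e set list" and w :: "(('v set => 'a + 'm) => 'r) set" assume xs: "xs \<in> CI p"
   have "finite (cut (last xs))" by (rule finite_subset[OF cut_subset]) simp
   \<comment> \<open>The apex exists since the full cycle is not a multipath.\<close>
   then have "Min (cut (last xs)) \<in> cut (last xs)" using cut_nonempty[OF CI_facts(5)[OF xs]] by (rule Min_in)
   then show "(xs, [Min (cut (last xs))]) \<in> TI p 0 \<and> fst (xs, [Min (cut (last xs))]) = xs \<and> w = w"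
    using xs by (simp add: TI_def slists_def)
  qed
  then show "\<exists>t\<in>carrier (TT p 0). Tep p t = x" using mod_hom_closed[OF Tm0_hom x] by blast
 next
  fix p t assume t: "t \<in> carrier (TT p 0)" and "Tep p t = \<zero>\<^bsub>dg_mod R A M Gm (int p)\<^esub>"
  then have z: "Tep p t = \<zero>\<^bsub>dsum (CI p) (%xs. Fo (hd xs))\<^esub>" by (simp add: Sk)
  have B: "Module.module R (dsum (CI p) (%xs. Fo (hd xs)))" by (rule module_dsum[OF R_cring module_F_obj])
  have "\<exists>s\<in>carrier (TT p (Suc 0)). dv p 0 s = t"
  \<comment> \<open>At the start of a row the augmentation plays the part of the single outgoing
    face: it forgets the only cut, and \<open>Tm0\<close> puts the apex in its place.\<close>
  proof (rule rows_contract[where D = "%_. Tep p", OF t B Tm0_hom Tep_hom])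
   show "altsum R (dsum (CI p) (%xs. Fo (hd xs))) 0 (%i. Tep p t) = \<zero>\<^bsub>dsum (CI p) (%xs. Fo (hd xs))\<^esub>"
    using altsum_0[OF B, of "%_. Tep p t"] mod_hom_closed[OF Tep_hom t] z by simp
   fix u w and i :: nat assume u: "u \<in> TI p 0" and w: "w \<in> carrier (TN u)" and i: "i \<le> 0"
   obtain a where "snd u = [a]" using TI_cuts(4)[OF u] by (auto simp: length_Suc_conv)
   then have d: "del_nth i (snd u) = []" using i by (simp add: del_nth_0)
   show "Tm0 p (Tep p (dsum_in (TI p 0) TN u w)) = dsum_in (TI p 0) TN (fst u, Min (cut (last (fst u))) # del_nth i (snd u)) w"
    unfolding Tm0_def Tep_def dface_in[OF dface_Tep u w] dface_in[OF dface_Tm0 TI_cuts(1)[OF u] w] d ..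
  qed
  then show "\<exists>s\<in>carrier (TT p 1). dv p 0 s = t" by simp
 next
  fix p q t assume t: "t \<in> carrier (TT p (Suc q))" and z: "dv p q t = \<zero>\<^bsub>TT p q\<^esub>"
  show "\<exists>s\<in>carrier (TT p (Suc (Suc q))). dv p (Suc q) s = t"
  proof (rule rows_contract[where D = "Tv p q", OF t module_TT Tm_hom Tv_hom _ z])
   fix u w i assume u: "u \<in> TI p (Suc q)" and w: "w \<in> carrier (TN u)" and i: "i \<le> Suc q"
   have w': "w \<in> carrier (TN (fst u, del_nth i (snd u)))" using w by simp
   show "Tm p q (Tv p q i (dsum_in (TI p (Suc q)) TN u w)) = dsum_in (TI p (Suc q)) TN (fst u, Min (cut (last (fst u))) # del_nth i (snd u)) w"
    unfolding Tm_def Tv_def dface_in[OF dface_Tv u w] dface_in[OF dface_Tm TI_del_snd[OF u i] w'] fst_conv snd_conv ..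
  qed
 next
  fix q y assume "y \<in> carrier (sx_mod (Cn n) (int q))"
  then have y: "y \<in> carrier (Cn n q)" by (simp add: C_complex(2))
  have "Tet q (Tc0 q y) = y"
   unfolding Tet_def Tc0_def
  proof (rule dface_retract[OF dface_Tc0 dface_Tet])
   show "y \<in> carrier (dsum (LI q) (%_. H q))" using y unfolding Cn_def .
   fix c w assume c: "c \<in> LI q" and w: "w \<in> carrier (H q)"
   note cc = LI_cuts(1)[OF c]
   have mem: "([xc c], c) \<in> TI 0 q"
    using c cut_xc[OF cc] xc_P[OF cc] by (auto simp: TI_def poset_chains_def slists_def)
   have bij: "bij_betw (thh c) (carrier (Fo (xc c))) (carrier (H q))"
    using bfun_tensor_fun(2)[OF cc] LI_cuts(2)[OF c] by simp
   have iv: "inv_into (carrier (Fo (xc c))) (thh c) w \<in> carrier (Fo (xc c))"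
    by (rule inv_into_into) (use bij w in "simp add: bij_betw_def")
   have "thh c (inv_into (carrier (Fo (xc c))) (thh c) w) = w"
    by (rule f_inv_into_f) (use bij w in "simp add: bij_betw_def")
   moreover have "Fmap (xc c) (xc c) (inv_into (carrier (Fo (xc c))) (thh c) w) = inv_into (carrier (Fo (xc c))) (thh c) w"
    unfolding F_map_eq by (rule Fm_refl[OF xc_P[OF cc] iv])
   ultimately show "([xc c], c) \<in> TI 0 q \<and> snd ([xc c], c) = c \<and>
     thh (snd ([xc c], c)) (Fmap (hd (fst ([xc c], c))) (xc (snd ([xc c], c))) (inv_into (carrier (Fo (xc c))) (thh c) w)) = w"
    using mem by simp
  qed
  then show "\<exists>t\<in>carrier (TT 0 q). Tet q t = y" using mod_hom_closed[OF Tc0_hom y] by blast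
 next
  fix q t assume t: "t \<in> carrier (TT 0 q)" and "Tet q t = \<zero>\<^bsub>sx_mod (Cn n) (int q)\<^esub>"
  then have z: "Tet q t = \<zero>\<^bsub>Cn n q\<^esub>" by (simp add: C_complex(2))
  have td: "t \<in> carrier (dsum (TI 0 q) TN)" using t unfolding TT_def .
  \<comment> \<open>The last face deletes the appended top again.\<close>
  have 1: "Th 0 q (Suc 0) (Tc 0 q t) = t"
   unfolding Th_def Tc_def
  proof (rule dface_retract[OF dface_Tc dface_Th[OF order_refl] _ td])
   fix u w assume u: "u \<in> TI 0 q"
   obtain x0 where "fst u = [x0]" using CI_facts(1)[OF TI_cuts(1)[OF u]] by (auto simp: length_Suc_conv)
   then show "(fst u @ [xc (snd u)], snd u) \<in> TI (Suc 0) q \<and>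
     (del_nth (Suc 0) (fst (fst u @ [xc (snd u)], snd u)), snd (fst u @ [xc (snd u)], snd u)) = u \<and>
     cf (Suc 0) (fst (fst u @ [xc (snd u)], snd u)) w = w"
    using TI_snoc[OF u] by (simp add: del_nth_0 del_nth_Suc_Cons prod_eq_iff)
  qed
  \<comment> \<open>Deleting the only original member moves the coefficient to \<open>xc c\<close>,
    and bijectivity of \<open>thh\<close> identifies the result with the round trip through
    Hochschild chains.\<close>
  have 0: "Th 0 q 0 (Tc 0 q t) = Tc0 q (Tet q t)"
   unfolding Th_def Tc_def Tc0_def Tet_def
  proof (rule dface_square[OF dface_Tc dface_Th[OF le0] dface_Tet dface_Tc0 _ td])
   fix u w assume u: "u \<in> TI 0 q" and w: "w \<in> carrier (TN u)"
   note f = TI_cuts[OF u]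
   obtain x0 where x: "fst u = [x0]" using CI_facts(1)[OF f(1)] by (auto simp: length_Suc_conv)
   have "Fmap x0 (xc (snd u)) w \<in> carrier (Fo (xc (snd u)))"
    using mod_hom_closed[OF PF.Fm[OF f(9) f(6) f(8)] w] by (simp add: x)
   then have "inv_into (carrier (Fo (xc (snd u)))) (thh (snd u)) (thh (snd u) (Fmap x0 (xc (snd u)) w)) = Fmap x0 (xc (snd u)) w"
    by (intro inv_into_f_f) (use bfun_tensor_fun(2)[OF f(3)] in "simp_all add: bij_betw_def")
   then show "(fst u @ [xc (snd u)], snd u) \<in> TI (Suc 0) q \<and> snd u \<in> LI q \<and>
     (del_nth 0 (fst (fst u @ [xc (snd u)], snd u)), snd (fst u @ [xc (snd u)], snd u)) = ([xc (snd u)], snd u) \<and>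
     cf 0 (fst (fst u @ [xc (snd u)], snd u)) w =
     inv_into (carrier (Fo (xc (snd u)))) (thh (snd u)) (thh (snd u) (Fmap (hd (fst u)) (xc (snd u)) w))"
    using TI_snoc[OF u] f(5) by (simp add: x del_nth_0)
  qed
  have "\<exists>s\<in>carrier (TT (Suc 0) q). dh 0 q s = t"
  proof (rule back_homotopy_exact[where D = "Th 0 q" and h' = "Tc0 q" and y = "Tc 0 q t" and k = 0
     and f = "%_. Tet q t", OF module_TT module_Cn module_TT Tc0_hom])
   show "altsum R (Cn n q) 0 (%_. Tet q t) = \<zero>\<^bsub>Cn n q\<^esub>"
    using altsum_0[OF module_Cn, of "%_. Tet q t"] mod_hom_closed[OF Tet_hom t] z by simp
   show "Tc 0 q t \<in> carrier (TT (Suc 0) q)" by (rule mod_hom_closed[OF Tc_hom t])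
  qed (use t 0 1 mod_hom_closed[OF Tet_hom t] Th_hom[of _ 0 q] in simp_all)
  then show "\<exists>s\<in>carrier (TT 1 q). dh 0 q s = t" by simp
 next
  fix p q t assume t: "t \<in> carrier (TT (Suc p) q)" and z: "dh p q t = \<zero>\<^bsub>TT p q\<^esub>"
  have td: "t \<in> carrier (dsum (TI (Suc p) q) TN)" using t unfolding TT_def .
  have 1: "Th (Suc p) q (Suc (Suc p)) (Tc (Suc p) q t) = t"
   unfolding Th_def Tc_def
  proof (rule dface_retract[OF dface_Tc dface_Th[OF order_refl] _ td])
   fix u w assume u: "u \<in> TI (Suc p) q"
   have "del_nth (Suc (Suc p)) (fst u @ [xc (snd u)]) = fst u"
    using CI_facts(1)[OF TI_cuts(1)[OF u]] by (simp add: del_nth_def)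
   then show "(fst u @ [xc (snd u)], snd u) \<in> TI (Suc (Suc p)) q \<and>
     (del_nth (Suc (Suc p)) (fst (fst u @ [xc (snd u)], snd u)), snd (fst u @ [xc (snd u)], snd u)) = u \<and>
     cf (Suc (Suc p)) (fst (fst u @ [xc (snd u)], snd u)) w = w"
    using TI_snoc[OF u] by simp
  qed
  have 0: "Th (Suc p) q i (Tc (Suc p) q t) = Tc p q (Th p q i t)" if i: "i \<le> Suc p" for i
   unfolding Th_def Tc_def
  proof (rule dface_square[OF dface_Tc dface_Th dface_Th[OF i] dface_Tc _ td])
   show "i \<le> Suc (Suc p)" using i by simp
   fix u w assume u: "u \<in> TI (Suc p) q"
   have l: "length (fst u) = Suc (Suc p)" by (rule CI_facts(1)[OF TI_cuts(1)[OF u]])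
   \<comment> \<open>The first two entries are untouched by appending, as the chain has at least
     two; one-element chains were treated with the augmentation.\<close>
   have "cf i (fst u @ [xc (snd u)]) w = cf i (fst u) w" using l by (simp add: nth_append)
   then show "(fst u @ [xc (snd u)], snd u) \<in> TI (Suc (Suc p)) q \<and> (del_nth i (fst u), snd u) \<in> TI p q \<and>
     (del_nth i (fst (fst u @ [xc (snd u)], snd u)), snd (fst u @ [xc (snd u)], snd u)) =
     (fst (del_nth i (fst u), snd u) @ [xc (snd (del_nth i (fst u), snd u))], snd (del_nth i (fst u), snd u)) \<and>
     cf i (fst (fst u @ [xc (snd u)], snd u)) w = cf i (fst u) w"
    unfolding fst_conv snd_conv
    using TI_snoc[OF u] TI_del_fst[OF u i] del_nth_append[of i "fst u" "[xc (snd u)]"] l i by simp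
  qed
  show "\<exists>s\<in>carrier (TT (Suc (Suc p)) q). dh (Suc p) q s = t"
  proof (rule back_homotopy_exact[where D = "Th (Suc p) q" and h' = "Tc p q" and y = "Tc (Suc p) q t" and k = "Suc p"
     and f = "%i. Th p q i t", OF module_TT module_TT module_TT Tc_hom])
   show "Tc (Suc p) q t \<in> carrier (TT (Suc (Suc p)) q)" by (rule mod_hom_closed[OF Tc_hom t])
   show "Th p q i t \<in> carrier (TT p q)" if "i \<le> Suc p" for i by (rule mod_hom_closed[OF Th_hom[OF that] t])
  qed (use t z 0 1 Th_hom in simp_all)
 qed simp
qed

end

theorem theorem1:
  fixes R :: "'r ring"
    and A :: "('r, 'a) module"
    and M :: "('r, 'm, 'a) bimodule"
  assumes "cring R"
    and "assoc_algebra R A"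
    and "algebra_bimodule R A M"
  shows "covariant_functor
      (DirGr_b :: (('v, 'e) pre_digraph \<times> 'v, ('v \<Rightarrow> 'v) \<times> ('e \<Rightarrow> 'e)) cat) (GrMod R)
      (dg_homology R A M) (dg_homology_map R A M) \<and>
    (\<forall>n (\<Gamma> :: ('v, 'e) pre_digraph \<times> 'v). \<Gamma> \<in> Obj DirGr_b \<longrightarrow> directed_ngon n (fst \<Gamma>) \<longrightarrow>
      (\<forall>i. 0 \<le> i \<and> i \<le> int n - 2 \<longrightarrow>
        mod_isomorphic R (dg_homology R A M \<Gamma> i) (hochschild_homology R A M i)))"
proof (intro conjI allI impI)
 interpret coefficients R A M by (rule coefficients.intro[OF assms(3)])
 show "covariant_functor
   (DirGr_b :: (('v, 'e) pre_digraph \<times> 'v, ('v => 'v) \<times> ('e => 'e)) cat) (GrMod R)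
   (dg_homology R A M) (dg_homology_map R A M)"
  by (rule functor_dg_homology)
 fix n i and Gm :: "('v, 'e) pre_digraph \<times> 'v"
 assume Gm: "Gm \<in> Obj DirGr_b" and ngon: "directed_ngon n (fst Gm)" and i: "0 \<le> i \<and> i \<le> int n - 2"
 interpret D: based_digraph R A M Gm by (rule based_digraphI[OF Gm])
 \<comment> \<open>The enumeration has to start at the base vertex, so that the factor
   \<open>M\<close> sits in block 0.\<close>
 obtain v e where ve: "bij_betw v {..<n} (verts (fst Gm))" "bij_betw e {..<n} (arcs (fst Gm))"
  "\<forall>i<n. tail (fst Gm) (e i) = v i \<and> head (fst Gm) (e i) = v (Suc i mod n)" "v 0 = snd Gm"
  using directed_ngon_based[OF ngon D.base] by (elim exE conjE) (rule that)
 interpret N: ngon R A M Gm n v e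
  by (intro ngon.intro D.based_digraph_axioms ngon_axioms.intro) (use ve ngon in "auto simp: directed_ngon_def")
 obtain j where j: "i = int j" using i nonneg_int_cases by blast
 then have "j + 2 \<le> n" using i by linarith
 then show "mod_isomorphic R (dg_homology R A M Gm i) (hochschild_homology R A M i)"
  unfolding j hochschild_homology_def by (rule mod_isomorphic_trans[OF N.path_complex_C C_hochschild])
qed

end
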